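(* Let $u\in H^1_D(\Omega)$ be the minimiser of $I$ and $\boldsymbol q\in\boldsymbol f+H_N(\mathrm{div};\Omega)$ the maximiser of $D$. Choose the discrete data $f_h=\Pi_hf\in\mathbb P^0(\mathcal T_h)$, $\boldsymbol f_h=\Pi_h\boldsymbol f\in(\mathbb P^0(\mathcal T_h))^d$, $\widehat u_D^h=\mathcal I_h^{cr}\widehat u_D\in V^h$, and let $u_h\in V^h_D$ be the minimiser of $I_h$ and $\boldsymbol q_h\in\boldsymbol f_h+\Sigma^h_N$ the maximiser of $D_h$. Then the following statements apply. (i) There holds the a priori error identity $$\|\nabla_h\mathcal I_h^{cr}u-\nabla_hu_h\|_\Omega^2+\|\Pi_h(\mathcal I_h^{rt}(\boldsymbol q-\boldsymbol f))-\Pi_h(\boldsymbol q_h-\boldsymbol f_h)\|_\Omega^2=\|\Pi_h(\boldsymbol q-\boldsymbol f)-\Pi_h\mathcal I_h^{rt}(\boldsymbol q-\boldsymbol f)\|_\Omega^2 .$$ (ii) There holds the quasi-optimal error estimate $$\|\nabla(u+\widehat u_D)-\nabla_h(u_h+\widehat u_D^h)\|_\Omega^2+\|\boldsymbol q-\Pi_h\boldsymbol q_h\|_\Omega^2\le 6\inf_{v_h\in V^h_D}\big\{\|\nabla(u+\widehat u_D)-\nabla_h(v_h+\widehat u_D^h)\|_\Omega^2\big\}+6\inf_{\boldsymbol r_h\in K^h_{\boldsymbol q}}\big\{\|\boldsymbol q-\Pi_h\boldsymbol r_h\|_\Omega^2\big\},$$ where $K^h_{\boldsymbol q}=\{\boldsymbol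 r_h\in\boldsymbol f_h+\Sigma^h_N:\mathrm{div}(\boldsymbol r_h-\boldsymbol f_h)=-f_h\text{ a.e. in }\Omega\}$.
   Context: Domain. $d\ge 2$; $\Omega\subset\mathbb R^d$ is a bounded polyhedral Lipschitz domain whose boundary is divided into disjoint relatively open parts $\Gamma_D\neq\emptyset$ and $\Gamma_N$ with $\overline\Gamma_D\cup\overline\Gamma_N=\partial\Omega$. $(\cdot,\cdot)_\Omega$, $\|\cdot\|_\Omega$ denote the $L^2(\Omega)$ inner product and norm (scalar or vector valued). $H^1_D(\Omega)$: functions in $H^1(\Omega)$ with zero trace on $\Gamma_D$. $H_N(\mathrm{div};\Omega)$: vector fields $\boldsymbol r\in(L^2(\Omega))^d$ with $\mathrm{div}\,\boldsymbol r\in L^2(\Omega)$ and $\boldsymbol r\cdot\boldsymbol n=0$ weakly on $\Gamma_N$, i.e. $(\boldsymbol r,\nabla v)_\Omega+(\mathrm{div}\,\boldsymbol r,v)_\Omega=0$ for all $v\in H^1_D(\Omega)$. Continuous Poisson problem. $\widehat u_D\in H^1(\Omega)$ is a lift of the Dirichlet datum; the load $f^*\in(H^1_D(\Omega))^*$ is represented by fixed $f\in L^2(\Omega)$ and $\boldsymbol f\in(L^2(\Omega))^d$ via $\langle f^*,v\rangle_\Omega=(f,v)_\Omega+(\boldsymbol f,\nabla v)_\Omega$. For $v\in H^1_D(\Omega)$, $I(v)=\frac12\|\nabla(v+\widehat u_D)\|_\Omega^2-\langle f^*,v\rangle_\Omega$. For $\boldsymbol r\in\boldsymbol f+H_N(\mathrm{div};\Omega)$,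 $D(\boldsymbol r)=-\frac12\|\boldsymbol r\|_\Omega^2+(\boldsymbol r,\nabla\widehat u_D)_\Omega$ if $\mathrm{div}(\boldsymbol r-\boldsymbol f)=-f$ a.e. in $\Omega$, and $D(\boldsymbol r)=-\infty$ otherwise. Mesh and spaces. $\mathcal T_h$ is a triangulation of $\Omega$ into closed simplices (from a shape-regular family), with each boundary side lying in $\overline\Gamma_D$ or in $\overline\Gamma_N$. $\mathbb P^k(\mathcal T_h)$: element-wise polynomials of degree at most $k$. $\Pi_h$: element-wise mean (componentwise). $\nabla_h$: element-wise gradient. $V^h$ (scalar Crouzeix–Raviart) is the set of $v_h\in\mathbb P^1(\mathcal T_h)$ whose jump has zero mean over every interior side; $V^h_D$ is the set of $v_h\in V^h$ having zero mean over every side in $\overline\Gamma_D$. $\Sigma^h$ (vector-valued Raviart–Thomas) is the set of $\boldsymbol r_h\in(\mathbb P^1(\mathcal T_h))^d$ such that, for each $T$, $\boldsymbol r_h|_T\cdot\boldsymbol n_T$ is constant on each side of $T$, and $\boldsymbol r_h\cdot\boldsymbol n$ is continuous across interior sides; $\Sigma^h_N=\{\boldsymbol r_h\in\Sigma^h:\boldsymbol r_h\cdot\boldsymbol n=0\text{ on }\Gamma_N\}$. $\mathcal I_h^{cr}:H^1(\Omega)\to V^h$: $\mathcal I_h^{cr}v$ is the element of $V^h$ with the same mean as $v$ on every side. $\mathcal I_h^{rt}:H_N(\mathrm{div};\Omega)\to\Sigma^h_N$ is a (quasi-)interpolation operator with $\mathrm{div}(\mathcal I_h^{rt}\boldsymbol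 r)=\Pi_h(\mathrm{div}\,\boldsymbol r)$ a.e. in $\Omega$ for all $\boldsymbol r$ (e.g. the one of Ern–Gudi–Smears–Vohralík, 2022). Discrete problem. For $v_h\in V_D^h$, $I_h(v_h)=\frac12\|\nabla_h(v_h+\widehat u^h_D)\|_\Omega^2-(f_h,\Pi_hv_h)_\Omega-(\boldsymbol f_h,\nabla_hv_h)_\Omega$. For $\boldsymbol r_h\in\boldsymbol f_h+\Sigma^h_N$, $D_h(\boldsymbol r_h)=-\frac12\|\Pi_h\boldsymbol r_h\|_\Omega^2+(\Pi_h\boldsymbol r_h,\nabla_h\widehat u^h_D)_\Omega$ if $\mathrm{div}(\boldsymbol r_h-\boldsymbol f_h)=-f_h$ a.e. in $\Omega$, and $D_h(\boldsymbol r_h)=-\infty$ otherwise.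
   Formalization: Functions in H^1_D(Ω) are required to have zero trace almost everywhere on the closure of Γ_D (also in the weak Neumann condition); this agrees with zero trace on Γ_D whenever the interface between Γ_D and Γ_N has surface measure zero, and (i) can fail otherwise. *)

theory Defs
  imports "HOL-Analysis.Analysis"
begin

section \<open>Smooth functions and square-integrable functions\<close>

definition gradient :: "('a::euclidean_space \<Rightarrow> real) \<Rightarrow> 'a \<Rightarrow> 'a" where
  "gradient f x = (\<Sum>b\<in>Basis. frechet_derivative f (at x) b *\<^sub>R b)"

primrec C_k :: "nat \<Rightarrow> ('a::euclidean_space \<Rightarrow> real) \<Rightarrow> bool" where
  "C_k 0 f \<longleftrightarrow> continuous_on UNIV f"
| "C_k (Suc k) f \<longleftrightarrow> (\<forall>x. f differentiable (at x)) \<and>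
     (\<forall>b\<in>Basis. C_k k (\<lambda>x. frechet_derivative f (at x) b))"

definition smooth :: "('a::euclidean_space \<Rightarrow> real) \<Rightarrow> bool" where
  "smooth f \<longleftrightarrow> (\<forall>k. C_k k f)"

definition test_function :: "'a::euclidean_space set \<Rightarrow> ('a \<Rightarrow> real) \<Rightarrow> bool" where
  "test_function U \<phi> \<longleftrightarrow> smooth \<phi> \<and> (\<exists>K. compact K \<and> K \<subseteq> U \<and> (\<forall>x. x \<notin> K \<longrightarrow> \<phi> x = 0))"

text \<open>Elements of \<open>L\<^sup>2\<close> are represented by functions; equality in \<open>L\<^sup>2\<close> is equality almost everywhere.\<close>

definition L2 :: "'a measure \<Rightarrow> ('a \<Rightarrow> 'b::euclidean_space) set" where
  "L2 M = {f \<in> borel_measurable M. integrable M (\<lambda>x. (norm (f x))\<^sup>2)}"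

definition L2_inner :: "'a measure \<Rightarrow> ('a \<Rightarrow> 'b::euclidean_space) \<Rightarrow> ('a \<Rightarrow> 'b) \<Rightarrow> real" where
  "L2_inner M f g = (LINT x|M. f x \<bullet> g x)"

definition L2_norm :: "'a measure \<Rightarrow> ('a \<Rightarrow> 'b::euclidean_space) \<Rightarrow> real" where
  "L2_norm M f = sqrt (L2_inner M f f)"

definition average :: "'a measure \<Rightarrow> ('a \<Rightarrow> 'b::euclidean_space) \<Rightarrow> 'b" where
  "average M f = (LINT x|M. f x) /\<^sub>R measure M (space M)"


section \<open>Weak gradient, \<open>H\<^sup>1\<close>, weak divergence\<close>

definition weak_gradient :: "'a::euclidean_space set \<Rightarrow> ('a \<Rightarrow> real) \<Rightarrow> ('a \<Rightarrow> 'a) \<Rightarrow> bool" where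
  "weak_gradient U v g \<longleftrightarrow> (\<forall>\<phi>. test_function U \<phi> \<longrightarrow> (\<forall>b\<in>Basis.
     (LINT x|lebesgue_on U. v x * (gradient \<phi> x \<bullet> b)) = - (LINT x|lebesgue_on U. (g x \<bullet> b) * \<phi> x)))"

definition H1 :: "'a::euclidean_space set \<Rightarrow> ('a \<Rightarrow> real) set" where
  "H1 U = {v \<in> L2 (lebesgue_on U). \<exists>g \<in> L2 (lebesgue_on U). weak_gradient U v g}"

definition grad :: "'a::euclidean_space set \<Rightarrow> ('a \<Rightarrow> real) \<Rightarrow> 'a \<Rightarrow> 'a" where
  "grad U v = (SOME g. g \<in> L2 (lebesgue_on U) \<and> weak_gradient U v g)"

definition weak_divergence :: "'a::euclidean_space set \<Rightarrow> ('a \<Rightarrow> 'a) \<Rightarrow> ('a \<Rightarrow> real) \<Rightarrow> bool" where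
  "weak_divergence U r w \<longleftrightarrow> (\<forall>\<phi>. test_function U \<phi> \<longrightarrow>
     (LINT x|lebesgue_on U. r x \<bullet> gradient \<phi> x) = - (LINT x|lebesgue_on U. w x * \<phi> x))"

definition Hdiv :: "'a::euclidean_space set \<Rightarrow> ('a \<Rightarrow> 'a) set" where
  "Hdiv U = {r \<in> L2 (lebesgue_on U). \<exists>w \<in> L2 (lebesgue_on U). weak_divergence U r w}"

definition divergence :: "'a::euclidean_space set \<Rightarrow> ('a \<Rightarrow> 'a) \<Rightarrow> 'a \<Rightarrow> real" where
  "divergence U r = (SOME w. w \<in> L2 (lebesgue_on U) \<and> weak_divergence U r w)"


section \<open>Surface measure on flat pieces and traces\<close>

text \<open>The \<open>(d-1)\<close>-dimensional measure of a Borel subset \<open>A\<close> of the hyperplane \<open>n \<bullet> x = c\<close>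
  (with \<open>n\<close> a unit vector) is the Lebesgue measure of the right cylinder of height \<open>1\<close> over \<open>A\<close>.\<close>

definition hyperplane_measure :: "'a::euclidean_space \<Rightarrow> real \<Rightarrow> 'a measure" where
  "hyperplane_measure n c =
     distr (restrict_space lborel {x. c \<le> n \<bullet> x \<and> n \<bullet> x \<le> c + 1}) borel (\<lambda>x. x - (n \<bullet> x - c) *\<^sub>R n)"

text \<open>Only used for sets \<open>S\<close> spanning a hyperplane; the two admissible choices \<open>(n, c)\<close> and
  \<open>(-n, -c)\<close> give the same measure.\<close>

definition surface_measure :: "'a::euclidean_space set \<Rightarrow> 'a measure" where
  "surface_measure S = (SOME M. \<exists>n c. norm n = 1 \<and> S \<subseteq> {x. n \<bullet> x = c} \<and>
     M = restrict_space (hyperplane_measure n c) S)"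

text \<open>\<open>g\<close> is the trace on the flat set \<open>S\<close> of \<open>v \<in> H\<^sup>1(U)\<close>, for bounded \<open>U\<close> with \<open>S\<close> in its closure:
  continuous extension of the restriction map from smooth functions to \<open>H\<^sup>1(U)\<close>.\<close>

definition has_trace ::
  "'a::euclidean_space set \<Rightarrow> ('a \<Rightarrow> real) \<Rightarrow> 'a set \<Rightarrow> ('a \<Rightarrow> real) \<Rightarrow> bool" where
  "has_trace U v S g \<longleftrightarrow> v \<in> H1 U \<and> g \<in> L2 (surface_measure S) \<and>
     (\<exists>\<phi> :: nat \<Rightarrow> 'a \<Rightarrow> real. (\<forall>n. smooth (\<phi> n)) \<and>
        (\<lambda>n. L2_norm (lebesgue_on U) (\<lambda>x. \<phi> n x - v x)) \<longlonglongrightarrow> 0 \<and>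
        (\<lambda>n. L2_norm (lebesgue_on U) (\<lambda>x. gradient (\<phi> n) x - grad U v x)) \<longlonglongrightarrow> 0 \<and>
        (\<lambda>n. L2_norm (surface_measure S) (\<lambda>x. \<phi> n x - g x)) \<longlonglongrightarrow> 0)"


section \<open>The domain and the spaces with boundary conditions\<close>

definition lipschitz_domain :: "'a::euclidean_space set \<Rightarrow> bool" where
  "lipschitz_domain \<Omega> \<longleftrightarrow> open \<Omega> \<and> connected \<Omega> \<and> \<Omega> \<noteq> {} \<and> bounded \<Omega> \<and>
     (\<forall>x \<in> frontier \<Omega>. \<exists>N e L \<zeta>. open N \<and> x \<in> N \<and> norm e = 1 \<and> lipschitz_on L UNIV \<zeta> \<and>
        \<Omega> \<inter> N = {y \<in> N. e \<bullet> y < \<zeta> (y - (e \<bullet> y) *\<^sub>R e)})"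

definition polyhedral :: "'a::euclidean_space set \<Rightarrow> bool" where
  "polyhedral \<Omega> \<longleftrightarrow> (\<exists>\<P>. finite \<P> \<and> (\<forall>P\<in>\<P>. polytope P) \<and> closure \<Omega> = \<Union>\<P>)"

definition boundary_partition ::
  "'a::euclidean_space set \<Rightarrow> 'a set \<Rightarrow> 'a set \<Rightarrow> bool" where
  "boundary_partition \<Omega> \<Gamma>D \<Gamma>N \<longleftrightarrow>
     openin (top_of_set (frontier \<Omega>)) \<Gamma>D \<and> openin (top_of_set (frontier \<Omega>)) \<Gamma>N \<and>
     \<Gamma>D \<inter> \<Gamma>N = {} \<and> \<Gamma>D \<noteq> {} \<and> closure \<Gamma>D \<union> closure \<Gamma>N = frontier \<Omega>"

text \<open>For polyhedral \<open>\<Omega>\<close>: the trace vanishes almost everywhere on \<open>\<Gamma> \<subseteq> \<partial>\<Omega>\<close>. It is tested on the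
  \<open>(d-1)\<close>-simplices contained in \<open>\<partial>\<Omega>\<close>, finitely many of which cover \<open>\<partial>\<Omega>\<close>.\<close>

definition zero_trace_on :: "'a::euclidean_space set \<Rightarrow> 'a set \<Rightarrow> ('a \<Rightarrow> real) \<Rightarrow> bool" where
  "zero_trace_on \<Omega> \<Gamma> v \<longleftrightarrow> (\<forall>F. (int DIM('a) - 1) simplex F \<and> F \<subseteq> frontier \<Omega> \<longrightarrow>
     (\<exists>g. has_trace \<Omega> v F g \<and> (AE x in surface_measure F. x \<in> \<Gamma> \<longrightarrow> g x = 0)))"

text \<open>The trace is required to vanish on \<open>closure \<Gamma>D\<close>. As soon as the interface between \<open>\<Gamma>D\<close> and
  \<open>\<Gamma>N\<close> is a null set, this is the same as vanishing on \<open>\<Gamma>D\<close>; the closure matches the discrete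
  space \<open>CR_D\<close>, whose condition is imposed on all sides contained in \<open>closure \<Gamma>D\<close>.\<close>

definition H1_D :: "'a::euclidean_space set \<Rightarrow> 'a set \<Rightarrow> ('a \<Rightarrow> real) set" where
  "H1_D \<Omega> \<Gamma>D = {v \<in> H1 \<Omega>. zero_trace_on \<Omega> (closure \<Gamma>D) v}"

text \<open>The Neumann condition \<open>r \<bullet> n = 0\<close> on the complement of \<open>\<Gamma>D\<close>, in weak form.\<close>

definition Hdiv_N :: "'a::euclidean_space set \<Rightarrow> 'a set \<Rightarrow> ('a \<Rightarrow> 'a) set" where
  "Hdiv_N \<Omega> \<Gamma>D = {r \<in> Hdiv \<Omega>. \<forall>v \<in> H1_D \<Omega> \<Gamma>D.
     L2_inner (lebesgue_on \<Omega>) r (grad \<Omega> v) + L2_inner (lebesgue_on \<Omega>) (divergence \<Omega> r) v = 0}"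


section \<open>Continuous primal and dual energy\<close>

definition primal_energy ::
  "'a::euclidean_space set \<Rightarrow> ('a \<Rightarrow> real) \<Rightarrow> ('a \<Rightarrow> 'a) \<Rightarrow> ('a \<Rightarrow> real) \<Rightarrow> ('a \<Rightarrow> real) \<Rightarrow> real" where
  "primal_energy \<Omega> f fv uD v =
     (L2_norm (lebesgue_on \<Omega>) (grad \<Omega> (\<lambda>x. v x + uD x)))\<^sup>2 / 2 -
     (L2_inner (lebesgue_on \<Omega>) f v + L2_inner (lebesgue_on \<Omega>) fv (grad \<Omega> v))"

definition dual_energy ::
  "'a::euclidean_space set \<Rightarrow> ('a \<Rightarrow> real) \<Rightarrow> ('a \<Rightarrow> 'a) \<Rightarrow> ('a \<Rightarrow> real) \<Rightarrow> ('a \<Rightarrow> 'a) \<Rightarrow> ereal" where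
  "dual_energy \<Omega> f fv uD r =
     (if AE x in lebesgue_on \<Omega>. divergence \<Omega> (\<lambda>y. r y - fv y) x = - f x
      then ereal (- (L2_norm (lebesgue_on \<Omega>) r)\<^sup>2 / 2 + L2_inner (lebesgue_on \<Omega>) r (grad \<Omega> uD))
      else - \<infinity>)"


section \<open>Triangulations and element-wise operators\<close>

definition simplicial_mesh ::
  "'a::euclidean_space set \<Rightarrow> 'a set \<Rightarrow> 'a set \<Rightarrow> 'a set set \<Rightarrow> bool" where
  "simplicial_mesh \<Omega> \<Gamma>D \<Gamma>N \<T> \<longleftrightarrow> triangulation \<T> \<and> (\<forall>T\<in>\<T>. int DIM('a) simplex T) \<and>
     \<Union>\<T> = closure \<Omega> \<and>
     (\<forall>T\<in>\<T>. \<forall>S. S facet_of T \<and> S \<subseteq> frontier \<Omega> \<longrightarrow> S \<subseteq> closure \<Gamma>D \<or> S \<subseteq> closure \<Gamma>N)"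

definition Pi_h :: "'a::euclidean_space set set \<Rightarrow> ('a \<Rightarrow> 'b::euclidean_space) \<Rightarrow> 'a \<Rightarrow> 'b" where
  "Pi_h \<T> v x = (\<Sum>T\<in>\<T>. indicator (interior T) x *\<^sub>R average (lebesgue_on T) v)"

definition nabla_h :: "'a::euclidean_space set set \<Rightarrow> ('a \<Rightarrow> real) \<Rightarrow> 'a \<Rightarrow> 'a" where
  "nabla_h \<T> v x = (\<Sum>T\<in>\<T>. indicator (interior T) x *\<^sub>R gradient v x)"

definition affine_map :: "('a::real_vector \<Rightarrow> 'b::real_vector) \<Rightarrow> bool" where
  "affine_map p \<longleftrightarrow> (\<exists>c l. linear l \<and> p = (\<lambda>x. c + l x))"

text \<open>Values on the skeleton of the mesh are irrelevant and left unconstrained.\<close>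

definition P1 :: "'a::euclidean_space set set \<Rightarrow> ('a \<Rightarrow> 'b::euclidean_space) set" where
  "P1 \<T> = {v. \<forall>T\<in>\<T>. \<exists>p. affine_map p \<and> (\<forall>x\<in>interior T. v x = p x)}"

text \<open>The polynomial that \<open>v \<in> P1 \<T>\<close> coincides with on the element \<open>T\<close>; it provides the one-sided
  values of \<open>v\<close> on the sides of \<open>T\<close>.\<close>

definition piece :: "'a::euclidean_space set \<Rightarrow> ('a \<Rightarrow> 'b::euclidean_space) \<Rightarrow> 'a \<Rightarrow> 'b" where
  "piece T v = (THE p. affine_map p \<and> (\<forall>x\<in>interior T. v x = p x))"

definition outer_normal :: "'a::euclidean_space set \<Rightarrow> 'a set \<Rightarrow> 'a" where
  "outer_normal T S =
     (THE n. norm n = 1 \<and> (\<exists>c. S \<subseteq> {x. n \<bullet> x = c} \<and> T \<subseteq> {x. n \<bullet> x \<le> c}))"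


section \<open>Crouzeix-Raviart and Raviart-Thomas spaces\<close>

definition CR :: "'a::euclidean_space set set \<Rightarrow> ('a \<Rightarrow> real) set" where
  "CR \<T> = {v \<in> P1 \<T>. \<forall>T\<in>\<T>. \<forall>T'\<in>\<T>. \<forall>S. T \<noteq> T' \<and> S facet_of T \<and> S facet_of T' \<longrightarrow>
     average (surface_measure S) (\<lambda>x. piece T v x - piece T' v x) = 0}"

definition CR_D :: "'a::euclidean_space set set \<Rightarrow> 'a set \<Rightarrow> ('a \<Rightarrow> real) set" where
  "CR_D \<T> \<Gamma>D = {v \<in> CR \<T>. \<forall>T\<in>\<T>. \<forall>S. S facet_of T \<and> S \<subseteq> closure \<Gamma>D \<longrightarrow>
     average (surface_measure S) (piece T v) = 0}"

definition RT :: "'a::euclidean_space set set \<Rightarrow> ('a \<Rightarrow> 'a) set" where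
  "RT \<T> = {r \<in> P1 \<T>.
     (\<forall>T\<in>\<T>. \<forall>S. S facet_of T \<longrightarrow> (\<exists>c. \<forall>x\<in>S. piece T r x \<bullet> outer_normal T S = c)) \<and>
     (\<forall>T\<in>\<T>. \<forall>T'\<in>\<T>. \<forall>S. T \<noteq> T' \<and> S facet_of T \<and> S facet_of T' \<longrightarrow>
        (\<forall>x\<in>S. piece T r x \<bullet> outer_normal T S = piece T' r x \<bullet> outer_normal T S))}"

definition RT_N :: "'a::euclidean_space set set \<Rightarrow> 'a set \<Rightarrow> ('a \<Rightarrow> 'a) set" where
  "RT_N \<T> \<Gamma>N = {r \<in> RT \<T>. \<forall>T\<in>\<T>. \<forall>S. S facet_of T \<and> S \<subseteq> closure \<Gamma>N \<longrightarrow>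
     (\<forall>x\<in>S. piece T r x \<bullet> outer_normal T S = 0)}"

definition cr_interpolant :: "'a::euclidean_space set set \<Rightarrow> ('a \<Rightarrow> real) \<Rightarrow> ('a \<Rightarrow> real) \<Rightarrow> bool" where
  "cr_interpolant \<T> v w \<longleftrightarrow> w \<in> CR \<T> \<and> (\<forall>T\<in>\<T>. \<forall>S. S facet_of T \<longrightarrow>
     (\<exists>g. has_trace (interior T) v S g \<and>
          average (surface_measure S) (piece T w) = average (surface_measure S) g))"

text \<open>The interpolant is unique up to its values on the skeleton.\<close>

definition I_cr :: "'a::euclidean_space set set \<Rightarrow> ('a \<Rightarrow> real) \<Rightarrow> 'a \<Rightarrow> real" where
  "I_cr \<T> v = (SOME w. cr_interpolant \<T> v w)"

definition rt_interpolation ::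
  "'a::euclidean_space set \<Rightarrow> 'a set \<Rightarrow> 'a set \<Rightarrow> 'a set set \<Rightarrow> (('a \<Rightarrow> 'a) \<Rightarrow> 'a \<Rightarrow> 'a) \<Rightarrow> bool" where
  "rt_interpolation \<Omega> \<Gamma>D \<Gamma>N \<T> J \<longleftrightarrow> (\<forall>r \<in> Hdiv_N \<Omega> \<Gamma>D. J r \<in> RT_N \<T> \<Gamma>N \<and>
     (AE x in lebesgue_on \<Omega>. divergence \<Omega> (J r) x = Pi_h \<T> (divergence \<Omega> r) x))"


section \<open>Discrete primal and dual energy\<close>

definition discrete_primal_energy ::
  "'a::euclidean_space set \<Rightarrow> 'a set set \<Rightarrow> ('a \<Rightarrow> real) \<Rightarrow> ('a \<Rightarrow> 'a) \<Rightarrow> ('a \<Rightarrow> real) \<Rightarrow> ('a \<Rightarrow> real) \<Rightarrow> real"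
where
  "discrete_primal_energy \<Omega> \<T> fh fvh uDh vh =
     (L2_norm (lebesgue_on \<Omega>) (nabla_h \<T> (\<lambda>x. vh x + uDh x)))\<^sup>2 / 2 -
     L2_inner (lebesgue_on \<Omega>) fh (Pi_h \<T> vh) - L2_inner (lebesgue_on \<Omega>) fvh (nabla_h \<T> vh)"

definition discrete_dual_energy ::
  "'a::euclidean_space set \<Rightarrow> 'a set set \<Rightarrow> ('a \<Rightarrow> real) \<Rightarrow> ('a \<Rightarrow> 'a) \<Rightarrow> ('a \<Rightarrow> real) \<Rightarrow> ('a \<Rightarrow> 'a) \<Rightarrow> ereal"
where
  "discrete_dual_energy \<Omega> \<T> fh fvh uDh rh =
     (if AE x in lebesgue_on \<Omega>. divergence \<Omega> (\<lambda>y. rh y - fvh y) x = - fh x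
      then ereal (- (L2_norm (lebesgue_on \<Omega>) (Pi_h \<T> rh))\<^sup>2 / 2 +
                  L2_inner (lebesgue_on \<Omega>) (Pi_h \<T> rh) (nabla_h \<T> uDh))
      else - \<infinity>)"

text \<open>The set \<open>K\<^sup>h\<^sub>q\<close> of discretely admissible fluxes.\<close>

definition admissible_fluxes ::
  "'a::euclidean_space set \<Rightarrow> 'a set \<Rightarrow> 'a set set \<Rightarrow> ('a \<Rightarrow> real) \<Rightarrow> ('a \<Rightarrow> 'a) \<Rightarrow> ('a \<Rightarrow> 'a) set" where
  "admissible_fluxes \<Omega> \<Gamma>N \<T> fh fvh = {rh. (\<lambda>x. rh x - fvh x) \<in> RT_N \<T> \<Gamma>N \<and>
     (AE x in lebesgue_on \<Omega>. divergence \<Omega> (\<lambda>y. rh y - fvh y) x = - fh x)}"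

end

theory Submission
  imports Defs
begin

text \<open>
  The maximiser of the dual problem is \<open>q = \<nabla>(u + uD)\<close>, and on the discrete level
  \<open>\<Pi>\<^sub>h qh = \<nabla>\<^sub>h (uh + uDh)\<close>. The latter holds because a piecewise constant field orthogonal to all
  gradients of \<open>CR_D\<close> functions is a divergence-free Raviart-Thomas field, hence a direction in which
  the discrete dual functional is stationary. The discrete integration by parts formula
  \<open>(\<Pi>\<^sub>h r, \<nabla>\<^sub>h v) = - (div r, \<Pi>\<^sub>h v)\<close> makes \<open>\<nabla>\<^sub>h v\<close> orthogonal to \<open>\<Pi>\<^sub>h r\<close> whenever \<open>div r = 0\<close>.

  For (i), \<open>x = \<nabla>\<^sub>h (I_cr u - uh)\<close> and \<open>y = \<Pi>\<^sub>h (I_rt (q - fv)) - \<Pi>\<^sub>h (qh - fvh)\<close> are orthogonal in this way,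
  and \<open>x - y = \<Pi>\<^sub>h (q - fv) - \<Pi>\<^sub>h (I_rt (q - fv))\<close> since \<open>\<nabla>\<^sub>h I_cr = \<Pi>\<^sub>h \<nabla>\<close>.
  For (ii), let \<open>z = \<nabla>(u + uD) - \<nabla>\<^sub>h (uh + uDh) = q - \<Pi>\<^sub>h qh\<close>. Given \<open>vh\<close> and \<open>rh\<close>, the fields
  \<open>x = \<nabla>\<^sub>h (vh - uh)\<close> and \<open>y = \<Pi>\<^sub>h (rh - qh)\<close> are orthogonal, so that
  \<open>\<parallel>z\<parallel>\<^sup>2 \<le> \<parallel>z - x\<parallel>\<^sup>2 + \<parallel>z - y\<parallel>\<^sup>2\<close>, which gives (ii) even with the constant \<open>2\<close>.

  The analytic input is the divergence theorem on a simplex. It follows from the cone formula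
  \<open>\<integral>\<^sub>T (d \<phi> + (x - a) \<bullet> \<nabla>\<phi>) = h \<integral>\<^sub>S \<phi>\<close> for the vertex \<open>a\<close> opposite to the facet \<open>S\<close>, which also yields the
  trace inequality; density of smooth functions then extends both to \<open>H\<^sup>1\<close>.
\<close>

text \<open>Much of the length is owed to \<open>I_cr\<close>: it is a choice operator applied to
  functions that are only weakly differentiable, so it has no usable property before each facet is
  known to carry a trace, and the same one from both sides. Density of smooth functions is therefore
  proved not on \<Omega> but on a patch, the interior of the union of the one or two elements at a
  facet. The patch is star-shaped, so arguments can be contracted towards a centre before
  mollifying, and no values beyond the boundary are consumed. The trace inequality and completeness
  of the surface \<open>L2\<close> space then produce the trace as a limit. Orthogonality to
  gradients becomes a statement on normal components through two facts on the mesh: a facet is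
  shared by two elements, with opposite normals, exactly if it does not lie in the boundary, and no
  facet lies in both \<open>closure \<Gamma>D\<close> and \<open>closure \<Gamma>N\<close>. The
  first uses that a Lipschitz domain is the interior of its closure, the second also that
  \<open>\<Gamma>D\<close> is relatively open and disjoint from \<open>\<Gamma>N\<close>. The
  constant 2 in (ii) counts the error terms on the left, both equal to the square of the norm of
  \<open>z\<close>.\<close>

lemma inner_gradient_Basis:
  assumes "b \<in> Basis"
  shows "gradient f x \<bullet> b = frechet_derivative f (at x) b"
  using assms by (simp add: gradient_def inner_sum_left inner_Basis if_distrib sum.delta cong: if_cong)

text \<open>Linearity of \<open>D\<close> reassembles the coordinates in the definition, so
  \<open>gradient f x\<close> is the Riesz representative of the derivative. This is the form in
  which derivatives are computed below.\<close>

lemma inner_gradient: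
  assumes "(f has_derivative D) (at x)"
  shows "gradient f x \<bullet> h = D h"
proof -
  interpret bounded_linear D using assms by (rule has_derivative_bounded_linear)
  have eq: "frechet_derivative f (at x) = D"
    using frechet_derivative_at[OF assms] by simp
  have "D h = D (\<Sum>b\<in>Basis. (h \<bullet> b) *\<^sub>R b)" by (simp add: euclidean_representation)
  also have "\<dots> = gradient f x \<bullet> h"
    by (simp add: sum scale gradient_def eq inner_sum_left inner_commute[of h] mult.commute)
  finally show ?thesis by simp
qed

lemma gradient_eqI:
  assumes "(f has_derivative (\<lambda>h. g \<bullet> h)) (at x)"
  shows "gradient f x = g"
  using inner_gradient[OF assms] by (metis inner_commute vector_eq_rdot)

lemma has_derivative_gradient:
  assumes "f differentiable (at x)"
  shows "(f has_derivative (\<lambda>h. gradient f x \<bullet> h)) (at x)"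
  using assms inner_gradient unfolding differentiable_def by (metis (no_types, lifting) ext)

subsection \<open>Continuously differentiable functions\<close>

text \<open>One continuous derivative is what the fundamental theorem of calculus along rays
  consumes. The class is closed under products, so the divergence theorem can be applied to squares
  and to products with affine functions.\<close>

definition C1 :: "('a::euclidean_space \<Rightarrow> real) \<Rightarrow> bool" where
  "C1 f \<longleftrightarrow> (\<forall>x. f differentiable (at x)) \<and> continuous_on UNIV (gradient f)"

lemma C1_has_derivative: "C1 f \<Longrightarrow> (f has_derivative (\<lambda>h. gradient f x \<bullet> h)) (at x)"
  by (auto simp: C1_def intro: has_derivative_gradient)

lemma C1_continuous_gradient: "C1 f \<Longrightarrow> continuous_on A (gradient f)"
  by (auto simp: C1_def intro: continuous_on_subset)

lemma C1_continuous: "C1 f \<Longrightarrow> continuous_on A f"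
  by (meson C1_has_derivative continuous_at_imp_continuous_on has_derivative_continuous)

lemma C1I:
  assumes "\<And>x. (f has_derivative (\<lambda>h. F x \<bullet> h)) (at x)" "continuous_on UNIV F"
  shows "C1 f" "gradient f = F"
proof -
  show *: "gradient f = F" using gradient_eqI[OF assms(1)] by auto
  show "C1 f" unfolding C1_def * using assms differentiable_def by blast
qed

lemma C1_add:
  assumes "C1 f" "C1 g"
  shows "C1 (\<lambda>x. f x + g x)" "gradient (\<lambda>x. f x + g x) = (\<lambda>x. gradient f x + gradient g x)"
proof -
  have "((\<lambda>x. f x + g x) has_derivative (\<lambda>h. (gradient f x + gradient g x) \<bullet> h)) (at x)" for x
    unfolding inner_add_left
    by (intro has_derivative_add C1_has_derivative assms)
  moreover have "continuous_on UNIV (\<lambda>x. gradient f x + gradient g x)"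
    by (intro continuous_intros C1_continuous_gradient assms)
  ultimately show "C1 (\<lambda>x. f x + g x)" "gradient (\<lambda>x. f x + g x) = (\<lambda>x. gradient f x + gradient g x)"
    by (rule C1I)+
qed

lemma C1_mult:
  assumes "C1 f" "C1 g"
  shows "C1 (\<lambda>x. f x * g x)"
    "gradient (\<lambda>x. f x * g x) = (\<lambda>x. f x *\<^sub>R gradient g x + g x *\<^sub>R gradient f x)"
proof -
  have "((\<lambda>x. f x * g x) has_derivative (\<lambda>h. (f x *\<^sub>R gradient g x + g x *\<^sub>R gradient f x) \<bullet> h)) (at x)" for x
    using has_derivative_mult[OF C1_has_derivative[OF assms(1)] C1_has_derivative[OF assms(2)], of x]
    by (simp add: inner_add_left mult.commute)
  moreover have "continuous_on UNIV (\<lambda>x. f x *\<^sub>R gradient g x + g x *\<^sub>R gradient f x)"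
    by (intro continuous_intros C1_continuous_gradient C1_continuous assms)
  ultimately show "C1 (\<lambda>x. f x * g x)"
    "gradient (\<lambda>x. f x * g x) = (\<lambda>x. f x *\<^sub>R gradient g x + g x *\<^sub>R gradient f x)"
    by (rule C1I)+
qed

lemma C1_affine: "C1 (\<lambda>x. c + g \<bullet> x)" "gradient (\<lambda>x. c + g \<bullet> x) = (\<lambda>x. g)"
proof -
  have "((\<lambda>x. c + g \<bullet> x) has_derivative (\<lambda>h. g \<bullet> h)) (at x)" for x
    by (auto intro!: derivative_eq_intros)
  moreover have "continuous_on UNIV (\<lambda>x. g)" by simp
  ultimately show "C1 (\<lambda>x. c + g \<bullet> x)" "gradient (\<lambda>x. c + g \<bullet> x) = (\<lambda>x. g)"
    by (rule C1I[where F = "\<lambda>x. g"])+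
qed

lemma C1_const: "C1 (\<lambda>x. c)" "gradient (\<lambda>x. c) = (\<lambda>x. 0)"
  using C1_affine[of c 0] by simp_all

lemma C1_diff:
  assumes "C1 f" "C1 g"
  shows "C1 (\<lambda>x. f x - g x)" "gradient (\<lambda>x. f x - g x) = (\<lambda>x. gradient f x - gradient g x)"
  using C1_add[OF assms(1) C1_mult(1)[OF C1_const(1)[of "-1"] assms(2)]]
    C1_mult(2)[OF C1_const(1)[of "-1"] assms(2)] by (simp_all add: C1_const)

subsection \<open>Smooth functions\<close>

lemma smooth_imp_C1: "smooth f \<Longrightarrow> C1 f"
proof -
  assume "smooth f"
  then have "C_k (Suc 0) f" by (simp add: smooth_def)
  then have d: "\<forall>x. f differentiable (at x)"
    and c: "\<And>b. b\<in>Basis \<Longrightarrow> continuous_on UNIV (\<lambda>x. frechet_derivative f (at x) b)" by auto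
  have "continuous_on UNIV (\<lambda>x. \<Sum>b\<in>Basis. frechet_derivative f (at x) b *\<^sub>R b)"
    by (intro continuous_intros c)
  then show "C1 f" using d by (simp add: C1_def gradient_def[abs_def])
qed

lemma smooth_partial:
  assumes "smooth f" "b \<in> Basis"
  shows "smooth (\<lambda>x. gradient f x \<bullet> b)"
  unfolding smooth_def inner_gradient_Basis[OF assms(2)]
proof
  fix k
  have "C_k (Suc k) f" using assms(1) smooth_def by blast
  then show "C_k k (\<lambda>x. frechet_derivative f (at x) b)" using assms(2) by simp
qed

text \<open>Lets a derivative found by the usual rules serve in the recursion of \<open>C_k\<close>,
  which is phrased with \<open>frechet_derivative\<close>.\<close>

lemma C_k_SucI:
  assumes "\<And>x. (f has_derivative D x) (at x)" "\<And>b. b \<in> Basis \<Longrightarrow> C_k k (\<lambda>x. D x b)"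
  shows "C_k (Suc k) f"
proof -
  have "frechet_derivative f (at x) = D x" for x
    using frechet_derivative_at[OF assms(1)] by simp
  then show ?thesis using assms by (auto simp: differentiable_def)
qed

lemma C_k_Suc_has_derivative:
  "C_k (Suc k) f \<Longrightarrow> (f has_derivative frechet_derivative f (at x)) (at x)"
  using frechet_derivative_works by auto

lemma C_k_const: "C_k k (\<lambda>x. c)"
proof (induction k arbitrary: c)
  case (Suc k)
  show ?case by (rule C_k_SucI[where D = "\<lambda>_ _. 0"]) (auto simp: Suc)
qed simp

lemma C_k_add: "C_k k f \<Longrightarrow> C_k k g \<Longrightarrow> C_k k (\<lambda>x. f x + g x)"
proof (induction k arbitrary: f g)
  case 0 then show ?case by (auto intro: continuous_intros)
next
  case (Suc k)
  show ?case
    by (rule C_k_SucI[OF has_derivative_add[OF Suc.prems[THEN C_k_Suc_has_derivative]]])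
      (use Suc in auto)
qed

lemma C_k_cmult: "C_k k f \<Longrightarrow> C_k k (\<lambda>x. c * f x)"
proof (induction k arbitrary: f)
  case 0 then show ?case by (auto intro: continuous_intros)
next
  case (Suc k)
  show ?case
    by (rule C_k_SucI[OF has_derivative_mult_right[OF C_k_Suc_has_derivative[OF Suc.prems]]])
      (use Suc in auto)
qed

lemma C_k_sum: "(\<And>i. i \<in> I \<Longrightarrow> C_k k (f i)) \<Longrightarrow> C_k k (\<lambda>x. \<Sum>i\<in>I. f i x)"
  by (induction I rule: infinite_finite_induct) (auto simp: C_k_const intro: C_k_add)

lemma C_k_compose_affine: "C_k k f \<Longrightarrow> C_k k (\<lambda>x. f (p + r *\<^sub>R x))"
proof (induction k arbitrary: f)
  case 0
  then have "continuous_on UNIV f" by simp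
  then show ?case
    by simp (rule continuous_on_compose2[of UNIV f], auto intro!: continuous_intros)
next
  case (Suc k)
  have "((\<lambda>x. f (p + r *\<^sub>R x)) has_derivative
      (\<lambda>h. r * frechet_derivative f (at (p + r *\<^sub>R x)) h)) (at x)" for x
  proof -
    have "((\<lambda>x. p + r *\<^sub>R x) has_derivative (\<lambda>h. r *\<^sub>R h)) (at x)"
      by (auto intro!: derivative_eq_intros)
    from has_derivative_compose[OF this C_k_Suc_has_derivative[OF Suc.prems]]
    show ?thesis
      using C_k_Suc_has_derivative[OF Suc.prems, of "p + r *\<^sub>R x"]
      by (simp add: bounded_linear.linear has_derivative_bounded_linear linear_cmul)
  qed
  then show ?case
    by (rule C_k_SucI) (use Suc in \<open>auto intro: C_k_cmult\<close>)
qed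

lemma smooth_add: "smooth f \<Longrightarrow> smooth g \<Longrightarrow> smooth (\<lambda>x. f x + g x)"
  by (simp add: smooth_def C_k_add)

lemma smooth_cmult: "smooth f \<Longrightarrow> smooth (\<lambda>x. c * f x)"
  by (simp add: smooth_def C_k_cmult)

lemma smooth_compose_affine: "smooth f \<Longrightarrow> smooth (\<lambda>x. f (p + r *\<^sub>R x))"
  by (simp add: smooth_def C_k_compose_affine)

lemma smooth_continuous: "smooth f \<Longrightarrow> continuous_on A f"
  using smooth_imp_C1 C1_continuous by blast

subsection \<open>A smooth bump function\<close>

text \<open>For \<open>m = 0\<close> this is the classical function \<open>exp (-1/t)\<close>, flat
  at 0. The factor \<open>inverse t ^ m\<close> makes the family closed under differentiation up to
  linear combinations, so smoothness can be proved for all members by one induction.\<close>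

definition flat_exp :: "nat \<Rightarrow> real \<Rightarrow> real" where
  "flat_exp m t = (if t > 0 then inverse t ^ m * exp (- inverse t) else 0)"

lemma power_le_fact_exp:
  fixes s :: real assumes "0 \<le> s" shows "s ^ n \<le> fact n * exp s"
proof -
  have "s ^ n /\<^sub>R fact n \<le> (\<Sum>n. s ^ n /\<^sub>R fact n)"
    using sum_le_suminf[OF summable_exp_generic, of "{n}" s] assms by auto
  then show ?thesis by (simp add: exp_def field_simps)
qed

lemma flat_exp_nonneg: "0 \<le> flat_exp m t"
  by (simp add: flat_exp_def)

text \<open>The exponential series at \<open>1/t\<close> bounds \<open>(1/t)^(m+1)\<close> by
  \<open>(m+1)! exp (1/t)\<close>. The resulting linear decay at 0 yields the derivative at 0 once
  the index is raised by one.\<close>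

lemma flat_exp_le: "flat_exp m t \<le> fact (Suc m) * \<bar>t\<bar>"
proof (cases "t > 0")
  case True
  have "inverse t * inverse t ^ m \<le> fact (Suc m) * exp (inverse t)"
    using power_le_fact_exp[of "inverse t" "Suc m"] True by simp
  then have "inverse t * inverse t ^ m * t * exp (- inverse t)
      \<le> fact (Suc m) * exp (inverse t) * t * exp (- inverse t)"
    using True by (intro mult_right_mono) auto
  then show ?thesis using True
    by (simp add: flat_exp_def exp_minus field_simps)
next
  case False
  have "0 \<le> fact (Suc m) * \<bar>t\<bar>" by (intro mult_nonneg_nonneg) auto
  then show ?thesis using False by (metis flat_exp_def)
qed

lemma DERIV_flat_exp:
  "(flat_exp m has_real_derivative (- real m * flat_exp (Suc m) t + flat_exp (m + 2) t)) (at t)"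
proof -
  consider "t > 0" | "t < 0" | "t = 0" by linarith
  then show ?thesis
  proof cases
    case 1
    define u where "u = inverse t"
    have i: "(inverse has_real_derivative - (u * u)) (at t)"
      using DERIV_inverse[of t] 1 by (simp add: u_def power2_eq_square)
    have "((\<lambda>t. inverse t ^ m * exp (- inverse t)) has_real_derivative
        (real m * (- (u * u) * u ^ (m - 1))) * exp (- u) + (exp (- u) * (u * u)) * u ^ m) (at t)"
      using DERIV_mult[OF DERIV_power[OF i, of m] DERIV_fun_exp[OF DERIV_minus[OF i]]]
      by (simp add: u_def mult.assoc)
    moreover have "(real m * (- (u * u) * u ^ (m - 1))) * exp (- u) + (exp (- u) * (u * u)) * u ^ m
       = - real m * flat_exp (Suc m) t + flat_exp (m + 2) t"
      using 1 by (cases m) (simp_all add: flat_exp_def flip: u_def, simp add: algebra_simps)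
    ultimately have d: "((\<lambda>t. inverse t ^ m * exp (- inverse t)) has_real_derivative
        (- real m * flat_exp (Suc m) t + flat_exp (m + 2) t)) (at t)" by simp
    have ev: "\<forall>\<^sub>F x in nhds t. flat_exp m x = inverse x ^ m * exp (- inverse x)"
      using eventually_nhds_in_open[of "{0<..}" t] 1
      by (auto simp: flat_exp_def elim: eventually_mono)
    show ?thesis using DERIV_cong_ev[OF refl ev refl] d by simp
  next
    case 2
    have ev: "\<forall>\<^sub>F x in nhds t. flat_exp m x = 0"
      using eventually_nhds_in_open[of "{..<0}" t] 2
      by (auto simp: flat_exp_def elim: eventually_mono)
    have "(flat_exp m has_real_derivative 0) (at t)"
      using DERIV_cong_ev[OF refl ev refl, of 0] by simp
    then show ?thesis using 2 by (simp add: flat_exp_def)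
  next
    case 3
    have lim: "((\<lambda>h. fact (Suc (Suc m)) * \<bar>h\<bar>) \<longlongrightarrow> fact (Suc (Suc m)) * \<bar>0::real\<bar>) (at 0)"
      by (intro tendsto_intros)
    have "((\<lambda>h. flat_exp m h / h) \<longlongrightarrow> 0) (at 0)"
    proof (rule Lim_null_comparison)
      show "((\<lambda>h. fact (Suc (Suc m)) * \<bar>h\<bar>) \<longlongrightarrow> (0::real)) (at 0)" using lim by simp
      \<comment> \<open>Division by \<open>h\<close> raises the index in the family by one, so the
        linear bound for \<open>Suc m\<close> shows that the difference quotient at 0 tends to
        0.\<close>
      have "norm (flat_exp m h / h) \<le> fact (Suc (Suc m)) * \<bar>h\<bar>" for h
      proof -
        have "norm (flat_exp m h / h) = flat_exp (Suc m) h"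
          by (auto simp: flat_exp_def divide_inverse)
        then show ?thesis using flat_exp_le[of "Suc m" h] by simp
      qed
      then show "\<forall>\<^sub>F h in at 0. norm (flat_exp m h / h) \<le> fact (Suc (Suc m)) * \<bar>h\<bar>" by simp
    qed
    then show ?thesis using 3 by (simp add: DERIV_def flat_exp_def)
  qed
qed

text \<open>Each factor carries its own exponent \<open>m w\<close>: differentiating raises one of
  them by 1 or 2 and leaves the shape of the product unchanged, so the induction on \<open>k\<close>
  closes when \<open>m\<close> is arbitrary.\<close>

lemma smooth_prod_flat_exp:
  fixes W :: "'a::euclidean_space set"
  assumes "finite W"
  shows "C_k k (\<lambda>x. \<Prod>w\<in>W. flat_exp (m w) (r + x \<bullet> w))"
proof (induction k arbitrary: m)
  case 0
  have "continuous_on UNIV (flat_exp n)" for n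
    using DERIV_flat_exp by (meson DERIV_continuous continuous_at_imp_continuous_on)
  then have "continuous_on UNIV (\<lambda>x::'a. flat_exp n (r + x \<bullet> w))" for n w
    by (rule continuous_on_compose2[of UNIV]) (auto intro!: continuous_intros)
  then show ?case by (simp add: continuous_on_prod)
next
  case (Suc k)
  let ?P = "\<lambda>m x. \<Prod>w\<in>W. flat_exp (m w) (r + x \<bullet> w)"
  have "(?P m has_derivative (\<lambda>h. \<Sum>w\<in>W. (h \<bullet> w) *
      (- real (m w) * ?P (m(w := Suc (m w))) x + ?P (m(w := m w + 2)) x))) (at x)" for x
  proof -
    have d: "((\<lambda>x. flat_exp (m w) (r + x \<bullet> w)) has_derivative
       (\<lambda>h. (h \<bullet> w) * (- real (m w) * flat_exp (Suc (m w)) (r + x \<bullet> w) + flat_exp (m w + 2) (r + x \<bullet> w)))) (at x)" for w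
    proof -
      have 1: "((\<lambda>x. r + x \<bullet> w) has_derivative (\<lambda>h. h \<bullet> w)) (at x)"
        by (auto intro!: derivative_eq_intros)
      show ?thesis
        using has_derivative_compose[OF 1 DERIV_flat_exp[unfolded has_field_derivative_def]]
        by (simp add: mult.commute)
    qed
    have split: "?P (m(w := j)) x = flat_exp j (r + x \<bullet> w) * (\<Prod>v\<in>W - {w}. flat_exp (m v) (r + x \<bullet> v))"
      if "w \<in> W" for w j
    proof -
      have "?P (m(w := j)) x = flat_exp ((m(w := j)) w) (r + x \<bullet> w) * (\<Prod>v\<in>W - {w}. flat_exp ((m(w := j)) v) (r + x \<bullet> v))"
        by (rule prod.remove[OF assms that])
      also have "(\<Prod>v\<in>W - {w}. flat_exp ((m(w := j)) v) (r + x \<bullet> v)) = (\<Prod>v\<in>W - {w}. flat_exp (m v) (r + x \<bullet> v))"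
        by (rule prod.cong) auto
      finally show ?thesis by simp
    qed
    have e: "(\<lambda>h. \<Sum>w\<in>W. ((h \<bullet> w) * (- real (m w) * flat_exp (Suc (m w)) (r + x \<bullet> w) + flat_exp (m w + 2) (r + x \<bullet> w)))
         * (\<Prod>v\<in>W - {w}. flat_exp (m v) (r + x \<bullet> v)))
      = (\<lambda>h. \<Sum>w\<in>W. (h \<bullet> w) *
      (- real (m w) * ?P (m(w := Suc (m w))) x + ?P (m(w := m w + 2)) x))"
    proof (intro ext sum.cong refl)
      fix h w assume w: "w \<in> W"
      show "((h \<bullet> w) * (- real (m w) * flat_exp (Suc (m w)) (r + x \<bullet> w) + flat_exp (m w + 2) (r + x \<bullet> w)))
         * (\<Prod>v\<in>W - {w}. flat_exp (m v) (r + x \<bullet> v)) = (h \<bullet> w) *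
      (- real (m w) * ?P (m(w := Suc (m w))) x + ?P (m(w := m w + 2)) x)"
        unfolding split[OF w] by (simp add: algebra_simps)
    qed
    show ?thesis
      by (rule has_derivative_eq_rhs[OF has_derivative_prod[OF d] e])
  qed
  then show ?case
    by (rule C_k_SucI) (intro C_k_sum C_k_cmult C_k_add Suc.IH)
qed

text \<open>The product over plus and minus the basis vectors is positive exactly on an open cube
  around 0. Its integral is positive because it is nonzero on an open set, and dividing by it gives
  the bump.\<close>

lemma smooth_bump_exists:
  obtains \<rho> :: "'a::euclidean_space \<Rightarrow> real"
  where "smooth \<rho>" "\<And>x. 0 \<le> \<rho> x" "\<And>x. 1 < norm x \<Longrightarrow> \<rho> x = 0" "(LINT x|lborel. \<rho> x) = 1"
proof -
  \<comment> \<open>Half the side of the cube. With \<open>1/d\<close> the absolute values of the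
    \<open>d\<close> coordinates sum to at most 1, which bounds the Euclidean norm.\<close>
  define \<delta> where "\<delta> = 1 / real DIM('a)"
  define W :: "'a set" where "W = Basis \<union> uminus ` Basis"
  define P where "P = (\<lambda>x::'a. \<Prod>w\<in>W. flat_exp 0 (\<delta> + x \<bullet> w))"
  have fin: "finite W" and d0: "\<delta> > 0" by (auto simp: W_def \<delta>_def)
  have sm: "smooth P" unfolding smooth_def P_def using smooth_prod_flat_exp[OF fin, of _ "\<lambda>_. 0"] by auto
  have nn: "0 \<le> P x" for x by (simp add: P_def prod_nonneg flat_exp_nonneg)
  have out: "P x = 0" if "1 < norm x" for x
  proof (rule ccontr)
    assume "P x \<noteq> 0"
    then have *: "\<delta> + x \<bullet> w > 0" if "w \<in> W" for w
      using that fin by (auto simp: P_def flat_exp_def split: if_splits)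
    have "\<bar>x \<bullet> b\<bar> \<le> \<delta>" if "b \<in> Basis" for b
      using *[of b] *[of "- b"] that by (auto simp: W_def)
    then have "(\<Sum>b\<in>Basis. \<bar>x \<bullet> b\<bar>) \<le> (\<Sum>b\<in>(Basis::'a set). \<delta>)" by (intro sum_mono)
    then have "norm x \<le> 1" using norm_le_l1[of x] by (simp add: \<delta>_def)
    then show False using that by simp
  qed
  have cont: "continuous_on A P" for A using smooth_continuous[OF sm] .
  have int: "integrable lborel P"
  proof -
    have "integrable lborel (\<lambda>x. indicator (cball 0 1) x *\<^sub>R P x)"
      using borel_integrable_compact[OF compact_cball cont] .
    moreover have "(\<lambda>x. indicator (cball 0 1) x *\<^sub>R P x) = P"
      using out by (auto simp: indicator_def fun_eq_iff not_le)
    ultimately show ?thesis by simp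
  qed
  have "(LINT x|lborel. P x) \<noteq> 0"
  proof
    assume "(LINT x|lborel. P x) = 0"
    then have ae: "AE x in lborel. P x = 0"
      using integral_nonneg_eq_0_iff_AE[OF int] nn by auto
    have op: "open {x. P x \<noteq> 0}"
      using open_Collect_neq[OF cont[of UNIV] continuous_on_const[of UNIV 0]] by simp
    have "P 0 \<noteq> 0" using d0 fin by (simp add: P_def flat_exp_def)
    then have "\<not> negligible {x. P x \<noteq> 0}"
      using open_not_negligible[OF op] by blast
    moreover have "negligible {x. P x \<noteq> 0}"
    proof -
      have "{x. P x \<noteq> 0} \<in> null_sets lborel"
        using AE_iff_null[of lborel "\<lambda>x. P x = 0"] ae op by auto
      then show ?thesis using null_sets_completionI negligible_iff_null_sets by blast
    qed
    ultimately show False by simp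
  qed
  moreover have "(LINT x|lborel. P x) \<ge> 0" using nn by simp
  ultimately have pos: "(LINT x|lborel. P x) > 0" by simp
  show thesis
    by (rule that[of "\<lambda>x. inverse (LINT x|lborel. P x) * P x"])
       (use pos nn out sm in \<open>auto intro: smooth_cmult\<close>)
qed

subsection \<open>Integration along hyperplanes\<close>

lemma nn_integral_lborel_translate:
  fixes f :: "'a::euclidean_space \<Rightarrow> ennreal"
  assumes [measurable]: "f \<in> borel_measurable borel"
  shows "(\<integral>\<^sup>+x. f (x + v) \<partial>lborel) = (\<integral>\<^sup>+x. f x \<partial>lborel)"
proof -
  have "(\<integral>\<^sup>+x. f x \<partial>distr lborel borel ((+) v)) = (\<integral>\<^sup>+x. f (v + x) \<partial>lborel)"
    by (rule nn_integral_distr) auto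
  then show ?thesis by (simp add: lborel_distr_plus add.commute)
qed

lemma nn_integral_lborel_affine:
  fixes f :: "'a::euclidean_space \<Rightarrow> ennreal"
  assumes [measurable]: "f \<in> borel_measurable borel" and "r > 0"
  shows "(\<integral>\<^sup>+x. f x \<partial>lborel) = ennreal (r ^ DIM('a)) * (\<integral>\<^sup>+x. f (p + r *\<^sub>R x) \<partial>lborel)"
proof -
  have "(\<integral>\<^sup>+x. f x \<partial>lborel) =
      (\<integral>\<^sup>+x. f x \<partial>density (distr lborel borel (\<lambda>x. p + r *\<^sub>R x)) (\<lambda>_. ennreal (\<bar>r\<bar> ^ DIM('a))))"
    using lborel_affine[of r p] assms by simp
  also have "\<dots> = ennreal (r ^ DIM('a)) * (\<integral>\<^sup>+x. f (p + r *\<^sub>R x) \<partial>lborel)"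
    using assms by (simp add: nn_integral_density nn_integral_distr nn_integral_cmult)
  finally show ?thesis .
qed

lemma sets_hyperplane_measure [measurable_cong]: "sets (hyperplane_measure n c) = sets borel"
  by (simp add: hyperplane_measure_def)

lemma space_hyperplane_measure [simp]: "space (hyperplane_measure n c) = UNIV"
  by (simp add: hyperplane_measure_def)

lemma nn_integral_hyperplane_measure:
  assumes [measurable]: "g \<in> borel_measurable borel"
  shows "(\<integral>\<^sup>+s. g s \<partial>hyperplane_measure n c) =
    (\<integral>\<^sup>+x. g (x - (n \<bullet> x - c) *\<^sub>R n) * indicator {c..c+1} (n \<bullet> x) \<partial>lborel)"
proof -
  have [measurable]: "{x::'a. c \<le> n \<bullet> x \<and> n \<bullet> x \<le> c + 1} \<in> sets borel" by measurable
  have "(\<integral>\<^sup>+s. g s \<partial>hyperplane_measure n c) =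
     (\<integral>\<^sup>+x. g (x - (n \<bullet> x - c) *\<^sub>R n) * indicator {x. c \<le> n \<bullet> x \<and> n \<bullet> x \<le> c + 1} x \<partial>lborel)"
    unfolding hyperplane_measure_def
    by (subst nn_integral_distr) (auto simp: nn_integral_restrict_space intro!: measurable_restrict_space1)
  also have "\<dots> = (\<integral>\<^sup>+x. g (x - (n \<bullet> x - c) *\<^sub>R n) * indicator {c..c+1} (n \<bullet> x) \<partial>lborel)"
    by (intro nn_integral_cong) (auto simp: indicator_def)
  finally show ?thesis .
qed

lemma AE_hyperplane_measure:
  assumes "norm n = 1"
  shows "AE s in hyperplane_measure n c. n \<bullet> s = c"
proof -
  have [measurable]: "{x::'a. c \<le> n \<bullet> x \<and> n \<bullet> x \<le> c + 1} \<in> sets borel" by measurable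
  have "n \<bullet> n = 1" using assms by (simp add: dot_square_norm)
  then show ?thesis unfolding hyperplane_measure_def
    by (subst AE_distr_iff) (auto intro!: measurable_restrict_space1 simp: inner_diff_right)
qed

text \<open>Foliation of space by the translates of a hyperplane. The surface measure is an integral
  over a slab of height 1, so after a shift in \<open>t\<close> and another in \<open>x\<close>
  Fubini leaves, for each \<open>x\<close>, the length of the set of \<open>t\<close> for which
  \<open>x\<close> lies in the shifted slab, and that length is 1.\<close>

lemma nn_integral_hyperplane_fibres:
  fixes G :: "'a::euclidean_space \<Rightarrow> ennreal"
  assumes [measurable]: "G \<in> borel_measurable borel" and n: "norm n = 1"
  shows "(\<integral>\<^sup>+x. G x \<partial>lborel) = (\<integral>\<^sup>+t. (\<integral>\<^sup>+s. G (s + t *\<^sub>R n) \<partial>hyperplane_measure n c) \<partial>lborel)"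
proof -
  have nn: "n \<bullet> n = 1" using n by (simp add: dot_square_norm)
  let ?I = "\<lambda>x. indicator {c..c+1} (n \<bullet> x) :: ennreal"
  have "(\<integral>\<^sup>+t. (\<integral>\<^sup>+s. G (s + t *\<^sub>R n) \<partial>hyperplane_measure n c) \<partial>lborel)
     = (\<integral>\<^sup>+t. (\<integral>\<^sup>+x. G (x - (n \<bullet> x - c) *\<^sub>R n + t *\<^sub>R n) * ?I x \<partial>lborel) \<partial>lborel)"
    by (intro nn_integral_cong nn_integral_hyperplane_measure) auto
  also have "\<dots> = (\<integral>\<^sup>+x. (\<integral>\<^sup>+t. G (x - (n \<bullet> x - c) *\<^sub>R n + t *\<^sub>R n) * ?I x \<partial>lborel) \<partial>lborel)"
    by (rule lborel_pair.Fubini') auto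
  also have "\<dots> = (\<integral>\<^sup>+x. (\<integral>\<^sup>+t. G (x + t *\<^sub>R n) * ?I x \<partial>lborel) \<partial>lborel)"
  proof (rule nn_integral_cong)
    fix x
    have "(\<integral>\<^sup>+t. G (x + t *\<^sub>R n) * ?I x \<partial>lborel)
        = (\<integral>\<^sup>+t. G (x + (t + - (n \<bullet> x - c)) *\<^sub>R n) * ?I x \<partial>lborel)"
      by (rule nn_integral_lborel_translate[symmetric]) auto
    then show "(\<integral>\<^sup>+t. G (x - (n \<bullet> x - c) *\<^sub>R n + t *\<^sub>R n) * ?I x \<partial>lborel) = (\<integral>\<^sup>+t. G (x + t *\<^sub>R n) * ?I x \<partial>lborel)"
      by (simp add: algebra_simps)
  qed
  also have "\<dots> = (\<integral>\<^sup>+t. (\<integral>\<^sup>+x. G (x + t *\<^sub>R n) * ?I x \<partial>lborel) \<partial>lborel)"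
    by (rule lborel_pair.Fubini'[symmetric]) auto
  also have "\<dots> = (\<integral>\<^sup>+t. (\<integral>\<^sup>+x. G x * indicator {c..c+1} (n \<bullet> x - t) \<partial>lborel) \<partial>lborel)"
  proof (rule nn_integral_cong)
    fix t :: real
    have "(\<integral>\<^sup>+x. G x * indicator {c..c+1} (n \<bullet> x - t) \<partial>lborel)
       = (\<integral>\<^sup>+x. G (x + t *\<^sub>R n) * indicator {c..c+1} (n \<bullet> (x + t *\<^sub>R n) - t) \<partial>lborel)"
      by (rule nn_integral_lborel_translate[symmetric]) auto
    then show "(\<integral>\<^sup>+x. G (x + t *\<^sub>R n) * ?I x \<partial>lborel) = (\<integral>\<^sup>+x. G x * indicator {c..c+1} (n \<bullet> x - t) \<partial>lborel)"
      by (simp add: inner_add_right nn)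
  qed
  also have "\<dots> = (\<integral>\<^sup>+x. (\<integral>\<^sup>+t. G x * indicator {c..c+1} (n \<bullet> x - t) \<partial>lborel) \<partial>lborel)"
    by (rule lborel_pair.Fubini') auto
  also have "\<dots> = (\<integral>\<^sup>+x. G x \<partial>lborel)"
  proof (rule nn_integral_cong)
    fix x
    have "(\<integral>\<^sup>+t. G x * indicator {c..c+1} (n \<bullet> x - t) \<partial>lborel)
       = (\<integral>\<^sup>+t. G x * indicator {n \<bullet> x - c - 1..n \<bullet> x - c} t \<partial>lborel)"
      by (intro nn_integral_cong) (auto simp: indicator_def)
    also have "\<dots> = G x" by (simp add: nn_integral_cmult)
    finally show "(\<integral>\<^sup>+t. G x * indicator {c..c+1} (n \<bullet> x - t) \<partial>lborel) = G x" .
  qed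
  finally show ?thesis by simp
qed

text \<open>The slab of height 1 used in \<open>hyperplane_measure\<close> is one choice of profile
  \<open>k\<close> in the normal direction. Other profiles are what remains after a reflection or a
  dilation.\<close>

lemma nn_integral_hyperplane_layer:
  fixes g :: "'a::euclidean_space \<Rightarrow> ennreal"
  assumes [measurable]: "g \<in> borel_measurable borel" "k \<in> borel_measurable borel" and n: "norm n = 1"
  shows "(\<integral>\<^sup>+x. g (x - (n \<bullet> x - c) *\<^sub>R n) * k (n \<bullet> x - c) \<partial>lborel) =
    (\<integral>\<^sup>+s. g s \<partial>hyperplane_measure n c) * (\<integral>\<^sup>+t. k t \<partial>lborel)"
proof -
  have nn: "n \<bullet> n = 1" using n by (simp add: dot_square_norm)
  let ?\<sigma> = "hyperplane_measure n c"
  have "(\<integral>\<^sup>+x. g (x - (n \<bullet> x - c) *\<^sub>R n) * k (n \<bullet> x - c) \<partial>lborel)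
    = (\<integral>\<^sup>+t. (\<integral>\<^sup>+s. g (s + t *\<^sub>R n - (n \<bullet> (s + t *\<^sub>R n) - c) *\<^sub>R n) * k (n \<bullet> (s + t *\<^sub>R n) - c) \<partial>?\<sigma>) \<partial>lborel)"
    by (rule nn_integral_hyperplane_fibres) (use n in auto)
  also have "\<dots> = (\<integral>\<^sup>+t. (\<integral>\<^sup>+s. g s * k t \<partial>?\<sigma>) \<partial>lborel)"
    by (intro nn_integral_cong nn_integral_cong_AE eventually_mono[OF AE_hyperplane_measure[OF n]])
      (auto simp: inner_add_right nn)
  also have "\<dots> = (\<integral>\<^sup>+s. g s \<partial>?\<sigma>) * (\<integral>\<^sup>+t. k t \<partial>lborel)"
    by (simp add: nn_integral_multc nn_integral_cmult)
  finally show ?thesis .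
qed

text \<open>The two normals put the slab on opposite sides of the hyperplane; the profiles on
  \<open>{0..1}\<close> and \<open>{-1..0}\<close> have the same mass. Hence the sign in the choice
  behind \<open>surface_measure\<close> is harmless.\<close>

lemma hyperplane_measure_uminus:
  assumes n: "norm n = 1"
  shows "hyperplane_measure (- n) (- c) = hyperplane_measure n c"
proof (rule measure_eqI)
  fix A assume "A \<in> sets (hyperplane_measure (- n) (- c))"
  then have [measurable]: "A \<in> sets borel" by (simp add: sets_hyperplane_measure)
  have "emeasure (hyperplane_measure (- n) (- c)) A = (\<integral>\<^sup>+s. indicator A s \<partial>hyperplane_measure (- n) (- c))"
    by (simp add: sets_hyperplane_measure)
  also have "\<dots> = (\<integral>\<^sup>+x. indicator A (x - (n \<bullet> x - c) *\<^sub>R n) * indicator {-1..0} (n \<bullet> x - c) \<partial>lborel)"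
    by (subst nn_integral_hyperplane_measure)
      (auto intro!: nn_integral_cong simp: indicator_def algebra_simps)
  also have "\<dots> = (\<integral>\<^sup>+s. indicator A s \<partial>hyperplane_measure n c) * (\<integral>\<^sup>+t. indicator {-1..0::real} t \<partial>lborel)"
    by (rule nn_integral_hyperplane_layer) (use n in auto)
  also have "\<dots> = emeasure (hyperplane_measure n c) A"
    by (simp add: sets_hyperplane_measure)
  finally show "emeasure (hyperplane_measure (- n) (- c)) A = emeasure (hyperplane_measure n c) A" .
qed (simp add: sets_hyperplane_measure)

text \<open>A dilation of the whole space contributes \<open>r ^ d\<close>, but it also turns the
  slab of height 1 into one of height \<open>1/r\<close>; together they leave the power
  \<open>d - 1\<close>.\<close>

lemma nn_integral_hyperplane_dilate:
  fixes g :: "'a::euclidean_space \<Rightarrow> ennreal"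
  assumes [measurable]: "g \<in> borel_measurable borel" and n: "norm n = 1" and p: "n \<bullet> p = c" and r: "r > 0"
  shows "(\<integral>\<^sup>+s. g s \<partial>hyperplane_measure n c) =
    ennreal (r ^ (DIM('a) - 1)) * (\<integral>\<^sup>+s. g (p + r *\<^sub>R (s - p)) \<partial>hyperplane_measure n c)"
proof -
  let ?\<sigma> = "hyperplane_measure n c"
  let ?G = "\<lambda>x. g (x - (n \<bullet> x - c) *\<^sub>R n) * indicator {0..1::real} (n \<bullet> x - c)"
  have "(\<integral>\<^sup>+s. g s \<partial>?\<sigma>) = (\<integral>\<^sup>+x. ?G x \<partial>lborel)"
    by (subst nn_integral_hyperplane_layer) (use n in auto)
  also have "\<dots> = ennreal (r ^ DIM('a)) * (\<integral>\<^sup>+x. ?G ((p - r *\<^sub>R p) + r *\<^sub>R x) \<partial>lborel)"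
    by (rule nn_integral_lborel_affine) (use r in auto)
  also have "(\<integral>\<^sup>+x. ?G ((p - r *\<^sub>R p) + r *\<^sub>R x) \<partial>lborel) =
     (\<integral>\<^sup>+x. g (p + r *\<^sub>R ((x - (n \<bullet> x - c) *\<^sub>R n) - p)) * indicator {0..1/r} (n \<bullet> x - c) \<partial>lborel)"
  proof (intro nn_integral_cong)
    fix x
    have *: "n \<bullet> (p - r *\<^sub>R p + r *\<^sub>R x) - c = r * (n \<bullet> x - c)"
      by (simp add: inner_add_right inner_diff_right p algebra_simps)
    have "indicator {0..1} (r * (n \<bullet> x - c)) = (indicator {0..1/r} (n \<bullet> x - c) :: ennreal)"
      using r by (auto simp: indicator_def field_simps zero_le_mult_iff)
    moreover have "p - r *\<^sub>R p + r *\<^sub>R x - (r * (n \<bullet> x - c)) *\<^sub>R n = p + r *\<^sub>R ((x - (n \<bullet> x - c) *\<^sub>R n) - p)"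
      by (simp add: algebra_simps)
    ultimately show "?G ((p - r *\<^sub>R p) + r *\<^sub>R x) = g (p + r *\<^sub>R ((x - (n \<bullet> x - c) *\<^sub>R n) - p)) * indicator {0..1/r} (n \<bullet> x - c)"
      by (simp only: *)
  qed
  also have "\<dots> = (\<integral>\<^sup>+s. g (p + r *\<^sub>R (s - p)) \<partial>?\<sigma>) * (\<integral>\<^sup>+t. indicator {0..1/r} t \<partial>lborel)"
  proof -
    have m: "(\<lambda>y. g (p + r *\<^sub>R (y - p))) \<in> borel_measurable borel" by measurable
    have k: "(indicator {0..1/r} :: real \<Rightarrow> ennreal) \<in> borel_measurable borel" by simp
    show ?thesis using nn_integral_hyperplane_layer[OF m k n, of c] by simp
  qed
  also have "(\<integral>\<^sup>+t. indicator {0..1/r} t \<partial>lborel) = ennreal (1 / r)"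
  proof -
    have "0 \<le> 1 / r" using r by simp
    then show ?thesis by (simp only: nn_integral_indicator sets_lborel borel_closed closed_atLeastAtMost emeasure_lborel_Icc) simp
  qed
  finally have e: "(\<integral>\<^sup>+s. g s \<partial>?\<sigma>) = ennreal (r ^ DIM('a)) * ((\<integral>\<^sup>+s. g (p + r *\<^sub>R (s - p)) \<partial>?\<sigma>) * ennreal (1 / r))" .
  have "r ^ DIM('a) = r ^ (DIM('a) - 1) * r"
    by (metis DIM_positive One_nat_def Suc_pred mult.commute power_Suc)
  then have "r ^ DIM('a) * (1 / r) = r ^ (DIM('a) - 1)" using r by simp
  then have "ennreal (r ^ DIM('a)) * ennreal (1 / r) = ennreal (r ^ (DIM('a) - 1))"
    using r by (subst ennreal_mult[symmetric]) auto
  moreover have "x * (y * z) = (x * z) * y" for x y z :: ennreal by (simp add: mult_ac)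
  ultimately show ?thesis using e by simp
qed

section \<open>Polar coordinates on a cone over a flat base\<close>

text \<open>The quotient \<open>(n \<bullet> x - c + h) / h\<close> is the relative height of
  \<open>x\<close> above the apex, 0 at \<open>a\<close> and 1 on the base plane; dividing
  \<open>x - a\<close> by it projects \<open>x\<close> from \<open>a\<close> onto that plane. The
  formula is integration in these coordinates, with Jacobian \<open>h * r ^ (d - 1)\<close>.\<close>

lemma nn_integral_cone:
  fixes G :: "'a::euclidean_space \<Rightarrow> ennreal"
  assumes [measurable]: "G \<in> borel_measurable borel" "S \<in> sets borel"
    and n: "norm n = 1" and a: "n \<bullet> a = c - h" and h: "h > 0"
    and T: "\<And>x. indicator T x = indicator {0<..1} ((n \<bullet> x - c + h) / h) * (indicator S (a + (x - a) /\<^sub>R ((n \<bullet> x - c + h) / h)) :: ennreal)"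
  shows "(\<integral>\<^sup>+x. G x * indicator T x \<partial>lborel) =
    (\<integral>\<^sup>+r. (\<integral>\<^sup>+y. ennreal (h * r ^ (DIM('a) - 1)) * G (a + r *\<^sub>R (y - a)) * indicator S y \<partial>hyperplane_measure n c) * indicator {0<..1} r \<partial>lborel)"
proof -
  let ?\<sigma> = "hyperplane_measure n c"
  have nn: "n \<bullet> n = 1" using n by (simp add: dot_square_norm)
  define F where "F = (\<lambda>x. G x * (indicator {0<..1} ((n \<bullet> x - c + h) / h) * indicator S (a + (x - a) /\<^sub>R ((n \<bullet> x - c + h) / h))))"
  have [measurable]: "F \<in> borel_measurable borel" unfolding F_def by measurable
  have "(\<integral>\<^sup>+x. G x * indicator T x \<partial>lborel) = (\<integral>\<^sup>+x. F x \<partial>lborel)" by (simp add: F_def T)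
  also have "\<dots> = (\<integral>\<^sup>+t. (\<integral>\<^sup>+s. F (s + t *\<^sub>R n) \<partial>?\<sigma>) \<partial>lborel)"
    by (rule nn_integral_hyperplane_fibres) (use n in auto)
  \<comment> \<open>The substitution \<open>t = -h + h r\<close> labels the parallel hyperplanes by
    the relative height \<open>r\<close> and brings out the factor \<open>h\<close>.\<close>
  also have "\<dots> = ennreal h * (\<integral>\<^sup>+r. (\<integral>\<^sup>+s. F (s + (- h + h *\<^sub>R r) *\<^sub>R n) \<partial>?\<sigma>) \<partial>lborel)"
  proof -
    have [measurable]: "(\<lambda>t. (\<integral>\<^sup>+s. F (s + t *\<^sub>R n) \<partial>?\<sigma>)) \<in> borel_measurable borel"
      by (subst nn_integral_hyperplane_measure) auto
    show ?thesis
      using nn_integral_lborel_affine[of "\<lambda>t. (\<integral>\<^sup>+s. F (s + t *\<^sub>R n) \<partial>?\<sigma>)" h "- h"] h by simp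
  qed
  also have "\<dots> = ennreal h * (\<integral>\<^sup>+r. (ennreal (r ^ (DIM('a) - 1)) * (\<integral>\<^sup>+y. G (a + r *\<^sub>R (y - a)) * indicator S y \<partial>?\<sigma>)) * indicator {0<..1} r \<partial>lborel)"
  proof (intro arg_cong2[where f = "(*)"] refl nn_integral_cong)
    fix r :: real
    \<comment> \<open>Foot of the perpendicular from \<open>a\<close> to the base plane. A dilation
      within the plane about \<open>?p\<close>, followed by the shift to height \<open>r\<close>, is
      the dilation of space about \<open>a\<close>.\<close>
    let ?p = "a + h *\<^sub>R n"
    have p: "n \<bullet> ?p = c" by (simp add: inner_add_right nn a)
    show "(\<integral>\<^sup>+s. F (s + (- h + h *\<^sub>R r) *\<^sub>R n) \<partial>?\<sigma>) = (ennreal (r ^ (DIM('a) - 1)) * (\<integral>\<^sup>+y. G (a + r *\<^sub>R (y - a)) * indicator S y \<partial>?\<sigma>)) * indicator {0<..1} r"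
    proof (cases "r \<in> {0<..1}")
      case False
      have "(\<integral>\<^sup>+s. F (s + (- h + h *\<^sub>R r) *\<^sub>R n) \<partial>?\<sigma>) = (\<integral>\<^sup>+s. 0 \<partial>?\<sigma>)"
        by (intro nn_integral_cong_AE eventually_mono[OF AE_hyperplane_measure[OF n]])
          (use False h in \<open>auto simp: F_def inner_add_right nn\<close>)
      then show ?thesis using False by simp
    next
      case True
      have "(\<integral>\<^sup>+s. F (s + (- h + h *\<^sub>R r) *\<^sub>R n) \<partial>?\<sigma>)
         = ennreal (r ^ (DIM('a) - 1)) * (\<integral>\<^sup>+s. F (?p + r *\<^sub>R (s - ?p) + (- h + h *\<^sub>R r) *\<^sub>R n) \<partial>?\<sigma>)"
        by (rule nn_integral_hyperplane_dilate[where g = "\<lambda>s. F (s + (- h + h *\<^sub>R r) *\<^sub>R n)"])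
          (use n p True in auto)
      also have "(\<integral>\<^sup>+s. F (?p + r *\<^sub>R (s - ?p) + (- h + h *\<^sub>R r) *\<^sub>R n) \<partial>?\<sigma>) = (\<integral>\<^sup>+y. G (a + r *\<^sub>R (y - a)) * indicator S y \<partial>?\<sigma>)"
      proof (intro nn_integral_cong_AE eventually_mono[OF AE_hyperplane_measure[OF n]])
        fix s assume s: "n \<bullet> s = c"
        have e: "?p + r *\<^sub>R (s - ?p) + (- h + h *\<^sub>R r) *\<^sub>R n = a + r *\<^sub>R (s - a)"
          by (simp add: algebra_simps)
        have "(n \<bullet> (a + r *\<^sub>R (s - a)) - c + h) / h = r"
          using h by (simp add: inner_add_right inner_diff_right a s)
        then show "F (?p + r *\<^sub>R (s - ?p) + (- h + h *\<^sub>R r) *\<^sub>R n) = G (a + r *\<^sub>R (s - a)) * indicator S s"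
          unfolding e F_def using True by simp
      qed
      finally show ?thesis using True by simp
    qed
  qed
  also have "\<dots> = (\<integral>\<^sup>+r. ennreal h * ((ennreal (r ^ (DIM('a) - 1)) * (\<integral>\<^sup>+y. G (a + r *\<^sub>R (y - a)) * indicator S y \<partial>?\<sigma>)) * indicator {0<..1} r) \<partial>lborel)"
  proof (rule nn_integral_cmult[symmetric])
    have [measurable]: "(\<lambda>r. (\<integral>\<^sup>+y. G (a + r *\<^sub>R (y - a)) * indicator S y \<partial>?\<sigma>)) \<in> borel_measurable borel"
      by (subst nn_integral_hyperplane_measure) auto
    show "(\<lambda>r. (ennreal (r ^ (DIM('a) - 1)) * (\<integral>\<^sup>+y. G (a + r *\<^sub>R (y - a)) * indicator S y \<partial>?\<sigma>)) * indicator {0<..1} r) \<in> borel_measurable lborel"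
      by measurable
  qed
  also have "\<dots> = (\<integral>\<^sup>+r. (\<integral>\<^sup>+y. ennreal (h * r ^ (DIM('a) - 1)) * G (a + r *\<^sub>R (y - a)) * indicator S y \<partial>?\<sigma>) * indicator {0<..1} r \<partial>lborel)"
  proof (intro nn_integral_cong)
    fix r :: real
    show "ennreal h * ((ennreal (r ^ (DIM('a) - 1)) * (\<integral>\<^sup>+y. G (a + r *\<^sub>R (y - a)) * indicator S y \<partial>?\<sigma>)) * indicator {0<..1} r) = (\<integral>\<^sup>+y. ennreal (h * r ^ (DIM('a) - 1)) * G (a + r *\<^sub>R (y - a)) * indicator S y \<partial>?\<sigma>) * indicator {0<..1} r"
    proof (cases "r \<in> {0<..1}")
      case True
      have "(\<integral>\<^sup>+y. ennreal (h * r ^ (DIM('a) - 1)) * G (a + r *\<^sub>R (y - a)) * indicator S y \<partial>?\<sigma>)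
         = ennreal (h * r ^ (DIM('a) - 1)) * (\<integral>\<^sup>+y. G (a + r *\<^sub>R (y - a)) * indicator S y \<partial>?\<sigma>)"
        unfolding mult.assoc by (rule nn_integral_cmult) measurable
      then show ?thesis using True h by (simp add: ennreal_mult mult.assoc)
    qed simp
  qed
  finally show ?thesis .
qed

lemma emeasure_hyperplane_measure_finite:
  fixes A :: "'a::euclidean_space set"
  assumes n: "norm n = 1" and [measurable]: "A \<in> sets borel" and bd: "bounded A"
  shows "emeasure (hyperplane_measure n c) A < \<infinity>"
proof -
  obtain R where R: "\<And>x. x \<in> A \<Longrightarrow> norm x \<le> R" using bd by (auto simp: bounded_iff)
  have "emeasure (hyperplane_measure n c) A = (\<integral>\<^sup>+s. indicator A s \<partial>hyperplane_measure n c)"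
    by (simp add: sets_hyperplane_measure)
  also have "\<dots> = (\<integral>\<^sup>+x. indicator A (x - (n \<bullet> x - c) *\<^sub>R n) * indicator {c..c+1} (n \<bullet> x) \<partial>lborel)"
    by (rule nn_integral_hyperplane_measure) measurable
  also have "\<dots> \<le> (\<integral>\<^sup>+x. indicator (cball (0::'a) (R + 1)) x \<partial>lborel)"
  proof (rule nn_integral_mono)
    fix x
    show "indicator A (x - (n \<bullet> x - c) *\<^sub>R n) * indicator {c..c+1} (n \<bullet> x) \<le> (indicator (cball 0 (R + 1)) x :: ennreal)"
    proof (cases "x - (n \<bullet> x - c) *\<^sub>R n \<in> A \<and> n \<bullet> x \<in> {c..c+1}")
      case True
      have "norm x \<le> norm (x - (n \<bullet> x - c) *\<^sub>R n) + norm ((n \<bullet> x - c) *\<^sub>R n)"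
        by (metis add.commute diff_add_cancel norm_triangle_ineq)
      also have "\<dots> \<le> R + 1" using R True n by (intro add_mono) auto
      finally show ?thesis by (simp add: indicator_def)
    qed (auto simp: indicator_def)
  qed
  also have "\<dots> = emeasure lborel (cball (0::'a) (R + 1))" by simp
  also have "emeasure lborel (cball (0::'a) (R + 1)) < \<infinity>" by (rule emeasure_bounded_finite) simp
  finally show ?thesis .
qed

lemma integral_lebesgue_on_eq:
  fixes f :: "'a::euclidean_space \<Rightarrow> 'b::euclidean_space"
  assumes "f \<in> borel_measurable borel" "S \<in> sets borel"
  shows "(LINT x|lebesgue_on S. f x) = (LINT x|lborel. indicator S x *\<^sub>R f x)"
proof -
  have "(LINT x|lebesgue_on S. f x) = (LINT x|lebesgue. indicator S x *\<^sub>R f x)"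
    using assms by (intro integral_restrict_space) auto
  also have "\<dots> = (LINT x|lborel. indicator S x *\<^sub>R f x)"
    using assms by (intro integral_completion) auto
  finally show ?thesis .
qed

text \<open>Applied to indicators, the nonnegative formula says that Lebesgue measure on the cone is
  the image of a product measure; as an identity of measures it extends to signed integrands. The
  apex is excluded so that a point determines its ray. The radial integral is the inner one, so that
  it can be evaluated along each ray.\<close>

lemma integral_cone:
  fixes f :: "'a::euclidean_space \<Rightarrow> real"
  assumes f [measurable]: "f \<in> borel_measurable borel" and S: "compact S" "S \<noteq> {}"
    and n: "norm n = 1" and a: "n \<bullet> a = c - h" and h: "h > 0"
    and Sc: "\<And>y. y \<in> S \<Longrightarrow> n \<bullet> y = c"
    and T: "T = {x. \<exists>r\<in>{0<..1}. \<exists>y\<in>S. x = a + r *\<^sub>R (y - a)}"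
    and B: "\<And>x. x \<in> T \<Longrightarrow> \<bar>f x\<bar> \<le> B"
  shows "T \<in> sets borel"
    "(LINT x|lborel. indicator T x * f x) = (LINT y|restrict_space (hyperplane_measure n c) S.
       (LINT r|lborel. indicator {0<..1} r * (h * r ^ (DIM('a) - 1) * f (a + r *\<^sub>R (y - a)))))"
proof -
  have [measurable]: "S \<in> sets borel" using S(1) by (simp add: borel_compact)
  let ?\<sigma> = "hyperplane_measure n c"
  let ?\<rho> = "\<lambda>x. (n \<bullet> x - c + h) / h"
  have Tiff: "x \<in> T \<longleftrightarrow> ?\<rho> x \<in> {0<..1} \<and> a + (x - a) /\<^sub>R ?\<rho> x \<in> S" for x
  proof
    assume "x \<in> T"
    then obtain r y where r: "r \<in> {0<..1}" and y: "y \<in> S" and x: "x = a + r *\<^sub>R (y - a)" using T by auto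
    have e: "?\<rho> x = r" using h Sc[OF y] by (simp add: x inner_add_right inner_diff_right a)
    show "?\<rho> x \<in> {0<..1} \<and> a + (x - a) /\<^sub>R ?\<rho> x \<in> S"
      unfolding e using r y by (simp add: x)
  next
    assume "?\<rho> x \<in> {0<..1} \<and> a + (x - a) /\<^sub>R ?\<rho> x \<in> S"
    moreover from this have "x = a + ?\<rho> x *\<^sub>R (a + (x - a) /\<^sub>R ?\<rho> x - a)"
      using h by auto
    ultimately show "x \<in> T" unfolding T by blast
  qed
  have Tind: "indicator T x = indicator {0<..1} (?\<rho> x) * (indicator S (a + (x - a) /\<^sub>R ?\<rho> x) :: ennreal)" for x
    using Tiff[of x] by (auto simp: indicator_def)
  have "T = {x \<in> space borel. ?\<rho> x \<in> {0<..1} \<and> a + (x - a) /\<^sub>R ?\<rho> x \<in> S}"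
    using Tiff by auto
  also have "\<dots> \<in> sets borel" by measurable
  finally show [measurable]: "T \<in> sets borel" .
  have "bounded T"
  proof -
    obtain R where R: "\<And>x. x \<in> S \<Longrightarrow> norm (x - a) \<le> R"
      using compact_imp_bounded[OF S(1)] by (metis bounded_any_center dist_norm dist_commute)
    have "norm (x - a) \<le> R" if x: "x \<in> T" for x
    proof -
      obtain r y where r: "r \<in> {0<..1}" and y: "y \<in> S" and x: "x = a + r *\<^sub>R (y - a)" using T x by auto
      have "norm (x - a) = r * norm (y - a)" using r x by simp
      also have "\<dots> \<le> 1 * norm (y - a)" using r by (intro mult_right_mono) auto
      finally show ?thesis using R[OF y] by simp
    qed
    then show ?thesis by (metis bounded_any_center dist_norm dist_commute)
  qed
  then have Tfin: "emeasure lborel T < \<infinity>" by (rule emeasure_bounded_finite)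
  define \<mu> where "\<mu> = restrict_space ?\<sigma> S"
  have meas_mu: "measurable \<mu> X = measurable (restrict_space borel S) X" for X :: "'c measure"
    unfolding \<mu>_def by (intro measurable_cong_sets sets_restrict_space_cong sets_hyperplane_measure refl)
  interpret \<mu>: finite_measure \<mu>
    by (rule finite_measureI) (use emeasure_hyperplane_measure_finite[OF n _ compact_imp_bounded[OF S(1)]] in
      \<open>auto simp: \<mu>_def space_restrict_space emeasure_restrict_space sets_hyperplane_measure less_top[symmetric]\<close>)
  define g where "g = (\<lambda>r::real. indicator {0<..1} r * (h * r ^ (DIM('a) - 1)))"
  have [measurable]: "g \<in> borel_measurable borel" unfolding g_def by measurable
  have g0: "g r \<ge> 0" for r using h by (auto simp: g_def indicator_def)
  define N where "N = density lborel (\<lambda>r. ennreal (g r))"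
  interpret N: finite_measure N
  proof (rule finite_measureI)
    have "emeasure N (space N) = (\<integral>\<^sup>+r. ennreal (g r) \<partial>lborel)" by (simp add: N_def emeasure_density)
    also have "\<dots> \<le> (\<integral>\<^sup>+r. ennreal h * indicator {0<..1::real} r \<partial>lborel)"
    proof (rule nn_integral_mono)
      fix r :: real
      have "h * r ^ (DIM('a) - 1) \<le> h * 1" if "0 < r" "r \<le> 1"
        using that h by (intro mult_left_mono power_le_one) auto
      then show "ennreal (g r) \<le> ennreal h * indicator {0<..1} r"
        by (auto simp: g_def indicator_def intro!: ennreal_leI)
    qed
    also have "\<dots> < \<infinity>" by (simp add: nn_integral_cmult ennreal_mult_less_top)
    finally show "emeasure N (space N) \<noteq> \<infinity>" by simp
  qed
  have sN: "sets N = sets borel" "space N = UNIV" by (simp_all add: N_def)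
  interpret P: pair_sigma_finite N \<mu> ..
  let ?\<Phi> = "\<lambda>(r, y). a + r *\<^sub>R (y - a)"
  have id_mu: "(\<lambda>y. y) \<in> measurable \<mu> borel"
    unfolding meas_mu by (rule measurable_restrict_space1) simp
  have [measurable]: "?\<Phi> \<in> measurable (N \<Otimes>\<^sub>M \<mu>) borel"
  proof -
    have [measurable]: "fst \<in> borel_measurable (N \<Otimes>\<^sub>M \<mu>)"
      using measurable_fst[of N \<mu>] measurable_cong_sets[OF refl sN(1)] by blast
    have [measurable]: "snd \<in> measurable (N \<Otimes>\<^sub>M \<mu>) borel"
      using measurable_compose[OF measurable_snd[of N \<mu>] id_mu] by simp
    have "(\<lambda>z. a + fst z *\<^sub>R (snd z - a)) \<in> measurable (N \<Otimes>\<^sub>M \<mu>) borel" by measurable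
    then show ?thesis by (simp add: case_prod_beta')
  qed
  have key: "density lborel (indicator T) = distr (N \<Otimes>\<^sub>M \<mu>) borel ?\<Phi>"
  proof (rule measure_eqI)
    fix A assume "A \<in> sets (density lborel (indicator T :: 'a \<Rightarrow> ennreal))"
    then have [measurable]: "A \<in> sets borel" by simp
    have "emeasure (density lborel (indicator T)) A = (\<integral>\<^sup>+x. indicator A x * indicator T x \<partial>lborel)"
      by (simp add: emeasure_density mult.commute)
    also have "\<dots> = (\<integral>\<^sup>+r. (\<integral>\<^sup>+y. ennreal (h * r ^ (DIM('a) - 1)) * indicator A (a + r *\<^sub>R (y - a)) * indicator S y \<partial>?\<sigma>) * indicator {0<..1} r \<partial>lborel)"
      by (rule nn_integral_cone[OF _ _ n a h Tind]) auto
    also have "\<dots> = (\<integral>\<^sup>+r. ennreal (g r) * (\<integral>\<^sup>+y. indicator A (a + r *\<^sub>R (y - a)) \<partial>\<mu>) \<partial>lborel)"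
    proof (rule nn_integral_cong)
      fix r :: real
      have "(\<integral>\<^sup>+y. ennreal (h * r ^ (DIM('a) - 1)) * indicator A (a + r *\<^sub>R (y - a)) * indicator S y \<partial>?\<sigma>)
        = ennreal (h * r ^ (DIM('a) - 1)) * (\<integral>\<^sup>+y. indicator A (a + r *\<^sub>R (y - a)) * indicator S y \<partial>?\<sigma>)"
        unfolding mult.assoc by (rule nn_integral_cmult) measurable
      also have "(\<integral>\<^sup>+y. indicator A (a + r *\<^sub>R (y - a)) * indicator S y \<partial>?\<sigma>) = (\<integral>\<^sup>+y. indicator A (a + r *\<^sub>R (y - a)) \<partial>\<mu>)"
        unfolding \<mu>_def by (rule nn_integral_restrict_space[symmetric]) (simp add: sets_hyperplane_measure)
      finally show "(\<integral>\<^sup>+y. ennreal (h * r ^ (DIM('a) - 1)) * indicator A (a + r *\<^sub>R (y - a)) * indicator S y \<partial>?\<sigma>) * indicator {0<..1} r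
         = ennreal (g r) * (\<integral>\<^sup>+y. indicator A (a + r *\<^sub>R (y - a)) \<partial>\<mu>)"
        by (auto simp: g_def indicator_def)
    qed
    also have "\<dots> = (\<integral>\<^sup>+r. (\<integral>\<^sup>+y. indicator A (?\<Phi> (r, y)) \<partial>\<mu>) \<partial>N)"
    proof -
      have "(\<lambda>z. indicator A (?\<Phi> z) :: ennreal) \<in> borel_measurable (N \<Otimes>\<^sub>M \<mu>)" by measurable
      from \<mu>.borel_measurable_nn_integral_fst[OF this]
      have "(\<lambda>r. \<integral>\<^sup>+y. indicator A (a + r *\<^sub>R (y - a)) \<partial>\<mu>) \<in> borel_measurable N" by simp
      then have [measurable]: "(\<lambda>r. \<integral>\<^sup>+y. indicator A (a + r *\<^sub>R (y - a)) \<partial>\<mu>) \<in> borel_measurable borel"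
        unfolding measurable_cong_sets[OF sN(1) refl] .
      then show ?thesis unfolding N_def by (subst nn_integral_density) auto
    qed
    also have "\<dots> = (\<integral>\<^sup>+z. indicator A (?\<Phi> z) \<partial>(N \<Otimes>\<^sub>M \<mu>))"
      by (rule \<mu>.nn_integral_fst) measurable
    also have "\<dots> = emeasure (distr (N \<Otimes>\<^sub>M \<mu>) borel ?\<Phi>) A"
    proof -
      have "emeasure (distr (N \<Otimes>\<^sub>M \<mu>) borel ?\<Phi>) A = (\<integral>\<^sup>+x. indicator A x \<partial>distr (N \<Otimes>\<^sub>M \<mu>) borel ?\<Phi>)" by simp
      also have "\<dots> = (\<integral>\<^sup>+z. indicator A (?\<Phi> z) \<partial>(N \<Otimes>\<^sub>M \<mu>))"
        by (rule nn_integral_distr) measurable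
      finally show ?thesis by simp
    qed
    finally show "emeasure (density lborel (indicator T)) A = emeasure (distr (N \<Otimes>\<^sub>M \<mu>) borel ?\<Phi>) A" .
  qed simp
  have ind: "density lborel (indicator T) = density lborel (\<lambda>x. ennreal (indicator T x))"
    by (simp add: ennreal_indicator)
  have intT: "integrable lborel (\<lambda>x. indicator T x * f x)"
  proof (rule Bochner_Integration.integrable_bound[of _ "\<lambda>x. indicator T x * B"])
    show "integrable lborel (\<lambda>x. indicator T x * B)"
      using Tfin by (intro integrable_mult_left integrable_real_indicator) auto
    show "AE x in lborel. norm (indicator T x * f x) \<le> norm (indicator T x * B)"
    proof (rule AE_I2)
      fix x show "norm (indicator T x * f x) \<le> norm (indicator T x * B)"
        using B[of x] by (auto simp: indicator_def)
    qed
  qed measurable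
  then have "integrable (density lborel (indicator T)) f"
    unfolding ind by (subst integrable_density) auto
  then have intP: "integrable (N \<Otimes>\<^sub>M \<mu>) (\<lambda>z. f (?\<Phi> z))"
    unfolding key by (subst (asm) integrable_distr_eq) auto
  have "(LINT x|lborel. indicator T x * f x) = integral\<^sup>L (density lborel (indicator T)) f"
    unfolding ind by (subst integral_density) auto
  also have "\<dots> = (LINT z|(N \<Otimes>\<^sub>M \<mu>). f (?\<Phi> z))"
    unfolding key by (rule integral_distr) auto
  also have "\<dots> = (LINT z|(N \<Otimes>\<^sub>M \<mu>). (\<lambda>(r, y). f (a + r *\<^sub>R (y - a))) z)"
    by (simp add: case_prod_beta')
  also have "\<dots> = (LINT y|\<mu>. (LINT r|N. f (a + r *\<^sub>R (y - a))))"
    by (rule P.integral_snd[symmetric]) (use intP in \<open>simp add: case_prod_beta'\<close>)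
  also have "\<dots> = (LINT y|\<mu>. (LINT r|lborel. indicator {0<..1} r * (h * r ^ (DIM('a) - 1) * f (a + r *\<^sub>R (y - a)))))"
  proof (rule Bochner_Integration.integral_cong[OF refl])
    fix y
    have "(LINT r|N. f (a + r *\<^sub>R (y - a))) = (LINT r|lborel. g r *\<^sub>R f (a + r *\<^sub>R (y - a)))"
      unfolding N_def by (rule integral_density) (auto simp: g0)
    then show "(LINT r|N. f (a + r *\<^sub>R (y - a))) = (LINT r|lborel. indicator {0<..1} r * (h * r ^ (DIM('a) - 1) * f (a + r *\<^sub>R (y - a))))"
      by (simp add: g_def mult.assoc)
  qed
  finally show "(LINT x|lborel. indicator T x * f x) = (LINT y|restrict_space (hyperplane_measure n c) S.
       (LINT r|lborel. indicator {0<..1} r * (h * r ^ (DIM('a) - 1) * f (a + r *\<^sub>R (y - a)))))"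
    by (simp add: \<mu>_def)
qed

text \<open>The integrand is the divergence of \<open>(x - a) \<phi>\<close>. Along a ray,
  \<open>h r^(d-1)\<close> times it is the derivative of
  \<open>h r^d \<phi> (a + r (y - a))\<close>, so each radial integral equals
  \<open>h \<phi> y\<close>. Geometrically, \<open>x - a\<close> has normal component
  \<open>h\<close> on the base and 0 on the lateral faces.\<close>

lemma cone_divergence:
  fixes a n :: "'a::euclidean_space"
  assumes phi: "C1 \<phi>" and S: "compact S" "convex S" "S \<noteq> {}"
    and n: "norm n = 1" and a: "n \<bullet> a = c - h" and h: "h > 0"
    and Sc: "\<And>y. y \<in> S \<Longrightarrow> n \<bullet> y = c"
  shows "(LINT x|lebesgue_on (convex hull (insert a S)). real DIM('a) * \<phi> x + (x - a) \<bullet> gradient \<phi> x) =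
    h * (LINT y|restrict_space (hyperplane_measure n c) S. \<phi> y)"
proof -
  define T where "T = {x. \<exists>r\<in>{0<..1}. \<exists>y\<in>S. x = a + r *\<^sub>R (y - a)}"
  define K where "K = convex hull (insert a S)"
  have KT: "K = insert a T"
  proof -
    have "K = {a + r *\<^sub>R (y - a) |r y. 0 \<le> r \<and> r \<le> 1 \<and> y \<in> S}"
    proof -
      have "K = {b. \<exists>u\<ge>0. \<exists>v\<ge>0. \<exists>y. u + v = 1 \<and> y \<in> S \<and> b = u *\<^sub>R a + v *\<^sub>R y}"
        unfolding K_def convex_hull_insert[OF S(3)] convex_hull_eq[THEN iffD2, OF S(2)] by blast
      also have "\<dots> = {a + r *\<^sub>R (y - a) |r y. 0 \<le> r \<and> r \<le> 1 \<and> y \<in> S}"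
      proof safe
        fix u v :: real and y assume "0 \<le> u" "0 \<le> v" "u + v = 1" "y \<in> S"
        moreover from this have u: "u = 1 - v" by simp
        ultimately show "\<exists>r ya. u *\<^sub>R a + v *\<^sub>R y = a + r *\<^sub>R (ya - a) \<and> 0 \<le> r \<and> r \<le> 1 \<and> ya \<in> S"
          unfolding u by (intro exI[of _ v] exI[of _ y]) (auto simp: algebra_simps)
      next
        fix r y assume "0 \<le> r" "r \<le> (1::real)" "y \<in> S"
        then show "\<exists>u\<ge>0. \<exists>v\<ge>0. \<exists>ya. u + v = 1 \<and> ya \<in> S \<and> a + r *\<^sub>R (y - a) = u *\<^sub>R a + v *\<^sub>R ya"
          by (intro exI[of _ "1 - r"] conjI exI[of _ r] exI[of _ y]) (auto simp: algebra_simps)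
      qed
      finally show ?thesis .
    qed
    also have "\<dots> = insert a T"
    proof (rule set_eqI, rule iffI)
      fix x assume "x \<in> {a + r *\<^sub>R (y - a) |r y. 0 \<le> r \<and> r \<le> 1 \<and> y \<in> S}"
      then obtain r y where "0 \<le> r" "r \<le> 1" "y \<in> S" "x = a + r *\<^sub>R (y - a)" by auto
      then show "x \<in> insert a T" by (cases "r = 0") (auto simp: T_def)
    next
      fix x assume "x \<in> insert a T"
      moreover obtain y0 where "y0 \<in> S" using S by auto
      moreover have "a = a + 0 *\<^sub>R (y0 - a)" by simp
      ultimately show "x \<in> {a + r *\<^sub>R (y - a) |r y. 0 \<le> r \<and> r \<le> 1 \<and> y \<in> S}"
        unfolding T_def
        by (smt (verit, best) greaterThanAtMost_iff insert_iff mem_Collect_eq)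
    qed
    finally show ?thesis .
  qed
  have cK: "compact K" unfolding K_def using S by (simp add: compact_convex_hull)
  let ?f = "\<lambda>x. real DIM('a) * \<phi> x + (x - a) \<bullet> gradient \<phi> x"
  have cf: "continuous_on A ?f" for A
    by (intro continuous_intros C1_continuous C1_continuous_gradient phi)
  have mf: "?f \<in> borel_measurable borel" using borel_measurable_continuous_onI cf by blast
  obtain B where B: "\<And>x. x \<in> K \<Longrightarrow> \<bar>?f x\<bar> \<le> B"
    using compact_imp_bounded[OF compact_continuous_image[OF cf cK]] by (auto simp: bounded_iff)
  note ic = integral_cone[OF mf S(1,3) n a h Sc T_def, of B]
  have Tm: "T \<in> sets borel" by (rule ic(1)) (use B KT in auto)
  have "(LINT x|lebesgue_on K. ?f x) = (LINT x|lborel. indicator K x *\<^sub>R ?f x)"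
    using cK by (intro integral_lebesgue_on_eq mf borel_compact)
  also have "\<dots> = (LINT x|lborel. indicator T x * ?f x)"
  proof (rule integral_cong_AE)
    show "AE x in lborel. indicator K x *\<^sub>R ?f x = indicator T x * ?f x"
      by (rule AE_I'[of "{a}"]) (auto simp: KT indicator_def)
    show "(\<lambda>x. indicator K x *\<^sub>R ?f x) \<in> borel_measurable lborel"
      using mf borel_compact[OF cK] by measurable
    show "(\<lambda>x. indicator T x * ?f x) \<in> borel_measurable lborel"
      using mf Tm by measurable
  qed
  also have "\<dots> = (LINT y|restrict_space (hyperplane_measure n c) S.
       (LINT r|lborel. indicator {0<..1} r * (h * r ^ (DIM('a) - 1) * ?f (a + r *\<^sub>R (y - a)))))"
    by (rule ic(2)) (use B KT in auto)
  also have "\<dots> = (LINT y|restrict_space (hyperplane_measure n c) S. h * \<phi> y)"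
  proof (rule Bochner_Integration.integral_cong[OF refl])
    fix y
    let ?k = "\<lambda>r. h * r ^ (DIM('a) - 1) * ?f (a + r *\<^sub>R (y - a))"
    have ck: "continuous_on A ?k" for A
      by (intro continuous_intros continuous_on_compose2[OF cf[of UNIV]]) auto
    have "(LINT r|lborel. indicator {0<..1} r * ?k r) = (LINT r|lborel. indicator {0..1} r *\<^sub>R ?k r)"
    proof (rule integral_cong_AE)
      show "AE r in lborel. indicator {0<..1} r * ?k r = indicator {0..1} r *\<^sub>R ?k r"
        by (rule AE_I'[of "{0}"]) (auto simp: indicator_def)
      have "?k \<in> borel_measurable borel" using ck borel_measurable_continuous_onI by blast
      then show "(\<lambda>r. indicator {0<..1} r * ?k r) \<in> borel_measurable lborel"
        "(\<lambda>r. indicator {0..1} r *\<^sub>R ?k r) \<in> borel_measurable lborel" by measurable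
    qed
    also have "\<dots> = (\<lambda>r. h * r ^ DIM('a) * \<phi> (a + r *\<^sub>R (y - a))) 1 - (\<lambda>r. h * r ^ DIM('a) * \<phi> (a + r *\<^sub>R (y - a))) 0"
    proof (rule integral_FTC_Icc)
      fix r :: real
      have d1: "((\<lambda>r. a + r *\<^sub>R (y - a)) has_derivative (\<lambda>t. t *\<^sub>R (y - a))) (at r)"
        by (auto intro!: derivative_eq_intros)
      have "((\<lambda>r. \<phi> (a + r *\<^sub>R (y - a))) has_real_derivative (y - a) \<bullet> gradient \<phi> (a + r *\<^sub>R (y - a))) (at r)"
        unfolding has_field_derivative_def
        using has_derivative_compose[OF d1 C1_has_derivative[OF phi]]
        by (simp add: inner_commute mult.commute[of _ "_ \<bullet> _"])
      from DERIV_mult[OF DERIV_cmult[OF DERIV_pow[of "DIM('a)" r], of h] this]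
      have "((\<lambda>r. h * r ^ DIM('a) * \<phi> (a + r *\<^sub>R (y - a))) has_real_derivative
        h * (real DIM('a) * r ^ (DIM('a) - Suc 0)) * \<phi> (a + r *\<^sub>R (y - a)) +
        (y - a) \<bullet> gradient \<phi> (a + r *\<^sub>R (y - a)) * (h * r ^ DIM('a))) (at r)" by simp
      moreover have "r ^ DIM('a) = r * r ^ (DIM('a) - 1)"
        by (metis DIM_positive One_nat_def Suc_pred power_Suc)
      ultimately have "((\<lambda>r. h * r ^ DIM('a) * \<phi> (a + r *\<^sub>R (y - a))) has_real_derivative ?k r) (at r)"
        by (simp add: algebra_simps)
      then show "((\<lambda>r. h * r ^ DIM('a) * \<phi> (a + r *\<^sub>R (y - a))) has_vector_derivative ?k r) (at r within {0..1})"
        using has_real_derivative_iff_has_vector_derivative has_vector_derivative_at_within by blast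
    qed (use ck in auto)
    also have "\<dots> = h * \<phi> y" by simp
    finally show "(LINT r|lborel. indicator {0<..1} r * ?k r) = h * \<phi> y" .
  qed
  also have "\<dots> = h * (LINT y|restrict_space (hyperplane_measure n c) S. \<phi> y)" by simp
  finally show ?thesis by (simp add: K_def)
qed

subsection \<open>The divergence theorem on a simplex\<close>

text \<open>With \<open>w\<close> the part of \<open>n'\<close> orthogonal to \<open>n\<close>, both
  \<open>c n\<close> and \<open>c n + w\<close> lie in the smaller hyperplane, so \<open>n'\<close>
  is orthogonal to \<open>w\<close> and \<open>w = 0\<close>. This controls the freedom left in the
  choices behind \<open>surface_measure\<close> and \<open>outer_normal\<close>.\<close>

lemma hyperplane_subset_imp_eq:
  fixes n n' :: "'a::euclidean_space"
  assumes n: "norm n = 1" and n': "norm n' = 1" and sub: "{x. n \<bullet> x = c} \<subseteq> {x. n' \<bullet> x = c'}"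
  shows "(n' = n \<and> c' = c) \<or> (n' = - n \<and> c' = - c)"
proof -
  have nn: "n \<bullet> n = 1" "n' \<bullet> n' = 1" using n n' by (simp_all add: dot_square_norm)
  have "c *\<^sub>R n \<in> {x. n' \<bullet> x = c'}" by (rule subsetD[OF sub]) (simp add: nn)
  then have c1: "n' \<bullet> (c *\<^sub>R n) = c'" by blast
  define w where "w = n' - (n \<bullet> n') *\<^sub>R n"
  have nw: "n \<bullet> w = 0" by (simp add: w_def inner_diff_right nn)
  have "c *\<^sub>R n + w \<in> {x. n' \<bullet> x = c'}" by (rule subsetD[OF sub]) (simp add: nn nw inner_add_right)
  then have "n' \<bullet> (c *\<^sub>R n + w) = c'" by blast
  then have n'w: "n' \<bullet> w = 0" using c1 by (simp add: inner_add_right)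
  have "w \<bullet> w = 0" using nw n'w by (simp add: w_def inner_diff_left)
  then have e: "n' = (n \<bullet> n') *\<^sub>R n" by (simp add: w_def)
  then have "\<bar>n \<bullet> n'\<bar> = 1" using n n' by (metis mult.right_neutral norm_scaleR real_norm_def)
  then have "n \<bullet> n' = 1 \<or> n \<bullet> n' = - 1" by linarith
  then show ?thesis
  proof
    assume "n \<bullet> n' = 1"
    then show ?thesis using e c1 nn by simp
  next
    assume "n \<bullet> n' = - 1"
    then have "n' = - n" using e by simp
    then show ?thesis using c1 nn by simp
  qed
qed

lemma surface_measure_eq:
  fixes n :: "'a::euclidean_space"
  assumes n: "norm n = 1" and aff: "affine hull S = {x. n \<bullet> x = c}"
  shows "surface_measure S = restrict_space (hyperplane_measure n c) S"
  unfolding surface_measure_def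
proof (rule some_equality)
  have "S \<subseteq> {x. n \<bullet> x = c}" using hull_subset[of S affine] aff by auto
  then show "\<exists>n' c'. norm n' = 1 \<and> S \<subseteq> {x. n' \<bullet> x = c'} \<and>
      restrict_space (hyperplane_measure n c) S = restrict_space (hyperplane_measure n' c') S"
    using n by blast
next
  fix M assume "\<exists>n' c'. norm n' = 1 \<and> S \<subseteq> {x. n' \<bullet> x = c'} \<and> M = restrict_space (hyperplane_measure n' c') S"
  then obtain n' c' where n': "norm n' = 1" and S: "S \<subseteq> {x. n' \<bullet> x = c'}"
    and M: "M = restrict_space (hyperplane_measure n' c') S" by blast
  have "{x. n \<bullet> x = c} \<subseteq> {x. n' \<bullet> x = c'}"
    unfolding aff[symmetric] by (intro hull_minimal S affine_hyperplane)
  from hyperplane_subset_imp_eq[OF n n' this] show "M = restrict_space (hyperplane_measure n c) S"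
    using M hyperplane_measure_uminus[OF n] by auto
qed

text \<open>The affine hull of \<open>S\<close> fixes the normal up to sign; the point
  \<open>a\<close> strictly on one side excludes the other sign.\<close>

lemma outer_normal_eq:
  fixes n :: "'a::euclidean_space"
  assumes n: "norm n = 1" and aff: "affine hull S = {x. n \<bullet> x = c}"
    and T: "T \<subseteq> {x. n \<bullet> x \<le> c}" and a: "a \<in> T" "n \<bullet> a < c"
  shows "outer_normal T S = n"
  unfolding outer_normal_def
proof (rule the_equality)
  have "S \<subseteq> {x. n \<bullet> x = c}" using hull_subset[of S affine] aff by auto
  then show "norm n = 1 \<and> (\<exists>c. S \<subseteq> {x. n \<bullet> x = c} \<and> T \<subseteq> {x. n \<bullet> x \<le> c})"
    using n T by blast
next
  fix n' assume "norm n' = 1 \<and> (\<exists>c. S \<subseteq> {x. n' \<bullet> x = c} \<and> T \<subseteq> {x. n' \<bullet> x \<le> c})"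
  then obtain c' where n': "norm n' = 1" and S: "S \<subseteq> {x. n' \<bullet> x = c'}" and T': "T \<subseteq> {x. n' \<bullet> x \<le> c'}"
    by blast
  have "{x. n \<bullet> x = c} \<subseteq> {x. n' \<bullet> x = c'}"
    unfolding aff[symmetric] by (intro hull_minimal S affine_hyperplane)
  from hyperplane_subset_imp_eq[OF n n' this] show "n' = n"
    using T' a by auto
qed

lemma simplex_vertices:
  assumes "int DIM('a) simplex (T :: 'a::euclidean_space set)"
  obtains C where "\<not> affine_dependent C" "finite C" "card C = Suc DIM('a)" "T = convex hull C"
  using assms aff_independent_finite unfolding simplex_def
  by (metis add.commute int_ops(4) nat_int of_nat_Suc)

text \<open>Presents the simplex as a cone with a vertex as apex and the opposite facet as base, in
  the form required by the cone formula; \<open>h\<close> is the height of the vertex over the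
  facet.\<close>

lemma simplex_face_geometry:
  fixes C :: "'a::euclidean_space set"
  assumes C: "\<not> affine_dependent C" "card C = Suc DIM('a)" and a: "a \<in> C"
    and S: "S = convex hull (C - {a})" and T: "T = convex hull C"
  obtains n c h where "outer_normal T S = n" "norm n = 1" "h > 0" "n \<bullet> a = c - h"
    "\<And>y. y \<in> S \<Longrightarrow> n \<bullet> y = c" "\<And>x. x \<in> T \<Longrightarrow> n \<bullet> x \<le> c" "affine hull S = {x. n \<bullet> x = c}"
    "surface_measure S = restrict_space (hyperplane_measure n c) S"
    "compact S" "convex S" "S \<noteq> {}" "convex hull (insert a S) = T"
proof -
  have fin: "finite C" using C(1) aff_independent_finite by blast
  have ind: "\<not> affine_dependent (C - {a})" using C(1) affine_dependent_subset by blast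
  have "aff_dim (C - {a}) = int (card (C - {a})) - 1" using aff_dim_affine_independent[OF ind] by simp
  also have "\<dots> = int DIM('a) - 1" using C(2) a fin by simp
  also have "\<dots> = int (DIM('a) - 1)" by (simp add: of_nat_diff)
  finally have "\<exists>m d. m \<noteq> 0 \<and> affine hull (C - {a}) = {x. m \<bullet> x = d}"
    by (rule aff_dim_eq_hyperplane[THEN iffD1])
  then obtain m d where m: "m \<noteq> 0" and md: "affine hull (C - {a}) = {x. m \<bullet> x = d}"
    by (elim exE conjE)
  have "a \<notin> affine hull (C - {a})" using C(1) a unfolding affine_dependent_def by blast
  then have ma: "m \<bullet> a \<noteq> d" using md by auto
  \<comment> \<open>Normalises \<open>m\<close> and orients it away from \<open>a\<close>.\<close>
  define s where "s = (if m \<bullet> a < d then 1 else -1) / norm m"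
  define n where "n = s *\<^sub>R m"
  define c where "c = s * d"
  define h where "h = c - n \<bullet> a"
  have s0: "s \<noteq> 0" using m by (simp add: s_def)
  have n1: "norm n = 1" using m by (simp add: n_def s_def)
  have h0: "h > 0" using ma m by (auto simp: h_def c_def n_def s_def field_simps)
  have affS: "affine hull S = {x. n \<bullet> x = c}"
    unfolding S affine_hull_convex_hull md using s0 by (auto simp: n_def c_def)
  have Sc: "n \<bullet> y = c" if "y \<in> S" for y
    using hull_subset[of S affine] affS that by auto
  have an: "n \<bullet> a = c - h" by (simp add: h_def)
  have "C \<subseteq> {x. n \<bullet> x \<le> c}"
  proof
    fix x assume "x \<in> C"
    then have "x = a \<or> x \<in> S" using hull_subset[of "C - {a}" convex] S by auto
    then show "x \<in> {x. n \<bullet> x \<le> c}" using Sc an h0 by auto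
  qed
  then have Tc: "T \<subseteq> {x. n \<bullet> x \<le> c}"
    unfolding T by (intro hull_minimal convex_halfspace_le)
  have aT: "a \<in> T" using a hull_inc T by metis
  have "outer_normal T S = n"
    by (rule outer_normal_eq[OF n1 affS Tc aT]) (use an h0 in simp)
  moreover have "surface_measure S = restrict_space (hyperplane_measure n c) S"
    by (rule surface_measure_eq[OF n1 affS])
  moreover have "compact S" "convex S"
    unfolding S using fin by (simp_all add: finite_imp_compact_convex_hull)
  moreover have "S \<noteq> {}"
  proof -
    have "C - {a} \<noteq> {}"
      using C(2) a fin by (metis DIM_positive Suc_inject card_Diff_singleton card.empty diff_Suc_1 less_irrefl)
    then show ?thesis unfolding S by simp
  qed
  moreover have "convex hull (insert a S) = T"
    unfolding S T using a by (metis hull_insert insert_Diff)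
  ultimately show thesis using that n1 h0 an Sc Tc affS by blast
qed

lemma facet_of_simplex:
  assumes "\<not> affine_dependent C" "card C = Suc DIM('a)"
  shows "S facet_of (convex hull C) \<longleftrightarrow> (\<exists>a\<in>C. S = convex hull (C - {a::'a::euclidean_space}))"
proof -
  have "convex hull (C - {a}) \<noteq> {}" if "a \<in> C" for a
  proof -
    have "finite C" using assms(1) aff_independent_finite by blast
    then have "C - {a} \<noteq> {}"
      using assms(2) that by (metis DIM_positive Suc_inject card_Diff_singleton card.empty diff_Suc_1 less_irrefl)
    then show ?thesis by simp
  qed
  then show ?thesis using facet_of_convex_hull_affine_independent[OF assms(1)] by blast
qed

lemma simplex_vertex_divergence:
  fixes C :: "'a::euclidean_space set"
  assumes C: "\<not> affine_dependent C" "card C = Suc DIM('a)" and a: "a \<in> C"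
  obtains c h where "h > 0" "outer_normal (convex hull C) (convex hull (C - {a})) \<bullet> a = c - h"
    "\<And>y. y \<in> C - {a} \<Longrightarrow> outer_normal (convex hull C) (convex hull (C - {a})) \<bullet> y = c"
    "\<And>\<phi>. C1 \<phi> \<Longrightarrow> (LINT x|lebesgue_on (convex hull C). real DIM('a) * \<phi> x + (x - a) \<bullet> gradient \<phi> x) =
       h * (LINT y|surface_measure (convex hull (C - {a})). \<phi> y)"
proof -
  obtain n c h where *: "outer_normal (convex hull C) (convex hull (C - {a})) = n" "norm n = 1" "h > 0" "n \<bullet> a = c - h"
    "\<And>y. y \<in> convex hull (C - {a}) \<Longrightarrow> n \<bullet> y = c"
    "surface_measure (convex hull (C - {a})) = restrict_space (hyperplane_measure n c) (convex hull (C - {a}))"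
    "compact (convex hull (C - {a}))" "convex (convex hull (C - {a}))" "convex hull (C - {a}) \<noteq> {}"
    "convex hull (insert a (convex hull (C - {a}))) = convex hull C"
    by (rule simplex_face_geometry[OF C a refl refl]) (rule that; assumption)
  show thesis
  proof (rule that[of h c])
    fix \<phi> :: "'a \<Rightarrow> real" assume "C1 \<phi>"
    from cone_divergence[OF this *(7,8,9,2,4,3,5)]
    show "(LINT x|lebesgue_on (convex hull C). real DIM('a) * \<phi> x + (x - a) \<bullet> gradient \<phi> x) =
       h * (LINT y|surface_measure (convex hull (C - {a})). \<phi> y)" by (simp add: * )
  next
    show "outer_normal (convex hull C) (convex hull (C - {a})) \<bullet> y = c" if "y \<in> C - {a}" for y
      using *(5)[OF hull_inc[OF that]] *(1) by simp
  qed (use * in auto)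
qed

lemma integrable_lebesgue_on_compact:
  fixes f :: "'a::euclidean_space \<Rightarrow> 'b::euclidean_space"
  assumes "compact K" "continuous_on K f"
  shows "integrable (lebesgue_on K) f"
proof -
  have i: "integrable lborel (\<lambda>x. indicator K x *\<^sub>R f x)"
    by (rule borel_integrable_compact[OF assms])
  have "integrable lebesgue (\<lambda>x. indicator K x *\<^sub>R f x)"
    using i borel_measurable_integrable[OF i] by (subst integrable_completion) auto
  moreover have "K \<inter> space lebesgue \<in> sets lebesgue" using assms(1) by (simp add: lmeasurable_compact fmeasurableD)
  ultimately show ?thesis by (simp only: integrable_restrict_space)
qed

text \<open>The cone formulas at the vertices are combined with weights \<open>\<beta>\<close> of
  sum 0 that represent the vector \<open>-b\<close>: the terms in \<open>\<phi>\<close> and in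
  \<open>x\<close> cancel, and the derivative in direction \<open>b\<close> remains. On the facet
  side \<open>\<beta> a * h a\<close> is the component of the normal along \<open>b\<close>, because
  this normal takes one value at all vertices but \<open>a\<close>, where it is smaller by
  \<open>h a\<close>.\<close>

lemma simplex_divergence:
  fixes T :: "'a::euclidean_space set"
  assumes T: "int DIM('a) simplex T" and phi: "C1 \<phi>"
  shows "(LINT x|lebesgue_on T. gradient \<phi> x \<bullet> b) =
    (\<Sum>S | S facet_of T. (outer_normal T S \<bullet> b) * (LINT y|surface_measure S. \<phi> y))"
proof -
  obtain C where C: "\<not> affine_dependent C" "finite C" "card C = Suc DIM('a)" and TC: "T = convex hull C"
    using simplex_vertices[OF T] .
  let ?S = "\<lambda>a. convex hull (C - {a})"
  let ?n = "\<lambda>a. outer_normal T (?S a)"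
  define Q where "Q = (\<lambda>a c h. h > 0 \<and> ?n a \<bullet> a = c - h \<and> (\<forall>y\<in>C - {a}. ?n a \<bullet> y = c) \<and>
      (LINT x|lebesgue_on T. real DIM('a) * \<phi> x + (x - a) \<bullet> gradient \<phi> x) =
       h * (LINT y|surface_measure (?S a). \<phi> y))"
  have "\<forall>a\<in>C. \<exists>c h. Q a c h"
  proof
    fix a assume "a \<in> C"
    then show "\<exists>c h. Q a c h"
      using phi unfolding Q_def TC by (rule_tac simplex_vertex_divergence[OF C(1,3)]) blast+
  qed
  then obtain c where "\<forall>a\<in>C. \<exists>h. Q a (c a) h"
    using bchoice[of C "\<lambda>a c. \<exists>h. Q a c h"] by blast
  then obtain h where "\<forall>a\<in>C. Q a (c a) (h a)"
    using bchoice[of C "\<lambda>a h. Q a (c a) h"] by blast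
  then have *: "\<And>a. a \<in> C \<Longrightarrow> h a > 0" "\<And>a. a \<in> C \<Longrightarrow> ?n a \<bullet> a = c a - h a"
    "\<And>a y. a \<in> C \<Longrightarrow> y \<in> C - {a} \<Longrightarrow> ?n a \<bullet> y = c a"
    "\<And>a. a \<in> C \<Longrightarrow> (LINT x|lebesgue_on T. real DIM('a) * \<phi> x + (x - a) \<bullet> gradient \<phi> x) =
       h a * (LINT y|surface_measure (?S a). \<phi> y)"
    unfolding Q_def by blast+
  have affC: "affine hull C = UNIV"
  proof -
    have "aff_dim C = int DIM('a)" using aff_dim_affine_independent[OF C(1)] C(3) by simp
    then show ?thesis using aff_dim_eq_full by blast
  qed
  have rep: "\<exists>u. sum u C = 1 \<and> (\<Sum>x\<in>C. u x *\<^sub>R x) = y" for y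
    using affine_hull_finite[OF C(2)] affC by blast
  \<comment> \<open>Barycentric coordinates of \<open>b\<close> and of the origin; their difference
    has coefficient sum 0 and represents the vector \<open>-b\<close>.\<close>
  obtain u where u: "sum u C = 1" "(\<Sum>x\<in>C. u x *\<^sub>R x) = b" using rep by blast
  obtain v where v: "sum v C = 1" "(\<Sum>x\<in>C. v x *\<^sub>R x) = 0" using rep by blast
  define \<beta> where "\<beta> = (\<lambda>x. v x - u x)"
  have b0: "(\<Sum>a\<in>C. \<beta> a) = 0" using u v by (simp add: \<beta>_def sum_subtractf)
  have bb: "(\<Sum>a\<in>C. \<beta> a *\<^sub>R a) = - b" using u v by (simp add: \<beta>_def sum_subtractf scaleR_left_diff_distrib)
  have nb: "?n a \<bullet> b = \<beta> a * h a" if a: "a \<in> C" for a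
  proof -
    have "- (?n a \<bullet> b) = (\<Sum>x\<in>C. \<beta> x * (?n a \<bullet> x))"
      using bb by (simp flip: inner_minus_right bb add: inner_sum_right)
    also have "\<dots> = \<beta> a * (c a - h a) + (\<Sum>x\<in>C - {a}. \<beta> x * c a)"
      using * a sum.remove[OF C(2) a, of "\<lambda>x. \<beta> x * (?n a \<bullet> x)"] by simp
    also have "\<dots> = (\<Sum>x\<in>C. \<beta> x * c a) - \<beta> a * h a"
      using sum.remove[OF C(2) a, of "\<lambda>x. \<beta> x * c a"] by (simp add: algebra_simps)
    also have "\<dots> = - \<beta> a * h a" using b0 by (simp flip: sum_distrib_right)
    finally show ?thesis by simp
  qed
  have cT: "compact T" using compact_simplex[OF T] .
  have int: "integrable (lebesgue_on T) (\<lambda>x. real DIM('a) * \<phi> x + (x - a) \<bullet> gradient \<phi> x)" for a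
    by (intro integrable_lebesgue_on_compact cT continuous_intros C1_continuous C1_continuous_gradient phi)
  have "(LINT x|lebesgue_on T. gradient \<phi> x \<bullet> b) =
     (LINT x|lebesgue_on T. (\<Sum>a\<in>C. \<beta> a * (real DIM('a) * \<phi> x + (x - a) \<bullet> gradient \<phi> x)))"
  proof (rule Bochner_Integration.integral_cong[OF refl])
    fix x
    have "(\<Sum>a\<in>C. \<beta> a * (real DIM('a) * \<phi> x + (x - a) \<bullet> gradient \<phi> x))
      = (\<Sum>a\<in>C. \<beta> a) * (real DIM('a) * \<phi> x + x \<bullet> gradient \<phi> x) - (\<Sum>a\<in>C. \<beta> a *\<^sub>R a) \<bullet> gradient \<phi> x"
      by (simp add: sum_distrib_right inner_sum_left inner_diff_left algebra_simps sum.distrib sum_subtractf sum_distrib_left)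
    then show "gradient \<phi> x \<bullet> b = (\<Sum>a\<in>C. \<beta> a * (real DIM('a) * \<phi> x + (x - a) \<bullet> gradient \<phi> x))"
      by (simp add: b0 bb inner_commute)
  qed
  also have "\<dots> = (\<Sum>a\<in>C. \<beta> a * (LINT x|lebesgue_on T. real DIM('a) * \<phi> x + (x - a) \<bullet> gradient \<phi> x))"
    using int by (subst Bochner_Integration.integral_sum) auto
  also have "\<dots> = (\<Sum>a\<in>C. (?n a \<bullet> b) * (LINT y|surface_measure (?S a). \<phi> y))"
    by (rule sum.cong) (auto simp: * nb)
  also have "\<dots> = (\<Sum>S | S facet_of T. (outer_normal T S \<bullet> b) * (LINT y|surface_measure S. \<phi> y))"
  proof (rule sum.reindex_bij_betw)
    have inj: "inj_on ?S C"
    proof (rule inj_onI)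
      fix x y assume xy: "x \<in> C" "y \<in> C" "?S x = ?S y"
      show "x = y"
      proof (rule ccontr)
        assume "x \<noteq> y"
        then have "x \<in> ?S y" using xy by (simp add: hull_inc)
        then have "x \<in> affine hull (C - {x})" using xy(3) convex_hull_subset_affine_hull by blast
        then show False using C(1) xy(1) unfolding affine_dependent_def by blast
      qed
    qed
    show "bij_betw ?S C {S. S facet_of T}"
      unfolding bij_betw_def TC facet_of_simplex[OF C(1,3)] using inj by auto
  qed
  finally show ?thesis .
qed

lemma finite_facets: "int DIM('a) simplex T \<Longrightarrow> finite {S. S facet_of (T::'a::euclidean_space set)}"
  by (simp add: finite_polyhedron_facets simplex_imp_polyhedron)

lemma facet_geometry:
  fixes T :: "'a::euclidean_space set"
  assumes T: "int DIM('a) simplex T" and S: "S facet_of T"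
  obtains a c h where "a \<in> T" "norm (outer_normal T S) = 1" "h > 0" "outer_normal T S \<bullet> a = c - h"
    "\<And>y. y \<in> S \<Longrightarrow> outer_normal T S \<bullet> y = c" "\<And>x. x \<in> T \<Longrightarrow> outer_normal T S \<bullet> x \<le> c"
    "affine hull S = {x. outer_normal T S \<bullet> x = c}"
    "surface_measure S = restrict_space (hyperplane_measure (outer_normal T S) c) S"
    "compact S" "convex S" "S \<noteq> {}"
    "\<And>\<phi>. C1 \<phi> \<Longrightarrow> (LINT x|lebesgue_on T. real DIM('a) * \<phi> x + (x - a) \<bullet> gradient \<phi> x) =
       h * (LINT y|surface_measure S. \<phi> y)"
proof -
  obtain C where C: "\<not> affine_dependent C" "finite C" "card C = Suc DIM('a)" and TC: "T = convex hull C"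
    using simplex_vertices[OF T] .
  obtain a where a: "a \<in> C" and Sa: "S = convex hull (C - {a})"
    using S facet_of_simplex[OF C(1,3)] unfolding TC by blast
  obtain n c h where *: "outer_normal T S = n" "norm n = 1" "h > 0" "n \<bullet> a = c - h"
    "\<And>y. y \<in> S \<Longrightarrow> n \<bullet> y = c" "\<And>x. x \<in> T \<Longrightarrow> n \<bullet> x \<le> c" "affine hull S = {x. n \<bullet> x = c}"
    "surface_measure S = restrict_space (hyperplane_measure n c) S"
    "compact S" "convex S" "S \<noteq> {}" "convex hull (insert a S) = T"
    by (rule simplex_face_geometry[OF C(1,3) a Sa TC]) (rule that; assumption)
  show thesis
  proof (rule that[of a h c])
    show "a \<in> T" using a TC hull_inc by metis
    fix \<phi> :: "'a \<Rightarrow> real" assume "C1 \<phi>"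
    from cone_divergence[OF this *(9,10,11,2,4,3,5)]
    show "(LINT x|lebesgue_on T. real DIM('a) * \<phi> x + (x - a) \<bullet> gradient \<phi> x) = h * (LINT y|surface_measure S. \<phi> y)"
      by (simp add: * )
  qed (use * in auto)
qed

subsection \<open>Square-integrable functions\<close>

lemma L2_measurable [dest]: "f \<in> L2 M \<Longrightarrow> f \<in> borel_measurable M"
  by (simp add: L2_def)

lemma L2_integrable_square: "f \<in> L2 M \<Longrightarrow> integrable M (\<lambda>x. (norm (f x))\<^sup>2)"
  by (simp add: L2_def)

lemma L2_I: "f \<in> borel_measurable M \<Longrightarrow> integrable M (\<lambda>x. (norm (f x))\<^sup>2) \<Longrightarrow> f \<in> L2 M"
  by (simp add: L2_def)

lemma L2_bound:
  assumes "f \<in> borel_measurable M" "integrable M k" "\<And>x. (norm (f x))\<^sup>2 \<le> k x"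
  shows "f \<in> L2 M"
proof (rule L2_I[OF assms(1)])
  show "integrable M (\<lambda>x. (norm (f x))\<^sup>2)"
    by (rule Bochner_Integration.integrable_bound[OF assms(2)])
      (use assms in \<open>auto intro!: AE_I2 order_trans[OF assms(3) abs_ge_self]\<close>)
qed

lemma L2_zero [simp]: "(\<lambda>x. 0) \<in> L2 M"
  by (simp add: L2_def)

lemma L2_add:
  assumes f: "f \<in> L2 M" and g: "g \<in> L2 M" shows "(\<lambda>x. f x + g x) \<in> L2 M"
proof (rule L2_bound)
  show "(\<lambda>x. f x + g x) \<in> borel_measurable M"
    using L2_measurable[OF f] L2_measurable[OF g] by measurable
  show "integrable M (\<lambda>x. 2 * ((norm (f x))\<^sup>2 + (norm (g x))\<^sup>2))"
    using f g by (intro integrable_mult_right Bochner_Integration.integrable_add L2_integrable_square)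
  fix x
  have "norm (f x + g x) \<le> norm (f x) + norm (g x)" by (rule norm_triangle_ineq)
  then have "(norm (f x + g x))\<^sup>2 \<le> (norm (f x) + norm (g x))\<^sup>2" by (rule power_mono) simp
  also have "\<dots> \<le> 2 * ((norm (f x))\<^sup>2 + (norm (g x))\<^sup>2)"
    using zero_le_power2[of "norm (f x) - norm (g x)"] by (simp add: power2_sum power2_diff)
  finally show "(norm (f x + g x))\<^sup>2 \<le> 2 * ((norm (f x))\<^sup>2 + (norm (g x))\<^sup>2)" .
qed

lemma L2_scaleR:
  assumes f: "f \<in> L2 M" shows "(\<lambda>x. c *\<^sub>R f x) \<in> L2 M"
  using assms by (auto simp: L2_def power_mult_distrib)

lemma L2_minus: "f \<in> L2 M \<Longrightarrow> (\<lambda>x. - f x) \<in> L2 M"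
  using L2_scaleR[of f M "-1"] by simp

lemma L2_diff: "f \<in> L2 M \<Longrightarrow> g \<in> L2 M \<Longrightarrow> (\<lambda>x. f x - g x) \<in> L2 M"
  using L2_add[OF _ L2_minus, of f M g] by simp

lemma L2_sum: "(\<And>i. i \<in> I \<Longrightarrow> f i \<in> L2 M) \<Longrightarrow> (\<lambda>x. \<Sum>i\<in>I. f i x) \<in> L2 M"
  by (induction I rule: infinite_finite_induct) (auto intro: L2_add)

lemma L2_inner_integrable:
  assumes f: "f \<in> L2 M" and g: "g \<in> L2 M" shows "integrable M (\<lambda>x. f x \<bullet> g x)"
proof (rule Bochner_Integration.integrable_bound)
  show "integrable M (\<lambda>x. (norm (f x))\<^sup>2 + (norm (g x))\<^sup>2)"
    using f g by (intro Bochner_Integration.integrable_add L2_integrable_square)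
  show "(\<lambda>x. f x \<bullet> g x) \<in> borel_measurable M"
    using L2_measurable[OF f] L2_measurable[OF g] by measurable
  show "AE x in M. norm (f x \<bullet> g x) \<le> norm ((norm (f x))\<^sup>2 + (norm (g x))\<^sup>2)"
  proof (rule AE_I2)
    fix x
    have "\<bar>f x \<bullet> g x\<bar> \<le> norm (f x) * norm (g x)" by (rule Cauchy_Schwarz_ineq2)
    also have "\<dots> \<le> (norm (f x))\<^sup>2 + (norm (g x))\<^sup>2"
    proof -
      have "2 * (norm (f x) * norm (g x)) \<le> (norm (f x))\<^sup>2 + (norm (g x))\<^sup>2"
        using zero_le_power2[of "norm (f x) - norm (g x)"] by (simp add: power2_diff)
      moreover have "0 \<le> norm (f x) * norm (g x)" by simp
      ultimately show ?thesis by linarith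
    qed
    finally show "norm (f x \<bullet> g x) \<le> norm ((norm (f x))\<^sup>2 + (norm (g x))\<^sup>2)" by simp
  qed
qed

lemma L2_mult_integrable:
  fixes f g :: "_ \<Rightarrow> real"
  shows "f \<in> L2 M \<Longrightarrow> g \<in> L2 M \<Longrightarrow> integrable M (\<lambda>x. f x * g x)"
  using L2_inner_integrable[of f M g] by simp

lemma L2_inner_commute: "L2_inner M f g = L2_inner M g f"
  by (simp add: L2_inner_def inner_commute)

lemma L2_inner_add_left:
  "f \<in> L2 M \<Longrightarrow> g \<in> L2 M \<Longrightarrow> k \<in> L2 M \<Longrightarrow>
    L2_inner M (\<lambda>x. f x + g x) k = L2_inner M f k + L2_inner M g k"
  by (simp add: L2_inner_def inner_add_left L2_inner_integrable)

lemma L2_inner_diff_left: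
  "f \<in> L2 M \<Longrightarrow> g \<in> L2 M \<Longrightarrow> k \<in> L2 M \<Longrightarrow>
    L2_inner M (\<lambda>x. f x - g x) k = L2_inner M f k - L2_inner M g k"
  by (simp add: L2_inner_def inner_diff_left L2_inner_integrable)

lemma L2_inner_scaleR_left: "L2_inner M (\<lambda>x. c *\<^sub>R f x) k = c * L2_inner M f k"
  by (simp add: L2_inner_def)

lemma L2_inner_minus_left: "L2_inner M (\<lambda>x. - f x) k = - L2_inner M f k"
  by (simp add: L2_inner_def)

lemma L2_inner_add_right:
  "f \<in> L2 M \<Longrightarrow> g \<in> L2 M \<Longrightarrow> k \<in> L2 M \<Longrightarrow>
    L2_inner M k (\<lambda>x. f x + g x) = L2_inner M k f + L2_inner M k g"
  by (simp add: L2_inner_def inner_add_right L2_inner_integrable)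

lemma L2_inner_diff_right:
  "f \<in> L2 M \<Longrightarrow> g \<in> L2 M \<Longrightarrow> k \<in> L2 M \<Longrightarrow>
    L2_inner M k (\<lambda>x. f x - g x) = L2_inner M k f - L2_inner M k g"
  by (simp add: L2_inner_def inner_diff_right L2_inner_integrable)

lemma L2_inner_scaleR_right: "L2_inner M k (\<lambda>x. c *\<^sub>R f x) = c * L2_inner M k f"
  by (simp add: L2_inner_def)

lemma L2_inner_self_nonneg: "0 \<le> L2_inner M f f"
  by (simp add: L2_inner_def)

lemma L2_norm_square: "(L2_norm M f)\<^sup>2 = L2_inner M f f"
  by (simp add: L2_norm_def L2_inner_self_nonneg)

lemma L2_norm_nonneg [simp]: "0 \<le> L2_norm M f"
  by (simp add: L2_norm_def L2_inner_self_nonneg)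

lemma L2_norm_square_integral: "(L2_norm M f)\<^sup>2 = (LINT x|M. (norm (f x))\<^sup>2)"
  by (simp add: L2_norm_square L2_inner_def power2_norm_eq_inner)

lemma L2_norm_square_add:
  assumes "f \<in> L2 M" "g \<in> L2 M"
  shows "(L2_norm M (\<lambda>x. f x + g x))\<^sup>2 = (L2_norm M f)\<^sup>2 + 2 * L2_inner M f g + (L2_norm M g)\<^sup>2"
  using assms by (simp add: L2_norm_square L2_inner_add_left L2_inner_add_right L2_add L2_inner_commute[of M g f])

lemma L2_norm_scaleR: "L2_norm M (\<lambda>x. c *\<^sub>R f x) = \<bar>c\<bar> * L2_norm M f"
  by (simp add: L2_norm_def L2_inner_scaleR_left L2_inner_scaleR_right real_sqrt_mult flip: mult.assoc power2_eq_square)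

lemma L2_norm_minus: "L2_norm M (\<lambda>x. - f x) = L2_norm M f"
  by (simp add: L2_norm_def L2_inner_def)

lemma L2_norm_zero [simp]: "L2_norm M (\<lambda>x. 0) = 0"
  by (simp add: L2_norm_def L2_inner_def)

text \<open>Discriminant argument, with a vanishing leading coefficient treated apart. It serves the
  Cauchy-Schwarz inequality and, with \<open>A = 0\<close>, the vanishing of first
  variations.\<close>

lemma nonneg_quadratic_imp:
  fixes A B C :: real
  assumes "\<And>t. 0 \<le> A + 2 * t * B + t\<^sup>2 * C" and A: "0 \<le> A" and C: "0 \<le> C"
  shows "B\<^sup>2 \<le> A * C"
proof (cases "C = 0")
  case True
  have "B = 0"
  proof (rule ccontr)
    assume B: "B \<noteq> 0"
    \<comment> \<open>This \<open>t\<close> is chosen to make the affine function take the value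
      \<open>-1\<close>.\<close>
    have "0 \<le> A + 2 * (- (A + 1) / (2 * B)) * B" using assms(1)[of "- (A + 1) / (2 * B)"] True by simp
    also have "\<dots> = -1" using B by (simp add: field_simps)
    finally show False by simp
  qed
  then show ?thesis using True by simp
next
  case False
  then have C0: "C > 0" using C by simp
  have "0 \<le> C * (A + 2 * (- B / C) * B + (- B / C)\<^sup>2 * C)"
    using assms(1)[of "- B / C"] C by (intro mult_nonneg_nonneg) auto
  also have "\<dots> = A * C - B\<^sup>2" using C0 by (simp add: field_simps power2_eq_square)
  finally show ?thesis by simp
qed

lemma L2_cauchy_schwarz:
  assumes f: "f \<in> L2 M" and g: "g \<in> L2 M"
  shows "\<bar>L2_inner M f g\<bar> \<le> L2_norm M f * L2_norm M g"
proof -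
  have "(L2_inner M f g)\<^sup>2 \<le> (L2_norm M f)\<^sup>2 * (L2_norm M g)\<^sup>2"
  proof (rule nonneg_quadratic_imp)
    fix t
    have "0 \<le> (L2_norm M (\<lambda>x. f x + t *\<^sub>R g x))\<^sup>2" by simp
    also have "\<dots> = (L2_norm M f)\<^sup>2 + 2 * t * L2_inner M f g + t\<^sup>2 * (L2_norm M g)\<^sup>2"
      using f g by (simp add: L2_norm_square_add L2_scaleR L2_inner_scaleR_right L2_norm_scaleR power_mult_distrib)
    finally show "0 \<le> (L2_norm M f)\<^sup>2 + 2 * t * L2_inner M f g + t\<^sup>2 * (L2_norm M g)\<^sup>2" .
  qed auto
  then have "(L2_inner M f g)\<^sup>2 \<le> (L2_norm M f * L2_norm M g)\<^sup>2" by (simp add: power_mult_distrib)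
  then show ?thesis using abs_le_square_iff[of "L2_inner M f g" "L2_norm M f * L2_norm M g"] by simp
qed

lemma L2_norm_triangle:
  assumes f: "f \<in> L2 M" and g: "g \<in> L2 M"
  shows "L2_norm M (\<lambda>x. f x + g x) \<le> L2_norm M f + L2_norm M g"
proof (rule power2_le_imp_le)
  have "(L2_norm M (\<lambda>x. f x + g x))\<^sup>2 \<le> (L2_norm M f)\<^sup>2 + 2 * (L2_norm M f * L2_norm M g) + (L2_norm M g)\<^sup>2"
    using L2_cauchy_schwarz[OF f g] by (simp add: L2_norm_square_add[OF f g])
  also have "\<dots> = (L2_norm M f + L2_norm M g)\<^sup>2" by (simp add: power2_sum)
  finally show "(L2_norm M (\<lambda>x. f x + g x))\<^sup>2 \<le> (L2_norm M f + L2_norm M g)\<^sup>2" .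
qed simp

lemma L2_norm_triangle_diff:
  assumes "f \<in> L2 M" "g \<in> L2 M" "k \<in> L2 M"
  shows "L2_norm M (\<lambda>x. f x - g x) \<le> L2_norm M (\<lambda>x. f x - k x) + L2_norm M (\<lambda>x. g x - k x)"
proof -
  have "L2_norm M (\<lambda>x. (f x - k x) + - (g x - k x)) \<le> L2_norm M (\<lambda>x. f x - k x) + L2_norm M (\<lambda>x. - (g x - k x))"
    by (intro L2_norm_triangle L2_diff L2_minus assms)
  then show ?thesis unfolding L2_norm_minus by simp
qed

lemma L2_norm_eq_0_imp_AE:
  assumes f: "f \<in> L2 M" and "L2_norm M f = 0"
  shows "AE x in M. f x = 0"
proof -
  have "(LINT x|M. (norm (f x))\<^sup>2) = 0" using assms(2) L2_norm_square_integral[of M f] by simp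
  then have "AE x in M. (norm (f x))\<^sup>2 = 0"
    by (subst (asm) integral_nonneg_eq_0_iff_AE) (auto simp: L2_integrable_square[OF f])
  then show ?thesis by simp
qed

lemma L2_inner_cong_AE:
  assumes "AE x in M. f x = f' x" "AE x in M. g x = g' x"
    and "f \<in> borel_measurable M" "f' \<in> borel_measurable M" "g \<in> borel_measurable M" "g' \<in> borel_measurable M"
  shows "L2_inner M f g = L2_inner M f' g'"
  unfolding L2_inner_def by (rule integral_cong_AE) (use assms in auto)

lemma L2_norm_cong_AE:
  assumes "AE x in M. f x = f' x" "f \<in> borel_measurable M" "f' \<in> borel_measurable M"
  shows "L2_norm M f = L2_norm M f'"
  unfolding L2_norm_def using L2_inner_cong_AE[OF assms(1,1,2,3,2,3)] by simp

lemma L2_cong_AE: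
  assumes "f \<in> L2 M" "AE x in M. f x = g x" "g \<in> borel_measurable M"
  shows "g \<in> L2 M"
proof (rule L2_I[OF assms(3)])
  show "integrable M (\<lambda>x. (norm (g x))\<^sup>2)"
    by (rule integrable_cong_AE_imp[OF L2_integrable_square[OF assms(1)]]) (use assms in auto)
qed

lemma L2_component:
  assumes f: "f \<in> L2 M" shows "(\<lambda>x. f x \<bullet> b) \<in> L2 M"
proof (rule L2_bound)
  show "(\<lambda>x. f x \<bullet> b) \<in> borel_measurable M" using L2_measurable[OF f] by measurable
  show "integrable M (\<lambda>x. (norm (f x))\<^sup>2 * (norm b)\<^sup>2)"
    using f by (intro integrable_mult_left L2_integrable_square) 
  fix x
  have "\<bar>f x \<bullet> b\<bar>\<^sup>2 \<le> (norm (f x) * norm b)\<^sup>2"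
    by (rule power_mono) (auto simp: Cauchy_Schwarz_ineq2)
  then show "(norm (f x \<bullet> b))\<^sup>2 \<le> (norm (f x))\<^sup>2 * (norm b)\<^sup>2" by (simp add: power_mult_distrib)
qed

lemma L2_norm_square_components:
  assumes f: "f \<in> L2 M"
  shows "(L2_norm M f)\<^sup>2 = (\<Sum>b\<in>Basis. (L2_norm M (\<lambda>x. f x \<bullet> b))\<^sup>2)"
proof -
  have "(L2_norm M f)\<^sup>2 = (LINT x|M. (\<Sum>b\<in>Basis. (norm (f x \<bullet> b))\<^sup>2))"
    unfolding L2_norm_square_integral
  proof (rule Bochner_Integration.integral_cong[OF refl])
    fix x
    have "(norm (f x))\<^sup>2 = f x \<bullet> f x" by (rule power2_norm_eq_inner)
    also have "\<dots> = (\<Sum>b\<in>Basis. (f x \<bullet> b) * (f x \<bullet> b))" by (rule euclidean_inner)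
    finally show "(norm (f x))\<^sup>2 = (\<Sum>b\<in>Basis. (norm (f x \<bullet> b))\<^sup>2)" by (simp add: power2_eq_square)
  qed
  also have "\<dots> = (\<Sum>b\<in>Basis. (LINT x|M. (norm (f x \<bullet> b))\<^sup>2))"
    by (rule Bochner_Integration.integral_sum) (rule L2_integrable_square[OF L2_component[OF f]])
  finally show ?thesis by (simp only: L2_norm_square_integral)
qed

lemma L2_inner_tendsto:
  assumes "\<And>n. \<phi> n \<in> L2 M" "v \<in> L2 M" "g \<in> L2 M" and lim: "(\<lambda>n. L2_norm M (\<lambda>x. \<phi> n x - v x)) \<longlonglongrightarrow> 0"
  shows "(\<lambda>n. L2_inner M (\<phi> n) g) \<longlonglongrightarrow> L2_inner M v g"
proof -
  have "(\<lambda>n. L2_inner M (\<phi> n) g - L2_inner M v g) \<longlonglongrightarrow> 0"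
  proof (rule Lim_null_comparison)
    show "\<forall>\<^sub>F n in sequentially. norm (L2_inner M (\<phi> n) g - L2_inner M v g) \<le> L2_norm M (\<lambda>x. \<phi> n x - v x) * L2_norm M g"
    proof (rule always_eventually, rule allI)
      fix n
      have "L2_inner M (\<phi> n) g - L2_inner M v g = L2_inner M (\<lambda>x. \<phi> n x - v x) g"
        using assms by (simp add: L2_inner_diff_left)
      then show "norm (L2_inner M (\<phi> n) g - L2_inner M v g) \<le> L2_norm M (\<lambda>x. \<phi> n x - v x) * L2_norm M g"
        using L2_cauchy_schwarz[OF L2_diff[OF assms(1,2)] assms(3)] by simp
    qed
    show "(\<lambda>n. L2_norm M (\<lambda>x. \<phi> n x - v x) * L2_norm M g) \<longlonglongrightarrow> 0"
      using tendsto_mult_right[OF lim, of "L2_norm M g"] by simp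
  qed
  then show ?thesis using LIM_zero_iff by blast
qed

lemma L2_const: "finite_measure M \<Longrightarrow> (\<lambda>x. c) \<in> L2 M"
  by (simp add: L2_def finite_measure.integrable_const)

lemma L2_integrable:
  fixes f :: "_ \<Rightarrow> real"
  assumes "finite_measure M" "f \<in> L2 M" shows "integrable M f"
  using L2_inner_integrable[OF L2_const[OF assms(1), of 1] assms(2)] by simp

lemma L2_integrable_vec:
  fixes f :: "_ \<Rightarrow> 'b::euclidean_space"
  assumes "finite_measure M" "f \<in> L2 M" shows "integrable M f"
proof -
  have "integrable M (\<lambda>x. \<Sum>b\<in>Basis. (f x \<bullet> b) *\<^sub>R b)"
    by (intro Bochner_Integration.integrable_sum integrable_scaleR_left L2_integrable[OF assms(1) L2_component[OF assms(2)]])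
  then show ?thesis by (simp add: euclidean_representation)
qed

lemma L2_integral_tendsto:
  fixes v :: "_ \<Rightarrow> real"
  assumes "finite_measure M" "\<And>n. \<phi> n \<in> L2 M" "v \<in> L2 M" "(\<lambda>n. L2_norm M (\<lambda>x. \<phi> n x - v x)) \<longlonglongrightarrow> 0"
  shows "(\<lambda>n. LINT x|M. \<phi> n x) \<longlonglongrightarrow> (LINT x|M. v x)"
  using L2_inner_tendsto[OF assms(2,3) L2_const[OF assms(1), of 1] assms(4)] by (simp add: L2_inner_def)

lemma L2_bounded:
  assumes "finite_measure M" "f \<in> borel_measurable M" "\<And>x. x \<in> space M \<Longrightarrow> norm (f x) \<le> B"
  shows "f \<in> L2 M"
proof (rule L2_I[OF assms(2)])
  show "integrable M (\<lambda>x. (norm (f x))\<^sup>2)"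
  proof (rule finite_measure.integrable_const_bound[OF assms(1)])
    show "AE x in M. norm ((norm (f x))\<^sup>2) \<le> B\<^sup>2"
      using assms(3) by (intro AE_I2) (simp add: power_mono)
  qed (use assms in auto)
qed

lemma L2_lebesgue_on_subset:
  fixes f :: "'a::euclidean_space \<Rightarrow> 'b::euclidean_space"
  assumes f: "f \<in> L2 (lebesgue_on U)" and VU: "V \<subseteq> U" and U: "U \<in> sets lebesgue" and V: "V \<in> sets lebesgue"
  shows "f \<in> L2 (lebesgue_on V)" "L2_norm (lebesgue_on V) f \<le> L2_norm (lebesgue_on U) f"
proof -
  have m: "f \<in> borel_measurable (lebesgue_on V)"
    using L2_measurable[OF f] VU measurable_restrict_mono by blast
  have iU: "integrable lebesgue (\<lambda>x. indicator U x *\<^sub>R (norm (f x))\<^sup>2)"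
    using L2_integrable_square[OF f] U by (subst (asm) integrable_restrict_space) auto
  have mV: "(\<lambda>x. indicator V x *\<^sub>R (norm (f x))\<^sup>2) \<in> borel_measurable lebesgue"
    using m V by (subst borel_measurable_restrict_space_iff[symmetric]) auto
  have iV: "integrable lebesgue (\<lambda>x. indicator V x *\<^sub>R (norm (f x))\<^sup>2)"
    by (rule Bochner_Integration.integrable_bound[OF iU mV]) (use VU in \<open>auto simp: indicator_def\<close>)
  show "f \<in> L2 (lebesgue_on V)"
    by (rule L2_I[OF m]) (use iV V in \<open>subst integrable_restrict_space; auto\<close>)
  have "(L2_norm (lebesgue_on V) f)\<^sup>2 = (LINT x|lebesgue. indicator V x *\<^sub>R (norm (f x))\<^sup>2)"
    unfolding L2_norm_square_integral using V by (subst integral_restrict_space) auto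
  also have "\<dots> \<le> (LINT x|lebesgue. indicator U x *\<^sub>R (norm (f x))\<^sup>2)"
    by (rule integral_mono[OF iV iU]) (use VU in \<open>auto simp: indicator_def\<close>)
  also have "\<dots> = (L2_norm (lebesgue_on U) f)\<^sup>2"
    unfolding L2_norm_square_integral using U by (subst integral_restrict_space) auto
  finally show "L2_norm (lebesgue_on V) f \<le> L2_norm (lebesgue_on U) f"
    by (rule power2_le_imp_le) simp
qed

subsection \<open>Convolution with a compactly supported kernel\<close>

lemma C1_gradient_outside:
  assumes psi: "C1 \<psi>" and supp: "\<And>z. R < norm z \<Longrightarrow> \<psi> z = 0" and z: "R < norm z"
  shows "gradient \<psi> z = 0"
proof (rule gradient_eqI)
  have op: "open {z::'a. R < norm z}" by (intro open_Collect_less continuous_intros)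
  have "((\<lambda>_. 0) has_derivative (\<lambda>h. 0 \<bullet> h)) (at z)" by simp
  then show "(\<psi> has_derivative (\<lambda>h. 0 \<bullet> h)) (at z)"
    by (rule has_derivative_transform_within_open[OF _ op]) (use z supp in auto)
qed

text \<open>Compact support makes the gradient uniformly continuous, and the mean value theorem on a
  segment turns this into a remainder estimate uniform in \<open>x\<close>. The uniformity allows
  the estimate to be integrated against a function that is merely integrable.\<close>

lemma C1_uniformly_differentiable:
  fixes \<psi> :: "'a::euclidean_space \<Rightarrow> real"
  assumes psi: "C1 \<psi>" and supp: "\<And>z. R < norm z \<Longrightarrow> \<psi> z = 0" and e: "e > 0"
  shows "\<exists>d>0. \<forall>x h. norm h < d \<longrightarrow> \<bar>\<psi> (x + h) - \<psi> x - gradient \<psi> x \<bullet> h\<bar> \<le> e * norm h"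
proof -
  \<comment> \<open>For steps shorter than 1, either both end points lie in this ball or both lie
    outside the support.\<close>
  let ?K = "cball (0::'a) (R + 2)"
  have "uniformly_continuous_on ?K (gradient \<psi>)"
    by (rule compact_uniformly_continuous[OF C1_continuous_gradient[OF psi] compact_cball])
  then have "\<exists>d>0. \<forall>x\<in>?K. \<forall>x'\<in>?K. dist x' x < d \<longrightarrow> dist (gradient \<psi> x') (gradient \<psi> x) < e"
    using e unfolding uniformly_continuous_on_def by (elim allE impE)
  then obtain d0 where d0: "d0 > 0"
    and uc: "\<And>x x'. x \<in> ?K \<Longrightarrow> x' \<in> ?K \<Longrightarrow> dist x' x < d0 \<Longrightarrow> dist (gradient \<psi> x') (gradient \<psi> x) < e"
    by (elim exE conjE) (rule that, assumption, blast)
  have unif: "norm (gradient \<psi> (x + k) - gradient \<psi> x) \<le> e" if k: "norm k < min d0 1" for x k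
  proof (cases "norm x \<le> R + 1")
    case True
    have "norm (x + k) \<le> R + 2" using norm_triangle_ineq[of x k] True k by simp
    then have "dist (gradient \<psi> (x + k)) (gradient \<psi> x) < e"
      using True k by (intro uc) (simp_all, simp add: dist_norm)
    then show ?thesis by (simp add: dist_norm)
  next
    case False
    have "norm x \<le> norm (x + k) + norm k" using norm_triangle_ineq4[of "x + k" k] by simp
    then have "R < norm (x + k)" "R < norm x" using False k by auto
    then show ?thesis using C1_gradient_outside[OF psi supp] e by simp
  qed
  show ?thesis
  proof (intro exI[of _ "min d0 1"] conjI allI impI)
    show "min d0 1 > 0" using d0 by simp
    fix x h :: 'a assume h: "norm h < min d0 1"
    let ?f = "\<lambda>t. \<psi> (x + t *\<^sub>R h)"
    have der: "(?f has_real_derivative gradient \<psi> (x + t *\<^sub>R h) \<bullet> h) (at t)" for t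
    proof -
      have d1: "((\<lambda>t. x + t *\<^sub>R h) has_derivative (\<lambda>s. s *\<^sub>R h)) (at t)"
        by (auto intro!: derivative_eq_intros)
      show ?thesis
        unfolding has_field_derivative_def
        using has_derivative_compose[OF d1 C1_has_derivative[OF psi]]
        by (simp add: mult.commute[of _ "_ \<bullet> _"])
    qed
    obtain t where t: "0 < t" "t < 1" and eq: "?f 1 - ?f 0 = (1 - 0) * (gradient \<psi> (x + t *\<^sub>R h) \<bullet> h)"
      using MVT2[of 0 1 ?f "\<lambda>t. gradient \<psi> (x + t *\<^sub>R h) \<bullet> h"] der by auto
    have "norm (t *\<^sub>R h) \<le> 1 * norm h" unfolding norm_scaleR using t by (intro mult_right_mono) auto
    then have th: "norm (t *\<^sub>R h) < min d0 1" using h by simp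
    have "\<psi> (x + h) - \<psi> x - gradient \<psi> x \<bullet> h = (gradient \<psi> (x + t *\<^sub>R h) - gradient \<psi> x) \<bullet> h"
      using eq by (simp add: inner_diff_left)
    also have "\<bar>\<dots>\<bar> \<le> norm (gradient \<psi> (x + t *\<^sub>R h) - gradient \<psi> x) * norm h"
      by (rule Cauchy_Schwarz_ineq2)
    also have "\<dots> \<le> e * norm h" by (intro mult_right_mono unif th) simp
    finally show "\<bar>\<psi> (x + h) - \<psi> x - gradient \<psi> x \<bullet> h\<bar> \<le> e * norm h" .
  qed
qed

text \<open>Convolution with the extension of \<open>v\<close> by zero, written as an integral over
  \<open>U\<close> so that values of \<open>v\<close> outside \<open>U\<close> never occur.\<close>

definition conv_on :: "'a::euclidean_space set \<Rightarrow> ('a \<Rightarrow> real) \<Rightarrow> ('a \<Rightarrow> real) \<Rightarrow> 'a \<Rightarrow> real" where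
  "conv_on U \<psi> v x = (LINT y|lebesgue_on U. \<psi> (x - y) * v y)"

lemma continuous_lebesgue_on_measurable:
  fixes f :: "'a::euclidean_space \<Rightarrow> 'b::euclidean_space"
  assumes "continuous_on UNIV f"
  shows "f \<in> borel_measurable (lebesgue_on U)"
proof -
  have "f \<in> borel_measurable borel" using assms by (rule borel_measurable_continuous_onI)
  then have "f \<in> borel_measurable lebesgue" by (simp add: measurable_completion)
  then show ?thesis by (rule measurable_restrict_space1)
qed

lemma conv_on_integrable:
  assumes v: "integrable (lebesgue_on U) v" and c: "continuous_on UNIV \<psi>"
    and supp: "\<And>z::'a::euclidean_space. R < norm z \<Longrightarrow> \<psi> z = (0::real)"
  shows "integrable (lebesgue_on U) (\<lambda>y. \<psi> (x - y) * v y)"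
proof -
  have "compact (\<psi> ` cball 0 R)" by (intro compact_continuous_image continuous_on_subset[OF c]) auto
  then obtain B where B: "\<And>z. z \<in> cball 0 R \<Longrightarrow> \<bar>\<psi> z\<bar> \<le> B"
    using compact_imp_bounded by (fastforce simp: bounded_iff)
  have B': "\<bar>\<psi> z\<bar> \<le> max B 0" for z
    using B[of z] supp[of z] by (cases "norm z \<le> R") auto
  show ?thesis
  proof (rule Bochner_Integration.integrable_bound)
    show "integrable (lebesgue_on U) (\<lambda>y. max B 0 * norm (v y))"
      using v by (intro integrable_mult_right integrable_norm)
    have "continuous_on UNIV (\<lambda>y. \<psi> (x - y))"
      by (rule continuous_on_compose2[OF c]) (auto intro!: continuous_intros)
    then show "(\<lambda>y. \<psi> (x - y) * v y) \<in> borel_measurable (lebesgue_on U)"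
      by (intro borel_measurable_times[OF continuous_lebesgue_on_measurable borel_measurable_integrable[OF v]])
    show "AE y in lebesgue_on U. norm (\<psi> (x - y) * v y) \<le> norm (max B 0 * norm (v y))"
      using B' by (intro AE_I2) (auto simp: abs_mult intro!: mult_right_mono)
  qed
qed

lemma conv_on_has_derivative:
  fixes \<psi> :: "'a::euclidean_space \<Rightarrow> real"
  assumes v: "integrable (lebesgue_on U) v" and psi: "C1 \<psi>" and supp: "\<And>z. R < norm z \<Longrightarrow> \<psi> z = 0"
  shows "(conv_on U \<psi> v has_derivative (\<lambda>h. (\<Sum>b\<in>Basis. conv_on U (\<lambda>z. gradient \<psi> z \<bullet> b) v x *\<^sub>R b) \<bullet> h)) (at x)"
proof -
  let ?G = "\<lambda>h. (\<Sum>b\<in>Basis. conv_on U (\<lambda>z. gradient \<psi> z \<bullet> b) v x *\<^sub>R b) \<bullet> h"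
  have c: "continuous_on UNIV \<psi>" using psi by (rule C1_continuous)
  have cg: "continuous_on UNIV (\<lambda>z. gradient \<psi> z \<bullet> h)" for h
    by (intro continuous_intros C1_continuous_gradient psi)
  have sg: "R < norm z \<Longrightarrow> gradient \<psi> z \<bullet> h = 0" for z h using C1_gradient_outside[OF psi supp] by simp
  have i1: "integrable (lebesgue_on U) (\<lambda>y. \<psi> (x - y) * v y)" for x
    by (rule conv_on_integrable[OF v c supp])
  have i2: "integrable (lebesgue_on U) (\<lambda>y. (gradient \<psi> (x - y) \<bullet> h) * v y)" for x h
    by (rule conv_on_integrable[OF v cg sg])
  have Geq: "?G h = (LINT y|lebesgue_on U. (gradient \<psi> (x - y) \<bullet> h) * v y)" for h
  proof -
    have "?G h = (\<Sum>b\<in>Basis. (h \<bullet> b) * (LINT y|lebesgue_on U. (gradient \<psi> (x - y) \<bullet> b) * v y))"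
      by (simp add: conv_on_def inner_sum_left inner_commute[of h] mult.commute)
    also have "\<dots> = (LINT y|lebesgue_on U. (\<Sum>b\<in>Basis. (h \<bullet> b) * ((gradient \<psi> (x - y) \<bullet> b) * v y)))"
      using i2 by (subst Bochner_Integration.integral_sum) auto
    also have "\<dots> = (LINT y|lebesgue_on U. (gradient \<psi> (x - y) \<bullet> h) * v y)"
    proof (rule Bochner_Integration.integral_cong[OF refl])
      fix y
      have "gradient \<psi> (x - y) \<bullet> h = (\<Sum>b\<in>Basis. (gradient \<psi> (x - y) \<bullet> b) * (h \<bullet> b))"
        by (rule euclidean_inner)
      then show "(\<Sum>b\<in>Basis. (h \<bullet> b) * ((gradient \<psi> (x - y) \<bullet> b) * v y)) = (gradient \<psi> (x - y) \<bullet> h) * v y"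
        by (simp add: sum_distrib_left sum_distrib_right mult_ac)
    qed
    finally show ?thesis .
  qed
  define I where "I = (LINT y|lebesgue_on U. \<bar>v y\<bar>)"
  have I0: "I \<ge> 0" by (simp add: I_def)
  show ?thesis
    unfolding has_derivative_at_alt
  proof (intro conjI allI impI)
    show "bounded_linear ?G" by (rule bounded_linear_inner_right)
    fix e :: real assume e: "e > 0"
    \<comment> \<open>\<open>I\<close> is the integral of the absolute value of \<open>v\<close>;
      the summand 1 covers the case \<open>I = 0\<close>.\<close>
    have e': "e / (I + 1) > 0" using e I0 by simp
    obtain d where d: "d > 0" "\<And>x h. norm h < d \<Longrightarrow> \<bar>\<psi> (x + h) - \<psi> x - gradient \<psi> x \<bullet> h\<bar> \<le> e / (I + 1) * norm h"
      using C1_uniformly_differentiable[OF psi supp e'] by blast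
    show "\<exists>d>0. \<forall>y. norm (y - x) < d \<longrightarrow> norm (conv_on U \<psi> v y - conv_on U \<psi> v x - ?G (y - x)) \<le> e * norm (y - x)"
    proof (intro exI[of _ d] conjI allI impI d(1))
      fix w assume w: "norm (w - x) < d"
      have eq: "conv_on U \<psi> v w - conv_on U \<psi> v x - ?G (w - x)
         = (LINT y|lebesgue_on U. \<psi> (w - y) * v y - \<psi> (x - y) * v y - (gradient \<psi> (x - y) \<bullet> (w - x)) * v y)"
        unfolding Geq unfolding conv_on_def using i1 i2 by simp
      have "norm (conv_on U \<psi> v w - conv_on U \<psi> v x - ?G (w - x)) \<le> (LINT y|lebesgue_on U. norm (\<psi> (w - y) * v y - \<psi> (x - y) * v y - (gradient \<psi> (x - y) \<bullet> (w - x)) * v y))"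
        unfolding eq by (rule integral_norm_bound)
      also have "\<dots> \<le> (LINT y|lebesgue_on U. e / (I + 1) * norm (w - x) * \<bar>v y\<bar>)"
      proof (rule integral_mono)
        show "integrable (lebesgue_on U) (\<lambda>y. norm (\<psi> (w - y) * v y - \<psi> (x - y) * v y - (gradient \<psi> (x - y) \<bullet> (w - x)) * v y))"
          by (intro integrable_norm Bochner_Integration.integrable_diff i1 i2)
        show "integrable (lebesgue_on U) (\<lambda>y. e / (I + 1) * norm (w - x) * \<bar>v y\<bar>)"
          using v by (intro integrable_mult_right integrable_abs)
        fix y
        have "norm (\<psi> (w - y) * v y - \<psi> (x - y) * v y - (gradient \<psi> (x - y) \<bullet> (w - x)) * v y)
          = \<bar>\<psi> ((x - y) + (w - x)) - \<psi> (x - y) - gradient \<psi> (x - y) \<bullet> (w - x)\<bar> * \<bar>v y\<bar>"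
          by (simp flip: abs_mult add: algebra_simps)
        also have "\<dots> \<le> e / (I + 1) * norm (w - x) * \<bar>v y\<bar>"
          by (intro mult_right_mono d(2) w) simp
        finally show "norm (\<psi> (w - y) * v y - \<psi> (x - y) * v y - (gradient \<psi> (x - y) \<bullet> (w - x)) * v y) \<le> e / (I + 1) * norm (w - x) * \<bar>v y\<bar>" .
      qed
      also have "\<dots> = e * norm (w - x) * (I / (I + 1))" by (simp add: I_def)
      also have "\<dots> \<le> e * norm (w - x) * 1" using e I0 by (intro mult_left_mono) auto
      finally show "norm (conv_on U \<psi> v w - conv_on U \<psi> v x - ?G (w - x)) \<le> e * norm (w - x)" by simp
    qed
  qed
qed

lemma gradient_conv_on:
  assumes "integrable (lebesgue_on U) v" "C1 \<psi>" "\<And>z. R < norm z \<Longrightarrow> \<psi> z = 0" "b \<in> Basis"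
  shows "gradient (conv_on U \<psi> v) x \<bullet> b = conv_on U (\<lambda>z. gradient \<psi> z \<bullet> b) v x"
  using inner_gradient[OF conv_on_has_derivative[OF assms(1-3)], where x = x and h = b] assms(4)
  by (simp add: inner_sum_left inner_Basis if_distrib sum.delta cong: if_cong)

text \<open>Each partial derivative is again a convolution of \<open>v\<close>, with a kernel that
  is smooth and has the same support bound; the induction therefore runs over all kernels with
  \<open>v\<close> fixed.\<close>

lemma smooth_conv_on:
  assumes v: "integrable (lebesgue_on U) v" and psi: "smooth \<psi>" and supp: "\<And>z. R < norm z \<Longrightarrow> \<psi> z = 0"
  shows "smooth (conv_on U \<psi> v)"
  unfolding smooth_def
proof
  fix k
  show "C_k k (conv_on U \<psi> v)"
    using psi supp
  proof (induction k arbitrary: \<psi>)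
    case 0
    show ?case
      using conv_on_has_derivative[OF v smooth_imp_C1[OF 0(1)] 0(2)]
      by simp (meson continuous_at_imp_continuous_on has_derivative_continuous)
  next
    case (Suc k)
    show ?case
    proof (rule C_k_SucI[OF conv_on_has_derivative[OF v smooth_imp_C1[OF Suc.prems(1)] Suc.prems(2)]])
      fix b :: 'a assume b: "b \<in> Basis"
      have "C_k k (conv_on U (\<lambda>z. gradient \<psi> z \<bullet> b) v)"
        by (rule Suc.IH[OF smooth_partial[OF Suc.prems(1) b]])
          (simp add: C1_gradient_outside[OF smooth_imp_C1[OF Suc.prems(1)] Suc.prems(2)])
      then show "C_k k (\<lambda>x. (\<Sum>b\<in>Basis. conv_on U (\<lambda>z. gradient \<psi> z \<bullet> b) v x *\<^sub>R b) \<bullet> b)"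
        using b by (simp add: inner_sum_left inner_Basis if_distrib sum.delta cong: if_cong)
    qed
  qed
qed

subsection \<open>Mollification\<close>

definition bump :: "'a::euclidean_space \<Rightarrow> real" where
  "bump = (SOME \<rho>. smooth \<rho> \<and> (\<forall>x. 0 \<le> \<rho> x) \<and> (\<forall>x. 1 < norm x \<longrightarrow> \<rho> x = 0) \<and> (LINT x|lborel. \<rho> x) = 1)"

lemma bump:
  shows smooth_bump: "smooth (bump :: 'a::euclidean_space \<Rightarrow> real)"
    and bump_nonneg: "0 \<le> bump (x::'a)"
    and bump_outside: "1 < norm (x::'a) \<Longrightarrow> bump x = 0"
    and integral_bump: "(LINT x|lborel. bump (x::'a)) = 1"
proof -
  have "\<exists>\<rho> :: 'a \<Rightarrow> real. smooth \<rho> \<and> (\<forall>x. 0 \<le> \<rho> x) \<and> (\<forall>x. 1 < norm x \<longrightarrow> \<rho> x = 0) \<and> (LINT x|lborel. \<rho> x) = 1"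
    by (rule smooth_bump_exists) blast
  from someI_ex[OF this] show "smooth (bump :: 'a \<Rightarrow> real)" "0 \<le> bump (x::'a)"
    "1 < norm (x::'a) \<Longrightarrow> bump x = 0" "(LINT x|lborel. bump (x::'a)) = 1"
    unfolding bump_def by blast+
qed

lemma integrable_bump: "integrable lborel (bump :: 'a::euclidean_space \<Rightarrow> real)"
  using integral_bump[where 'a = 'a] not_integrable_integral_eq[of lborel "bump :: 'a \<Rightarrow> real"] by force

definition mollifier :: "real \<Rightarrow> 'a::euclidean_space \<Rightarrow> real" where
  "mollifier e z = inverse e ^ DIM('a) * bump (inverse e *\<^sub>R z)"

lemma smooth_mollifier: "smooth (mollifier e)"
  unfolding mollifier_def
  using smooth_cmult[OF smooth_compose_affine[OF smooth_bump, where p = 0 and r = "inverse e"]] by simp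

lemma mollifier_outside: "0 < e \<Longrightarrow> e < norm z \<Longrightarrow> mollifier e z = 0"
  by (simp add: mollifier_def bump_outside field_simps)

lemma test_function_mollifier:
  assumes e: "0 < e" and sub: "cball x e \<subseteq> U"
  shows "test_function U (\<lambda>y. mollifier e (x - y))"
  unfolding test_function_def
proof (intro conjI exI[of _ "cball x e"] allI impI)
  show "smooth (\<lambda>y. mollifier e (x - y))"
    using smooth_compose_affine[OF smooth_mollifier[of e], where p = x and r = "-1"] by simp
  show "mollifier e (x - y) = 0" if "y \<notin> cball x e" for y
    using that e by (intro mollifier_outside) (auto simp: dist_norm)
qed (use sub in auto)

lemma gradient_reflect:
  assumes "C1 \<psi>" shows "gradient (\<lambda>y. \<psi> (x - y)) y = - gradient \<psi> (x - y)"
proof (rule gradient_eqI)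
  have "((\<lambda>y. x - y) has_derivative (\<lambda>h. - h)) (at y)" by (auto intro!: derivative_eq_intros)
  from has_derivative_compose[OF this C1_has_derivative[OF assms]]
  show "((\<lambda>y. \<psi> (x - y)) has_derivative (\<lambda>h. (- gradient \<psi> (x - y)) \<bullet> h)) (at y)" by simp
qed

text \<open>While the ball of radius \<open>e\<close> about \<open>x\<close> stays inside
  \<open>U\<close>, the reflected kernel is a test function on \<open>U\<close>, and the definition
  of the weak gradient moves the derivative from the kernel to \<open>v\<close>. The sign from the
  reflection cancels the one from integration by parts.\<close>

lemma gradient_mollified:
  assumes v: "integrable (lebesgue_on U) v" and wg: "weak_gradient U v g"
    and e: "0 < e" and sub: "cball x e \<subseteq> U" and b: "b \<in> Basis"
  shows "gradient (conv_on U (mollifier e) v) x \<bullet> b = conv_on U (mollifier e) (\<lambda>y. g y \<bullet> b) x"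
proof -
  have "gradient (conv_on U (mollifier e) v) x \<bullet> b = (LINT y|lebesgue_on U. (gradient (mollifier e) (x - y) \<bullet> b) * v y)"
    using gradient_conv_on[OF v smooth_imp_C1[OF smooth_mollifier] mollifier_outside[OF e] b] by (simp add: conv_on_def)
  also have "\<dots> = - (LINT y|lebesgue_on U. v y * (gradient (\<lambda>y. mollifier e (x - y)) y \<bullet> b))"
    by (simp add: gradient_reflect[OF smooth_imp_C1[OF smooth_mollifier]] mult.commute)
  also have "\<dots> = (LINT y|lebesgue_on U. (g y \<bullet> b) * mollifier e (x - y))"
    using wg test_function_mollifier[OF e sub] b unfolding weak_gradient_def by simp
  finally show ?thesis by (simp add: conv_on_def mult.commute)
qed

lemma L2_norm_le_nn_integral:
  assumes f: "f \<in> borel_measurable M" and b: "(\<integral>\<^sup>+x. ennreal ((norm (f x))\<^sup>2) \<partial>M) \<le> ennreal (c\<^sup>2)" and c: "0 \<le> c"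
  shows "f \<in> L2 M" "L2_norm M f \<le> c"
proof -
  have m: "(\<lambda>x. (norm (f x))\<^sup>2) \<in> borel_measurable M" using f by measurable
  have i: "integrable M (\<lambda>x. (norm (f x))\<^sup>2)"
    by (rule integrableI_nonneg[OF m]) (use b le_less_trans in \<open>auto intro: le_less_trans[OF b]\<close>)
  then show "f \<in> L2 M" using f by (rule_tac L2_I)
  have "ennreal (LINT x|M. (norm (f x))\<^sup>2) = (\<integral>\<^sup>+x. ennreal ((norm (f x))\<^sup>2) \<partial>M)"
    by (rule nn_integral_eq_integral[symmetric, OF i]) simp
  then have "ennreal ((L2_norm M f)\<^sup>2) \<le> ennreal (c\<^sup>2)" using b by (simp add: L2_norm_square_integral)
  then have "(L2_norm M f)\<^sup>2 \<le> c\<^sup>2" by simp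
  then show "L2_norm M f \<le> c" using c by (rule power2_le_imp_le)
qed

lemma L2_norm_tendsto_dominated:
  assumes m: "\<And>n. f n \<in> borel_measurable M" and k: "integrable M k"
    and lim: "AE x in M. (\<lambda>n. f n x) \<longlonglongrightarrow> 0" and bd: "\<And>n. AE x in M. (norm (f n x))\<^sup>2 \<le> k x"
  shows "(\<lambda>n. L2_norm M (f n)) \<longlonglongrightarrow> 0"
proof -
  have "(\<lambda>n. LINT x|M. (norm (f n x))\<^sup>2) \<longlonglongrightarrow> (LINT x|M. 0)"
  proof (rule integral_dominated_convergence[OF _ _ k])
    show "AE x in M. (\<lambda>n. (norm (f n x))\<^sup>2) \<longlonglongrightarrow> 0"
      using lim
    proof eventually_elim
      fix x assume "(\<lambda>n. f n x) \<longlonglongrightarrow> 0"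
      from tendsto_power[OF tendsto_norm[OF this], of 2] show "(\<lambda>n. (norm (f n x))\<^sup>2) \<longlonglongrightarrow> 0" by simp
    qed
    show "(\<lambda>x. (norm (f n x))\<^sup>2) \<in> borel_measurable M" for n using m by measurable
    show "AE x in M. norm ((norm (f n x))\<^sup>2) \<le> k x" for n using bd[of n] by simp
  qed simp
  then have "(\<lambda>n. (L2_norm M (f n))\<^sup>2) \<longlonglongrightarrow> 0" by (simp add: L2_norm_square_integral)
  from tendsto_real_sqrt[OF this] show ?thesis by simp
qed

lemma bounded_lebesgue_finite_measure:
  assumes "bounded U" "U \<in> sets lebesgue"
  shows "finite_measure (lebesgue_on U)"
  using assms bounded_set_imp_lmeasurable finite_measure_lebesgue_on by blast

lemma L2_continuous_bounded_domain:
  fixes f :: "'a::euclidean_space \<Rightarrow> 'b::euclidean_space"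
  assumes f: "continuous_on UNIV f" and U: "bounded U" "U \<in> sets lebesgue"
  shows "f \<in> L2 (lebesgue_on U)"
proof -
  have "compact (f ` closure U)"
    by (rule compact_continuous_image[OF continuous_on_subset[OF f]]) (use U in \<open>auto simp: compact_closure\<close>)
  then obtain B where B: "\<And>x. x \<in> closure U \<Longrightarrow> norm (f x) \<le> B"
    using compact_imp_bounded by (fastforce simp: bounded_iff)
  show ?thesis
    by (rule L2_bounded[OF bounded_lebesgue_finite_measure[OF U] continuous_lebesgue_on_measurable[OF f]])
      (use B closure_subset in auto)
qed

text \<open>The function is truncated at a high level, and then so are continuous functions
  converging to it almost everywhere. The common bound makes dominated convergence available here,
  and again later for the mollifications of \<open>w\<close>.\<close>

lemma L2_approx_bounded_continuous:
  fixes v :: "'a::euclidean_space \<Rightarrow> real"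
  assumes U: "bounded U" "U \<in> sets lebesgue" and v: "v \<in> L2 (lebesgue_on U)" and \<eta>: "\<eta> > 0"
  obtains w B where "continuous_on UNIV w" "\<And>x. \<bar>w x\<bar> \<le> B" "L2_norm (lebesgue_on U) (\<lambda>x. v x - w x) < \<eta>"
proof -
  define cl where "cl = (\<lambda>M t::real. max (- M) (min M t))"
  have cl1: "\<bar>cl M t\<bar> \<le> M" if "M \<ge> 0" for M t using that by (auto simp: cl_def)
  have cl2: "\<bar>t - cl M t\<bar> \<le> \<bar>t\<bar>" if "M \<ge> 0" for M t using that by (auto simp: cl_def)
  have cl3: "cl M t = t" if "\<bar>t\<bar> \<le> M" for M t using that by (auto simp: cl_def)
  have clc: "continuous_on A (cl M)" for A M unfolding cl_def by (intro continuous_intros)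
  have clm: "cl M \<in> borel_measurable borel" for M by (rule borel_measurable_continuous_onI[OF clc])
  let ?M = "lebesgue_on U"
  note fin = bounded_lebesgue_finite_measure[OF U]
  have vm: "v \<in> borel_measurable ?M" using v by (rule L2_measurable)
  have clv: "(\<lambda>x. cl m (v x)) \<in> borel_measurable ?M" for m
    using measurable_compose[OF vm clm] .
  have "(\<lambda>n. L2_norm ?M (\<lambda>x. v x - cl (real n) (v x))) \<longlonglongrightarrow> 0"
  proof (rule L2_norm_tendsto_dominated)
    show "(\<lambda>x. v x - cl (real n) (v x)) \<in> borel_measurable ?M" for n using vm clv by measurable
    show "integrable ?M (\<lambda>x. (norm (v x))\<^sup>2)" using v by (rule L2_integrable_square)
    show "AE x in ?M. (\<lambda>n. v x - cl (real n) (v x)) \<longlonglongrightarrow> 0"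
    proof (rule AE_I2)
      fix x
      obtain N where N: "\<bar>v x\<bar> \<le> real N" using real_arch_simple by blast
      have "\<forall>\<^sub>F n in sequentially. v x - cl (real n) (v x) = 0"
        using eventually_ge_at_top[of N] by eventually_elim (use N cl3 in auto)
      then show "(\<lambda>n. v x - cl (real n) (v x)) \<longlonglongrightarrow> 0" by (rule tendsto_eventually)
    qed
    show "AE x in ?M. (norm (v x - cl (real n) (v x)))\<^sup>2 \<le> (norm (v x))\<^sup>2" for n
      using cl2[of "real n"] by (intro AE_I2 power_mono) auto
  qed
  then have "\<forall>\<^sub>F n in sequentially. L2_norm ?M (\<lambda>x. v x - cl (real n) (v x)) < \<eta> / 2"
    using \<eta> by (intro order_tendstoD) auto
  then obtain m where m: "L2_norm ?M (\<lambda>x. v x - cl (real m) (v x)) < \<eta> / 2"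
    using eventually_sequentially by auto
  have "v measurable_on U" using vm U(2) measurable_on_iff_borel_measurable by blast
  then obtain N g where N: "negligible N" and g: "\<And>n. continuous_on UNIV (g n)"
    and gl: "\<And>x. x \<notin> N \<Longrightarrow> (\<lambda>n. g n x) \<longlonglongrightarrow> (if x \<in> U then v x else 0)"
    unfolding measurable_on_def by blast
  have gc: "continuous_on UNIV (\<lambda>x. cl (real m) (g n x))" for n
    by (rule continuous_on_compose2[OF clc[of UNIV] g]) auto
  have "(\<lambda>n. L2_norm ?M (\<lambda>x. cl (real m) (v x) - cl (real m) (g n x))) \<longlonglongrightarrow> 0"
  proof (rule L2_norm_tendsto_dominated)
    show "(\<lambda>x. cl (real m) (v x) - cl (real m) (g n x)) \<in> borel_measurable ?M" for n
      using clv continuous_lebesgue_on_measurable[OF gc] by measurable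
    show "integrable ?M (\<lambda>x. (2 * real m)\<^sup>2)" using fin finite_measure.integrable_const by blast
    have "AE x in lebesgue. x \<notin> N" using N by (intro AE_not_in) (simp add: negligible_iff_null_sets)
    then have "AE x in ?M. x \<notin> N" using U(2) by (subst AE_restrict_space_iff) (auto elim: eventually_mono)
    then show "AE x in ?M. (\<lambda>n. cl (real m) (v x) - cl (real m) (g n x)) \<longlonglongrightarrow> 0"
      using AE_space
    proof eventually_elim
      fix x assume x: "x \<notin> N" "x \<in> space ?M"
      then have l: "(\<lambda>n. g n x) \<longlonglongrightarrow> v x" using gl[of x] by simp
      have "(\<lambda>n. cl (real m) (g n x)) \<longlonglongrightarrow> cl (real m) (v x)"
        by (rule continuous_on_tendsto_compose[OF clc[of UNIV] l]) auto
      from tendsto_diff[OF tendsto_const[of "cl (real m) (v x)"] this]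
      show "(\<lambda>n. cl (real m) (v x) - cl (real m) (g n x)) \<longlonglongrightarrow> 0" by simp
    qed
    show "AE x in ?M. (norm (cl (real m) (v x) - cl (real m) (g n x)))\<^sup>2 \<le> (2 * real m)\<^sup>2" for n
    proof (intro AE_I2 power_mono)
      fix x
      show "norm (cl (real m) (v x) - cl (real m) (g n x)) \<le> 2 * real m"
        using cl1[of "real m" "v x"] cl1[of "real m" "g n x"] by auto
    qed simp
  qed
  then have "\<forall>\<^sub>F n in sequentially. L2_norm ?M (\<lambda>x. cl (real m) (v x) - cl (real m) (g n x)) < \<eta> / 2"
    using \<eta> by (intro order_tendstoD) auto
  then obtain n where n: "L2_norm ?M (\<lambda>x. cl (real m) (v x) - cl (real m) (g n x)) < \<eta> / 2"
    using eventually_sequentially by auto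
  have L: "(\<lambda>x. cl (real m) (g n x)) \<in> L2 ?M" by (rule L2_continuous_bounded_domain[OF gc U])
  have L': "(\<lambda>x. cl (real m) (v x)) \<in> L2 ?M"
    by (rule L2_bounded[OF fin clv, of _ "real m"]) (use cl1 in auto)
  have "L2_norm ?M (\<lambda>x. (v x - cl (real m) (v x)) + (cl (real m) (v x) - cl (real m) (g n x)))
     \<le> L2_norm ?M (\<lambda>x. v x - cl (real m) (v x)) + L2_norm ?M (\<lambda>x. cl (real m) (v x) - cl (real m) (g n x))"
    by (intro L2_norm_triangle L2_diff v L L')
  then have "L2_norm ?M (\<lambda>x. v x - cl (real m) (g n x)) < \<eta>" using m n by simp
  then show thesis using that[OF gc[of n], of "real m"] cl1[of "real m"] by auto
qed

lemma integral_lborel_affine: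
  fixes f :: "'a::euclidean_space \<Rightarrow> real"
  assumes f: "f \<in> borel_measurable borel" and c: "c \<noteq> 0"
  shows "(LINT y|lborel. f y) = \<bar>c\<bar> ^ DIM('a) * (LINT z|lborel. f (x + c *\<^sub>R z))"
proof -
  have "(LINT y|lborel. f y) = integral\<^sup>L (density (distr lborel borel (\<lambda>z. x + c *\<^sub>R z)) (\<lambda>_. ennreal (\<bar>c\<bar> ^ DIM('a)))) f"
    using lborel_affine[OF c, of x] by simp
  also have "\<dots> = (LINT y|distr lborel borel (\<lambda>z. x + c *\<^sub>R z). \<bar>c\<bar> ^ DIM('a) *\<^sub>R f y)"
    using f by (intro integral_density) auto
  also have "\<dots> = (LINT z|lborel. \<bar>c\<bar> ^ DIM('a) *\<^sub>R f (x + c *\<^sub>R z))"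
    using f by (intro integral_distr) auto
  finally show ?thesis by simp
qed

text \<open>The changes of variables and Fubini arguments below are carried out for Borel functions;
  the representative found here also carries the extension by zero.\<close>

lemma lebesgue_on_Borel_representative:
  fixes v :: "'a::euclidean_space \<Rightarrow> real"
  assumes v: "v \<in> borel_measurable (lebesgue_on U)" and U: "U \<in> sets lebesgue"
  obtains v' where "v' \<in> borel_measurable borel" "AE x in lebesgue. indicator U x * v x = v' x"
proof -
  have "(\<lambda>x. indicator U x *\<^sub>R v x) \<in> borel_measurable lebesgue"
    using v U by (subst borel_measurable_restrict_space_iff[symmetric]) auto
  then obtain v' where v': "v' \<in> borel_measurable lborel" "AE x in lborel. indicator U x *\<^sub>R v x = v' x"
    using completion_ex_borel_measurable_real by blast
  show thesis using that[of v'] v'(1) AE_completion[OF v'(2)] by simp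
qed

lemma measurable_bump [measurable]: "bump \<in> borel_measurable borel"
  by (rule borel_measurable_continuous_onI[OF smooth_continuous[OF smooth_bump]])

lemma measurable_mollifier [measurable]: "mollifier e \<in> borel_measurable borel"
  by (rule borel_measurable_continuous_onI[OF smooth_continuous[OF smooth_mollifier]])

text \<open>The substitution \<open>y = x - e z\<close> fixes the kernel and moves the scale into
  the argument, the form in which limits for vanishing \<open>e\<close> and uniform bounds are
  taken.\<close>

lemma conv_on_mollifier:
  fixes v v' :: "'a::euclidean_space \<Rightarrow> real"
  assumes U: "U \<in> sets lebesgue" and v': "v' \<in> borel_measurable borel" "AE x in lebesgue. indicator U x * v x = v' x"
    and e: "e > 0" and vm: "v \<in> borel_measurable (lebesgue_on U)"
  shows "conv_on U (mollifier e) v x = (LINT z|lborel. bump z * v' (x - e *\<^sub>R z))"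
proof -
  have m: "(\<lambda>x. indicator U x *\<^sub>R v x) \<in> borel_measurable lebesgue"
    using vm U by (subst borel_measurable_restrict_space_iff[symmetric]) auto
  have mm: "(\<lambda>y. mollifier e (x - y)) \<in> borel_measurable borel" by measurable
  then have mm': "(\<lambda>y. mollifier e (x - y)) \<in> borel_measurable lebesgue" by (simp add: measurable_completion)
  have vl: "v' \<in> borel_measurable lebesgue" using v'(1) by (simp add: measurable_completion)
  have "conv_on U (mollifier e) v x = (LINT y|lebesgue. indicator U y *\<^sub>R (mollifier e (x - y) * v y))"
    unfolding conv_on_def using U by (subst integral_restrict_space) auto
  also have "\<dots> = (LINT y|lebesgue. mollifier e (x - y) * v' y)"
  proof (rule integral_cong_AE)
    have "(\<lambda>y. mollifier e (x - y) * (indicator U y *\<^sub>R v y)) \<in> borel_measurable lebesgue"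
      using mm' m by measurable
    then show "(\<lambda>y. indicator U y *\<^sub>R (mollifier e (x - y) * v y)) \<in> borel_measurable lebesgue"
      by (simp add: mult_ac)
    show "(\<lambda>y. mollifier e (x - y) * v' y) \<in> borel_measurable lebesgue" using mm' vl by measurable
    show "AE y in lebesgue. indicator U y *\<^sub>R (mollifier e (x - y) * v y) = mollifier e (x - y) * v' y"
      using v'(2) by eventually_elim (simp add: mult_ac)
  qed
  also have "\<dots> = (LINT y|lborel. mollifier e (x - y) * v' y)"
    using v'(1) mm by (intro integral_completion) measurable
  also have "\<dots> = \<bar>- e\<bar> ^ DIM('a) * (LINT z|lborel. mollifier e (x - (x + (- e) *\<^sub>R z)) * v' (x + (- e) *\<^sub>R z))"
  proof (rule integral_lborel_affine)
    show "(\<lambda>y. mollifier e (x - y) * v' y) \<in> borel_measurable borel" using mm v'(1) by measurable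
  qed (use e in simp)
  also have "\<dots> = (LINT z|lborel. \<bar>- e\<bar> ^ DIM('a) * (mollifier e (x - (x + (- e) *\<^sub>R z)) * v' (x + (- e) *\<^sub>R z)))"
    by simp
  also have "\<dots> = (LINT z|lborel. bump z * v' (x - e *\<^sub>R z))"
    by (rule Bochner_Integration.integral_cong[OF refl]) (use e in \<open>simp add: mollifier_def power_inverse flip: mult.assoc\<close>)
  finally show ?thesis .
qed

text \<open>Cauchy-Schwarz against the constant 1 in the probability measure with density
  \<open>bump\<close>. An infinite right-hand side is allowed and trivial.\<close>

lemma bump_jensen:
  fixes h :: "'a::euclidean_space \<Rightarrow> real"
  assumes [measurable]: "h \<in> borel_measurable borel"
  shows "ennreal ((LINT z|lborel. bump z * h z)\<^sup>2) \<le> (\<integral>\<^sup>+z. ennreal (bump z) * ennreal ((h z)\<^sup>2) \<partial>lborel)"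
proof (cases "(\<integral>\<^sup>+z. ennreal (bump z) * ennreal ((h z)\<^sup>2) \<partial>lborel) = \<infinity>")
  case False
  define M where "M = density lborel (\<lambda>z::'a. ennreal (bump z))"
  have mM: "h \<in> borel_measurable M" by (simp add: M_def)
  have "emeasure M (space M) = (\<integral>\<^sup>+z. ennreal (bump (z::'a)) \<partial>lborel)" by (simp add: M_def emeasure_density)
  also have "\<dots> = ennreal 1"
    using nn_integral_eq_integral[OF integrable_bump[where 'a = 'a]] integral_bump[where 'a = 'a] by (simp add: bump_nonneg)
  finally have one: "emeasure M (space M) = 1" by simp
  then have fin: "finite_measure M" by (intro finite_measureI) simp
  have nn: "(\<integral>\<^sup>+z. ennreal ((norm (h z))\<^sup>2) \<partial>M) = (\<integral>\<^sup>+z. ennreal (bump z) * ennreal ((h z)\<^sup>2) \<partial>lborel)"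
    unfolding M_def by (subst nn_integral_density) auto
  then obtain k where k: "0 \<le> k" "(\<integral>\<^sup>+z. ennreal ((norm (h z))\<^sup>2) \<partial>M) = ennreal k"
    using False by (cases "\<integral>\<^sup>+z. ennreal ((norm (h z))\<^sup>2) \<partial>M") auto
  have "(\<integral>\<^sup>+z. ennreal ((norm (h z))\<^sup>2) \<partial>M) \<le> ennreal ((sqrt k)\<^sup>2)" using k by simp
  note hL = L2_norm_le_nn_integral[OF mM this]
  have h2: "h \<in> L2 M" "L2_norm M h \<le> sqrt k" using hL k by auto
  have n1: "L2_norm M (\<lambda>x. 1::real) = 1"
    using one by (simp add: L2_norm_def L2_inner_def measure_def)
  have "(LINT z|lborel. bump z * h z) = L2_inner M h (\<lambda>x. 1)"
    unfolding L2_inner_def M_def by (subst integral_density) (auto simp: bump_nonneg)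
  then have "\<bar>LINT z|lborel. bump z * h z\<bar> \<le> sqrt k"
    using L2_cauchy_schwarz[OF h2(1) L2_const[OF fin, of 1]] n1 h2(2) by simp
  then have "(LINT z|lborel. bump z * h z)\<^sup>2 \<le> k"
    using power_mono[of "\<bar>LINT z|lborel. bump z * h z\<bar>" "sqrt k" 2] k(1) by simp
  moreover have "(\<integral>\<^sup>+z. ennreal (bump z) * ennreal ((h z)\<^sup>2) \<partial>lborel) = ennreal k"
    using nn k(2) by metis
  ultimately show ?thesis using ennreal_leI by presburger
qed simp

text \<open>Jensen in \<open>z\<close>, then for each fixed \<open>z\<close> a change of variables
  in \<open>x\<close>: contraction by \<open>l\<close> costs \<open>1 / l^d\<close>, at most
  \<open>2^d\<close>. What matters is that the constant depends neither on \<open>e\<close> nor on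
  the affine map.\<close>

lemma L2_norm_mollified_le:
  fixes u :: "'a::euclidean_space \<Rightarrow> real"
  assumes u: "u \<in> L2 (lebesgue_on U)" and U: "U \<in> sets lebesgue" and V: "V \<in> sets lebesgue"
    and e: "e > 0" and l: "1/2 \<le> l"
  shows "L2_norm (lebesgue_on V) (\<lambda>x. conv_on U (mollifier e) u (p + l *\<^sub>R x)) \<le> sqrt (2 ^ DIM('a)) * L2_norm (lebesgue_on U) u"
proof -
  obtain u' where [measurable]: "u' \<in> borel_measurable borel" and ae: "AE x in lebesgue. indicator U x * u x = u' x"
    by (rule lebesgue_on_Borel_representative[OF L2_measurable[OF u] U])
  let ?m = "\<lambda>x. LINT z|lborel. bump z * u' (p + l *\<^sub>R x - e *\<^sub>R z)"
  have eq: "conv_on U (mollifier e) u (p + l *\<^sub>R x) = ?m x" for x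
    by (rule conv_on_mollifier[OF U _ ae e L2_measurable[OF u]]) measurable
  have u'nn: "(\<integral>\<^sup>+x. ennreal ((u' x)\<^sup>2) \<partial>lborel) = ennreal ((L2_norm (lebesgue_on U) u)\<^sup>2)"
  proof -
    have iU: "integrable lebesgue (\<lambda>x. indicator U x *\<^sub>R (norm (u x))\<^sup>2)"
      using L2_integrable_square[OF u] U by (subst (asm) integrable_restrict_space) auto
    have "(\<integral>\<^sup>+x. ennreal ((u' x)\<^sup>2) \<partial>lborel) = (\<integral>\<^sup>+x. ennreal ((u' x)\<^sup>2) \<partial>lebesgue)"
      by (rule nn_integral_completion[symmetric]) measurable
    also have "\<dots> = (\<integral>\<^sup>+x. ennreal (indicator U x *\<^sub>R (norm (u x))\<^sup>2) \<partial>lebesgue)"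
      by (rule nn_integral_cong_AE, use ae in eventually_elim) (auto simp: indicator_def split: if_splits)
    also have "\<dots> = ennreal (LINT x|lebesgue. indicator U x *\<^sub>R (norm (u x))\<^sup>2)"
      by (rule nn_integral_eq_integral[OF iU]) auto
    also have "(LINT x|lebesgue. indicator U x *\<^sub>R (norm (u x))\<^sup>2) = (L2_norm (lebesgue_on U) u)\<^sup>2"
      unfolding L2_norm_square_integral using U by (subst integral_restrict_space) auto
    finally show ?thesis .
  qed
  have mB: "?m \<in> borel_measurable borel" by measurable
  have "(\<integral>\<^sup>+x. ennreal ((?m x)\<^sup>2) \<partial>lborel) \<le> (\<integral>\<^sup>+x. (\<integral>\<^sup>+z. ennreal (bump z) * ennreal ((u' (p + l *\<^sub>R x - e *\<^sub>R z))\<^sup>2) \<partial>lborel) \<partial>lborel)"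
    by (intro nn_integral_mono bump_jensen) measurable
  also have "\<dots> = (\<integral>\<^sup>+z. (\<integral>\<^sup>+x. ennreal (bump z) * ennreal ((u' (p + l *\<^sub>R x - e *\<^sub>R z))\<^sup>2) \<partial>lborel) \<partial>lborel)"
    by (rule lborel_pair.Fubini') measurable
  also have "\<dots> \<le> (\<integral>\<^sup>+z. ennreal (bump (z::'a)) * (ennreal (2 ^ DIM('a)) * ennreal ((L2_norm (lebesgue_on U) u)\<^sup>2)) \<partial>lborel)"
  proof (rule nn_integral_mono)
    fix z
    let ?I = "\<integral>\<^sup>+x. ennreal ((u' ((p - e *\<^sub>R z) + l *\<^sub>R x))\<^sup>2) \<partial>lborel"
    have "1 \<le> (2 * l) ^ DIM('a)" using l by (intro one_le_power) auto
    then have "ennreal 1 \<le> ennreal ((2 * l) ^ DIM('a))" by (rule ennreal_leI)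
    then have "1 * ?I \<le> ennreal ((2 * l) ^ DIM('a)) * ?I"
      by (intro mult_right_mono) auto
    also have "\<dots> = ennreal (2 ^ DIM('a)) * (ennreal (l ^ DIM('a)) * ?I)"
      using l by (simp add: power_mult_distrib ennreal_mult mult.assoc)
    also have "ennreal (l ^ DIM('a)) * ?I = (\<integral>\<^sup>+x. ennreal ((u' x)\<^sup>2) \<partial>lborel)"
      by (rule nn_integral_lborel_affine[symmetric, where f = "\<lambda>x. ennreal ((u' x)\<^sup>2)"]) (use l in auto)
    finally have I: "?I \<le> ennreal (2 ^ DIM('a)) * ennreal ((L2_norm (lebesgue_on U) u)\<^sup>2)" by (simp add: u'nn)
    have "(\<integral>\<^sup>+x. ennreal (bump z) * ennreal ((u' (p + l *\<^sub>R x - e *\<^sub>R z))\<^sup>2) \<partial>lborel) = ennreal (bump z) * ?I"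
      by (subst nn_integral_cmult[symmetric]) (auto simp: algebra_simps)
    then show "(\<integral>\<^sup>+x. ennreal (bump z) * ennreal ((u' (p + l *\<^sub>R x - e *\<^sub>R z))\<^sup>2) \<partial>lborel)
       \<le> ennreal (bump z) * (ennreal (2 ^ DIM('a)) * ennreal ((L2_norm (lebesgue_on U) u)\<^sup>2))"
      using I by (simp add: mult_left_mono)
  qed
  also have "\<dots> = (\<integral>\<^sup>+z. ennreal (bump (z::'a)) \<partial>lborel) * (ennreal (2 ^ DIM('a)) * ennreal ((L2_norm (lebesgue_on U) u)\<^sup>2))"
    by (rule nn_integral_multc) measurable
  also have "(\<integral>\<^sup>+z. ennreal (bump (z::'a)) \<partial>lborel) = ennreal 1"
    using nn_integral_eq_integral[OF integrable_bump[where 'a = 'a]] integral_bump[where 'a = 'a] by (simp add: bump_nonneg)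
  finally have b1: "(\<integral>\<^sup>+x. ennreal ((?m x)\<^sup>2) \<partial>lborel) \<le> ennreal (2 ^ DIM('a)) * ennreal ((L2_norm (lebesgue_on U) u)\<^sup>2)" by simp
  have "(\<integral>\<^sup>+x. ennreal ((norm (?m x))\<^sup>2) \<partial>lebesgue_on V) = (\<integral>\<^sup>+x. ennreal ((norm (?m x))\<^sup>2) * indicator V x \<partial>lebesgue)"
    using V by (intro nn_integral_restrict_space) auto
  also have "\<dots> \<le> (\<integral>\<^sup>+x. ennreal ((?m x)\<^sup>2) \<partial>lebesgue)"
    by (intro nn_integral_mono) (auto simp: indicator_def)
  also have "\<dots> = (\<integral>\<^sup>+x. ennreal ((?m x)\<^sup>2) \<partial>lborel)"
    using mB by (intro nn_integral_completion) measurable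
  also have "\<dots> \<le> ennreal ((sqrt (2 ^ DIM('a)) * L2_norm (lebesgue_on U) u)\<^sup>2)"
    using b1 by (simp add: power_mult_distrib ennreal_mult)
  finally have b2: "(\<integral>\<^sup>+x. ennreal ((norm (?m x))\<^sup>2) \<partial>lebesgue_on V) \<le> ennreal ((sqrt (2 ^ DIM('a)) * L2_norm (lebesgue_on U) u)\<^sup>2)" .
  have "?m \<in> borel_measurable lebesgue" using mB by (simp add: measurable_completion)
  then have "?m \<in> borel_measurable (lebesgue_on V)" by (rule measurable_restrict_space1)
  from L2_norm_le_nn_integral(2)[OF this b2]
  show ?thesis unfolding eq by simp
qed

lemma open_imp_lebesgue: "open (U :: 'a::euclidean_space set) \<Longrightarrow> U \<in> sets lebesgue"
  by (rule sets_completionI_sets) simp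

text \<open>A uniform operator bound reduces convergence to bounded continuous functions, for which
  it is pointwise and dominated. The affine maps are carried along because mollifications will be
  evaluated at contracted points; with identity maps this is ordinary mollification on a smaller
  set.\<close>

lemma mollified_tendsto:
  fixes v :: "'a::euclidean_space \<Rightarrow> real"
  assumes U: "open U" "bounded U" and V: "V \<in> sets lebesgue" "V \<subseteq> U"
    and v: "v \<in> L2 (lebesgue_on U)"
    and e: "\<And>n. 0 < e n" "e \<longlonglongrightarrow> 0" and l: "\<And>n. 1/2 \<le> l n"
    and lim: "\<And>x. (\<lambda>n. p n + l n *\<^sub>R x) \<longlonglongrightarrow> x"
    and sub: "\<And>n x. x \<in> V \<Longrightarrow> cball (p n + l n *\<^sub>R x) (e n) \<subseteq> U"
  shows "(\<lambda>n. L2_norm (lebesgue_on V) (\<lambda>x. conv_on U (mollifier (e n)) v (p n + l n *\<^sub>R x) - v x)) \<longlonglongrightarrow> 0"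
    and "(\<lambda>x. conv_on U (mollifier (e n)) v (p n + l n *\<^sub>R x)) \<in> L2 (lebesgue_on V)"
proof -
  let ?M = "lebesgue_on V"
  have Um: "U \<in> sets lebesgue" using U(1) by (rule open_imp_lebesgue)
  have Vb: "bounded V" using U(2) V(2) bounded_subset by blast
  note finU = bounded_lebesgue_finite_measure[OF U(2) Um]
  have pc: "continuous_on UNIV (\<lambda>x. conv_on U (mollifier (e n)) w (p n + l n *\<^sub>R x))" if "integrable (lebesgue_on U) w" for w n
    by (intro smooth_continuous smooth_compose_affine smooth_conv_on[OF that smooth_mollifier mollifier_outside[OF e(1)]])
  have pL: "(\<lambda>x. conv_on U (mollifier (e n)) w (p n + l n *\<^sub>R x)) \<in> L2 ?M" if "integrable (lebesgue_on U) w" for w n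
    by (rule L2_continuous_bounded_domain[OF pc[OF that] Vb V(1)])
  note vi = L2_integrable[OF finU v]
  show "(\<lambda>x. conv_on U (mollifier (e n)) v (p n + l n *\<^sub>R x)) \<in> L2 ?M" by (rule pL[OF vi])
  let ?c = "sqrt (2 ^ DIM('a))"
  have c1: "1 \<le> ?c" by simp
  show "(\<lambda>n. L2_norm ?M (\<lambda>x. conv_on U (mollifier (e n)) v (p n + l n *\<^sub>R x) - v x)) \<longlonglongrightarrow> 0"
  proof (rule LIMSEQ_I)
    fix \<eta> :: real assume \<eta>: "0 < \<eta>"
    \<comment> \<open>The factor \<open>?c\<close> absorbs the operator bound; three errors of size
      \<open>\<eta> / 4\<close> stay below \<open>\<eta>\<close>.\<close>
    then have \<eta>': "0 < \<eta> / (4 * ?c)" by simp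
    obtain w B where wc: "continuous_on UNIV w" and wB: "\<And>x. \<bar>w x\<bar> \<le> B"
      and vw: "L2_norm (lebesgue_on U) (\<lambda>x. v x - w x) < \<eta> / (4 * ?c)"
      using L2_approx_bounded_continuous[OF U(2) Um v \<eta>'] by blast
    have wL: "w \<in> L2 (lebesgue_on U)" by (rule L2_continuous_bounded_domain[OF wc U(2) Um])
    note wi = L2_integrable[OF finU wL]
    have wb: "w \<in> borel_measurable borel" by (rule borel_measurable_continuous_onI[OF wc])
    have dL: "(\<lambda>x. v x - w x) \<in> L2 (lebesgue_on U)" by (rule L2_diff[OF v wL])
    note di = L2_integrable[OF finU dL]
    define W where "W = (\<lambda>n x. LINT z|lborel. bump z * w (p n + l n *\<^sub>R x - e n *\<^sub>R z))"
    have Weq: "conv_on U (mollifier (e n)) w (p n + l n *\<^sub>R x) = W n x" if x: "x \<in> V" for n x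
    proof -
      have m: "(\<lambda>x. indicator U x * w x) \<in> borel_measurable borel"
        using wb U(1) by (intro borel_measurable_times borel_measurable_indicator) auto
      have "conv_on U (mollifier (e n)) w (p n + l n *\<^sub>R x)
         = (LINT z|lborel. bump z * (indicator U (p n + l n *\<^sub>R x - e n *\<^sub>R z) * w (p n + l n *\<^sub>R x - e n *\<^sub>R z)))"
        by (rule conv_on_mollifier[OF Um m _ e(1) L2_measurable[OF wL]]) simp
      \<comment> \<open>On the support of \<open>bump\<close> the shifted point stays in
        \<open>U\<close>, so the cut-off by \<open>U\<close> is invisible.\<close>
      also have "\<dots> = W n x"
        unfolding W_def
      proof (rule Bochner_Integration.integral_cong[OF refl])
        fix z
        show "bump z * (indicator U (p n + l n *\<^sub>R x - e n *\<^sub>R z) * w (p n + l n *\<^sub>R x - e n *\<^sub>R z)) = bump z * w (p n + l n *\<^sub>R x - e n *\<^sub>R z)"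
        proof (cases "1 < norm z")
          case False
          then have "p n + l n *\<^sub>R x - e n *\<^sub>R z \<in> cball (p n + l n *\<^sub>R x) (e n)"
            using e(1)[of n] by (simp add: dist_norm)
          then have "p n + l n *\<^sub>R x - e n *\<^sub>R z \<in> U" using sub[OF x] by blast
          then show ?thesis by simp
        qed (simp add: bump_outside)
      qed
      finally show ?thesis .
    qed
    have "(\<lambda>n. L2_norm ?M (\<lambda>x. conv_on U (mollifier (e n)) w (p n + l n *\<^sub>R x) - w x)) \<longlonglongrightarrow> 0"
    proof (rule L2_norm_tendsto_dominated)
      show "(\<lambda>x. conv_on U (mollifier (e n)) w (p n + l n *\<^sub>R x) - w x) \<in> borel_measurable ?M" for n
        by (intro continuous_lebesgue_on_measurable continuous_intros pc[OF wi] wc)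
      show "integrable ?M (\<lambda>x. (2 * B)\<^sup>2)"
        using finite_measure.integrable_const[OF bounded_lebesgue_finite_measure[OF Vb V(1)]] .
      have bW: "\<bar>W n x\<bar> \<le> B" for n x
      proof -
        have "norm (W n x) \<le> (LINT z|lborel. norm (bump z * w (p n + l n *\<^sub>R x - e n *\<^sub>R z)))"
          unfolding W_def by (rule integral_norm_bound)
        also have "\<dots> \<le> (LINT z|lborel. bump (z::'a) * B)"
        proof (rule integral_mono)
          show I2: "integrable lborel (\<lambda>z::'a. bump z * B)" using integrable_bump by (rule integrable_mult_left)
          have le: "norm (bump z * w (p n + l n *\<^sub>R x - e n *\<^sub>R z)) \<le> bump z * B" for z
            using wB bump_nonneg[of z] by (simp add: abs_mult mult_left_mono)
          then show "norm (bump z * w (p n + l n *\<^sub>R x - e n *\<^sub>R z)) \<le> bump z * B" for z .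
          have mz: "(\<lambda>z. norm (bump z * w (p n + l n *\<^sub>R x - e n *\<^sub>R z))) \<in> borel_measurable lborel"
            using wb by measurable
          show "integrable lborel (\<lambda>z. norm (bump z * w (p n + l n *\<^sub>R x - e n *\<^sub>R z)))"
            by (rule Bochner_Integration.integrable_bound[OF I2 mz])
              (use le order_trans[OF le abs_ge_self] in \<open>auto intro!: AE_I2\<close>)
        qed
        also have "\<dots> = B" using integral_bump[where 'a = 'a] by simp
        finally show ?thesis by simp
      qed
      show "AE x in ?M. (norm (conv_on U (mollifier (e n)) w (p n + l n *\<^sub>R x) - w x))\<^sup>2 \<le> (2 * B)\<^sup>2" for n
      proof (intro AE_I2 power_mono)
        fix x assume "x \<in> space ?M"
        then show "norm (conv_on U (mollifier (e n)) w (p n + l n *\<^sub>R x) - w x) \<le> 2 * B"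
          using Weq[of x n] bW[of n x] wB[of x] by simp
      qed simp
      show "AE x in ?M. (\<lambda>n. conv_on U (mollifier (e n)) w (p n + l n *\<^sub>R x) - w x) \<longlonglongrightarrow> 0"
      proof (rule AE_I2)
        fix x assume x: "x \<in> space ?M"
        have "(\<lambda>n. W n x) \<longlonglongrightarrow> (LINT z|lborel. bump (z::'a) * w x)"
          unfolding W_def
        proof (rule integral_dominated_convergence[where w = "\<lambda>z. bump z * B"])
          show "integrable lborel (\<lambda>z::'a. bump z * B)" using integrable_bump by (rule integrable_mult_left)
          show "(\<lambda>z. bump z * w x) \<in> borel_measurable lborel" by measurable
          show "(\<lambda>z. bump z * w (p n + l n *\<^sub>R x - e n *\<^sub>R z)) \<in> borel_measurable lborel" for n
            using wb by measurable
          show "AE z in lborel. norm (bump z * w (p n + l n *\<^sub>R x - e n *\<^sub>R z)) \<le> bump z * B" for n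
            using wB by (intro AE_I2) (simp add: abs_mult abs_of_nonneg[OF bump_nonneg] mult_left_mono bump_nonneg)
          show "AE z in lborel. (\<lambda>n. bump z * w (p n + l n *\<^sub>R x - e n *\<^sub>R z)) \<longlonglongrightarrow> bump z * w x"
          proof (rule AE_I2)
            fix z
            have "(\<lambda>n. p n + l n *\<^sub>R x - e n *\<^sub>R z) \<longlonglongrightarrow> x - 0 *\<^sub>R z"
              by (intro tendsto_intros lim e)
            then have "(\<lambda>n. w (p n + l n *\<^sub>R x - e n *\<^sub>R z)) \<longlonglongrightarrow> w x"
              by (intro continuous_on_tendsto_compose[OF wc]) auto
            then show "(\<lambda>n. bump z * w (p n + l n *\<^sub>R x - e n *\<^sub>R z)) \<longlonglongrightarrow> bump z * w x"
              by (intro tendsto_intros)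
          qed
        qed
        then have "(\<lambda>n. W n x - w x) \<longlonglongrightarrow> w x - w x"
          using integral_bump[where 'a = 'a] by (intro tendsto_intros) simp
        then show "(\<lambda>n. conv_on U (mollifier (e n)) w (p n + l n *\<^sub>R x) - w x) \<longlonglongrightarrow> 0"
          using Weq[of x] x by simp
      qed
    qed
    then have "\<exists>no. \<forall>n\<ge>no. norm (L2_norm ?M (\<lambda>x. conv_on U (mollifier (e n)) w (p n + l n *\<^sub>R x) - w x) - 0) < \<eta> / 4"
      by (rule LIMSEQ_D) (use \<eta> in simp)
    then obtain N where N: "\<And>n. n \<ge> N \<Longrightarrow> norm (L2_norm ?M (\<lambda>x. conv_on U (mollifier (e n)) w (p n + l n *\<^sub>R x) - w x) - 0) < \<eta> / 4"
      by (elim exE) (rule that, elim allE impE, assumption+)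
    show "\<exists>no. \<forall>n\<ge>no. norm (L2_norm ?M (\<lambda>x. conv_on U (mollifier (e n)) v (p n + l n *\<^sub>R x) - v x) - 0) < \<eta>"
    proof (intro exI[of _ N] allI impI)
      fix n assume n: "n \<ge> N"
      let ?A = "\<lambda>x. p n + l n *\<^sub>R x"
      let ?K = "conv_on U (mollifier (e n))"
      have lin: "?K (\<lambda>x. v x - w x) y = ?K v y - ?K w y" for y
        unfolding conv_on_def
        using conv_on_integrable[OF vi smooth_continuous[OF smooth_mollifier] mollifier_outside[OF e(1)]]
          conv_on_integrable[OF wi smooth_continuous[OF smooth_mollifier] mollifier_outside[OF e(1)]]
        by (simp add: right_diff_distrib)
      have vV: "v \<in> L2 ?M" "w \<in> L2 ?M" using L2_lebesgue_on_subset(1)[OF _ V(2) Um V(1)] v wL by auto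
      have "L2_norm ?M (\<lambda>x. ?K v (?A x) - v x)
         = L2_norm ?M (\<lambda>x. (?K (\<lambda>x. v x - w x) (?A x) + (?K w (?A x) - w x)) + - (v x - w x))"
        by (simp add: lin)
      also have "\<dots> \<le> L2_norm ?M (\<lambda>x. ?K (\<lambda>x. v x - w x) (?A x) + (?K w (?A x) - w x)) + L2_norm ?M (\<lambda>x. - (v x - w x))"
        by (intro L2_norm_triangle L2_add L2_minus L2_diff pL di wi vV)
      also have "\<dots> \<le> (L2_norm ?M (\<lambda>x. ?K (\<lambda>x. v x - w x) (?A x)) + L2_norm ?M (\<lambda>x. ?K w (?A x) - w x)) + L2_norm ?M (\<lambda>x. v x - w x)"
        unfolding L2_norm_minus
        by (intro add_right_mono L2_norm_triangle L2_add L2_minus L2_diff pL di wi vV)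
      also have "\<dots> < (\<eta> / 4 + \<eta> / 4) + \<eta> / 4"
      proof (intro add_strict_mono)
        have "L2_norm ?M (\<lambda>x. ?K (\<lambda>x. v x - w x) (?A x)) \<le> ?c * L2_norm (lebesgue_on U) (\<lambda>x. v x - w x)"
          by (rule L2_norm_mollified_le[OF dL Um V(1) e(1) l])
        also have "\<dots> < ?c * (\<eta> / (4 * ?c))" using vw c1 by (intro mult_strict_left_mono) auto
        also have "\<dots> = \<eta> / 4" by simp
        finally show "L2_norm ?M (\<lambda>x. ?K (\<lambda>x. v x - w x) (?A x)) < \<eta> / 4" .
        show "L2_norm ?M (\<lambda>x. ?K w (?A x) - w x) < \<eta> / 4" using N[OF n] by simp
        have "L2_norm ?M (\<lambda>x. v x - w x) \<le> L2_norm (lebesgue_on U) (\<lambda>x. v x - w x)"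
          by (rule L2_lebesgue_on_subset(2)[OF dL V(2) Um V(1)])
        also have "\<dots> < \<eta> / (4 * ?c)" by (rule vw)
        also have "\<dots> \<le> \<eta> / (4 * 1)" using c1 \<eta> by (intro divide_left_mono) auto
        finally show "L2_norm ?M (\<lambda>x. v x - w x) < \<eta> / 4" by simp
      qed
      finally show "norm (L2_norm ?M (\<lambda>x. ?K v (?A x) - v x) - 0) < \<eta>" using \<eta> by simp
    qed
  qed
qed

subsection \<open>Uniqueness of weak derivatives\<close>

lemma compact_subset_open_cball:
  fixes K :: "'a::euclidean_space set"
  assumes "compact K" "open U" "K \<subseteq> U"
  obtains d where "d > 0" "\<And>x. x \<in> K \<Longrightarrow> cball x d \<subseteq> U"
proof -
  obtain d where d: "d > 0" "(\<Union>x\<in>K. cball x d) \<subseteq> U"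
    using compact_subset_open_imp_cball_epsilon_subset[OF assms] by blast
  then show thesis using that by blast
qed

text \<open>On a box inside \<open>U\<close> the mollifications of \<open>g\<close> with small
  radius vanish, because their kernels are test functions, and they converge to \<open>g\<close>.
  Countably many boxes exhaust \<open>U\<close>.\<close>

lemma test_orthogonal_imp_AE_zero:
  fixes g :: "'a::euclidean_space \<Rightarrow> real"
  assumes U: "open U" "bounded U" and g: "g \<in> L2 (lebesgue_on U)"
    and orth: "\<And>\<phi>. test_function U \<phi> \<Longrightarrow> (LINT x|lebesgue_on U. g x * \<phi> x) = 0"
  shows "AE x in lebesgue_on U. g x = 0"
proof -
  have Um: "U \<in> sets lebesgue" using U(1) by (rule open_imp_lebesgue)
  have box: "AE x in lebesgue. x \<in> cbox a b \<longrightarrow> g x = 0" if ab: "cbox a b \<subseteq> U" for a b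
  proof -
    obtain d where d: "d > 0" "\<And>x. x \<in> cbox a b \<Longrightarrow> cball x d \<subseteq> U"
      by (rule compact_subset_open_cball[OF compact_cbox U(1) ab]) (rule that, assumption+)
    define e where "e = (\<lambda>n. d * inverse (real (Suc n)))"
    have e0: "0 < e n" for n using d by (simp add: e_def)
    have el: "e \<longlonglongrightarrow> 0" unfolding e_def using tendsto_mult_left[OF LIMSEQ_inverse_real_of_nat, of d] by simp
    have ed: "e n \<le> d" for n using d by (simp add: e_def field_simps)
    have Vm: "cbox a b \<in> sets lebesgue" by simp
    have "(\<lambda>n. L2_norm (lebesgue_on (cbox a b)) (\<lambda>x. conv_on U (mollifier (e n)) g (0 + 1 *\<^sub>R x) - g x)) \<longlonglongrightarrow> 0"
    proof (rule mollified_tendsto(1)[OF U Vm ab g e0 el])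
      show "cball (0 + 1 *\<^sub>R x) (e n) \<subseteq> U" if "x \<in> cbox a b" for n x
        using d(2)[OF that] ed[of n] by auto
    qed auto
    moreover have "L2_norm (lebesgue_on (cbox a b)) (\<lambda>x. conv_on U (mollifier (e n)) g (0 + 1 *\<^sub>R x) - g x) = L2_norm (lebesgue_on (cbox a b)) g" for n
    proof -
      have "conv_on U (mollifier (e n)) g x = 0" if "x \<in> cbox a b" for x
      proof -
        have "cball x (e n) \<subseteq> U" using d(2)[OF that] ed[of n] by auto
        from orth[OF test_function_mollifier[OF e0 this]] show ?thesis by (simp add: conv_on_def mult.commute)
      qed
      then have "L2_norm (lebesgue_on (cbox a b)) (\<lambda>x. conv_on U (mollifier (e n)) g (0 + 1 *\<^sub>R x) - g x) = L2_norm (lebesgue_on (cbox a b)) (\<lambda>x. - g x)"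
        unfolding L2_norm_def L2_inner_def
        by (intro arg_cong[where f = sqrt] Bochner_Integration.integral_cong[OF refl]) simp
      then show ?thesis by (simp add: L2_norm_minus)
    qed
    ultimately have "L2_norm (lebesgue_on (cbox a b)) g = 0"
      using LIMSEQ_unique[OF tendsto_const] by simp
    then have "AE x in lebesgue_on (cbox a b). g x = 0"
      using L2_norm_eq_0_imp_AE[OF L2_lebesgue_on_subset(1)[OF g ab Um Vm]] by blast
    then show ?thesis by (simp add: AE_restrict_space_iff)
  qed
  obtain \<D> where D: "countable \<D>" "\<D> \<subseteq> Pow U" "\<And>X. X \<in> \<D> \<Longrightarrow> \<exists>a b. X = cbox a b" "\<Union>\<D> = U"
    by (rule open_countable_Union_open_cbox[OF U(1)]) blast
  have "AE x in lebesgue. \<forall>X\<in>\<D>. x \<in> X \<longrightarrow> g x = 0"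
    unfolding AE_ball_countable[OF D(1)]
  proof
    fix X assume X: "X \<in> \<D>"
    then obtain a b where "X = cbox a b" using D(3) by blast
    then show "AE x in lebesgue. x \<in> X \<longrightarrow> g x = 0" using box[of a b] D(2) X by blast
  qed
  then have "AE x in lebesgue. x \<in> U \<longrightarrow> g x = 0"
    by (rule eventually_mono) (use D(4) in blast)
  then show ?thesis using Um by (subst AE_restrict_space_iff) auto
qed

lemma test_function_L2:
  assumes "test_function U \<phi>" "bounded V" "V \<in> sets lebesgue"
  shows "\<phi> \<in> L2 (lebesgue_on V)"
  using assms L2_continuous_bounded_domain smooth_continuous unfolding test_function_def by blast

text \<open>Makes the choice in \<open>grad\<close> immaterial up to null sets; the difference is
  tested one coordinate at a time.\<close>

lemma weak_gradient_unique:
  fixes g g' :: "'a::euclidean_space \<Rightarrow> 'a"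
  assumes U: "open U" "bounded U" and g: "g \<in> L2 (lebesgue_on U)" "g' \<in> L2 (lebesgue_on U)"
    and wg: "weak_gradient U v g" "weak_gradient U v g'"
  shows "AE x in lebesgue_on U. g x = g' x"
proof -
  have Um: "U \<in> sets lebesgue" using U(1) by (rule open_imp_lebesgue)
  have "AE x in lebesgue_on U. \<forall>b\<in>Basis. (g x - g' x) \<bullet> b = 0"
    unfolding AE_finite_all[OF finite_Basis]
  proof
    fix b :: 'a assume b: "b \<in> Basis"
    show "AE x in lebesgue_on U. (g x - g' x) \<bullet> b = 0"
    proof (rule test_orthogonal_imp_AE_zero[OF U])
      show "(\<lambda>x. (g x - g' x) \<bullet> b) \<in> L2 (lebesgue_on U)" by (intro L2_component L2_diff g)
      fix \<phi> assume phi: "test_function U \<phi>"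
      have pL: "\<phi> \<in> L2 (lebesgue_on U)" by (rule test_function_L2[OF phi U(2) Um])
      have "(LINT x|lebesgue_on U. ((g x - g' x) \<bullet> b) * \<phi> x) = (LINT x|lebesgue_on U. (g x \<bullet> b) * \<phi> x) - (LINT x|lebesgue_on U. (g' x \<bullet> b) * \<phi> x)"
        using L2_mult_integrable[OF L2_component[OF g(1)] pL] L2_mult_integrable[OF L2_component[OF g(2)] pL]
        by (simp add: inner_diff_left left_diff_distrib)
      then show "(LINT x|lebesgue_on U. ((g x - g' x) \<bullet> b) * \<phi> x) = 0"
        using wg phi b unfolding weak_gradient_def by fastforce
    qed
  qed
  then show ?thesis
    by (rule eventually_mono) (metis euclidean_eqI inner_diff_left right_minus_eq)
qed

lemma weak_divergence_unique:
  fixes w w' :: "'a::euclidean_space \<Rightarrow> real"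
  assumes U: "open U" "bounded U" and w: "w \<in> L2 (lebesgue_on U)" "w' \<in> L2 (lebesgue_on U)"
    and wd: "weak_divergence U r w" "weak_divergence U r w'"
  shows "AE x in lebesgue_on U. w x = w' x"
proof -
  have Um: "U \<in> sets lebesgue" using U(1) by (rule open_imp_lebesgue)
  have "AE x in lebesgue_on U. w x - w' x = 0"
  proof (rule test_orthogonal_imp_AE_zero[OF U])
    show "(\<lambda>x. w x - w' x) \<in> L2 (lebesgue_on U)" by (intro L2_diff w)
    fix \<phi> assume phi: "test_function U \<phi>"
    have pL: "\<phi> \<in> L2 (lebesgue_on U)" by (rule test_function_L2[OF phi U(2) Um])
    have "(LINT x|lebesgue_on U. (w x - w' x) * \<phi> x) = (LINT x|lebesgue_on U. w x * \<phi> x) - (LINT x|lebesgue_on U. w' x * \<phi> x)"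
      using L2_mult_integrable[OF w(1) pL] L2_mult_integrable[OF w(2) pL] by (simp add: left_diff_distrib)
    then show "(LINT x|lebesgue_on U. (w x - w' x) * \<phi> x) = 0"
      using wd phi unfolding weak_divergence_def by fastforce
  qed
  then show ?thesis by simp
qed

subsection \<open>Density of smooth functions\<close>

text \<open>The approximants are mollifications of \<open>v\<close> evaluated at
  \<open>x0 + l (x - x0)\<close>. By star-shapedness the contracted closure of \<open>U\<close> is a
  compact subset of \<open>U\<close>, which leaves room for a positive mollification radius. The
  gradient acquires a factor \<open>l n\<close>, which tends to 1.\<close>

lemma H1_smooth_approximation:
  fixes v :: "'a::euclidean_space \<Rightarrow> real" and g :: "'a \<Rightarrow> 'a"
  assumes U: "open U" "bounded U"
    and star: "\<And>t x. 0 < t \<Longrightarrow> t < 1 \<Longrightarrow> x \<in> closure U \<Longrightarrow> x0 + t *\<^sub>R (x - x0) \<in> U"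
    and v: "v \<in> L2 (lebesgue_on U)" and g: "g \<in> L2 (lebesgue_on U)" and wg: "weak_gradient U v g"
  obtains \<phi> :: "nat \<Rightarrow> 'a \<Rightarrow> real" where "\<And>n. smooth (\<phi> n)"
    "(\<lambda>n. L2_norm (lebesgue_on U) (\<lambda>x. \<phi> n x - v x)) \<longlonglongrightarrow> 0"
    "(\<lambda>n. L2_norm (lebesgue_on U) (\<lambda>x. gradient (\<phi> n) x - g x)) \<longlonglongrightarrow> 0"
proof -
  let ?M = "lebesgue_on U"
  have Um: "U \<in> sets lebesgue" using U(1) by (rule open_imp_lebesgue)
  note finU = bounded_lebesgue_finite_measure[OF U(2) Um]
  \<comment> \<open>Starting at \<open>n + 2\<close> gives \<open>l 0 = 1/2\<close>, the lower bound
    under which the mollification estimate is uniform.\<close>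
  define l where "l = (\<lambda>n. 1 - inverse (real (Suc (Suc n))))"
  define p where "p = (\<lambda>n. x0 - l n *\<^sub>R x0)"
  have l1: "1/2 \<le> l n" "0 < l n" "l n < 1" for n by (auto simp: l_def field_simps)
  have ll: "l \<longlonglongrightarrow> 1"
  proof -
    have "(\<lambda>n. inverse (real (Suc (Suc n)))) \<longlonglongrightarrow> 0"
      using LIMSEQ_Suc[OF LIMSEQ_inverse_real_of_nat] by simp
    from tendsto_diff[OF tendsto_const[of 1] this] show ?thesis by (simp add: l_def)
  qed
  have A: "p n + l n *\<^sub>R x = x0 + l n *\<^sub>R (x - x0)" for n x by (simp add: p_def algebra_simps)
  have lim: "(\<lambda>n. p n + l n *\<^sub>R x) \<longlonglongrightarrow> x" for x
  proof -
    have "(\<lambda>n. x0 + l n *\<^sub>R (x - x0)) \<longlonglongrightarrow> x0 + 1 *\<^sub>R (x - x0)" by (intro tendsto_intros ll)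
    then show ?thesis by (simp add: A)
  qed
  have "\<exists>d>0. \<forall>x\<in>U. cball (p n + l n *\<^sub>R x) d \<subseteq> U" for n
  proof -
    have cK: "compact ((\<lambda>x. p n + l n *\<^sub>R x) ` closure U)"
      by (intro compact_continuous_image continuous_intros) (use U(2) in \<open>simp add: compact_closure\<close>)
    have "(\<lambda>x. p n + l n *\<^sub>R x) ` closure U \<subseteq> U"
      unfolding A using star[OF l1(2,3)] by blast
    then obtain d where "d > 0" "\<And>x. x \<in> (\<lambda>x. p n + l n *\<^sub>R x) ` closure U \<Longrightarrow> cball x d \<subseteq> U"
      using compact_subset_open_cball[OF cK U(1)] by metis
    then show ?thesis using closure_subset by blast
  qed
  then obtain d where d: "\<And>n. d n > 0" "\<And>n x. x \<in> U \<Longrightarrow> cball (p n + l n *\<^sub>R x) (d n) \<subseteq> U" by metis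
  \<comment> \<open>Small enough for the room \<open>d n\<close>, and forced to tend to 0, since
    \<open>d n\<close> is only known to be positive.\<close>
  define e where "e = (\<lambda>n. min (d n) (inverse (real (Suc n))))"
  have e0: "0 < e n" for n using d by (simp add: e_def)
  have el: "e \<longlonglongrightarrow> 0"
  proof (rule tendsto_sandwich[OF _ _ tendsto_const LIMSEQ_inverse_real_of_nat])
    show "\<forall>\<^sub>F n in sequentially. 0 \<le> e n" using e0 by (intro always_eventually allI less_imp_le)
    show "\<forall>\<^sub>F n in sequentially. e n \<le> inverse (real (Suc n))" by (simp add: e_def)
  qed
  have sub: "cball (p n + l n *\<^sub>R x) (e n) \<subseteq> U" if "x \<in> U" for n x
    using d(2)[OF that, of n] by (auto simp: e_def)
  note vi = L2_integrable[OF finU v]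
  define C where "C = (\<lambda>n. conv_on U (mollifier (e n)) v)"
  define \<phi> where "\<phi> = (\<lambda>n x. C n (p n + l n *\<^sub>R x))"
  have smC: "smooth (C n)" for n
    unfolding C_def by (rule smooth_conv_on[OF vi smooth_mollifier mollifier_outside[OF e0]])
  have sm: "smooth (\<phi> n)" for n unfolding \<phi>_def by (intro smooth_compose_affine smC)
  have gphi: "gradient (\<phi> n) x = l n *\<^sub>R gradient (C n) (p n + l n *\<^sub>R x)" for n x
  proof (rule gradient_eqI)
    have "((\<lambda>x. p n + l n *\<^sub>R x) has_derivative (\<lambda>h. l n *\<^sub>R h)) (at x)" by (auto intro!: derivative_eq_intros)
    from has_derivative_compose[OF this C1_has_derivative[OF smooth_imp_C1[OF smC]]]
    show "(\<phi> n has_derivative (\<lambda>h. (l n *\<^sub>R gradient (C n) (p n + l n *\<^sub>R x)) \<bullet> h)) (at x)"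
      by (simp add: \<phi>_def)
  qed
  note mt = mollified_tendsto[OF U Um order_refl _ e0 el l1(1) lim sub]
  have c1: "(\<lambda>n. L2_norm ?M (\<lambda>x. \<phi> n x - v x)) \<longlonglongrightarrow> 0"
    unfolding \<phi>_def C_def by (rule mt(1)[OF v])
  have pgL: "gradient (\<phi> n) \<in> L2 ?M" for n
    by (rule L2_continuous_bounded_domain[OF C1_continuous_gradient[OF smooth_imp_C1[OF sm]] U(2) Um])
  have comp: "(\<lambda>n. L2_norm ?M (\<lambda>x. (gradient (\<phi> n) x - g x) \<bullet> b)) \<longlonglongrightarrow> 0" if b: "b \<in> Basis" for b
  proof -
    have gb: "(\<lambda>x. g x \<bullet> b) \<in> L2 ?M" by (rule L2_component[OF g])
    let ?H = "\<lambda>n x. conv_on U (mollifier (e n)) (\<lambda>y. g y \<bullet> b) (p n + l n *\<^sub>R x)"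
    have HL: "?H n \<in> L2 ?M" for n by (rule mt(2)[OF gb])
    have H0: "(\<lambda>n. L2_norm ?M (\<lambda>x. ?H n x - g x \<bullet> b)) \<longlonglongrightarrow> 0" by (rule mt(1)[OF gb])
    have bound: "L2_norm ?M (\<lambda>x. (gradient (\<phi> n) x - g x) \<bullet> b)
       \<le> \<bar>l n\<bar> * L2_norm ?M (\<lambda>x. ?H n x - g x \<bullet> b) + \<bar>l n - 1\<bar> * L2_norm ?M (\<lambda>x. g x \<bullet> b)" for n
    proof -
      have "L2_norm ?M (\<lambda>x. (gradient (\<phi> n) x - g x) \<bullet> b)
        = L2_norm ?M (\<lambda>x. l n *\<^sub>R (?H n x - g x \<bullet> b) + (l n - 1) *\<^sub>R (g x \<bullet> b))"
        unfolding L2_norm_def L2_inner_def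
      proof (intro arg_cong[where f = sqrt] Bochner_Integration.integral_cong[OF refl])
        fix x assume "x \<in> space ?M"
        then have x: "x \<in> U" by simp
        have "gradient (C n) (p n + l n *\<^sub>R x) \<bullet> b = ?H n x"
          unfolding C_def by (rule gradient_mollified[OF vi wg e0 sub[OF x] b])
        then have "(gradient (\<phi> n) x - g x) \<bullet> b = l n *\<^sub>R (?H n x - g x \<bullet> b) + (l n - 1) *\<^sub>R (g x \<bullet> b)"
          by (simp add: gphi inner_diff_left algebra_simps)
        then show "((gradient (\<phi> n) x - g x) \<bullet> b) \<bullet> ((gradient (\<phi> n) x - g x) \<bullet> b) =
          (l n *\<^sub>R (?H n x - g x \<bullet> b) + (l n - 1) *\<^sub>R (g x \<bullet> b)) \<bullet> (l n *\<^sub>R (?H n x - g x \<bullet> b) + (l n - 1) *\<^sub>R (g x \<bullet> b))"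
          by (simp only:)
      qed
      also have "\<dots> \<le> L2_norm ?M (\<lambda>x. l n *\<^sub>R (?H n x - g x \<bullet> b)) + L2_norm ?M (\<lambda>x. (l n - 1) *\<^sub>R (g x \<bullet> b))"
        by (intro L2_norm_triangle L2_scaleR L2_diff HL gb)
      finally show ?thesis by (simp only: L2_norm_scaleR)
    qed
    have "(\<lambda>n. \<bar>l n\<bar> * L2_norm ?M (\<lambda>x. ?H n x - g x \<bullet> b) + \<bar>l n - 1\<bar> * L2_norm ?M (\<lambda>x. g x \<bullet> b)) \<longlonglongrightarrow> \<bar>1\<bar> * 0 + \<bar>1 - 1\<bar> * L2_norm ?M (\<lambda>x. g x \<bullet> b)"
      by (intro tendsto_intros ll H0)
    then have z: "(\<lambda>n. \<bar>l n\<bar> * L2_norm ?M (\<lambda>x. ?H n x - g x \<bullet> b) + \<bar>l n - 1\<bar> * L2_norm ?M (\<lambda>x. g x \<bullet> b)) \<longlonglongrightarrow> 0" by simp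
    show ?thesis
      by (rule Lim_null_comparison[OF _ z]) (use bound in simp)
  qed
  have "(\<lambda>n. \<Sum>b\<in>Basis. (L2_norm ?M (\<lambda>x. (gradient (\<phi> n) x - g x) \<bullet> b))\<^sup>2) \<longlonglongrightarrow> (\<Sum>b\<in>(Basis::'a set). 0\<^sup>2)"
    by (intro tendsto_sum tendsto_power comp)
  then have "(\<lambda>n. (L2_norm ?M (\<lambda>x. gradient (\<phi> n) x - g x))\<^sup>2) \<longlonglongrightarrow> 0"
    by (simp add: L2_norm_square_components[OF L2_diff[OF pgL g]])
  from tendsto_real_sqrt[OF this] have c2: "(\<lambda>n. L2_norm ?M (\<lambda>x. gradient (\<phi> n) x - g x)) \<longlonglongrightarrow> 0" by simp
  show thesis by (rule that[OF sm c1 c2])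
qed

subsection \<open>Weak gradients and \<open>H\<^sup>1\<close>\<close>

lemma test_function_C1: "test_function U \<phi> \<Longrightarrow> C1 \<phi>"
  by (simp add: test_function_def smooth_imp_C1)

lemma test_functionE:
  assumes "test_function U \<phi>"
  obtains K where "compact K" "K \<subseteq> U" "\<And>x. x \<notin> K \<Longrightarrow> \<phi> x = 0" "\<And>x. x \<notin> K \<Longrightarrow> gradient \<phi> x = 0"
proof -
  obtain K where K: "compact K" "K \<subseteq> U" "\<And>x. x \<notin> K \<Longrightarrow> \<phi> x = 0"
    using assms unfolding test_function_def by blast
  have "gradient \<phi> x = 0" if "x \<notin> K" for x
  proof (rule gradient_eqI)
    have op: "open (- K)" using K(1) by (simp add: compact_imp_closed open_Compl)
    have "((\<lambda>_. 0) has_derivative (\<lambda>h. 0 \<bullet> h)) (at x)" by simp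
    then show "(\<phi> has_derivative (\<lambda>h. 0 \<bullet> h)) (at x)"
      by (rule has_derivative_transform_within_open[OF _ op]) (use that K(3) in auto)
  qed
  then show thesis using that K by blast
qed

text \<open>By translation invariance the convolution of \<open>F\<close> with 1 is constant near
  the origin, so its partial derivative there, which is the integral of the partial derivative of
  \<open>F\<close>, vanishes.\<close>

lemma integral_partial_compact_support:
  fixes F :: "'a::euclidean_space \<Rightarrow> real"
  assumes F: "C1 F" and supp: "\<And>x. R < norm x \<Longrightarrow> F x = 0" and b: "b \<in> Basis"
  shows "(LINT x|lborel. gradient F x \<bullet> b) = 0"
proof -
  \<comment> \<open>The extra radius 1 keeps the reflected and shifted support inside
    \<open>U\<close> for all shifts shorter than 1.\<close>
  define U :: "'a set" where "U = cball 0 (R + 1)"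
  have Ub: "U \<in> sets borel" and Um: "U \<in> sets lebesgue" and Ubd: "bounded U" by (auto simp: U_def)
  have i1: "integrable (lebesgue_on U) (\<lambda>x. 1::real)"
    using finite_measure.integrable_const[OF bounded_lebesgue_finite_measure[OF Ubd Um]] .
  have ext: "(LINT y|lebesgue_on U. H (x - y)) = (LINT y|lborel. H y)"
    if H: "continuous_on UNIV H" "\<And>x. R < norm x \<Longrightarrow> H x = 0" and x: "norm x < 1" for H :: "'a \<Rightarrow> real" and x
  proof -
    have Hb: "H \<in> borel_measurable borel" by (rule borel_measurable_continuous_onI[OF H(1)])
    have Hc: "(\<lambda>y. H (x - y)) \<in> borel_measurable borel" using Hb by measurable
    have "(LINT y|lebesgue_on U. H (x - y)) = (LINT y|lborel. indicator U y *\<^sub>R H (x - y))"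
      by (rule integral_lebesgue_on_eq[OF Hc Ub])
    also have "\<dots> = (LINT y|lborel. H (x + (-1) *\<^sub>R y))"
    proof (rule Bochner_Integration.integral_cong[OF refl])
      fix y
      show "indicator U y *\<^sub>R H (x - y) = H (x + (-1) *\<^sub>R y)"
      proof (cases "y \<in> U")
        case False
        then have "R + 1 < norm y" by (simp add: U_def)
        also have "norm y \<le> norm (x - y) + norm x" using norm_triangle_ineq4[of x "x - y"] by simp
        finally have "R < norm (x - y)" using x by simp
        then show ?thesis using H(2) by simp
      qed simp
    qed
    also have "\<dots> = (LINT y|lborel. H y)"
      using integral_lborel_affine[OF Hb, of "-1" x] by simp
    finally show ?thesis .
  qed
  have op: "open (ball (0::'a) 1)" by simp
  have "gradient (conv_on U F (\<lambda>x. 1)) 0 = 0"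
  proof (rule gradient_eqI)
    have "((\<lambda>_. LINT y|lborel. F y) has_derivative (\<lambda>h. 0 \<bullet> h)) (at 0)" by simp
    then show "(conv_on U F (\<lambda>x. 1) has_derivative (\<lambda>h. 0 \<bullet> h)) (at 0)"
      by (rule has_derivative_transform_within_open[OF _ op])
        (use ext[OF C1_continuous[OF F] supp] in \<open>auto simp: conv_on_def\<close>)
  qed
  moreover have "gradient (conv_on U F (\<lambda>x. 1)) 0 \<bullet> b = conv_on U (\<lambda>z. gradient F z \<bullet> b) (\<lambda>x. 1) 0"
    by (rule gradient_conv_on[OF i1 F supp b])
  moreover have "conv_on U (\<lambda>z. gradient F z \<bullet> b) (\<lambda>x. 1) 0 = (LINT y|lebesgue_on U. gradient F (0 - y) \<bullet> b)"
    by (simp add: conv_on_def)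
  moreover have "\<dots> = (LINT x|lborel. gradient F x \<bullet> b)"
    by (rule ext[where H = "\<lambda>z. gradient F z \<bullet> b"])
      (auto intro!: continuous_intros C1_continuous_gradient[OF F] simp: C1_gradient_outside[OF F supp])
  ultimately show ?thesis by (metis inner_zero_left)
qed

lemma integral_lebesgue_on_support:
  fixes f :: "'a::euclidean_space \<Rightarrow> 'b::euclidean_space"
  assumes "V \<subseteq> U" "U \<in> sets lebesgue" "V \<in> sets lebesgue" "\<And>x. x \<in> U \<Longrightarrow> x \<notin> V \<Longrightarrow> f x = 0"
  shows "(LINT x|lebesgue_on U. f x) = (LINT x|lebesgue_on V. f x)"
proof -
  have "(LINT x|lebesgue_on U. f x) = (LINT x|lebesgue. indicator U x *\<^sub>R f x)"
    using assms by (subst integral_restrict_space) auto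
  also have "\<dots> = (LINT x|lebesgue. indicator V x *\<^sub>R f x)"
    by (rule Bochner_Integration.integral_cong[OF refl]) (use assms in \<open>auto simp: indicator_def\<close>)
  also have "\<dots> = (LINT x|lebesgue_on V. f x)"
    using assms by (subst integral_restrict_space) auto
  finally show ?thesis .
qed

text \<open>The product of \<open>f\<close> with a test function has compact support, so its partial
  derivatives integrate to 0, and the product rule splits this into the two sides.\<close>

lemma weak_gradient_C1:
  fixes f :: "'a::euclidean_space \<Rightarrow> real"
  assumes f: "C1 f" and U: "open U" "bounded U"
  shows "weak_gradient U f (gradient f)"
  unfolding weak_gradient_def
proof (intro allI impI ballI)
  fix \<phi> and b :: 'a assume phi: "test_function U \<phi>" and b: "b \<in> Basis"
  have Um: "U \<in> sets lebesgue" by (rule open_imp_lebesgue[OF U(1)])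
  obtain K where K: "compact K" "K \<subseteq> U" "\<And>x. x \<notin> K \<Longrightarrow> \<phi> x = 0" "\<And>x. x \<notin> K \<Longrightarrow> gradient \<phi> x = 0"
    by (rule test_functionE[OF phi]) blast
  note p = test_function_C1[OF phi]
  obtain R where R: "\<And>x. x \<in> K \<Longrightarrow> norm x \<le> R" using compact_imp_bounded[OF K(1)] by (auto simp: bounded_iff)
  let ?F = "\<lambda>x. f x * \<phi> x"
  have gF: "gradient ?F x \<bullet> b = f x * (gradient \<phi> x \<bullet> b) + (gradient f x \<bullet> b) * \<phi> x" for x
    by (simp add: C1_mult(2)[OF f p] inner_add_left)
  have "(LINT x|lborel. gradient ?F x \<bullet> b) = 0"
    by (rule integral_partial_compact_support[OF C1_mult(1)[OF f p] _ b, of R]) (use K(3) R in \<open>auto simp: not_le[symmetric]\<close>)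
  moreover have "(LINT x|lborel. gradient ?F x \<bullet> b) = (LINT x|lebesgue_on UNIV. gradient ?F x \<bullet> b)"
  proof -
    have "(\<lambda>x. gradient ?F x \<bullet> b) \<in> borel_measurable borel"
      by (intro borel_measurable_continuous_onI continuous_intros C1_continuous_gradient C1_mult(1)[OF f p])
    then show ?thesis by (subst integral_lebesgue_on_eq) auto
  qed
  moreover have "\<dots> = (LINT x|lebesgue_on U. gradient ?F x \<bullet> b)"
    by (rule integral_lebesgue_on_support) (use Um in \<open>simp_all add: gF K(3,4)[OF contra_subsetD[OF K(2)]]\<close>)
  moreover have "\<dots> = (LINT x|lebesgue_on U. f x * (gradient \<phi> x \<bullet> b)) + (LINT x|lebesgue_on U. (gradient f x \<bullet> b) * \<phi> x)"
    unfolding gF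
    by (intro Bochner_Integration.integral_add L2_mult_integrable L2_component L2_continuous_bounded_domain
        C1_continuous C1_continuous_gradient f p U Um)
  ultimately show "(LINT x|lebesgue_on U. f x * (gradient \<phi> x \<bullet> b)) = - (LINT x|lebesgue_on U. (gradient f x \<bullet> b) * \<phi> x)"
    by simp
qed

lemma weak_gradient_restrict:
  assumes wg: "weak_gradient U v g" and VU: "V \<subseteq> U" and U: "open U" and V: "open V"
  shows "weak_gradient V v g"
  unfolding weak_gradient_def
proof (intro allI impI ballI)
  fix \<phi> and b :: 'a assume phi: "test_function V \<phi>" and b: "b \<in> Basis"
  obtain K where K: "compact K" "K \<subseteq> V" "\<And>x. x \<notin> K \<Longrightarrow> \<phi> x = 0" "\<And>x. x \<notin> K \<Longrightarrow> gradient \<phi> x = 0"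
    by (rule test_functionE[OF phi]) blast
  have "test_function U \<phi>" using phi VU unfolding test_function_def by blast
  then have "(LINT x|lebesgue_on U. v x * (gradient \<phi> x \<bullet> b)) = - (LINT x|lebesgue_on U. (g x \<bullet> b) * \<phi> x)"
    using wg b unfolding weak_gradient_def by blast
  moreover have "(LINT x|lebesgue_on U. v x * (gradient \<phi> x \<bullet> b)) = (LINT x|lebesgue_on V. v x * (gradient \<phi> x \<bullet> b))"
    by (rule integral_lebesgue_on_support[OF VU open_imp_lebesgue[OF U] open_imp_lebesgue[OF V]])
      (simp add: K(3,4)[OF contra_subsetD[OF K(2)]])
  moreover have "(LINT x|lebesgue_on U. (g x \<bullet> b) * \<phi> x) = (LINT x|lebesgue_on V. (g x \<bullet> b) * \<phi> x)"
    by (rule integral_lebesgue_on_support[OF VU open_imp_lebesgue[OF U] open_imp_lebesgue[OF V]])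
      (simp add: K(3,4)[OF contra_subsetD[OF K(2)]])
  ultimately show "(LINT x|lebesgue_on V. v x * (gradient \<phi> x \<bullet> b)) = - (LINT x|lebesgue_on V. (g x \<bullet> b) * \<phi> x)" by simp
qed

lemma weak_gradient_combination:
  assumes U: "open U" "bounded U" and v: "v \<in> L2 (lebesgue_on U)" "v' \<in> L2 (lebesgue_on U)"
    and g: "g \<in> L2 (lebesgue_on U)" "g' \<in> L2 (lebesgue_on U)"
    and wg: "weak_gradient U v g" "weak_gradient U v' g'"
  shows "weak_gradient U (\<lambda>x. v x + c * v' x) (\<lambda>x. g x + c *\<^sub>R g' x)"
  unfolding weak_gradient_def
proof (intro allI impI ballI)
  fix \<phi> and b :: 'a assume phi: "test_function U \<phi>" and b: "b \<in> Basis"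
  have Um: "U \<in> sets lebesgue" by (rule open_imp_lebesgue[OF U(1)])
  have pL: "\<phi> \<in> L2 (lebesgue_on U)" by (rule test_function_L2[OF phi U(2) Um])
  have gL: "(\<lambda>x. gradient \<phi> x \<bullet> b) \<in> L2 (lebesgue_on U)"
    by (intro L2_component L2_continuous_bounded_domain C1_continuous_gradient test_function_C1[OF phi] U(2) Um)
  have "(LINT x|lebesgue_on U. (v x + c * v' x) * (gradient \<phi> x \<bullet> b))
     = (LINT x|lebesgue_on U. v x * (gradient \<phi> x \<bullet> b)) + c * (LINT x|lebesgue_on U. v' x * (gradient \<phi> x \<bullet> b))"
    using L2_mult_integrable[OF v(1) gL] L2_mult_integrable[OF v(2) gL]
    by (simp add: distrib_right mult.assoc)
  also have "\<dots> = - (LINT x|lebesgue_on U. (g x \<bullet> b) * \<phi> x) + c * - (LINT x|lebesgue_on U. (g' x \<bullet> b) * \<phi> x)"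
    using wg phi b unfolding weak_gradient_def by simp
  also have "\<dots> = - (LINT x|lebesgue_on U. ((g x + c *\<^sub>R g' x) \<bullet> b) * \<phi> x)"
    using L2_mult_integrable[OF L2_component[OF g(1)] pL] L2_mult_integrable[OF L2_component[OF g(2)] pL]
    by (simp add: inner_add_left distrib_right mult.assoc)
  finally show "(LINT x|lebesgue_on U. (v x + c * v' x) * (gradient \<phi> x \<bullet> b)) = - (LINT x|lebesgue_on U. ((g x + c *\<^sub>R g' x) \<bullet> b) * \<phi> x)" .
qed

lemma H1_D1: "v \<in> H1 U \<Longrightarrow> v \<in> L2 (lebesgue_on U)"
  by (simp add: H1_def)

lemma H1_grad:
  assumes "v \<in> H1 U" shows "grad U v \<in> L2 (lebesgue_on U)" "weak_gradient U v (grad U v)"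
proof -
  have "\<exists>g. g \<in> L2 (lebesgue_on U) \<and> weak_gradient U v g" using assms by (auto simp: H1_def)
  from someI_ex[OF this] show "grad U v \<in> L2 (lebesgue_on U)" "weak_gradient U v (grad U v)"
    unfolding grad_def by blast+
qed

lemma H1_I: "v \<in> L2 (lebesgue_on U) \<Longrightarrow> g \<in> L2 (lebesgue_on U) \<Longrightarrow> weak_gradient U v g \<Longrightarrow> v \<in> H1 U"
  by (auto simp: H1_def)

lemma grad_eq_AE:
  assumes U: "open U" "bounded U" and "v \<in> L2 (lebesgue_on U)" "g \<in> L2 (lebesgue_on U)" "weak_gradient U v g"
  shows "AE x in lebesgue_on U. grad U v x = g x"
  using weak_gradient_unique[OF U] H1_grad[OF H1_I[OF assms(3-5)]] assms by blast

lemma H1_combination: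
  assumes U: "open U" "bounded U" and v: "v \<in> H1 U" "v' \<in> H1 U"
  shows "(\<lambda>x. v x + c * v' x) \<in> H1 U"
    "AE x in lebesgue_on U. grad U (\<lambda>x. v x + c * v' x) x = grad U v x + c *\<^sub>R grad U v' x"
proof -
  have L: "(\<lambda>x. v x + c * v' x) \<in> L2 (lebesgue_on U)"
    using L2_add[OF H1_D1[OF v(1)] L2_scaleR[OF H1_D1[OF v(2)], of c]] by simp
  have G: "(\<lambda>x. grad U v x + c *\<^sub>R grad U v' x) \<in> L2 (lebesgue_on U)"
    by (intro L2_add L2_scaleR H1_grad v)
  have W: "weak_gradient U (\<lambda>x. v x + c * v' x) (\<lambda>x. grad U v x + c *\<^sub>R grad U v' x)"
    by (intro weak_gradient_combination U H1_D1 H1_grad v)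
  show "(\<lambda>x. v x + c * v' x) \<in> H1 U" by (rule H1_I[OF L G W])
  show "AE x in lebesgue_on U. grad U (\<lambda>x. v x + c * v' x) x = grad U v x + c *\<^sub>R grad U v' x"
    by (rule grad_eq_AE[OF U L G W])
qed

lemma H1_C1:
  assumes U: "open U" "bounded U" and f: "C1 f"
  shows "f \<in> H1 U" "AE x in lebesgue_on U. grad U f x = gradient f x"
proof -
  have Um: "U \<in> sets lebesgue" by (rule open_imp_lebesgue[OF U(1)])
  note L = L2_continuous_bounded_domain[OF C1_continuous[OF f] U(2) Um]
  note G = L2_continuous_bounded_domain[OF C1_continuous_gradient[OF f] U(2) Um]
  show "f \<in> H1 U" by (rule H1_I[OF L G weak_gradient_C1[OF f U]])
  show "AE x in lebesgue_on U. grad U f x = gradient f x" by (rule grad_eq_AE[OF U L G weak_gradient_C1[OF f U]])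
qed

lemma H1_restrict:
  assumes U: "open U" "bounded U" and V: "open V" "V \<subseteq> U" and v: "v \<in> H1 U"
  shows "v \<in> H1 V" "AE x in lebesgue_on V. grad V v x = grad U v x"
proof -
  have m: "U \<in> sets lebesgue" "V \<in> sets lebesgue" using U V open_imp_lebesgue by auto
  have Vb: "bounded V" using U(2) V(2) bounded_subset by blast
  note L = L2_lebesgue_on_subset(1)[OF H1_D1[OF v] V(2) m]
  note G = L2_lebesgue_on_subset(1)[OF H1_grad(1)[OF v] V(2) m]
  note W = weak_gradient_restrict[OF H1_grad(2)[OF v] V(2) U(1) V(1)]
  show "v \<in> H1 V" by (rule H1_I[OF L G W])
  show "AE x in lebesgue_on V. grad V v x = grad U v x" by (rule grad_eq_AE[OF V(1) Vb L G W])
qed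

subsection \<open>Traces\<close>

text \<open>The same smooth sequence serves on the smaller set, where the norms only decrease. A
  trace built on a patch thus becomes a trace from within each element of it.\<close>

lemma has_trace_restrict:
  assumes U: "open U" "bounded U" and V: "open V" "V \<subseteq> U" and t: "has_trace U v S g"
  shows "has_trace V v S g"
proof -
  have m: "U \<in> sets lebesgue" "V \<in> sets lebesgue" using U V open_imp_lebesgue by auto
  have vU: "v \<in> H1 U" using t by (simp add: has_trace_def)
  obtain \<phi> :: "nat \<Rightarrow> 'a \<Rightarrow> real" where p: "\<And>n. smooth (\<phi> n)"
    "(\<lambda>n. L2_norm (lebesgue_on U) (\<lambda>x. \<phi> n x - v x)) \<longlonglongrightarrow> 0"
    "(\<lambda>n. L2_norm (lebesgue_on U) (\<lambda>x. gradient (\<phi> n) x - grad U v x)) \<longlonglongrightarrow> 0"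
    "(\<lambda>n. L2_norm (surface_measure S) (\<lambda>x. \<phi> n x - g x)) \<longlonglongrightarrow> 0" and gL: "g \<in> L2 (surface_measure S)"
    using t unfolding has_trace_def by auto
  have pU: "\<phi> n \<in> L2 (lebesgue_on U)" "gradient (\<phi> n) \<in> L2 (lebesgue_on U)" for n
    by (intro L2_continuous_bounded_domain smooth_continuous C1_continuous_gradient smooth_imp_C1 p U m)+
  have a: "(\<lambda>n. L2_norm (lebesgue_on V) (\<lambda>x. \<phi> n x - v x)) \<longlonglongrightarrow> 0"
    by (rule Lim_null_comparison[OF _ p(2)])
      (use L2_lebesgue_on_subset(2)[OF L2_diff[OF pU(1) H1_D1[OF vU]] V(2) m] in auto)
  have "(\<lambda>n. L2_norm (lebesgue_on V) (\<lambda>x. gradient (\<phi> n) x - grad U v x)) \<longlonglongrightarrow> 0"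
    by (rule Lim_null_comparison[OF _ p(3)])
      (use L2_lebesgue_on_subset(2)[OF L2_diff[OF pU(2) H1_grad(1)[OF vU]] V(2) m] in auto)
  moreover have "L2_norm (lebesgue_on V) (\<lambda>x. gradient (\<phi> n) x - grad U v x) = L2_norm (lebesgue_on V) (\<lambda>x. gradient (\<phi> n) x - grad V v x)" for n
  proof (rule L2_norm_cong_AE)
    show "AE x in lebesgue_on V. gradient (\<phi> n) x - grad U v x = gradient (\<phi> n) x - grad V v x"
      using H1_restrict(2)[OF U V vU] by eventually_elim simp
    have "gradient (\<phi> n) \<in> L2 (lebesgue_on V)" "grad U v \<in> L2 (lebesgue_on V)" "grad V v \<in> L2 (lebesgue_on V)"
      using L2_lebesgue_on_subset(1)[OF pU(2) V(2) m] L2_lebesgue_on_subset(1)[OF H1_grad(1)[OF vU] V(2) m]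
        H1_grad(1)[OF H1_restrict(1)[OF U V vU]] by auto
    then show "(\<lambda>x. gradient (\<phi> n) x - grad U v x) \<in> borel_measurable (lebesgue_on V)"
      "(\<lambda>x. gradient (\<phi> n) x - grad V v x) \<in> borel_measurable (lebesgue_on V)"
      by (auto dest!: L2_measurable)
  qed
  ultimately have b: "(\<lambda>n. L2_norm (lebesgue_on V) (\<lambda>x. gradient (\<phi> n) x - grad V v x)) \<longlonglongrightarrow> 0" by simp
  show ?thesis
    unfolding has_trace_def using H1_restrict(1)[OF U V vU] gL p(1,4) a b by blast
qed

lemma L2_norm_combination_tendsto:
  assumes "\<And>n. f n \<in> L2 M" "\<And>n. f' n \<in> L2 M"
    and "(\<lambda>n. L2_norm M (f n)) \<longlonglongrightarrow> 0" "(\<lambda>n. L2_norm M (f' n)) \<longlonglongrightarrow> 0"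
  shows "(\<lambda>n. L2_norm M (\<lambda>x. f n x + c *\<^sub>R f' n x)) \<longlonglongrightarrow> 0"
proof (rule Lim_null_comparison)
  show "\<forall>\<^sub>F n in sequentially. norm (L2_norm M (\<lambda>x. f n x + c *\<^sub>R f' n x)) \<le> L2_norm M (f n) + \<bar>c\<bar> * L2_norm M (f' n)"
    using L2_norm_triangle[OF assms(1) L2_scaleR[OF assms(2)], of _ c] by (simp add: L2_norm_scaleR)
  show "(\<lambda>n. L2_norm M (f n) + \<bar>c\<bar> * L2_norm M (f' n)) \<longlonglongrightarrow> 0"
    using tendsto_add[OF assms(3) tendsto_mult_left[OF assms(4), of "\<bar>c\<bar>"]] by simp
qed

lemma has_trace_combination:
  assumes U: "open U" "bounded U" and t: "has_trace U v S g" "has_trace U v' S g'"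
    and L: "\<And>\<phi>. smooth \<phi> \<Longrightarrow> \<phi> \<in> L2 (surface_measure S)"
  shows "has_trace U (\<lambda>x. v x + c * v' x) S (\<lambda>x. g x + c * g' x)"
proof -
  let ?M = "lebesgue_on U" and ?S = "surface_measure S"
  have m: "U \<in> sets lebesgue" using U open_imp_lebesgue by auto
  have vU: "v \<in> H1 U" "v' \<in> H1 U" and gL: "g \<in> L2 ?S" "g' \<in> L2 ?S" using t by (auto simp: has_trace_def)
  obtain \<phi> :: "nat \<Rightarrow> 'a \<Rightarrow> real" where p: "\<And>n. smooth (\<phi> n)"
    "(\<lambda>n. L2_norm ?M (\<lambda>x. \<phi> n x - v x)) \<longlonglongrightarrow> 0" "(\<lambda>n. L2_norm ?M (\<lambda>x. gradient (\<phi> n) x - grad U v x)) \<longlonglongrightarrow> 0"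
    "(\<lambda>n. L2_norm ?S (\<lambda>x. \<phi> n x - g x)) \<longlonglongrightarrow> 0"
    using t(1) unfolding has_trace_def by auto
  obtain \<psi> :: "nat \<Rightarrow> 'a \<Rightarrow> real" where p': "\<And>n. smooth (\<psi> n)"
    "(\<lambda>n. L2_norm ?M (\<lambda>x. \<psi> n x - v' x)) \<longlonglongrightarrow> 0" "(\<lambda>n. L2_norm ?M (\<lambda>x. gradient (\<psi> n) x - grad U v' x)) \<longlonglongrightarrow> 0"
    "(\<lambda>n. L2_norm ?S (\<lambda>x. \<psi> n x - g' x)) \<longlonglongrightarrow> 0"
    using t(2) unfolding has_trace_def by auto
  have smL: "\<omega> \<in> L2 ?M" "gradient \<omega> \<in> L2 ?M" if "smooth \<omega>" for \<omega>
    using that by (intro L2_continuous_bounded_domain smooth_continuous C1_continuous_gradient smooth_imp_C1 U m; simp)+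
  define \<omega> where "\<omega> = (\<lambda>n x. \<phi> n x + c * \<psi> n x)"
  have sm: "smooth (\<omega> n)" for n unfolding \<omega>_def by (intro smooth_add smooth_cmult p p')
  have gchi: "gradient (\<omega> n) x = gradient (\<phi> n) x + c *\<^sub>R gradient (\<psi> n) x" for n x
    unfolding \<omega>_def
    using C1_add(2)[OF smooth_imp_C1[OF p(1)] C1_mult(1)[OF C1_const(1)[of c] smooth_imp_C1[OF p'(1)]], of n n]
      C1_mult(2)[OF C1_const(1)[of c] smooth_imp_C1[OF p'(1)], of n] by (simp add: C1_const(2))
  have 1: "(\<lambda>n. L2_norm ?M (\<lambda>x. \<omega> n x - (v x + c * v' x))) \<longlonglongrightarrow> 0"
    using L2_norm_combination_tendsto[OF L2_diff[OF smL(1)[OF p(1)] H1_D1[OF vU(1)]] L2_diff[OF smL(1)[OF p'(1)] H1_D1[OF vU(2)]] p(2) p'(2), of c]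
    by (simp add: \<omega>_def algebra_simps)
  have 2: "(\<lambda>n. L2_norm ?S (\<lambda>x. \<omega> n x - (g x + c * g' x))) \<longlonglongrightarrow> 0"
    using L2_norm_combination_tendsto[OF L2_diff[OF L[OF p(1)] gL(1)] L2_diff[OF L[OF p'(1)] gL(2)] p(4) p'(4), of c]
    by (simp add: \<omega>_def algebra_simps)
  have 3: "(\<lambda>n. L2_norm ?M (\<lambda>x. gradient (\<omega> n) x - (grad U v x + c *\<^sub>R grad U v' x))) \<longlonglongrightarrow> 0"
    using L2_norm_combination_tendsto[OF L2_diff[OF smL(2)[OF p(1)] H1_grad(1)[OF vU(1)]] L2_diff[OF smL(2)[OF p'(1)] H1_grad(1)[OF vU(2)]] p(3) p'(3), of c]
    by (simp add: gchi algebra_simps)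
  have "L2_norm ?M (\<lambda>x. gradient (\<omega> n) x - (grad U v x + c *\<^sub>R grad U v' x)) = L2_norm ?M (\<lambda>x. gradient (\<omega> n) x - grad U (\<lambda>x. v x + c * v' x) x)" for n
  proof (rule L2_norm_cong_AE)
    show "AE x in ?M. gradient (\<omega> n) x - (grad U v x + c *\<^sub>R grad U v' x) = gradient (\<omega> n) x - grad U (\<lambda>x. v x + c * v' x) x"
      using H1_combination(2)[OF U vU, of c] by eventually_elim simp
    show "(\<lambda>x. gradient (\<omega> n) x - (grad U v x + c *\<^sub>R grad U v' x)) \<in> borel_measurable ?M"
      by (intro L2_measurable L2_diff L2_add L2_scaleR smL sm H1_grad vU)
    show "(\<lambda>x. gradient (\<omega> n) x - grad U (\<lambda>x. v x + c * v' x) x) \<in> borel_measurable ?M"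
      by (intro L2_measurable L2_diff smL sm H1_grad H1_combination(1) U vU)
  qed
  then have 4: "(\<lambda>n. L2_norm ?M (\<lambda>x. gradient (\<omega> n) x - grad U (\<lambda>x. v x + c * v' x) x)) \<longlonglongrightarrow> 0" using 3 by simp
  have "(\<lambda>x. g x + c * g' x) \<in> L2 ?S" using L2_add[OF gL(1) L2_scaleR[OF gL(2), of c]] by simp
  then show ?thesis unfolding has_trace_def using H1_combination(1)[OF U vU] sm 1 2 4 by blast
qed

text \<open>Passage between a closed simplex, which carries the divergence theorem, and its
  interior, which carries weak derivatives.\<close>

lemma lebesgue_on_spike_set:
  fixes f :: "'a::euclidean_space \<Rightarrow> 'b::euclidean_space"
  assumes UT: "U \<subseteq> T" "negligible (T - U)" and m: "U \<in> sets lebesgue" "T \<in> sets lebesgue"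
    and f: "f \<in> borel_measurable (lebesgue_on U)"
  shows "f \<in> borel_measurable (lebesgue_on T)" "(LINT x|lebesgue_on T. f x) = (LINT x|lebesgue_on U. f x)"
    "integrable (lebesgue_on T) f \<longleftrightarrow> integrable (lebesgue_on U) f"
proof -
  have U: "(\<lambda>x. indicator U x *\<^sub>R f x) \<in> borel_measurable lebesgue"
    using f m by (subst borel_measurable_restrict_space_iff[symmetric]) auto
  have ae: "AE x in lebesgue. indicator U x *\<^sub>R f x = indicator T x *\<^sub>R f x"
    by (rule AE_I'[of "T - U"]) (use UT in \<open>auto simp: indicator_def negligible_iff_null_sets\<close>)
  then have T: "(\<lambda>x. indicator T x *\<^sub>R f x) \<in> borel_measurable lebesgue"
    using U by (rule_tac borel_measurable_AE)
  then show "f \<in> borel_measurable (lebesgue_on T)"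
    using m by (subst borel_measurable_restrict_space_iff) auto
  have "(LINT x|lebesgue. indicator T x *\<^sub>R f x) = (LINT x|lebesgue. indicator U x *\<^sub>R f x)"
    by (rule integral_cong_AE[OF T U]) (use ae in eventually_elim, auto)
  then show "(LINT x|lebesgue_on T. f x) = (LINT x|lebesgue_on U. f x)"
    using m by (simp add: integral_restrict_space)
  have "integrable lebesgue (\<lambda>x. indicator T x *\<^sub>R f x) \<longleftrightarrow> integrable lebesgue (\<lambda>x. indicator U x *\<^sub>R f x)"
    by (rule integrable_cong_AE[OF T U]) (use ae in eventually_elim, auto)
  then show "integrable (lebesgue_on T) f \<longleftrightarrow> integrable (lebesgue_on U) f"
    using m by (simp add: integrable_restrict_space)
qed

lemma L2_spike_set:
  fixes f :: "'a::euclidean_space \<Rightarrow> 'b::euclidean_space"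
  assumes UT: "U \<subseteq> T" "negligible (T - U)" and m: "U \<in> sets lebesgue" "T \<in> sets lebesgue"
    and f: "f \<in> L2 (lebesgue_on U)"
  shows "f \<in> L2 (lebesgue_on T)" "L2_norm (lebesgue_on T) f = L2_norm (lebesgue_on U) f"
proof -
  have n: "(\<lambda>x. (norm (f x))\<^sup>2) \<in> borel_measurable (lebesgue_on U)" using L2_measurable[OF f] by measurable
  note s = lebesgue_on_spike_set[OF UT m n]
  show "f \<in> L2 (lebesgue_on T)"
    using lebesgue_on_spike_set(1)[OF UT m L2_measurable[OF f]] s(3) L2_integrable_square[OF f] by (intro L2_I) auto
  have "(L2_norm (lebesgue_on T) f)\<^sup>2 = (L2_norm (lebesgue_on U) f)\<^sup>2"
    unfolding L2_norm_square_integral by (rule s(2))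
  then show "L2_norm (lebesgue_on T) f = L2_norm (lebesgue_on U) f" by simp
qed

lemma simplex_basics:
  fixes T :: "'a::euclidean_space set"
  assumes T: "int DIM('a) simplex T"
  shows "compact T" "convex T" "interior T \<noteq> {}" "negligible (T - interior T)" "T \<in> sets lebesgue"
    "interior T \<in> sets lebesgue" "bounded (interior T)" "finite_measure (lebesgue_on T)"
    "0 < measure (lebesgue_on T) T" "closure (interior T) = T"
proof -
  show c: "compact T" and v: "convex T" using compact_simplex[OF T] convex_simplex[OF T] by auto
  have "aff_dim T = int DIM('a)" using aff_dim_simplex[OF T] by simp
  then have a: "affine hull T = UNIV" using aff_dim_eq_full by blast
  then have "T \<noteq> {}" by auto
  then show i: "interior T \<noteq> {}" using rel_interior_interior[OF a] rel_interior_eq_empty[OF v] by simp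
  show "negligible (T - interior T)"
    using negligible_convex_frontier[OF v] closure_subset by (auto simp: frontier_def intro: negligible_subset)
  show Tm: "T \<in> sets lebesgue" using c by (simp add: lmeasurable_compact fmeasurableD)
  show Im: "interior T \<in> sets lebesgue" by (simp add: open_imp_lebesgue)
  show "bounded (interior T)" using c compact_imp_bounded bounded_subset interior_subset by metis
  show "finite_measure (lebesgue_on T)"
    by (rule bounded_lebesgue_finite_measure[OF compact_imp_bounded[OF c] Tm])
  have "\<not> negligible T" using i open_not_negligible[of "interior T"] negligible_subset[OF _ interior_subset] by blast
  then have "measure lebesgue T \<noteq> 0"
    using c lmeasurable_compact negligible_iff_measure by blast
  then show "0 < measure (lebesgue_on T) T"
    using Tm by (simp add: measure_restrict_space measure_nonneg less_le)
  show "closure (interior T) = T"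
    using convex_closure_interior[OF v i] c by (simp add: compact_imp_closed)
qed

lemma facet_surface_measure:
  fixes T :: "'a::euclidean_space set"
  assumes T: "int DIM('a) simplex T" and S: "S facet_of T"
  shows "finite_measure (surface_measure S)" "space (surface_measure S) = S"
    "0 < measure (surface_measure S) S" "compact S" "S \<subseteq> T"
    "\<And>f :: 'a \<Rightarrow> real. continuous_on UNIV f \<Longrightarrow> f \<in> L2 (surface_measure S)"
proof -
  obtain a c h where *: "norm (outer_normal T S) = 1" "h > 0"
    "surface_measure S = restrict_space (hyperplane_measure (outer_normal T S) c) S" "compact S"
    "\<And>\<phi>. C1 \<phi> \<Longrightarrow> (LINT x|lebesgue_on T. real DIM('a) * \<phi> x + (x - a) \<bullet> gradient \<phi> x) = h * (LINT y|surface_measure S. \<phi> y)"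
    by (rule facet_geometry[OF T S]) (rule that; assumption)
  show sp: "space (surface_measure S) = S" by (simp add: *(3) space_restrict_space)
  have Sm: "S \<in> sets borel" using *(4) by (simp add: borel_compact)
  show fin: "finite_measure (surface_measure S)"
    by (rule finite_measureI)
      (use emeasure_hyperplane_measure_finite[OF *(1) Sm compact_imp_bounded[OF *(4)], of c] Sm in
        \<open>simp add: *(3) space_restrict_space emeasure_restrict_space sets_hyperplane_measure\<close>)
  show "compact S" by fact
  show "S \<subseteq> T" using S by (simp add: facet_of_imp_subset)
  \<comment> \<open>The cone formula with \<open>\<phi> = 1\<close> is the volume formula: height
    times facet area is \<open>d\<close> times the volume. Positivity of the volume passes to the
    facet.\<close>
  have "h * measure (surface_measure S) S = h * (LINT y|surface_measure S. 1)" using sp by simp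
  also have "\<dots> = (LINT x|lebesgue_on T. real DIM('a) * 1 + (x - a) \<bullet> gradient (\<lambda>x. 1) x)"
    by (rule *(5)[symmetric]) (rule C1_const)
  also have "\<dots> = real DIM('a) * measure (lebesgue_on T) T" by (simp add: C1_const)
  also have "\<dots> > 0" using simplex_basics(9)[OF T] by simp
  finally show "0 < measure (surface_measure S) S" using *(2) by (simp add: zero_less_mult_iff)
  fix f :: "'a \<Rightarrow> real" assume f: "continuous_on UNIV f"
  have "f \<in> borel_measurable borel" using f by (rule borel_measurable_continuous_onI)
  then have "f \<in> borel_measurable (hyperplane_measure (outer_normal T S) c)" by measurable
  then have fm: "f \<in> borel_measurable (surface_measure S)" unfolding *(3) by (rule measurable_restrict_space1)
  have "compact (f ` S)" by (rule compact_continuous_image[OF continuous_on_subset[OF f] *(4)]) simp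
  then obtain B where "\<And>x. x \<in> S \<Longrightarrow> norm (f x) \<le> B"
    using compact_imp_bounded by (fastforce simp: bounded_iff)
  then show "f \<in> L2 (surface_measure S)" by (intro L2_bounded[OF fin fm]) (use sp in auto)
qed

section \<open>Trace inequality, uniqueness and existence of traces on a facet\<close>

text \<open>The cone formula for the square of \<open>\<phi>\<close> expresses \<open>h\<close>
  times the surface integral through
  \<open>d \<phi>^2 + 2 \<phi> (x - a) \<bullet> gradient \<phi> x\<close>. Young's inequality, with
  \<open>D\<close> bounding the distance to the vertex, gives
  \<open>K = (d + D) / h\<close>.\<close>

lemma trace_inequality:
  fixes T :: "'a::euclidean_space set"
  assumes T: "int DIM('a) simplex T" and S: "S facet_of T"
  obtains K where "K \<ge> 0" "\<And>\<phi>. C1 \<phi> \<Longrightarrow> (L2_norm (surface_measure S) \<phi>)\<^sup>2 \<le>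
    K * ((L2_norm (lebesgue_on T) \<phi>)\<^sup>2 + (L2_norm (lebesgue_on T) (gradient \<phi>))\<^sup>2)"
proof -
  obtain a c h where h: "h > 0" and
    cone: "\<And>\<phi>. C1 \<phi> \<Longrightarrow> (LINT x|lebesgue_on T. real DIM('a) * \<phi> x + (x - a) \<bullet> gradient \<phi> x) = h * (LINT y|surface_measure S. \<phi> y)"
    by (rule facet_geometry[OF T S]) (rule that; assumption)
  note Tb = simplex_basics[OF T]
  obtain D where D: "\<And>x. x \<in> T \<Longrightarrow> norm (x - a) \<le> D"
    using compact_imp_bounded[OF Tb(1)] by (metis bounded_any_center dist_norm dist_commute)
  have "T \<noteq> {}" using Tb(3) interior_subset by blast
  then obtain x1 where "x1 \<in> T" by blast
  then have D0: "D \<ge> 0" using D[of x1] norm_ge_zero order_trans by blast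
  define K where "K = (real DIM('a) + D) / h"
  have "(L2_norm (surface_measure S) \<phi>)\<^sup>2 \<le> K * ((L2_norm (lebesgue_on T) \<phi>)\<^sup>2 + (L2_norm (lebesgue_on T) (gradient \<phi>))\<^sup>2)"
    if phi: "C1 \<phi>" for \<phi>
  proof -
    let ?M = "lebesgue_on T"
    have cont: "continuous_on A \<phi>" "continuous_on A (gradient \<phi>)" for A
      using phi by (auto intro: C1_continuous C1_continuous_gradient)
    have "h * (L2_norm (surface_measure S) \<phi>)\<^sup>2 = h * (LINT y|surface_measure S. \<phi> y * \<phi> y)"
      by (simp add: L2_norm_square L2_inner_def)
    also have "\<dots> = (LINT x|?M. real DIM('a) * (\<phi> x * \<phi> x) + (x - a) \<bullet> gradient (\<lambda>x. \<phi> x * \<phi> x) x)"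
      by (rule cone[symmetric]) (rule C1_mult(1)[OF phi phi])
    also have "\<dots> \<le> (LINT x|?M. (real DIM('a) + D) * (\<phi> x * \<phi> x + gradient \<phi> x \<bullet> gradient \<phi> x))"
    proof (rule integral_mono)
      show "integrable ?M (\<lambda>x. real DIM('a) * (\<phi> x * \<phi> x) + (x - a) \<bullet> gradient (\<lambda>x. \<phi> x * \<phi> x) x)"
        unfolding C1_mult(2)[OF phi phi]
        by (intro integrable_lebesgue_on_compact Tb(1) continuous_intros cont)
      show "integrable ?M (\<lambda>x. (real DIM('a) + D) * (\<phi> x * \<phi> x + gradient \<phi> x \<bullet> gradient \<phi> x))"
        by (intro integrable_lebesgue_on_compact Tb(1) continuous_intros cont)
      fix x assume "x \<in> space ?M"
      then have x: "x \<in> T" by simp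
      have "(x - a) \<bullet> gradient (\<lambda>x. \<phi> x * \<phi> x) x = 2 * \<phi> x * ((x - a) \<bullet> gradient \<phi> x)"
        by (simp add: C1_mult(2)[OF phi phi] inner_add_right)
      also have "\<dots> \<le> 2 * \<bar>\<phi> x\<bar> * (D * norm (gradient \<phi> x))"
      proof -
        have "\<bar>(x - a) \<bullet> gradient \<phi> x\<bar> \<le> norm (x - a) * norm (gradient \<phi> x)" by (rule Cauchy_Schwarz_ineq2)
        also have "\<dots> \<le> D * norm (gradient \<phi> x)" by (intro mult_right_mono D x) simp
        finally have "\<bar>2 * \<phi> x * ((x - a) \<bullet> gradient \<phi> x)\<bar> \<le> 2 * \<bar>\<phi> x\<bar> * (D * norm (gradient \<phi> x))"
          by (simp add: abs_mult mult_left_mono)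
        then show ?thesis by linarith
      qed
      also have "\<dots> = D * (2 * \<bar>\<phi> x\<bar> * norm (gradient \<phi> x))" by simp
      also have "\<dots> \<le> D * ((\<phi> x)\<^sup>2 + (norm (gradient \<phi> x))\<^sup>2)"
        using zero_le_power2[of "\<bar>\<phi> x\<bar> - norm (gradient \<phi> x)"] D0
        by (intro mult_left_mono) (simp_all add: power2_diff)
      finally have "(x - a) \<bullet> gradient (\<lambda>x. \<phi> x * \<phi> x) x \<le> D * (\<phi> x * \<phi> x + gradient \<phi> x \<bullet> gradient \<phi> x)"
        by (simp add: power2_eq_square[of "\<phi> x"] power2_norm_eq_inner)
      moreover have "0 \<le> real DIM('a) * (gradient \<phi> x \<bullet> gradient \<phi> x)" by simp
      ultimately show "real DIM('a) * (\<phi> x * \<phi> x) + (x - a) \<bullet> gradient (\<lambda>x. \<phi> x * \<phi> x) x \<le> (real DIM('a) + D) * (\<phi> x * \<phi> x + gradient \<phi> x \<bullet> gradient \<phi> x)"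
        by (simp only: distrib_left distrib_right)
    qed
    also have "\<dots> = (real DIM('a) + D) * ((L2_norm ?M \<phi>)\<^sup>2 + (L2_norm ?M (gradient \<phi>))\<^sup>2)"
    proof -
      have "integrable ?M (\<lambda>x. \<phi> x * \<phi> x)" "integrable ?M (\<lambda>x. gradient \<phi> x \<bullet> gradient \<phi> x)"
        by (intro integrable_lebesgue_on_compact Tb(1) continuous_intros cont)+
      then show ?thesis by (simp add: L2_norm_square L2_inner_def)
    qed
    finally show ?thesis using h by (simp add: K_def field_simps)
  qed
  moreover have "K \<ge> 0" using h D0 by (simp add: K_def)
  ultimately show thesis using that by blast
qed

lemma nn_integral_L2_norm:
  assumes "f \<in> L2 M"
  shows "(\<integral>\<^sup>+x. ennreal ((norm (f x))\<^sup>2) \<partial>M) = ennreal ((L2_norm M f)\<^sup>2)"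
  unfolding L2_norm_square_integral by (rule nn_integral_eq_integral[OF L2_integrable_square[OF assms]]) simp

text \<open>Riesz-Fischer: along a subsequence with increments below \<open>(1/2)^k\<close> the sum
  of the increments is integrable, which gives almost everywhere convergence; Fatou then gives
  convergence in norm. A subsequence suffices for a trace, since \<open>has_trace\<close> asks for
  some approximating sequence.\<close>

lemma L2_complete:
  fixes f :: "nat \<Rightarrow> 'a \<Rightarrow> real"
  assumes fin: "finite_measure M" and f: "\<And>n. f n \<in> L2 M"
    and Cauchy: "\<And>e. e > 0 \<Longrightarrow> \<exists>N. \<forall>m\<ge>N. \<forall>n\<ge>N. L2_norm M (\<lambda>x. f m x - f n x) < e"
  obtains g r where "g \<in> L2 M" "strict_mono (r :: nat \<Rightarrow> nat)" "(\<lambda>k. L2_norm M (\<lambda>x. f (r k) x - g x)) \<longlonglongrightarrow> 0"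
proof -
  have "\<forall>k. \<exists>N. \<forall>m\<ge>N. \<forall>n\<ge>N. L2_norm M (\<lambda>x. f m x - f n x) < (1/2) ^ k" using Cauchy by simp
  then obtain N where N: "\<And>k m n. N k \<le> m \<Longrightarrow> N k \<le> n \<Longrightarrow> L2_norm M (\<lambda>x. f m x - f n x) < (1/2) ^ k"
    by (auto dest!: choice)
  \<comment> \<open>The added sum makes \<open>r k\<close> at least \<open>N k\<close>, the added
    \<open>k\<close> makes \<open>r\<close> strictly increasing.\<close>
  define r where "r = (\<lambda>k. k + (\<Sum>j\<le>k. N j))"
  have rN: "N k \<le> r k" for k
    unfolding r_def using member_le_sum[of k "{..k}" N] by auto
  have sm: "strict_mono r"
    by (rule strict_monoI_Suc) (simp add: r_def)
  have step: "L2_norm M (\<lambda>x. f (r i) x - f (r j) x) < (1/2) ^ k" if "k \<le> i" "k \<le> j" for i j k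
  proof (rule N)
    have "r k \<le> r i" "r k \<le> r j" using that strict_mono_mono[OF sm] by (auto dest: monoD)
    then show "N k \<le> r i" "N k \<le> r j" using rN[of k] by auto
  qed
  define h where "h = (\<lambda>k x. f (r (Suc k)) x - f (r k) x)"
  have hL: "h k \<in> L2 M" for k unfolding h_def by (intro L2_diff f)
  have one: "(\<lambda>x. 1::real) \<in> L2 M" by (rule L2_const[OF fin])
  let ?C = "L2_norm M (\<lambda>x. 1::real)"
  have absL: "(\<lambda>x. \<bar>h k x\<bar>) \<in> L2 M" for k
    using hL[of k] by (auto simp: L2_def)
  have "(\<integral>\<^sup>+x. ennreal \<bar>h k x\<bar> \<partial>M) \<le> ennreal (?C * (1/2) ^ k)" for k
  proof -
    have "(\<integral>\<^sup>+x. ennreal \<bar>h k x\<bar> \<partial>M) = ennreal (LINT x|M. \<bar>h k x\<bar>)"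
      by (rule nn_integral_eq_integral[OF L2_integrable[OF fin absL]]) simp
    also have "(LINT x|M. \<bar>h k x\<bar>) = L2_inner M (\<lambda>x. \<bar>h k x\<bar>) (\<lambda>x. 1)" by (simp add: L2_inner_def)
    also have "\<dots> \<le> L2_norm M (\<lambda>x. \<bar>h k x\<bar>) * ?C" using L2_cauchy_schwarz[OF absL one] by (meson abs_le_D1)
    also have "L2_norm M (\<lambda>x. \<bar>h k x\<bar>) = L2_norm M (h k)" by (simp add: L2_norm_def L2_inner_def)
    also have "L2_norm M (h k) * ?C \<le> (1/2) ^ k * ?C"
      using step[of k "Suc k" k] by (intro mult_right_mono) (auto simp: h_def)
    finally show ?thesis by (simp add: mult.commute ennreal_leI)
  qed
  then have "(\<integral>\<^sup>+x. (\<Sum>k. ennreal \<bar>h k x\<bar>) \<partial>M) \<le> (\<Sum>k. ennreal (?C * (1/2) ^ k))"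
    using L2_measurable[OF absL] by (subst nn_integral_suminf) (auto intro!: suminf_le)
  also have "\<dots> = ennreal (\<Sum>k. ?C * (1/2) ^ k)"
    by (rule suminf_ennreal2) (auto intro!: summable_mult summable_geometric)
  finally have "(\<integral>\<^sup>+x. (\<Sum>k. ennreal \<bar>h k x\<bar>) \<partial>M) \<noteq> \<infinity>" by (auto simp: top_unique)
  then have "AE x in M. (\<Sum>k. ennreal \<bar>h k x\<bar>) \<noteq> \<infinity>"
    by (rule nn_integral_PInf_AE[rotated]) (use L2_measurable[OF absL] in measurable)
  then have conv: "AE x in M. convergent (\<lambda>k. f (r k) x)"
  proof eventually_elim
    fix x assume "(\<Sum>k. ennreal \<bar>h k x\<bar>) \<noteq> \<infinity>"
    then have "summable (\<lambda>k. \<bar>h k x\<bar>)" by (intro summable_suminf_not_top) (auto simp: top_unique)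
    then have "summable (\<lambda>k. h k x)" by (rule summable_rabs_cancel)
    then have "convergent (\<lambda>k. \<Sum>j<k. h j x)" by (simp add: summable_iff_convergent)
    moreover have "(\<Sum>j<k. h j x) = f (r k) x - f (r 0) x" for k
      unfolding h_def by (induction k) auto
    ultimately have "convergent (\<lambda>k. f (r k) x - f (r 0) x)" by simp
    then show "convergent (\<lambda>k. f (r k) x)" by (simp add: convergent_diff_const_right_iff)
  qed
  define g where "g = (\<lambda>x. lim (\<lambda>k. f (r k) x))"
  have gm: "g \<in> borel_measurable M" unfolding g_def using L2_measurable[OF f] by measurable
  have lim: "AE x in M. (\<lambda>k. f (r k) x) \<longlonglongrightarrow> g x"
    using conv by eventually_elim (simp add: g_def convergent_LIMSEQ_iff)
  have bound: "(\<lambda>x. f (r k) x - g x) \<in> L2 M \<and> L2_norm M (\<lambda>x. f (r k) x - g x) \<le> (1/2) ^ k" for k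
  proof -
    have m: "(\<lambda>x. f (r k) x - g x) \<in> borel_measurable M" using gm L2_measurable[OF f] by measurable
    have "(\<integral>\<^sup>+x. ennreal ((norm (f (r k) x - g x))\<^sup>2) \<partial>M) = (\<integral>\<^sup>+x. liminf (\<lambda>j. ennreal ((norm (f (r k) x - f (r j) x))\<^sup>2)) \<partial>M)"
    proof (rule nn_integral_cong_AE, use lim in eventually_elim)
      fix x assume "(\<lambda>k. f (r k) x) \<longlonglongrightarrow> g x"
      then have "(\<lambda>j. ennreal ((norm (f (r k) x - f (r j) x))\<^sup>2)) \<longlonglongrightarrow> ennreal ((norm (f (r k) x - g x))\<^sup>2)"
        by (intro tendsto_intros)
      then show "ennreal ((norm (f (r k) x - g x))\<^sup>2) = liminf (\<lambda>j. ennreal ((norm (f (r k) x - f (r j) x))\<^sup>2))"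
        using lim_imp_Liminf[OF sequentially_bot] by metis
    qed
    also have "\<dots> \<le> liminf (\<lambda>j. \<integral>\<^sup>+x. ennreal ((norm (f (r k) x - f (r j) x))\<^sup>2) \<partial>M)"
      by (rule nn_integral_liminf) (use L2_measurable[OF f] in measurable)
    also have "\<dots> \<le> limsup (\<lambda>j. \<integral>\<^sup>+x. ennreal ((norm (f (r k) x - f (r j) x))\<^sup>2) \<partial>M)"
      by (rule Liminf_le_Limsup) simp
    also have "\<dots> \<le> ennreal (((1/2) ^ k)\<^sup>2)"
    proof (rule Limsup_bounded)
      show "\<forall>\<^sub>F j in sequentially. (\<integral>\<^sup>+x. ennreal ((norm (f (r k) x - f (r j) x))\<^sup>2) \<partial>M) \<le> ennreal (((1/2) ^ k)\<^sup>2)"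
        using eventually_ge_at_top[of k]
      proof eventually_elim
        fix j assume "k \<le> j"
        then have "L2_norm M (\<lambda>x. f (r k) x - f (r j) x) \<le> (1/2) ^ k" using step[of k k j] by simp
        then have "(L2_norm M (\<lambda>x. f (r k) x - f (r j) x))\<^sup>2 \<le> ((1/2) ^ k)\<^sup>2" by (rule power_mono) simp
        then show "(\<integral>\<^sup>+x. ennreal ((norm (f (r k) x - f (r j) x))\<^sup>2) \<partial>M) \<le> ennreal (((1/2) ^ k)\<^sup>2)"
          unfolding nn_integral_L2_norm[OF L2_diff[OF f f]] by (rule ennreal_leI)
      qed
    qed
    finally show ?thesis using L2_norm_le_nn_integral[OF m] by simp
  qed
  have "(\<lambda>x. f (r 0) x - (f (r 0) x - g x)) \<in> L2 M" by (rule L2_diff[OF f conjunct1[OF bound]])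
  moreover have "(\<lambda>x. f (r 0) x - (f (r 0) x - g x)) = g" by auto
  ultimately have gL: "g \<in> L2 M" by simp
  have "(\<lambda>k. L2_norm M (\<lambda>x. f (r k) x - g x)) \<longlonglongrightarrow> 0"
  proof (rule tendsto_sandwich[OF _ _ tendsto_const])
    show "\<forall>\<^sub>F n in sequentially. 0 \<le> L2_norm M (\<lambda>x. f (r n) x - g x)" by simp
    show "\<forall>\<^sub>F n in sequentially. L2_norm M (\<lambda>x. f (r n) x - g x) \<le> (1/2) ^ n" using bound by simp
    show "(\<lambda>n. (1/2::real) ^ n) \<longlonglongrightarrow> 0" by (rule LIMSEQ_power_zero) simp
  qed
  then show thesis using that gL sm by blast
qed

lemma L2_norm_simplex_le:
  fixes T :: "'a::euclidean_space set" and f :: "'a \<Rightarrow> 'b::euclidean_space"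
  assumes T: "int DIM('a) simplex T" and W: "interior T \<subseteq> W" "W \<in> sets lebesgue" and f: "f \<in> L2 (lebesgue_on W)"
  shows "L2_norm (lebesgue_on T) f \<le> L2_norm (lebesgue_on W) f"
proof -
  note Tb = simplex_basics[OF T]
  note s = L2_lebesgue_on_subset[OF f W Tb(6)]
  show ?thesis using s(2) L2_spike_set(2)[OF interior_subset Tb(4) Tb(6) Tb(5) s(1)] by simp
qed

text \<open>Two sequences with the same limit are compared by the trace inequality applied to their
  differences. Equal sequences give the Cauchy property, different ones the independence of the
  trace from the sequence. Approximation may hold on a larger set \<open>W\<close>; the estimate
  uses one element in it.\<close>

lemma trace_Cauchy:
  fixes T :: "'a::euclidean_space set"
  assumes T: "int DIM('a) simplex T" and S: "S facet_of T"
    and W: "interior T \<subseteq> W" "open W" "bounded W"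
    and p: "\<And>n. smooth (\<phi> n)" "\<And>n. smooth (\<psi> n)" and v: "v \<in> L2 (lebesgue_on W)" "g \<in> L2 (lebesgue_on W)"
    and lim: "(\<lambda>n. L2_norm (lebesgue_on W) (\<lambda>x. \<phi> n x - v x)) \<longlonglongrightarrow> 0"
      "(\<lambda>n. L2_norm (lebesgue_on W) (\<lambda>x. gradient (\<phi> n) x - g x)) \<longlonglongrightarrow> 0"
      "(\<lambda>n. L2_norm (lebesgue_on W) (\<lambda>x. \<psi> n x - v x)) \<longlonglongrightarrow> 0"
      "(\<lambda>n. L2_norm (lebesgue_on W) (\<lambda>x. gradient (\<psi> n) x - g x)) \<longlonglongrightarrow> 0"
    and e: "e > 0"
  shows "\<exists>N. \<forall>m\<ge>N. \<forall>n\<ge>N. L2_norm (surface_measure S) (\<lambda>x. \<phi> m x - \<psi> n x) < e"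
proof -
  have Wm: "W \<in> sets lebesgue" using W open_imp_lebesgue by auto
  obtain K where K: "K \<ge> 0" "\<And>\<phi>. C1 \<phi> \<Longrightarrow> (L2_norm (surface_measure S) \<phi>)\<^sup>2 \<le>
    K * ((L2_norm (lebesgue_on T) \<phi>)\<^sup>2 + (L2_norm (lebesgue_on T) (gradient \<phi>))\<^sup>2)"
    by (rule trace_inequality[OF T S]) (rule that; assumption)
  let ?N = "L2_norm (lebesgue_on W)"
  \<comment> \<open>Chosen so that \<open>(2 K + 1) (2 d)^2 = e^2\<close>; the summand 1 keeps the
    quotient meaningful for \<open>K = 0\<close> and the inequality strict.\<close>
  define d where "d = e / (2 * sqrt (2 * K + 1))"
  have d0: "d > 0" using e K(1) by (simp add: d_def)
  have ev: "\<forall>\<^sub>F n in sequentially. ?N (\<lambda>x. \<phi> n x - v x) < d \<and> ?N (\<lambda>x. gradient (\<phi> n) x - g x) < d \<and>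
      ?N (\<lambda>x. \<psi> n x - v x) < d \<and> ?N (\<lambda>x. gradient (\<psi> n) x - g x) < d"
    using lim[THEN order_tendstoD(2)[OF _ d0]] by (simp add: eventually_conj_iff)
  then obtain N where N: "\<And>n. n \<ge> N \<Longrightarrow> ?N (\<lambda>x. \<phi> n x - v x) < d \<and> ?N (\<lambda>x. gradient (\<phi> n) x - g x) < d \<and>
      ?N (\<lambda>x. \<psi> n x - v x) < d \<and> ?N (\<lambda>x. gradient (\<psi> n) x - g x) < d"
    unfolding eventually_sequentially by blast
  have L: "\<omega> \<in> L2 (lebesgue_on W)" "gradient \<omega> \<in> L2 (lebesgue_on W)" if "smooth \<omega>" for \<omega>
    using that by (intro L2_continuous_bounded_domain smooth_continuous C1_continuous_gradient smooth_imp_C1 W Wm; simp)+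
  have "L2_norm (surface_measure S) (\<lambda>x. \<phi> m x - \<psi> n x) < e" if mn: "m \<ge> N" "n \<ge> N" for m n
  proof -
    note cm = smooth_imp_C1[OF p(1)[of m]] and cn = smooth_imp_C1[OF p(2)[of n]]
    note tr = L2_norm_simplex_le[OF T W(1) Wm]
    have "?N (\<lambda>x. \<phi> m x - \<psi> n x) \<le> ?N (\<lambda>x. \<phi> m x - v x) + ?N (\<lambda>x. \<psi> n x - v x)"
      by (rule L2_norm_triangle_diff[OF L(1)[OF p(1)] L(1)[OF p(2)] v(1)])
    then have a: "?N (\<lambda>x. \<phi> m x - \<psi> n x) < 2 * d" using N[OF mn(1)] N[OF mn(2)] by linarith
    have "?N (\<lambda>x. gradient (\<phi> m) x - gradient (\<psi> n) x) \<le> ?N (\<lambda>x. gradient (\<phi> m) x - g x) + ?N (\<lambda>x. gradient (\<psi> n) x - g x)"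
      by (rule L2_norm_triangle_diff[OF L(2)[OF p(1)] L(2)[OF p(2)] v(2)])
    then have b: "?N (\<lambda>x. gradient (\<phi> m) x - gradient (\<psi> n) x) < 2 * d" using N[OF mn(1)] N[OF mn(2)] by linarith
    have "(L2_norm (surface_measure S) (\<lambda>x. \<phi> m x - \<psi> n x))\<^sup>2
      \<le> K * ((L2_norm (lebesgue_on T) (\<lambda>x. \<phi> m x - \<psi> n x))\<^sup>2 + (L2_norm (lebesgue_on T) (\<lambda>x. gradient (\<phi> m) x - gradient (\<psi> n) x))\<^sup>2)"
      using K(2)[OF C1_diff(1)[OF cm cn]] by (simp add: C1_diff(2)[OF cm cn])
    also have "\<dots> \<le> K * ((2 * d)\<^sup>2 + (2 * d)\<^sup>2)"
      using a b tr[OF L2_diff[OF L(1)[OF p(1)] L(1)[OF p(2)]], of m n] tr[OF L2_diff[OF L(2)[OF p(1)] L(2)[OF p(2)]], of m n]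
      by (intro mult_left_mono add_mono power_mono K(1)) auto
    also have "\<dots> < (2 * K + 1) * (2 * d)\<^sup>2" using d0 by (simp add: algebra_simps)
    also have "\<dots> = e\<^sup>2" using K(1) by (simp add: d_def power_mult_distrib power_divide)
    finally show ?thesis using e by (simp add: power2_less_imp_less)
  qed
  then show ?thesis by blast
qed

text \<open>A trace comes with one approximating sequence; comparison with it shows that every other
  approximating sequence converges to this trace on the facet as well. In particular one sequence
  serves all facets of \<open>T\<close>.\<close>

lemma trace_limit:
  fixes T :: "'a::euclidean_space set"
  assumes T: "int DIM('a) simplex T" and S: "S facet_of T" and t: "has_trace (interior T) v S g"
    and p: "\<And>n. smooth (\<phi> n)"
    and lim: "(\<lambda>n. L2_norm (lebesgue_on (interior T)) (\<lambda>x. \<phi> n x - v x)) \<longlonglongrightarrow> 0"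
      "(\<lambda>n. L2_norm (lebesgue_on (interior T)) (\<lambda>x. gradient (\<phi> n) x - grad (interior T) v x)) \<longlonglongrightarrow> 0"
  shows "(\<lambda>n. L2_norm (surface_measure S) (\<lambda>x. \<phi> n x - g x)) \<longlonglongrightarrow> 0"
proof -
  note Tb = simplex_basics[OF T] and Sb = facet_surface_measure[OF T S]
  have vH: "v \<in> H1 (interior T)" and gL: "g \<in> L2 (surface_measure S)" using t by (auto simp: has_trace_def)
  obtain \<psi> :: "nat \<Rightarrow> 'a \<Rightarrow> real" where p': "\<And>n. smooth (\<psi> n)"
    "(\<lambda>n. L2_norm (lebesgue_on (interior T)) (\<lambda>x. \<psi> n x - v x)) \<longlonglongrightarrow> 0"
    "(\<lambda>n. L2_norm (lebesgue_on (interior T)) (\<lambda>x. gradient (\<psi> n) x - grad (interior T) v x)) \<longlonglongrightarrow> 0"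
    "(\<lambda>n. L2_norm (surface_measure S) (\<lambda>x. \<psi> n x - g x)) \<longlonglongrightarrow> 0"
    using t unfolding has_trace_def by auto
  have L: "\<omega> \<in> L2 (surface_measure S)" if "smooth \<omega>" for \<omega> by (rule Sb(6)[OF smooth_continuous[OF that]])
  show ?thesis
  proof (rule LIMSEQ_I)
    fix e :: real assume e: "0 < e"
    then have e2: "0 < e / 2" by simp
    obtain N where N: "\<And>m n. m \<ge> N \<Longrightarrow> n \<ge> N \<Longrightarrow> L2_norm (surface_measure S) (\<lambda>x. \<phi> m x - \<psi> n x) < e / 2"
      using trace_Cauchy[OF T S order_refl open_interior Tb(7) p p'(1) H1_D1[OF vH] H1_grad(1)[OF vH] lim p'(2,3) e2] by blast
    obtain N' where N': "\<And>n. n \<ge> N' \<Longrightarrow> L2_norm (surface_measure S) (\<lambda>x. \<psi> n x - g x) < e / 2"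
      using order_tendstoD(2)[OF p'(4) e2] unfolding eventually_sequentially by blast
    show "\<exists>no. \<forall>n\<ge>no. norm (L2_norm (surface_measure S) (\<lambda>x. \<phi> n x - g x) - 0) < e"
    proof (intro exI[of _ "max N N'"] allI impI)
      fix n assume n: "max N N' \<le> n"
      have "L2_norm (surface_measure S) (\<lambda>x. (\<phi> n x - \<psi> n x) + (\<psi> n x - g x)) \<le>
        L2_norm (surface_measure S) (\<lambda>x. \<phi> n x - \<psi> n x) + L2_norm (surface_measure S) (\<lambda>x. \<psi> n x - g x)"
        by (intro L2_norm_triangle L2_diff L p p' gL)
      then show "norm (L2_norm (surface_measure S) (\<lambda>x. \<phi> n x - g x) - 0) < e"
        using N[of n n] N'[of n] n by simp
    qed
  qed
qed

lemma has_trace_approximation: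
  assumes "has_trace U v S g"
  obtains \<phi> :: "nat \<Rightarrow> 'a::euclidean_space \<Rightarrow> real" where "\<And>n. smooth (\<phi> n)"
    "(\<lambda>n. L2_norm (lebesgue_on U) (\<lambda>x. \<phi> n x - v x)) \<longlonglongrightarrow> 0"
    "(\<lambda>n. L2_norm (lebesgue_on U) (\<lambda>x. gradient (\<phi> n) x - grad U v x)) \<longlonglongrightarrow> 0"
    "(\<lambda>n. L2_norm (surface_measure S) (\<lambda>x. \<phi> n x - g x)) \<longlonglongrightarrow> 0"
  using assms unfolding has_trace_def by auto

lemma trace_unique:
  fixes T :: "'a::euclidean_space set"
  assumes T: "int DIM('a) simplex T" and S: "S facet_of T"
    and t: "has_trace (interior T) v S g" "has_trace (interior T) v S g'"
  shows "AE x in surface_measure S. g x = g' x"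
proof -
  note Sb = facet_surface_measure[OF T S]
  have gL: "g \<in> L2 (surface_measure S)" "g' \<in> L2 (surface_measure S)" using t by (auto simp: has_trace_def)
  obtain \<phi> :: "nat \<Rightarrow> 'a \<Rightarrow> real" where p: "\<And>n. smooth (\<phi> n)"
    "(\<lambda>n. L2_norm (lebesgue_on (interior T)) (\<lambda>x. \<phi> n x - v x)) \<longlonglongrightarrow> 0"
    "(\<lambda>n. L2_norm (lebesgue_on (interior T)) (\<lambda>x. gradient (\<phi> n) x - grad (interior T) v x)) \<longlonglongrightarrow> 0"
    "(\<lambda>n. L2_norm (surface_measure S) (\<lambda>x. \<phi> n x - g x)) \<longlonglongrightarrow> 0"
    by (rule has_trace_approximation[OF t(1)]) (rule that; assumption)
  note l' = trace_limit[OF T S t(2) p(1,2,3)]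
  have L: "\<phi> n \<in> L2 (surface_measure S)" for n by (rule Sb(6)[OF smooth_continuous[OF p(1)]])
  have "(\<lambda>n. L2_norm (surface_measure S) (\<lambda>x. (\<phi> n x - g' x) + (-1) *\<^sub>R (\<phi> n x - g x))) \<longlonglongrightarrow> 0"
    by (intro L2_norm_combination_tendsto L2_diff L gL l' p(4))
  then have "L2_norm (surface_measure S) (\<lambda>x. g x - g' x) = 0"
    using LIMSEQ_unique[OF tendsto_const] by (simp add: algebra_simps)
  from L2_norm_eq_0_imp_AE[OF L2_diff[OF gL] this] show ?thesis by simp
qed

lemma average_trace_unique:
  fixes T :: "'a::euclidean_space set"
  assumes T: "int DIM('a) simplex T" and S: "S facet_of T"
    and t: "has_trace (interior T) v S g" "has_trace (interior T) v S g'"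
  shows "average (surface_measure S) g = average (surface_measure S) g'"
proof -
  have "g \<in> L2 (surface_measure S)" "g' \<in> L2 (surface_measure S)" using t by (auto simp: has_trace_def)
  then have "(LINT x|surface_measure S. g x) = (LINT x|surface_measure S. g' x)"
    by (intro integral_cong_AE L2_measurable trace_unique[OF T S t])
  then show ?thesis by (simp add: average_def)
qed

text \<open>The approximation lives on the patch \<open>W\<close>, while the Cauchy estimate on the
  facet is taken from the single element \<open>T\<close>. The limit is a trace relative to
  \<open>W\<close>, so it restricts to all elements of the patch.\<close>

lemma trace_exists:
  fixes T :: "'a::euclidean_space set"
  assumes T: "int DIM('a) simplex T" and S: "S facet_of T"
    and W: "interior T \<subseteq> W" "open W" "bounded W" and v: "v \<in> H1 W"
    and p: "\<And>n. smooth (\<phi> n)"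
    and lim: "(\<lambda>n. L2_norm (lebesgue_on W) (\<lambda>x. \<phi> n x - v x)) \<longlonglongrightarrow> 0"
      "(\<lambda>n. L2_norm (lebesgue_on W) (\<lambda>x. gradient (\<phi> n) x - grad W v x)) \<longlonglongrightarrow> 0"
  obtains g where "has_trace W v S g"
proof -
  note Sb = facet_surface_measure[OF T S]
  have L: "\<phi> n \<in> L2 (surface_measure S)" for n by (rule Sb(6)[OF smooth_continuous[OF p(1)]])
  obtain g r where g: "g \<in> L2 (surface_measure S)" and r: "strict_mono (r :: nat \<Rightarrow> nat)"
    and c: "(\<lambda>k. L2_norm (surface_measure S) (\<lambda>x. \<phi> (r k) x - g x)) \<longlonglongrightarrow> 0"
    using L2_complete[OF Sb(1) L trace_Cauchy[OF T S W p p H1_D1[OF v] H1_grad(1)[OF v] lim lim]] by blast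
  have "has_trace W v S g"
    unfolding has_trace_def
    using v g p c LIMSEQ_subseq_LIMSEQ[OF lim(1) r] LIMSEQ_subseq_LIMSEQ[OF lim(2) r]
    by (intro conjI exI[of _ "\<lambda>k. \<phi> (r k)"]) (auto simp: o_def)
  then show thesis by (rule that)
qed

text \<open>The divergence theorem for smooth approximants passes to the limit termwise. The
  sequence attached to a single facet \<open>S0\<close> is used for all of them.\<close>

lemma integral_grad_eq_traces:
  fixes T :: "'a::euclidean_space set"
  assumes T: "int DIM('a) simplex T" and t: "\<And>S. S facet_of T \<Longrightarrow> has_trace (interior T) v S (g S)"
  shows "(LINT x|lebesgue_on (interior T). grad (interior T) v x \<bullet> b) =
    (\<Sum>S | S facet_of T. (outer_normal T S \<bullet> b) * (LINT y|surface_measure S. g S y))"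
proof -
  note Tb = simplex_basics[OF T]
  let ?M = "lebesgue_on (interior T)"
  have fin: "finite_measure ?M" by (rule bounded_lebesgue_finite_measure[OF Tb(7,6)])
  have "\<exists>S. S facet_of T"
  proof -
    obtain C where C: "\<not> affine_dependent C" "finite C" "card C = Suc DIM('a)" and TC: "T = convex hull C"
      using simplex_vertices[OF T] .
    then obtain a where "a \<in> C" by fastforce
    then show ?thesis unfolding TC facet_of_simplex[OF C(1,3)] by blast
  qed
  then obtain S0 where S0: "S0 facet_of T" by blast
  obtain \<phi> :: "nat \<Rightarrow> 'a \<Rightarrow> real" where p: "\<And>n. smooth (\<phi> n)"
    "(\<lambda>n. L2_norm ?M (\<lambda>x. \<phi> n x - v x)) \<longlonglongrightarrow> 0"
    "(\<lambda>n. L2_norm ?M (\<lambda>x. gradient (\<phi> n) x - grad (interior T) v x)) \<longlonglongrightarrow> 0"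
    by (rule has_trace_approximation[OF t[OF S0]]) (rule that; assumption)
  have vH: "v \<in> H1 (interior T)" using t[OF S0] by (simp add: has_trace_def)
  have pg: "gradient (\<phi> n) \<in> L2 ?M" for n
    by (intro L2_continuous_bounded_domain C1_continuous_gradient smooth_imp_C1 p Tb)
  have l1: "(\<lambda>n. LINT x|?M. gradient (\<phi> n) x \<bullet> b) \<longlonglongrightarrow> (LINT x|?M. grad (interior T) v x \<bullet> b)"
    using L2_inner_tendsto[OF pg H1_grad(1)[OF vH] L2_const[OF fin] p(3), of b] by (simp add: L2_inner_def)
  have "(LINT x|?M. gradient (\<phi> n) x \<bullet> b) = (\<Sum>S | S facet_of T. (outer_normal T S \<bullet> b) * (LINT y|surface_measure S. \<phi> n y))" for n
    using lebesgue_on_spike_set(2)[OF interior_subset Tb(4) Tb(6) Tb(5) L2_measurable[OF L2_component[OF pg]], of n b]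
      simplex_divergence[OF T smooth_imp_C1[OF p(1)], of n b] by simp
  moreover have "(\<lambda>n. \<Sum>S | S facet_of T. (outer_normal T S \<bullet> b) * (LINT y|surface_measure S. \<phi> n y))
    \<longlonglongrightarrow> (\<Sum>S | S facet_of T. (outer_normal T S \<bullet> b) * (LINT y|surface_measure S. g S y))"
  proof (intro tendsto_sum tendsto_mult tendsto_const)
    fix S assume "S \<in> {S. S facet_of T}"
    then have S: "S facet_of T" by simp
    note Sb = facet_surface_measure[OF T S]
    have gS: "g S \<in> L2 (surface_measure S)" using t[OF S] by (simp add: has_trace_def)
    show "(\<lambda>n. LINT y|surface_measure S. \<phi> n y) \<longlonglongrightarrow> (LINT y|surface_measure S. g S y)"
      by (rule L2_integral_tendsto[OF Sb(1) Sb(6)[OF smooth_continuous[OF p(1)]] gS trace_limit[OF T S t[OF S] p]])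
  qed
  ultimately show ?thesis using LIMSEQ_unique[OF l1] by simp
qed

subsection \<open>Facets of a simplicial mesh\<close>

text \<open>Projection of \<open>z\<close> from the opposite vertex \<open>a\<close> onto the facet
  plane gives a point \<open>s\<close> near \<open>y\<close>, which lies in \<open>S\<close> because
  \<open>y\<close> is in the relative interior; \<open>z\<close> is on the segment from
  \<open>a\<close> to \<open>s\<close>.\<close>

lemma simplex_half_ball:
  fixes T :: "'a::euclidean_space set"
  assumes T: "int DIM('a) simplex T" and S: "S facet_of T" and y: "y \<in> rel_interior S"
  obtains \<delta> where "\<delta> > 0" "\<And>z. dist y z < \<delta> \<Longrightarrow> outer_normal T S \<bullet> z \<le> outer_normal T S \<bullet> y \<Longrightarrow> z \<in> T"
proof -
  obtain a c h where *: "a \<in> T" "norm (outer_normal T S) = 1" "h > 0" "outer_normal T S \<bullet> a = c - h"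
    "\<And>y. y \<in> S \<Longrightarrow> outer_normal T S \<bullet> y = c" "affine hull S = {x. outer_normal T S \<bullet> x = c}"
    by (rule facet_geometry[OF T S]) (rule that; assumption)
  define n where "n = outer_normal T S"
  note * = *[folded n_def]
  have ST: "S \<subseteq> T" using S by (simp add: facet_of_imp_subset)
  obtain e where e: "e > 0" "ball y e \<inter> affine hull S \<subseteq> S" and yS: "y \<in> S"
    using y unfolding mem_rel_interior_ball by blast
  have ny: "n \<bullet> y = c" using *(5)[OF yS] .
  \<comment> \<open>Bound for the growth of distances to \<open>y\<close> under that projection: for
    \<open>r \<ge> 1/2\<close> the factor \<open>1/r\<close> is at most 2, and
    \<open>1/r - 1\<close> is at most \<open>2 * norm (z - y) / h\<close>.\<close>
  define k where "k = 2 + 2 * norm (a - y) / h"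
  have k: "k > 0" using *(3) by (simp add: k_def add_pos_nonneg)
  define \<delta> where "\<delta> = min (h / 2) (e / k)"
  have d0: "\<delta> > 0" using *(3) e(1) k by (simp add: \<delta>_def)
  have "z \<in> T" if z: "dist y z < \<delta>" "n \<bullet> z \<le> n \<bullet> y" for z
  proof -
    have zy: "norm (z - y) < h / 2" "norm (z - y) < e / k" using z(1) by (auto simp: \<delta>_def dist_norm norm_minus_commute)
    have "\<bar>n \<bullet> (z - y)\<bar> \<le> norm n * norm (z - y)" by (rule Cauchy_Schwarz_ineq2)
    then have nz: "c - n \<bullet> z \<le> norm (z - y)" using *(2) by (simp add: inner_diff_right ny)
    define r where "r = (n \<bullet> z - c + h) / h"
    have r: "1/2 \<le> r" "r \<le> 1" using nz zy(1) z(2) ny *(3) by (auto simp: r_def field_simps)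
    define s where "s = a + (z - a) /\<^sub>R r"
    have ns: "n \<bullet> s = c"
    proof -
      have "n \<bullet> (z - a) = r * h" using *(3,4) by (simp add: r_def inner_diff_right)
      then have "n \<bullet> s = c - h + inverse r * (r * h)" by (simp add: s_def inner_add_right *(4))
      then show ?thesis using r by simp
    qed
    have "s - y = (z - y) /\<^sub>R r + (1 - inverse r) *\<^sub>R (a - y)"
      by (simp add: s_def algebra_simps)
    then have "norm (s - y) \<le> norm ((z - y) /\<^sub>R r) + norm ((1 - inverse r) *\<^sub>R (a - y))"
      by (metis norm_triangle_ineq)
    also have "\<dots> \<le> 2 * norm (z - y) + (2 * norm (z - y) / h) * norm (a - y)"
    proof (rule add_mono)
      have i2: "inverse r \<le> 2" using r by (simp add: field_simps)
      then show "norm ((z - y) /\<^sub>R r) \<le> 2 * norm (z - y)"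
        using r by (simp add: mult_right_mono)
      have "1 - r = (c - n \<bullet> z) / h" using *(3) by (simp add: r_def field_simps)
      then have r1: "1 - r \<le> norm (z - y) / h" using nz *(3) by (simp add: divide_right_mono)
      have "\<bar>1 - inverse r\<bar> = inverse r * (1 - r)" using r by (simp add: field_simps)
      also have "\<dots> \<le> 2 * (norm (z - y) / h)" using i2 r1 r by (intro mult_mono) auto
      finally show "norm ((1 - inverse r) *\<^sub>R (a - y)) \<le> (2 * norm (z - y) / h) * norm (a - y)"
        unfolding norm_scaleR real_norm_def by (intro mult_right_mono) auto
    qed
    also have "\<dots> = norm (z - y) * k" by (simp add: k_def algebra_simps)
    also have "\<dots> < e" using zy(2) k by (simp add: field_simps)
    finally have "s \<in> S" using e(2) ns by (auto simp: *(6) dist_norm norm_minus_commute)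
    then have sT: "s \<in> T" using ST by blast
    have "z = (1 - r) *\<^sub>R a + r *\<^sub>R s" using r by (simp add: s_def algebra_simps)
    then show "z \<in> T"
      using convexD_alt[OF simplex_basics(2)[OF T] *(1) sT, of r] r by simp
  qed
  then show thesis using that d0 unfolding n_def by blast
qed

text \<open>The part of \<open>T\<close> in the supporting hyperplane is a proper face containing
  \<open>S\<close>. Its dimension cannot exceed that of the facet, and a face of equal dimension
  inside it is all of it.\<close>

lemma facet_eq_Int_hyperplane:
  fixes T :: "'a::euclidean_space set"
  assumes T: "int DIM('a) simplex T" and S: "S facet_of T" and x: "x \<in> T" and y: "y \<in> S"
    and e: "outer_normal T S \<bullet> x = outer_normal T S \<bullet> y"
  shows "x \<in> S"
proof -
  obtain a c h where *: "a \<in> T" "h > 0" "outer_normal T S \<bullet> a = c - h"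
    "\<And>y. y \<in> S \<Longrightarrow> outer_normal T S \<bullet> y = c" "\<And>x. x \<in> T \<Longrightarrow> outer_normal T S \<bullet> x \<le> c"
    by (rule facet_geometry[OF T S]) (rule that; assumption)
  define F where "F = T \<inter> {x. outer_normal T S \<bullet> x = c}"
  have cT: "convex T" by (rule simplex_basics(2)[OF T])
  have FT: "F face_of T"
    unfolding F_def by (rule face_of_Int_supporting_hyperplane_le[OF cT *(5)])
  have SF: "S \<subseteq> F" using *(4) S by (auto simp: F_def facet_of_imp_subset[THEN subsetD])
  have "a \<notin> F" using *(2,3) by (auto simp: F_def)
  then have "F \<noteq> T" using *(1) by blast
  then have "aff_dim F < aff_dim T" using face_of_aff_dim_lt[OF cT FT] by blast
  then have dF: "aff_dim F \<le> aff_dim S" using S by (simp add: facet_of_def)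
  have "S face_of F" using S SF FT by (meson face_of_imp_subset face_of_subset facet_of_imp_face_of)
  then have "S = F" using face_of_aff_dim_lt[OF face_of_imp_convex[OF FT]] dF by force
  moreover have "x \<in> F" using x e *(4)[OF y] by (simp add: F_def)
  ultimately show ?thesis by (simp only:)
qed

lemma facet_rel_interior:
  fixes T :: "'a::euclidean_space set"
  assumes T: "int DIM('a) simplex T" and S: "S facet_of T"
  obtains y where "y \<in> rel_interior S"
proof -
  have "convex S" by (rule face_of_imp_convex[OF facet_of_imp_face_of[OF S]])
  moreover have "S \<noteq> {}" using S by (simp add: facet_of_def)
  ultimately have "rel_interior S \<noteq> {}" by (simp add: rel_interior_eq_empty)
  then show thesis using that by blast
qed

text \<open>Equal normals would put half balls of both simplices on the same side of the facet, and
  their interiors would meet.\<close>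

lemma same_facet_normals:
  fixes T T' :: "'a::euclidean_space set"
  assumes T: "int DIM('a) simplex T" "int DIM('a) simplex T'" and S: "S facet_of T" "S facet_of T'"
    and disj: "interior T \<inter> interior T' = {}"
  shows "outer_normal T' S = - outer_normal T S"
proof -
  obtain a c h where *: "norm (outer_normal T S) = 1" "\<And>y. y \<in> S \<Longrightarrow> outer_normal T S \<bullet> y = c"
    "affine hull S = {x. outer_normal T S \<bullet> x = c}"
    by (rule facet_geometry[OF T(1) S(1)]) (rule that; assumption)
  obtain a' c' h' where **: "norm (outer_normal T' S) = 1" "affine hull S = {x. outer_normal T' S \<bullet> x = c'}"
    by (rule facet_geometry[OF T(2) S(2)]) (rule that; assumption)
  obtain y where y: "y \<in> rel_interior S" by (rule facet_rel_interior[OF T(1) S(1)])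
  obtain d where d: "d > 0" "\<And>z. dist y z < d \<Longrightarrow> outer_normal T S \<bullet> z \<le> outer_normal T S \<bullet> y \<Longrightarrow> z \<in> T"
    by (rule simplex_half_ball[OF T(1) S(1) y]) (rule that; assumption)
  obtain d' where d': "d' > 0" "\<And>z. dist y z < d' \<Longrightarrow> outer_normal T' S \<bullet> z \<le> outer_normal T' S \<bullet> y \<Longrightarrow> z \<in> T'"
    by (rule simplex_half_ball[OF T(2) S(2) y]) (rule that; assumption)
  have "outer_normal T' S \<noteq> outer_normal T S"
  proof
    assume eq: "outer_normal T' S = outer_normal T S"
    define n where "n = outer_normal T S"
    define B where "B = ball y (min d d') \<inter> {z. n \<bullet> z < n \<bullet> y}"
    have "open B" unfolding B_def by (intro open_Int open_ball open_halfspace_lt)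
    moreover have "B \<subseteq> T" "B \<subseteq> T'" using d(2) d'(2) eq by (auto simp: B_def n_def)
    ultimately have "B \<subseteq> interior T \<inter> interior T'" by (simp add: interior_maximal)
    then have "B = {}" using disj by blast
    moreover have "y - (min d d' / 2) *\<^sub>R n \<in> B"
      using d(1) d'(1) *(1) by (auto simp: B_def n_def dist_norm inner_diff_right dot_square_norm)
    ultimately show False by blast
  qed
  then show ?thesis
    using hyperplane_subset_imp_eq[OF *(1) **(1), of c c'] *(3) **(2) by auto
qed

section \<open>Conforming meshes of a Lipschitz domain\<close>

locale simplicial_triangulation =
  fixes \<Omega> \<Gamma>D \<Gamma>N :: "'a::euclidean_space set" and \<T> :: "'a set set"
  assumes lipschitz: "lipschitz_domain \<Omega>" and partition: "boundary_partition \<Omega> \<Gamma>D \<Gamma>N"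
    and mesh: "simplicial_mesh \<Omega> \<Gamma>D \<Gamma>N \<T>"
begin

lemma domain: "open \<Omega>" "bounded \<Omega>" "\<Omega> \<noteq> {}" "\<Omega> \<in> sets lebesgue" "finite_measure (lebesgue_on \<Omega>)"
  using lipschitz bounded_lebesgue_finite_measure open_imp_lebesgue unfolding lipschitz_domain_def by auto

lemma finite_mesh: "finite \<T>"
  and simplex: "T \<in> \<T> \<Longrightarrow> int DIM('a) simplex T"
  and face_Int: "T \<in> \<T> \<Longrightarrow> T' \<in> \<T> \<Longrightarrow> (T \<inter> T') face_of T"
  and Union_mesh: "\<Union>\<T> = closure \<Omega>"
  using mesh unfolding simplicial_mesh_def triangulation_def by auto

text \<open>The intersection of two elements is a face of each, and a proper face misses the
  interior.\<close>

lemma mesh_distinct: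
  assumes "T \<in> \<T>" "T' \<in> \<T>" "T \<noteq> T'"
  shows "interior T \<inter> interior T' = {}" "\<not> T \<subseteq> T'"
proof -
  have *: "\<not> T \<subseteq> T'" if "T \<in> \<T>" "T' \<in> \<T>" "T \<noteq> T'" for T T'
  proof
    assume sub: "T \<subseteq> T'"
    then have "T face_of T'" using face_Int[OF that(2,1)] by (simp add: Int_absorb1)
    then have "T \<inter> interior T' = {}" using face_of_disjoint_interior that(3) by blast
    moreover have "interior T \<noteq> {}" using simplex_basics(3)[OF simplex[OF that(1)]] .
    ultimately show False using interior_mono[OF sub] interior_subset by blast
  qed
  then show "\<not> T \<subseteq> T'" using assms by blast
  have "(T \<inter> T') \<inter> interior T = {}"
    using face_of_disjoint_interior[OF face_Int[OF assms(1,2)]] * assms by blast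
  then show "interior T \<inter> interior T' = {}" using interior_subset by blast
qed

text \<open>A Lipschitz domain lies locally on one side of its boundary.\<close>

lemma interior_closure_domain: "interior (closure \<Omega>) = \<Omega>"
proof
  show "\<Omega> \<subseteq> interior (closure \<Omega>)" using domain(1) by (simp add: interior_maximal closure_subset)
  show "interior (closure \<Omega>) \<subseteq> \<Omega>"
  proof
    fix x assume x: "x \<in> interior (closure \<Omega>)"
    show "x \<in> \<Omega>"
    proof (rule ccontr)
      assume nx: "x \<notin> \<Omega>"
      have "x \<in> frontier \<Omega>" using x nx interior_subset domain(1) by (auto simp: frontier_def interior_open)
      then obtain N e L \<zeta> where N: "open N" "x \<in> N" "norm e = 1" "lipschitz_on L UNIV \<zeta>"
        "\<Omega> \<inter> N = {y \<in> N. e \<bullet> y < \<zeta> (y - (e \<bullet> y) *\<^sub>R e)}"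
        using lipschitz unfolding lipschitz_domain_def by blast
      have ee: "e \<bullet> e = 1" using N(3) by (simp add: dot_square_norm)
      have cz: "continuous_on UNIV \<zeta>" using N(4) by (rule lipschitz_on_continuous_on)
      have "x \<notin> {y \<in> N. e \<bullet> y < \<zeta> (y - (e \<bullet> y) *\<^sub>R e)}" using nx N(5) by blast
      then have ge: "e \<bullet> x \<ge> \<zeta> (x - (e \<bullet> x) *\<^sub>R e)" using N(2) by simp
      define G where "G = {y. \<zeta> (y - (e \<bullet> y) *\<^sub>R e) < e \<bullet> y}"
      have oG: "open G" unfolding G_def
        by (intro open_Collect_less continuous_on_compose2[OF cz] continuous_intros) auto
      have "open (N \<inter> interior (closure \<Omega>))" using N(1) by blast
      then obtain d where d: "d > 0" "ball x d \<subseteq> N \<inter> interior (closure \<Omega>)"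
        using N(2) x open_contains_ball by blast
      \<comment> \<open>Moving up along \<open>e\<close> puts \<open>y\<close> strictly above the
        graph while it remains in the interior of the closure of \<Omega>.\<close>
      define y where "y = x + (d / 2) *\<^sub>R e"
      have yb: "y \<in> ball x d" using d(1) N(3) by (simp add: y_def dist_norm)
      have eqy: "y - (e \<bullet> y) *\<^sub>R e = x - (e \<bullet> x) *\<^sub>R e" by (simp add: y_def inner_add_right ee algebra_simps)
      have "e \<bullet> x < e \<bullet> y" using d(1) by (simp add: y_def inner_add_right ee)
      then have "y \<in> G" using ge unfolding G_def mem_Collect_eq eqy by simp
      then have "y \<in> N \<inter> G" using yb d(2) by blast
      moreover have "open (N \<inter> G)" using N(1) oG by blast
      moreover have "(N \<inter> G) \<inter> \<Omega> = {}"
      proof -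
        have "z \<notin> G" if "z \<in> \<Omega>" "z \<in> N" for z
        proof -
          have "z \<in> {y \<in> N. e \<bullet> y < \<zeta> (y - (e \<bullet> y) *\<^sub>R e)}" using N(5) that by blast
          then show ?thesis by (simp add: G_def)
        qed
        then show ?thesis by blast
      qed
      ultimately have "y \<notin> closure \<Omega>" using open_Int_closure_eq_empty by blast
      then show False using yb d(2) interior_subset by blast
    qed
  qed
qed

lemma interior_mesh_subset:
  assumes "T \<in> \<T>" shows "interior T \<subseteq> \<Omega>"
proof -
  have "T \<subseteq> closure \<Omega>" using assms Union_mesh by blast
  then show ?thesis using interior_mono[of T "closure \<Omega>"] interior_closure_domain by simp
qed

lemma domain_subset_Union: "\<Omega> \<subseteq> \<Union>\<T>"
  unfolding Union_mesh by (rule closure_subset)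

lemma negligible_skeleton: "negligible (\<Omega> - (\<Union>T\<in>\<T>. interior T))"
proof (rule negligible_subset)
  show "negligible (\<Union>T\<in>\<T>. T - interior T)"
    using finite_mesh simplex_basics(4)[OF simplex] by (intro negligible_Union) auto
  show "\<Omega> - (\<Union>T\<in>\<T>. interior T) \<subseteq> (\<Union>T\<in>\<T>. T - interior T)"
    using domain_subset_Union by blast
qed

lemma AE_in_element: "AE x in lebesgue_on \<Omega>. \<exists>T\<in>\<T>. x \<in> interior T"
proof -
  have "AE x in lebesgue. x \<notin> \<Omega> - (\<Union>T\<in>\<T>. interior T)"
    using negligible_skeleton by (intro AE_not_in) (simp add: negligible_iff_null_sets)
  then have "AE x in lebesgue. x \<in> \<Omega> \<longrightarrow> (\<exists>T\<in>\<T>. x \<in> interior T)" by (rule eventually_mono) blast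
  then show ?thesis using domain(4) by (subst AE_restrict_space_iff) auto
qed

lemma element_sum:
  fixes f :: "'a set \<Rightarrow> 'b::real_vector"
  assumes "T \<in> \<T>" "x \<in> interior T"
  shows "(\<Sum>T\<in>\<T>. indicator (interior T) x *\<^sub>R f T) = f T"
proof -
  have "(\<Sum>T'\<in>\<T>. indicator (interior T') x *\<^sub>R f T') = (\<Sum>T'\<in>\<T>. if T' = T then f T else 0)"
  proof (rule sum.cong[OF refl])
    fix T' assume "T' \<in> \<T>"
    then show "indicator (interior T') x *\<^sub>R f T' = (if T' = T then f T else 0)"
      using mesh_distinct(1)[OF assms(1), of T'] assms by (auto simp: indicator_def)
  qed
  then show ?thesis using finite_mesh assms(1) by simp
qed

lemma integral_elements:
  fixes f :: "'a \<Rightarrow> 'b::euclidean_space"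
  assumes f: "integrable (lebesgue_on \<Omega>) f"
  shows "(LINT x|lebesgue_on \<Omega>. f x) = (\<Sum>T\<in>\<T>. LINT x|lebesgue_on (interior T). f x)"
proof -
  have i: "integrable lebesgue (\<lambda>x. indicator \<Omega> x *\<^sub>R f x)"
    using f domain(4) by (subst (asm) integrable_restrict_space) auto
  have iT: "integrable lebesgue (\<lambda>x. indicator (interior T) x *\<^sub>R f x)" if "T \<in> \<T>" for T
  proof -
    have "integrable lebesgue (\<lambda>x. indicator (interior T) x *\<^sub>R (indicator \<Omega> x *\<^sub>R f x))"
      by (rule integrable_mult_indicator[OF open_imp_lebesgue[OF open_interior] i])
    moreover have "(\<lambda>x. indicator (interior T) x *\<^sub>R (indicator \<Omega> x *\<^sub>R f x)) = (\<lambda>x. indicator (interior T) x *\<^sub>R f x)"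
      using interior_mesh_subset[OF that] by (auto simp: indicator_def fun_eq_iff)
    ultimately show ?thesis by simp
  qed
  have "(LINT x|lebesgue_on \<Omega>. f x) = (LINT x|lebesgue. indicator \<Omega> x *\<^sub>R f x)"
    using domain(4) by (subst integral_restrict_space) auto
  also have "\<dots> = (LINT x|lebesgue. (\<Sum>T\<in>\<T>. indicator (interior T) x *\<^sub>R f x))"
  proof (rule integral_cong_AE)
    show "(\<lambda>x. indicator \<Omega> x *\<^sub>R f x) \<in> borel_measurable lebesgue" using i by simp
    show "(\<lambda>x. \<Sum>T\<in>\<T>. indicator (interior T) x *\<^sub>R f x) \<in> borel_measurable lebesgue"
      using iT by (intro borel_measurable_sum) auto
    have "AE x in lebesgue. x \<notin> \<Omega> - (\<Union>T\<in>\<T>. interior T)"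
      using negligible_skeleton by (intro AE_not_in) (simp add: negligible_iff_null_sets)
    then show "AE x in lebesgue. indicator \<Omega> x *\<^sub>R f x = (\<Sum>T\<in>\<T>. indicator (interior T) x *\<^sub>R f x)"
    proof eventually_elim
      fix x assume x: "x \<notin> \<Omega> - (\<Union>T\<in>\<T>. interior T)"
      show "indicator \<Omega> x *\<^sub>R f x = (\<Sum>T\<in>\<T>. indicator (interior T) x *\<^sub>R f x)"
      proof (cases "x \<in> \<Omega>")
        case True
        then obtain T where "T \<in> \<T>" "x \<in> interior T" using x by blast
        then show ?thesis using element_sum[of T x "\<lambda>_. f x"] True by simp
      next
        case False
        then have "x \<notin> interior T" if "T \<in> \<T>" for T using interior_mesh_subset[OF that] by blast
        then show ?thesis using False by simp
      qed
    qed
  qed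
  also have "\<dots> = (\<Sum>T\<in>\<T>. LINT x|lebesgue. indicator (interior T) x *\<^sub>R f x)"
    using iT by (rule Bochner_Integration.integral_sum)
  also have "\<dots> = (\<Sum>T\<in>\<T>. LINT x|lebesgue_on (interior T). f x)"
    by (rule sum.cong[OF refl], subst integral_restrict_space) (auto simp: open_imp_lebesgue)
  finally show ?thesis .
qed

text \<open>Conformity excludes hanging nodes: the intersection of the two elements is a face of
  \<open>T\<close> that meets the relative interior of \<open>S\<close>, so it contains
  \<open>S\<close>; it is proper, so it has no larger dimension.\<close>

lemma facet_of_meeting:
  assumes T: "T \<in> \<T>" and S: "S facet_of T" and y: "y \<in> rel_interior S"
    and T': "T' \<in> \<T>" and ne0: "T' \<noteq> T" and yT': "y \<in> T'"
  shows "S facet_of T'"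
proof -
  have yS: "y \<in> S" using y rel_interior_subset by blast
  have "(T \<inter> T') \<inter> rel_interior S \<noteq> {}" using y yS yT' S facet_of_imp_subset by blast
  then have sub: "S \<subseteq> T \<inter> T'"
    by (rule subset_of_face_of[OF face_Int[OF T T'] facet_of_imp_subset[OF S]])
  have ne: "T \<inter> T' \<noteq> T" using mesh_distinct(2)[OF T T'] ne0 by blast
  have cT: "convex T" by (rule simplex_basics(2)[OF simplex[OF T]])
  have "aff_dim (T \<inter> T') < aff_dim T" by (rule face_of_aff_dim_lt[OF cT face_Int[OF T T'] ne])
  then have le: "aff_dim (T \<inter> T') \<le> aff_dim S" using S by (simp add: facet_of_def)
  have "S face_of (T \<inter> T')" using S sub by (meson facet_of_imp_face_of face_of_subset inf_le1)
  then have eq: "S = T \<inter> T'"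
    using face_of_aff_dim_lt[of "T \<inter> T'" S] le face_of_imp_convex[OF face_Int[OF T T']] by force
  have "S face_of T'" using face_Int[OF T' T] eq by (simp add: Int_commute)
  moreover have "aff_dim T = aff_dim T'" using aff_dim_simplex simplex[OF T] simplex[OF T'] by metis
  ultimately show "S facet_of T'" using S by (simp add: facet_of_def)
qed

text \<open>Some relative interior point of \<open>S\<close> lies in \<Omega>. If \<open>T\<close>
  were the only element near it, a small step along the outer normal would stay in \<Omega> and
  hence in \<open>T\<close>, contradicting that \<open>T\<close> lies on one side. The other element
  met there shares the whole facet.\<close>

lemma facet_neighbour:
  assumes T: "T \<in> \<T>" and S: "S facet_of T" and nb: "\<not> S \<subseteq> frontier \<Omega>"
  obtains T' where "T' \<in> \<T>" "T' \<noteq> T" "S facet_of T'"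
proof -
  note sT = simplex[OF T]
  have cS: "closed S" "convex S" using facet_surface_measure(4)[OF sT S] S
    by (auto simp: compact_imp_closed facet_of_def face_of_imp_convex)
  have "S \<subseteq> closure \<Omega>" using S T Union_mesh by (metis UnionI facet_of_imp_subset subset_iff)
  then have "\<not> rel_interior S \<subseteq> - \<Omega>"
  proof -
    assume sub: "S \<subseteq> closure \<Omega>"
    have "closure (rel_interior S) = S" using convex_closure_rel_interior[OF cS(2)] cS(1) by simp
    then have "S \<subseteq> - \<Omega>" if "rel_interior S \<subseteq> - \<Omega>"
      using closure_minimal[OF that] domain(1) by auto
    then show ?thesis using nb sub domain(1) by (auto simp: frontier_def interior_open)
  qed
  then obtain y where y: "y \<in> rel_interior S" "y \<in> \<Omega>" by blast
  have yS: "y \<in> S" using y rel_interior_subset by blast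
  obtain c where c: "norm (outer_normal T S) = 1" "\<And>y. y \<in> S \<Longrightarrow> outer_normal T S \<bullet> y = c"
    "\<And>x. x \<in> T \<Longrightarrow> outer_normal T S \<bullet> x \<le> c"
    by (rule facet_geometry[OF sT S]) (rule that; assumption)
  define n where "n = outer_normal T S"
  have "y \<in> \<Union>(\<T> - {T})"
  proof (rule ccontr)
    assume ny: "y \<notin> \<Union>(\<T> - {T})"
    have "closed (\<Union>(\<T> - {T}))"
      using finite_mesh simplex_basics(1)[OF simplex] by (intro closed_Union) (auto simp: compact_imp_closed)
    then have "open (\<Omega> - \<Union>(\<T> - {T}))" using domain(1) by (rule open_Diff[rotated])
    then obtain d where d: "d > 0" "ball y d \<subseteq> \<Omega> - \<Union>(\<T> - {T})"
      using y(2) ny open_contains_ball by blast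
    have "y + (d / 2) *\<^sub>R n \<in> ball y d" using d(1) c(1) by (simp add: dist_norm n_def)
    then have "y + (d / 2) *\<^sub>R n \<in> T" using d(2) domain_subset_Union by blast
    from c(3)[OF this] show False
      using c(1) c(2)[OF yS] d(1) by (simp add: n_def inner_add_right dot_square_norm)
  qed
  then obtain T' where T': "T' \<in> \<T>" "T' \<noteq> T" "y \<in> T'" by blast
  then have "S facet_of T'" using facet_of_meeting[OF T S y(1)] by blast
  then show thesis using that T' by blast
qed

lemma facet_opposite_normals:
  assumes "T \<in> \<T>" "T' \<in> \<T>" "T \<noteq> T'" "S facet_of T" "S facet_of T'"
  shows "outer_normal T' S = - outer_normal T S"
  using same_facet_normals simplex mesh_distinct(1) assms by blast

text \<open>Normals of distinct elements at a common facet are opposite; three elements would force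
  a normal to equal its negative.\<close>

lemma facet_at_most_two:
  assumes "T \<in> \<T>" "T' \<in> \<T>" "T'' \<in> \<T>" "S facet_of T" "S facet_of T'" "S facet_of T''" "T \<noteq> T'" "T'' \<noteq> T"
  shows "T'' = T'"
proof (rule ccontr)
  assume ne: "T'' \<noteq> T'"
  have "outer_normal T' S = - outer_normal T S" "outer_normal T'' S = - outer_normal T S" "outer_normal T'' S = - outer_normal T' S"
    using facet_opposite_normals assms ne by metis+
  then have "outer_normal T' S = - outer_normal T' S" by simp
  then have "2 *\<^sub>R outer_normal T' S = 0" by (metis add.right_inverse scaleR_2)
  then have "outer_normal T' S = 0" by simp
  moreover have "norm (outer_normal T' S) = 1"
    by (rule facet_geometry[OF simplex[OF assms(2)] assms(5)]) assumption
  ultimately show False by simp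
qed

lemma shared_facet_interior:
  assumes T: "T \<in> \<T>" "T' \<in> \<T>" "T \<noteq> T'" and S: "S facet_of T" "S facet_of T'" and y: "y \<in> rel_interior S"
  shows "y \<in> interior (T \<union> T')"
proof -
  obtain d where d: "d > 0" "\<And>z. dist y z < d \<Longrightarrow> outer_normal T S \<bullet> z \<le> outer_normal T S \<bullet> y \<Longrightarrow> z \<in> T"
    by (rule simplex_half_ball[OF simplex[OF T(1)] S(1) y]) (rule that; assumption)
  obtain d' where d': "d' > 0" "\<And>z. dist y z < d' \<Longrightarrow> outer_normal T' S \<bullet> z \<le> outer_normal T' S \<bullet> y \<Longrightarrow> z \<in> T'"
    by (rule simplex_half_ball[OF simplex[OF T(2)] S(2) y]) (rule that; assumption)
  have tb: "z \<in> T \<union> T'" if "dist y z < min d d'" for z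
    using d(2)[of z] d'(2)[of z] that facet_opposite_normals[OF T S]
    by (cases "outer_normal T S \<bullet> z \<le> outer_normal T S \<bullet> y") auto
  have "ball y (min d d') \<subseteq> T \<union> T'"
  proof
    show "z \<in> T \<union> T'" if "z \<in> ball y (min d d')" for z by (rule tb) (use that in simp)
  qed
  then show ?thesis using d(1) d'(1) unfolding mem_interior by (intro exI[of _ "min d d'"]) simp
qed

text \<open>Two elements fill a neighbourhood of a relative interior point, which therefore belongs
  to the interior of the closure of \<Omega>, that is, to \<Omega>. A domain with a slit along the
  facet is what the Lipschitz property excludes here.\<close>

lemma shared_facet_not_frontier:
  assumes T: "T \<in> \<T>" "T' \<in> \<T>" "T \<noteq> T'" and S: "S facet_of T" "S facet_of T'"
  shows "\<not> S \<subseteq> frontier \<Omega>"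
proof -
  obtain y where y: "y \<in> rel_interior S" by (rule facet_rel_interior[OF simplex[OF T(1)] S(1)])
  have "T \<union> T' \<subseteq> closure \<Omega>" using T Union_mesh by blast
  then have "y \<in> \<Omega>"
    using shared_facet_interior[OF T S y] interior_mono[of "T \<union> T'" "closure \<Omega>"] interior_closure_domain by blast
  then have "y \<notin> frontier \<Omega>" using domain(1) by (simp add: frontier_def interior_open)
  then show ?thesis using y rel_interior_subset by blast
qed

lemma boundary_parts:
  shows "closure \<Gamma>D \<subseteq> frontier \<Omega>" "closure \<Gamma>N \<subseteq> frontier \<Omega>"
  using partition by (auto simp: boundary_partition_def)

text \<open>Near a relative interior point of a boundary facet, the boundary of the domain coincides with
  that facet; the relatively open sets \<open>\<Gamma>D\<close> and \<open>\<Gamma>N\<close> then cannot both be dense in it.\<close>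

lemma facet_not_both_parts:
  assumes T: "T \<in> \<T>" and S: "S facet_of T" and N: "S \<subseteq> closure \<Gamma>N"
  shows "\<not> S \<subseteq> closure \<Gamma>D"
proof
  assume D: "S \<subseteq> closure \<Gamma>D"
  note sT = simplex[OF T]
  have Sf: "S \<subseteq> frontier \<Omega>" using N boundary_parts by blast
  obtain y where y: "y \<in> rel_interior S" by (rule facet_rel_interior[OF sT S])
  have yS: "y \<in> S" using y rel_interior_subset by blast
  have ny: "y \<notin> \<Union>(\<T> - {T})"
  proof
    assume "y \<in> \<Union>(\<T> - {T})"
    then obtain T' where T': "T' \<in> \<T>" "T' \<noteq> T" "y \<in> T'" by blast
    then have "S facet_of T'" using facet_of_meeting[OF T S y] by blast
    then show False using shared_facet_not_frontier[OF T T'(1) T'(2)[symmetric] S] Sf by blast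
  qed
  have "closed (\<Union>(\<T> - {T}))"
    using finite_mesh simplex_basics(1)[OF simplex] by (intro closed_Union) (auto simp: compact_imp_closed)
  then have "open (- \<Union>(\<T> - {T}))" by (rule open_Compl)
  then obtain e where e: "e > 0" "ball y e \<subseteq> - \<Union>(\<T> - {T})" using ny open_contains_ball by blast
  obtain d where d: "d > 0" "\<And>z. dist y z < d \<Longrightarrow> outer_normal T S \<bullet> z \<le> outer_normal T S \<bullet> y \<Longrightarrow> z \<in> T"
    by (rule simplex_half_ball[OF sT S y]) (rule that; assumption)
  obtain c where c: "\<And>y. y \<in> S \<Longrightarrow> outer_normal T S \<bullet> y = c" "\<And>x. x \<in> T \<Longrightarrow> outer_normal T S \<bullet> x \<le> c"
    by (rule facet_geometry[OF sT S]) (rule that; assumption)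
  have fS: "z \<in> S" if z: "z \<in> frontier \<Omega>" "dist y z < min d e" for z
  proof (rule ccontr)
    assume nS: "z \<notin> S"
    have "z \<in> \<Union>\<T>" using z(1) Union_mesh by (simp add: frontier_def)
    then have zT: "z \<in> T" using e(2) z(2) by auto
    have "outer_normal T S \<bullet> z < outer_normal T S \<bullet> y"
      using c(2)[OF zT] c(1)[OF yS] facet_eq_Int_hyperplane[OF sT S zT yS] nS by fastforce
    define B where "B = ball y d \<inter> {z. outer_normal T S \<bullet> z < outer_normal T S \<bullet> y}"
    have "open B" unfolding B_def by (intro open_Int open_ball open_halfspace_lt)
    moreover have "B \<subseteq> T" using d(2) by (auto simp: B_def)
    moreover have "z \<in> B" using z(2) \<open>outer_normal T S \<bullet> z < outer_normal T S \<bullet> y\<close> by (simp add: B_def)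
    ultimately have "z \<in> interior T" using interior_maximal by blast
    then have "z \<in> \<Omega>" using interior_mesh_subset[OF T] by blast
    then show False using z(1) domain(1) by (simp add: frontier_def interior_open)
  qed
  have op: "openin (top_of_set (frontier \<Omega>)) \<Gamma>D" "\<Gamma>D \<inter> \<Gamma>N = {}" "\<Gamma>N \<subseteq> frontier \<Omega>"
    using partition boundary_parts(2) closure_subset unfolding boundary_partition_def by blast+
  then obtain O' where O': "open O'" "\<Gamma>D = frontier \<Omega> \<inter> O'" by (metis openin_open)
  have "y \<in> closure \<Gamma>D" using D yS by blast
  then obtain z where z: "z \<in> \<Gamma>D" "dist z y < min d e" using d(1) e(1) unfolding closure_approachable by (meson min_less_iff_conj)
  then have "z \<in> S" using fS[of z] O'(2) by (simp add: dist_commute)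
  then have "z \<in> closure \<Gamma>N" "z \<in> O'" using N z(1) O'(2) by blast+
  then obtain w where "w \<in> \<Gamma>N" "w \<in> O'" using O'(1) open_Int_closure_eq_empty[of O' \<Gamma>N] by blast
  then show False using op(2,3) O'(2) by blast
qed

section \<open>Star-shaped patches and the common trace\<close>

text \<open>With one element the centre is an interior point, with two it is a relative interior
  point \<open>x0\<close> of the shared facet. The union need not be convex, but each half is, and
  each half is pulled towards \<open>x0\<close> separately.\<close>

lemma facet_patch:
  assumes T: "T \<in> \<T>" and S: "S facet_of T"
  obtains W x0 where "open W" "W \<subseteq> \<Omega>" "\<And>T'. T' \<in> \<T> \<Longrightarrow> S facet_of T' \<Longrightarrow> interior T' \<subseteq> W"
    "\<And>t x. 0 < t \<Longrightarrow> t < 1 \<Longrightarrow> x \<in> closure W \<Longrightarrow> x0 + t *\<^sub>R (x - x0) \<in> W"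
proof (cases "\<exists>T'. T' \<in> \<T> \<and> T' \<noteq> T \<and> S facet_of T'")
  case False
  note Tb = simplex_basics[OF simplex[OF T]]
  obtain x0 where x0: "x0 \<in> interior T" using Tb(3) by blast
  show thesis
  proof (rule that[of "interior T" x0])
    show "interior T' \<subseteq> interior T" if "T' \<in> \<T>" "S facet_of T'" for T' using False that by blast
    fix t :: real and x assume t: "0 < t" "t < 1" and x: "x \<in> closure (interior T)"
    have "x - (1 - t) *\<^sub>R (x - x0) \<in> interior T"
      by (rule mem_interior_closure_convex_shrink[OF Tb(2) x0]) (use t x closure_mono[OF interior_subset] in auto)
    then show "x0 + t *\<^sub>R (x - x0) \<in> interior T" by (simp add: algebra_simps)
  qed (use interior_mesh_subset[OF T] in auto)
next
  case True
  then obtain T' where T': "T' \<in> \<T>" "T' \<noteq> T" "S facet_of T'" by blast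
  obtain x0 where x0: "x0 \<in> rel_interior S" by (rule facet_rel_interior[OF simplex[OF T] S])
  define W where "W = interior (T \<union> T')"
  have cl: "closure W \<subseteq> T \<union> T'"
    unfolding W_def using simplex_basics(1)[OF simplex[OF T]] simplex_basics(1)[OF simplex[OF T'(1)]]
    by (intro closure_minimal interior_subset closed_Un) (auto simp: compact_imp_closed)
  have relW: "y \<in> W" if "y \<in> rel_interior S" for y
    unfolding W_def by (rule shared_facet_interior[OF T T'(1) T'(2)[symmetric] S T'(3) that])
  have star: "x0 + t *\<^sub>R (x - x0) \<in> W" if t: "0 < t" "t < 1" and R: "R \<in> {T, T'}" and x: "x \<in> R" for t x R
  proof -
    have RT: "R \<in> \<T>" and SR: "S facet_of R" using R T T' S by auto
    have RW: "interior R \<subseteq> W" unfolding W_def by (rule interior_mono) (use R in blast)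
    note Rb = simplex_basics[OF simplex[OF RT]]
    obtain d where d: "d > 0" "\<And>z. dist x0 z < d \<Longrightarrow> outer_normal R S \<bullet> z \<le> outer_normal R S \<bullet> x0 \<Longrightarrow> z \<in> R"
      by (rule simplex_half_ball[OF simplex[OF RT] SR x0]) (rule that; assumption)
    obtain c where c: "\<And>y. y \<in> S \<Longrightarrow> outer_normal R S \<bullet> y = c" "\<And>x. x \<in> R \<Longrightarrow> outer_normal R S \<bullet> x \<le> c"
      by (rule facet_geometry[OF simplex[OF RT] SR]) (rule that; assumption)
    have x0S: "x0 \<in> S" using x0 rel_interior_subset by blast
    show ?thesis
    \<comment> \<open>A point of the facet plane is pulled into the relative interior of
      \<open>S\<close>. For any other point, a point \<open>m\<close> of the segment close to
      \<open>x0\<close> is interior to the element, and convexity allows shrinking from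
      \<open>x\<close> towards \<open>m\<close>.\<close>
    proof (cases "outer_normal R S \<bullet> x = c")
      case True
      then have "x \<in> S" using facet_eq_Int_hyperplane[OF simplex[OF RT] SR x x0S] c(1)[OF x0S] by simp
      then have "x - (1 - t) *\<^sub>R (x - x0) \<in> rel_interior S"
        using S t x0 closure_subset by (intro rel_interior_closure_convex_shrink) (auto simp: facet_of_def face_of_imp_convex)
      then show ?thesis using relW by (simp add: algebra_simps)
    next
      case False
      then have lt: "outer_normal R S \<bullet> x < outer_normal R S \<bullet> x0" using c(2)[OF x] c(1)[OF x0S] by simp
      \<comment> \<open>Below \<open>t\<close>, so that the target lies between \<open>m\<close> and
        \<open>x\<close>; small enough for \<open>m\<close> to lie in the half ball about
        \<open>x0\<close>.\<close>
      define s where "s = min (t / 2) (d / (2 * (norm (x - x0) + 1)))"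
      have s: "0 < s" "s < t" "s \<le> d / (2 * (norm (x - x0) + 1))" using t d(1) by (auto simp: s_def add_nonneg_pos)
      define m where "m = x0 + s *\<^sub>R (x - x0)"
      have "norm (s *\<^sub>R (x - x0)) = s * norm (x - x0)" using s by simp
      also have "\<dots> \<le> d / (2 * (norm (x - x0) + 1)) * norm (x - x0)"
        by (intro mult_right_mono s(3)) simp
      also have "\<dots> < d"
      proof -
        define N where "N = norm (x - x0)"
        have N0: "0 \<le> N" by (simp add: N_def)
        then have "d * N < d * (2 * (N + 1))" using d(1) by (intro mult_strict_left_mono) simp_all
        moreover have "0 < 2 * (N + 1)" using N0 by simp
        ultimately show ?thesis unfolding N_def[symmetric] by (simp only: times_divide_eq_left pos_divide_less_eq)
      qed
      finally have md: "dist x0 m < d" by (simp add: m_def dist_norm)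
      have mn: "outer_normal R S \<bullet> m < outer_normal R S \<bullet> x0"
        using lt s(1) by (simp add: m_def inner_add_right inner_diff_right mult_pos_neg)
      define B where "B = ball x0 d \<inter> {z. outer_normal R S \<bullet> z < outer_normal R S \<bullet> x0}"
      have "open B" unfolding B_def by (intro open_Int open_ball open_halfspace_lt)
      moreover have "B \<subseteq> R" using d(2) by (auto simp: B_def)
      moreover have "m \<in> B" using md mn by (simp add: B_def)
      ultimately have mi: "m \<in> interior R" using interior_maximal by blast
      \<comment> \<open>Shrinking from \<open>x\<close> towards \<open>m\<close> by this factor
        lands exactly on the target \<open>x0 + t (x - x0)\<close>.\<close>
      define e where "e = (1 - t) / (1 - s)"
      have e: "0 < e" "e \<le> 1" using s t by (auto simp: e_def field_simps)
      have "x - e *\<^sub>R (x - m) \<in> interior R" by (rule mem_interior_convex_shrink[OF Rb(2) mi x e])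
      moreover have "x - e *\<^sub>R (x - m) = x0 + t *\<^sub>R (x - x0)"
      proof -
        have "x - m = (1 - s) *\<^sub>R (x - x0)" by (simp add: m_def algebra_simps)
        then have "e *\<^sub>R (x - m) = (1 - t) *\<^sub>R (x - x0)" using s t by (simp add: e_def)
        then show ?thesis by (simp add: algebra_simps)
      qed
      ultimately show ?thesis using RW by auto
    qed
  qed
  show thesis
  proof (rule that[of W x0])
    show "open W" by (simp add: W_def)
    have "T \<union> T' \<subseteq> closure \<Omega>" using T T' Union_mesh by blast
    then show "W \<subseteq> \<Omega>" unfolding W_def using interior_mono[of "T \<union> T'" "closure \<Omega>"] interior_closure_domain by simp
    show "interior T'' \<subseteq> W" if "T'' \<in> \<T>" "S facet_of T''" for T''
    proof -
      have "T'' = T \<or> T'' = T'" using facet_at_most_two[OF T T'(1) that(1) S T'(3) that(2)] T'(2) by blast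
      then show ?thesis by (auto simp: W_def intro: interior_mono[THEN subsetD])
    qed
    show "x0 + t *\<^sub>R (x - x0) \<in> W" if "0 < t" "t < 1" "x \<in> closure W" for t x
      using star[OF that(1,2)] cl that(3) by blast
  qed
qed

text \<open>One approximating sequence on the patch yields one trace, valid from both sides. This
  single-valuedness is what puts the interpolant into \<open>CR\<close>.\<close>

lemma common_trace:
  assumes T: "T \<in> \<T>" and S: "S facet_of T" and v: "v \<in> H1 \<Omega>"
  obtains g where "\<And>T'. T' \<in> \<T> \<Longrightarrow> S facet_of T' \<Longrightarrow> has_trace (interior T') v S g"
proof -
  obtain W x0 where W: "open W" "W \<subseteq> \<Omega>" "\<And>T'. T' \<in> \<T> \<Longrightarrow> S facet_of T' \<Longrightarrow> interior T' \<subseteq> W"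
    "\<And>t x. 0 < t \<Longrightarrow> t < 1 \<Longrightarrow> x \<in> closure W \<Longrightarrow> x0 + t *\<^sub>R (x - x0) \<in> W"
    by (rule facet_patch[OF T S]) (rule that; assumption)
  have Wb: "bounded W" using W(2) domain(2) bounded_subset by blast
  note vW = H1_restrict(1)[OF domain(1,2) W(1,2) v]
  obtain \<phi> :: "nat \<Rightarrow> 'a \<Rightarrow> real" where p: "\<And>n. smooth (\<phi> n)"
    "(\<lambda>n. L2_norm (lebesgue_on W) (\<lambda>x. \<phi> n x - v x)) \<longlonglongrightarrow> 0"
    "(\<lambda>n. L2_norm (lebesgue_on W) (\<lambda>x. gradient (\<phi> n) x - grad W v x)) \<longlonglongrightarrow> 0"
    by (rule H1_smooth_approximation[OF W(1) Wb _ H1_D1[OF vW] H1_grad[OF vW]], erule (2) W(4), rule that; assumption)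
  obtain g where g: "has_trace W v S g"
    by (rule trace_exists[OF simplex[OF T] S W(3)[OF T S] W(1) Wb vW p])
  show thesis
    using that has_trace_restrict[OF W(1) Wb open_interior W(3) g] by blast
qed

end

subsection \<open>Affine functions on a simplex\<close>

lemma affine_map_realE:
  fixes p :: "'a::euclidean_space \<Rightarrow> real"
  assumes "affine_map p"
  obtains c g where "p = (\<lambda>x. c + g \<bullet> x)"
proof -
  obtain c l where l: "linear l" "p = (\<lambda>x. c + l x)" using assms unfolding affine_map_def by blast
  have lx: "l x = (\<Sum>b\<in>Basis. l b *\<^sub>R b) \<bullet> x" for x
  proof -
    have "l x = l (\<Sum>b\<in>Basis. (x \<bullet> b) *\<^sub>R b)" by (simp add: euclidean_representation)
    also have "\<dots> = (\<Sum>b\<in>Basis. (x \<bullet> b) * l b)" using l(1) by (simp add: linear_sum linear_cmul)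
    also have "\<dots> = (\<Sum>b\<in>Basis. l b *\<^sub>R b) \<bullet> x" by (simp add: inner_sum_left inner_commute[of x] mult.commute)
    finally show ?thesis .
  qed
  have "p = (\<lambda>x. c + (\<Sum>b\<in>Basis. l b *\<^sub>R b) \<bullet> x)"
    unfolding l(2) by (rule ext) (subst lx, rule refl)
  then show thesis by (rule that)
qed

lemma affine_map_realI: "affine_map (\<lambda>x. c + g \<bullet> (x::'a::euclidean_space))"
  unfolding affine_map_def
  by (intro exI[of _ c] exI[of _ "\<lambda>x. g \<bullet> x"]) (auto intro: bounded_linear.linear bounded_linear_inner_right)

lemma affine_map_C1:
  fixes p :: "'a::euclidean_space \<Rightarrow> real"
  assumes "affine_map p"
  shows "C1 p" "gradient p x = gradient p y"
proof -
  obtain c g where p: "p = (\<lambda>x. c + g \<bullet> x)" by (rule affine_map_realE[OF assms])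
  show "C1 p" "gradient p x = gradient p y" unfolding p by (simp_all add: C1_affine)
qed

lemma affine_map_const: "affine_map (\<lambda>x. k)"
  unfolding affine_map_def by (intro exI[of _ k] exI[of _ "\<lambda>x. 0"]) (auto simp: linear_zero)

lemma affine_map_combination:
  assumes "affine_map p" "affine_map q" shows "affine_map (\<lambda>x. p x + a *\<^sub>R q x)"
proof -
  obtain c l c' l' where *: "linear l" "p = (\<lambda>x. c + l x)" "linear l'" "q = (\<lambda>x. c' + l' x)"
    using assms unfolding affine_map_def by blast
  show ?thesis
    unfolding affine_map_def
    by (intro exI[of _ "c + a *\<^sub>R c'"] exI[of _ "\<lambda>x. l x + a *\<^sub>R l' x"])
      (auto simp: *(2,4) algebra_simps intro!: linear_compose_add linear_compose_scale_right *)
qed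

lemma affine_map_component:
  assumes "affine_map (r :: 'a::euclidean_space \<Rightarrow> 'b::euclidean_space)" shows "affine_map (\<lambda>x. r x \<bullet> b)"
proof -
  obtain c l where *: "linear l" "r = (\<lambda>x. c + l x)" using assms unfolding affine_map_def by blast
  have "linear (\<lambda>x. l x \<bullet> b)" using *(1) by (auto simp: linear_iff inner_add_left)
  then show ?thesis
    unfolding affine_map_def by (intro exI[of _ "c \<bullet> b"] exI[of _ "\<lambda>x. l x \<bullet> b"]) (simp add: *(2) inner_add_left)
qed

lemma affine_map_continuous:
  fixes r :: "'a::euclidean_space \<Rightarrow> 'b::euclidean_space"
  assumes "affine_map r" shows "continuous_on A r"
proof -
  obtain c l where *: "linear l" "r = (\<lambda>x. c + l x)" using assms unfolding affine_map_def by blast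
  show ?thesis unfolding *(2) by (intro continuous_intros linear_continuous_on) (simp add: *(1) linear_linear)
qed

text \<open>The difference is affine and vanishes on a ball; a short segment from the centre towards
  any point determines the linear part in that direction. This makes the description operator in
  \<open>piece\<close> meaningful.\<close>

lemma affine_map_unique:
  fixes p q :: "'a::euclidean_space \<Rightarrow> 'b::euclidean_space"
  assumes p: "affine_map p" and q: "affine_map q" and U: "open U" "U \<noteq> {}" and eq: "\<And>x. x \<in> U \<Longrightarrow> p x = q x"
  shows "p = q"
proof
  fix y
  have "affine_map (\<lambda>x. p x + (-1) *\<^sub>R q x)" by (rule affine_map_combination[OF p q])
  then obtain c l where l: "linear l" "(\<lambda>x. p x + (-1) *\<^sub>R q x) = (\<lambda>x. c + l x)" unfolding affine_map_def by blast
  have pq: "p x - q x = c + l x" for x using fun_cong[OF l(2), of x] by simp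
  obtain x0 where x0: "x0 \<in> U" using U by blast
  obtain e where e: "e > 0" "ball x0 e \<subseteq> U" using U(1) x0 open_contains_ball by blast
  define t where "t = e / (2 * (norm (y - x0) + 1))"
  have t: "t > 0" using e by (simp add: t_def add_nonneg_pos)
  have "norm (t *\<^sub>R (y - x0)) < e"
  proof -
    have "norm (t *\<^sub>R (y - x0)) = e * (norm (y - x0) / (2 * (norm (y - x0) + 1)))"
      using t e by (simp add: t_def)
    also have "\<dots> < e * 1"
    proof (intro mult_strict_left_mono e)
      have "N / (2 * (N + 1)) < 1" if "0 \<le> N" for N :: real using that by (simp add: field_simps)
      then show "norm (y - x0) / (2 * (norm (y - x0) + 1)) < 1" using norm_ge_zero[of "y - x0"] by blast
    qed
    finally show ?thesis by simp
  qed
  then have z: "x0 + t *\<^sub>R (y - x0) \<in> U" using e(2) by (auto simp: dist_norm)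
  have "c + l x0 = 0" using pq[of x0] eq[OF x0] by simp
  moreover have "c + l (x0 + t *\<^sub>R (y - x0)) = 0" using pq[of "x0 + t *\<^sub>R (y - x0)"] eq[OF z] by simp
  moreover have "c + l (x0 + t *\<^sub>R (y - x0)) = (c + l x0) + t *\<^sub>R l (y - x0)"
    using l(1) by (simp add: linear_add linear_cmul)
  ultimately have "t *\<^sub>R l (y - x0) = 0" by simp
  then have "l y = l x0" using t l(1) by (simp add: linear_diff)
  then show "p y = q y" using pq[of y] \<open>c + l x0 = 0\<close> by simp
qed

text \<open>The divergence of an affine field is constant; evaluation at 0 is an arbitrary
  choice.\<close>

definition affine_div :: "('a::euclidean_space \<Rightarrow> 'a) \<Rightarrow> real" where
  "affine_div r = (\<Sum>b\<in>Basis. gradient (\<lambda>x. r x \<bullet> b) 0 \<bullet> b)"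

lemma affine_div_const: "affine_div (\<lambda>x. k) = 0"
  by (simp add: affine_div_def C1_const(2))

lemma facet_integrable:
  assumes T: "int DIM('a) simplex (T :: 'a::euclidean_space set)" and S: "S facet_of T"
    and f: "continuous_on UNIV (f :: 'a \<Rightarrow> real)"
  shows "integrable (surface_measure S) f"
  by (rule L2_integrable[OF facet_surface_measure(1)[OF T S] facet_surface_measure(6)[OF T S f]])

text \<open>The scalar theorem is applied to \<open>\<phi>\<close> times each component of
  \<open>r\<close> in the matching direction, and the product rule separates
  \<open>r x \<bullet> gradient \<phi> x\<close> from the constant divergence.\<close>

lemma simplex_affine_divergence:
  fixes T :: "'a::euclidean_space set"
  assumes T: "int DIM('a) simplex T" and r: "affine_map r" and phi: "C1 \<phi>"
  shows "(LINT x|lebesgue_on T. r x \<bullet> gradient \<phi> x + affine_div r * \<phi> x) =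
    (\<Sum>S | S facet_of T. LINT y|surface_measure S. (r y \<bullet> outer_normal T S) * \<phi> y)"
proof -
  have cT: "compact T" by (rule simplex_basics(1)[OF T])
  note rb = affine_map_C1[OF affine_map_component[OF r]]
  have C: "C1 (\<lambda>x. \<phi> x * (r x \<bullet> b))" for b by (rule C1_mult(1)[OF phi rb(1)])
  have int: "integrable (lebesgue_on T) (\<lambda>x. gradient (\<lambda>x. \<phi> x * (r x \<bullet> b)) x \<bullet> b)" for b
    by (intro integrable_lebesgue_on_compact cT continuous_intros C1_continuous_gradient C)
  have "(LINT x|lebesgue_on T. r x \<bullet> gradient \<phi> x + affine_div r * \<phi> x)
    = (LINT x|lebesgue_on T. (\<Sum>b\<in>Basis. gradient (\<lambda>x. \<phi> x * (r x \<bullet> b)) x \<bullet> b))"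
  proof (rule Bochner_Integration.integral_cong[OF refl])
    fix x
    have "gradient (\<lambda>x. \<phi> x * (r x \<bullet> b)) x \<bullet> b = \<phi> x * (gradient (\<lambda>x. r x \<bullet> b) 0 \<bullet> b) + (r x \<bullet> b) * (gradient \<phi> x \<bullet> b)" for b
      using rb(2)[of b x 0] by (simp add: C1_mult(2)[OF phi rb(1)] inner_add_left)
    then have "(\<Sum>b\<in>Basis. gradient (\<lambda>x. \<phi> x * (r x \<bullet> b)) x \<bullet> b)
       = \<phi> x * affine_div r + (\<Sum>b\<in>Basis. (r x \<bullet> b) * (gradient \<phi> x \<bullet> b))"
      by (simp add: sum.distrib affine_div_def sum_distrib_left)
    also have "(\<Sum>b\<in>Basis. (r x \<bullet> b) * (gradient \<phi> x \<bullet> b)) = r x \<bullet> gradient \<phi> x"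
      by (rule euclidean_inner[symmetric])
    finally show "r x \<bullet> gradient \<phi> x + affine_div r * \<phi> x = (\<Sum>b\<in>Basis. gradient (\<lambda>x. \<phi> x * (r x \<bullet> b)) x \<bullet> b)"
      by (simp add: mult.commute)
  qed
  also have "\<dots> = (\<Sum>b\<in>Basis. LINT x|lebesgue_on T. gradient (\<lambda>x. \<phi> x * (r x \<bullet> b)) x \<bullet> b)"
    by (rule Bochner_Integration.integral_sum[OF int])
  also have "\<dots> = (\<Sum>b\<in>Basis. \<Sum>S | S facet_of T. (outer_normal T S \<bullet> b) * (LINT y|surface_measure S. \<phi> y * (r y \<bullet> b)))"
    by (simp add: simplex_divergence[OF T C])
  also have "\<dots> = (\<Sum>S | S facet_of T. \<Sum>b\<in>Basis. (outer_normal T S \<bullet> b) * (LINT y|surface_measure S. \<phi> y * (r y \<bullet> b)))"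
    by (rule sum.swap)
  also have "\<dots> = (\<Sum>S | S facet_of T. LINT y|surface_measure S. (r y \<bullet> outer_normal T S) * \<phi> y)"
  proof (rule sum.cong[OF refl])
    fix S assume "S \<in> {S. S facet_of T}"
    then have S: "S facet_of T" by simp
    have i: "integrable (surface_measure S) (\<lambda>y. (outer_normal T S \<bullet> b) * (\<phi> y * (r y \<bullet> b)))" for b
      by (intro integrable_mult_right facet_integrable[OF T S] C1_continuous C)
    have "(LINT y|surface_measure S. (r y \<bullet> outer_normal T S) * \<phi> y)
      = (LINT y|surface_measure S. (\<Sum>b\<in>Basis. (outer_normal T S \<bullet> b) * (\<phi> y * (r y \<bullet> b))))"
    proof (rule Bochner_Integration.integral_cong[OF refl])
      fix y
      have "r y \<bullet> outer_normal T S = (\<Sum>b\<in>Basis. (r y \<bullet> b) * (outer_normal T S \<bullet> b))"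
        by (rule euclidean_inner)
      then show "(r y \<bullet> outer_normal T S) * \<phi> y = (\<Sum>b\<in>Basis. (outer_normal T S \<bullet> b) * (\<phi> y * (r y \<bullet> b)))"
        by (simp add: sum_distrib_right sum_distrib_left mult_ac)
    qed
    also have "\<dots> = (\<Sum>b\<in>Basis. LINT y|surface_measure S. (outer_normal T S \<bullet> b) * (\<phi> y * (r y \<bullet> b)))"
      by (rule Bochner_Integration.integral_sum[OF i])
    finally show "(\<Sum>b\<in>Basis. (outer_normal T S \<bullet> b) * (LINT y|surface_measure S. \<phi> y * (r y \<bullet> b)))
      = (LINT y|surface_measure S. (r y \<bullet> outer_normal T S) * \<phi> y)" by simp
  qed
  finally show ?thesis .
qed

text \<open>The cone formula applied to the barycentric coordinate \<open>\<lambda>\<close> of a vertex \<open>a\<close> shows that \<open>\<lambda>\<close> has mean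
  \<open>1 / d\<close> on each facet containing \<open>a\<close>; hence \<open>1 - d \<lambda>\<close> has mean \<open>0\<close> there and mean \<open>1\<close> on the facet
  opposite to \<open>a\<close>.\<close>

lemma facet_basis_function:
  fixes T :: "'a::euclidean_space set"
  assumes T: "int DIM('a) simplex T" and S: "S facet_of T"
  obtains p where "affine_map p" "average (surface_measure S) p = (1::real)"
    "\<And>S'. S' facet_of T \<Longrightarrow> S' \<noteq> S \<Longrightarrow> average (surface_measure S') p = 0"
proof -
  obtain C where C: "\<not> affine_dependent C" "finite C" "card C = Suc DIM('a)" and TC: "T = convex hull C"
    using simplex_vertices[OF T] .
  obtain a where a: "a \<in> C" and Sa: "S = convex hull (C - {a})"
    using S facet_of_simplex[OF C(1,3)] unfolding TC by blast
  let ?M = "lebesgue_on T" and ?d = "real DIM('a)"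
  obtain c h where ch: "h > 0" "outer_normal T S \<bullet> a = c - h" "\<And>y. y \<in> C - {a} \<Longrightarrow> outer_normal T S \<bullet> y = c"
    "\<And>\<phi>. C1 \<phi> \<Longrightarrow> (LINT x|?M. ?d * \<phi> x + (x - a) \<bullet> gradient \<phi> x) = h * (LINT y|surface_measure S. \<phi> y)"
    by (rule simplex_vertex_divergence[OF C(1,3) a, folded TC, folded Sa]) (rule that; assumption)
  have Sc: "outer_normal T S \<bullet> y = c" if "y \<in> S" for y
  proof -
    have "C - {a} \<subseteq> {x. outer_normal T S \<bullet> x = c}" using ch(3) by blast
    then have "S \<subseteq> {x. outer_normal T S \<bullet> x = c}" unfolding Sa by (intro hull_minimal convex_hyperplane)
    then show ?thesis using that by blast
  qed
  \<comment> \<open>With this slope \<open>l x\<close> is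
    \<open>(c - outer_normal T S \<bullet> x) / h\<close>, the barycentric coordinate of
    \<open>a\<close>: 1 at \<open>a\<close> and 0 on the opposite facet.\<close>
  define g where "g = - outer_normal T S /\<^sub>R h"
  define l where "l = (\<lambda>x. c / h + g \<bullet> x)"
  have la: "affine_map l" unfolding l_def by (rule affine_map_realI)
  have lC1: "C1 l" and lg: "gradient l = (\<lambda>x. g)" unfolding l_def by (simp_all add: C1_affine)
  have l1: "l a = 1" using ch(1) by (simp add: l_def g_def ch(2) field_simps)
  have l0: "l y = 0" if "outer_normal T S \<bullet> y = c" for y using that by (simp add: l_def g_def divide_inverse)
  have diff: "(x - y) \<bullet> g = l x - l y" for x y by (simp add: l_def inner_diff_left inner_commute[of g])
  define I where "I = (LINT x|?M. l x)"
  define V where "V = measure ?M T"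
  have cT: "compact T" by (rule simplex_basics(1)[OF T])
  have il: "integrable ?M l" by (intro integrable_lebesgue_on_compact cT C1_continuous lC1)
  have fin: "finite_measure ?M" by (rule simplex_basics(8)[OF T])
  have i1: "integrable ?M (\<lambda>x. k)" for k :: real using finite_measure.integrable_const[OF fin] .
  have "h * (LINT y|surface_measure S. l y) = (LINT x|?M. ?d * l x + (x - a) \<bullet> gradient l x)"
    using ch(4)[OF lC1] by simp
  also have "\<dots> = (LINT x|?M. (?d + 1) * l x - 1)"
  proof (rule Bochner_Integration.integral_cong[OF refl])
    fix x
    have "(x - a) \<bullet> gradient l x = l x - 1" by (simp only: lg diff l1)
    then show "?d * l x + (x - a) \<bullet> gradient l x = (?d + 1) * l x - 1" by (simp only: distrib_right)
  qed
  also have "\<dots> = (?d + 1) * I - V" using il i1 by (simp add: I_def V_def)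
  also have "(LINT y|surface_measure S. l y) = (LINT y|surface_measure S. 0)"
    by (rule Bochner_Integration.integral_cong[OF refl]) (use l0 Sc facet_surface_measure(2)[OF T S] in auto)
  \<comment> \<open>Since \<open>l\<close> vanishes on \<open>S\<close>, the cone formula at
    \<open>a\<close> says that \<open>l\<close> has mean \<open>1 / (d + 1)\<close> over
    \<open>T\<close>.\<close>
  finally have IV: "(?d + 1) * I = V" by simp
  define p where "p = (\<lambda>x. 1 - ?d * l x)"
  have pC1: "C1 p" unfolding p_def by (intro C1_diff C1_mult C1_const lC1)
  have pa: "affine_map p"
    using affine_map_combination[OF affine_map_const[of 1] la, of "- ?d"] by (simp add: p_def)
  show thesis
  proof (rule that[OF pa])
    note Sb = facet_surface_measure[OF T S]
    have "(LINT y|surface_measure S. p y) = (LINT y|surface_measure S. 1)"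
      by (rule Bochner_Integration.integral_cong[OF refl]) (use l0 Sc Sb(2) in \<open>auto simp: p_def\<close>)
    then show "average (surface_measure S) p = 1" using Sb(2,3) by (simp add: average_def)
    fix S' assume S': "S' facet_of T" "S' \<noteq> S"
    obtain b where b: "b \<in> C" and Sb': "S' = convex hull (C - {b})"
      using S' facet_of_simplex[OF C(1,3)] unfolding TC by blast
    have ba: "b \<in> C - {a}" using b S'(2) Sb' Sa by blast
    then have lb: "l b = 0" using ch(3) l0 by blast
    obtain h' where h': "h' > 0"
      "\<And>\<phi>. C1 \<phi> \<Longrightarrow> (LINT x|?M. ?d * \<phi> x + (x - b) \<bullet> gradient \<phi> x) = h' * (LINT y|surface_measure S'. \<phi> y)"
      by (rule simplex_vertex_divergence[OF C(1,3) b, folded TC, folded Sb']) (rule that; assumption)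
    have "h' * (LINT y|surface_measure S'. p y) = (LINT x|?M. ?d * p x + (x - b) \<bullet> gradient p x)"
      using h'(2)[OF pC1] by simp
    also have "\<dots> = (LINT x|?M. ?d - ?d * ((?d + 1) * l x))"
    proof (rule Bochner_Integration.integral_cong[OF refl])
      fix x
      have "gradient p x = - ?d *\<^sub>R g"
        unfolding p_def
        by (simp add: C1_diff(2)[OF C1_const(1) C1_mult(1)[OF C1_const(1) lC1]] C1_mult(2)[OF C1_const(1) lC1] C1_const(2) lg)
      then have "(x - b) \<bullet> gradient p x = - ?d * l x" by (simp add: diff lb)
      then show "?d * p x + (x - b) \<bullet> gradient p x = ?d - ?d * ((?d + 1) * l x)"
        by (simp add: p_def algebra_simps)
    qed
    also have "\<dots> = ?d * V - ?d * ((?d + 1) * I)" using il i1 by (simp add: I_def V_def)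
    also have "\<dots> = 0" using IV by simp
    finally show "average (surface_measure S') p = 0" using h'(1) by (simp add: average_def)
  qed
qed

text \<open>Superposition of the facet basis functions: facet means can be prescribed freely, which
  is the existence half of Crouzeix-Raviart unisolvence.\<close>

lemma affine_with_facet_means:
  fixes T :: "'a::euclidean_space set" and m :: "'a set \<Rightarrow> real"
  assumes T: "int DIM('a) simplex T"
  obtains p where "affine_map p" "\<And>S. S facet_of T \<Longrightarrow> average (surface_measure S) p = m S"
proof -
  define Q where "Q = (\<lambda>S p. S facet_of T \<longrightarrow> (affine_map p \<and> average (surface_measure S) p = (1::real) \<and>
      (\<forall>S'. S' facet_of T \<longrightarrow> S' \<noteq> S \<longrightarrow> average (surface_measure S') p = 0)))"
  have "\<forall>S. \<exists>p. Q S p"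
  proof
    fix S show "\<exists>p. Q S p"
    proof (cases "S facet_of T")
      case True
      show ?thesis by (rule facet_basis_function[OF T True]) (use Q_def in blast)
    qed (simp add: Q_def)
  qed
  from choice[OF this] obtain p where "\<forall>S. Q S (p S)" by blast
  then have p: "\<And>S. S facet_of T \<Longrightarrow> affine_map (p S)" "\<And>S. S facet_of T \<Longrightarrow> average (surface_measure S) (p S) = (1::real)"
    "\<And>S S'. S facet_of T \<Longrightarrow> S' facet_of T \<Longrightarrow> S' \<noteq> S \<Longrightarrow> average (surface_measure S') (p S) = 0"
    unfolding Q_def by blast+
  let ?F = "{S. S facet_of T}"
  have fin: "finite ?F" by (rule finite_facets[OF T])
  define P where "P = (\<lambda>x. \<Sum>S\<in>?F. m S *\<^sub>R p S x)"
  have aff: "affine_map (\<lambda>x. \<Sum>S\<in>G. m S *\<^sub>R p S x)" if "finite G" "G \<subseteq> ?F" for G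
    using that
  proof (induction G rule: finite_induct)
    case empty then show ?case using affine_map_const[of 0] by simp
  next
    case (insert S G)
    then show ?case using affine_map_combination[OF _ p(1)[of S], of "\<lambda>x. \<Sum>S\<in>G. m S *\<^sub>R p S x" "m S"]
      by (simp add: add.commute)
  qed
  show thesis
  proof (rule that[of P])
    show "affine_map P" unfolding P_def by (rule aff[OF fin]) simp
    fix S assume S: "S facet_of T"
    have "(LINT y|surface_measure S. P y) = (\<Sum>S'\<in>?F. LINT y|surface_measure S. m S' *\<^sub>R p S' y)"
      unfolding P_def
      by (rule Bochner_Integration.integral_sum)
        (auto intro!: integrable_mult_right facet_integrable[OF T S] affine_map_continuous p)
    then have "average (surface_measure S) P = (\<Sum>S'\<in>?F. m S' * average (surface_measure S) (p S'))"
      by (simp add: average_def sum_distrib_left mult_ac)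
    also have "\<dots> = (\<Sum>S'\<in>?F. if S' = S then m S else 0)"
      by (rule sum.cong) (use p S in auto)
    also have "\<dots> = m S" using fin S by simp
    finally show "average (surface_measure S) P = m S" .
  qed
qed

subsection \<open>Piecewise affine and piecewise constant functions\<close>

text \<open>Common normal form of \<open>Pi_h\<close>, and of \<open>nabla_h\<close> on
  \<open>P1\<close> functions, with value 0 on the skeleton and outside the mesh. Both reduce to it
  as functions and not merely almost everywhere.\<close>

definition pw_const :: "'a::euclidean_space set set \<Rightarrow> ('a set \<Rightarrow> 'b::euclidean_space) \<Rightarrow> 'a \<Rightarrow> 'b" where
  "pw_const \<T> k x = (\<Sum>T\<in>\<T>. indicator (interior T) x *\<^sub>R k T)"

definition slope :: "'a::euclidean_space set \<Rightarrow> ('a \<Rightarrow> real) \<Rightarrow> 'a" where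
  "slope T v = gradient (piece T v) 0"

text \<open>Evaluated at an arbitrary point of \<open>S\<close>; for Raviart-Thomas fields the
  normal component is constant there.\<close>

definition flux :: "('a::euclidean_space \<Rightarrow> 'a) \<Rightarrow> 'a set \<Rightarrow> 'a set \<Rightarrow> real" where
  "flux r T S = piece T r (SOME y. y \<in> S) \<bullet> outer_normal T S"

lemma piece_eqI:
  fixes p :: "'a::euclidean_space \<Rightarrow> 'b::euclidean_space"
  assumes "affine_map p" "interior T \<noteq> {}" "\<And>x. x \<in> interior T \<Longrightarrow> v x = p x"
  shows "piece T v = p"
  unfolding piece_def
proof (rule the_equality)
  show "affine_map p \<and> (\<forall>x\<in>interior T. v x = p x)" using assms by blast
  fix q assume q: "affine_map q \<and> (\<forall>x\<in>interior T. v x = q x)"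
  show "q = p" by (rule affine_map_unique[OF _ assms(1) open_interior assms(2)]) (use q assms(3) in auto)
qed

lemma Pi_h_eq_pw_const: "Pi_h \<T> v = pw_const \<T> (\<lambda>T. average (lebesgue_on T) v)"
  by (auto simp: Pi_h_def pw_const_def)

lemma lebesgue_on_measurable_AE:
  fixes f :: "'a::euclidean_space \<Rightarrow> 'b::euclidean_space"
  assumes U: "U \<in> sets lebesgue" and f: "f \<in> borel_measurable (lebesgue_on U)" and ae: "AE x in lebesgue_on U. f x = g x"
  shows "g \<in> borel_measurable (lebesgue_on U)"
proof -
  have "(\<lambda>x. indicator U x *\<^sub>R f x) \<in> borel_measurable lebesgue"
    using f U by (subst borel_measurable_restrict_space_iff[symmetric]) auto
  moreover have "AE x in lebesgue. indicator U x *\<^sub>R f x = indicator U x *\<^sub>R g x"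
    using ae U by (subst (asm) AE_restrict_space_iff) (auto elim!: eventually_mono simp: indicator_def)
  ultimately have "(\<lambda>x. indicator U x *\<^sub>R g x) \<in> borel_measurable lebesgue" by (rule borel_measurable_AE)
  then show ?thesis using U by (subst borel_measurable_restrict_space_iff) auto
qed

lemma average_combination:
  fixes T :: "'a::euclidean_space set" and f g :: "'a \<Rightarrow> real"
  assumes T: "int DIM('a) simplex T" and S: "S facet_of T" and "continuous_on UNIV f" "continuous_on UNIV g"
  shows "average (surface_measure S) (\<lambda>x. f x + c * g x) = average (surface_measure S) f + c * average (surface_measure S) g"
  using facet_integrable[OF T S assms(3)] facet_integrable[OF T S assms(4)]
  by (simp add: average_def algebra_simps)

context simplicial_triangulation
begin

lemma mesh_interior: "T \<in> \<T> \<Longrightarrow> interior T \<noteq> {}"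
  using simplex_basics(3)[OF simplex] .

lemma pw_const_interior: "T \<in> \<T> \<Longrightarrow> x \<in> interior T \<Longrightarrow> pw_const \<T> k x = k T"
  unfolding pw_const_def by (rule element_sum)

lemma AE_elementsI:
  assumes "\<And>T x. T \<in> \<T> \<Longrightarrow> x \<in> interior T \<Longrightarrow> P x" shows "AE x in lebesgue_on \<Omega>. P x"
  using AE_in_element by eventually_elim (use assms in blast)

lemma P1_piece:
  fixes v :: "'a \<Rightarrow> 'b::euclidean_space"
  assumes "v \<in> P1 \<T>" "T \<in> \<T>"
  shows "affine_map (piece T v)" "x \<in> interior T \<Longrightarrow> v x = piece T v x"
proof -
  obtain p where p: "affine_map p" "\<forall>x\<in>interior T. v x = p x" using assms unfolding P1_def by blast
  then have "piece T v = p" using piece_eqI[OF p(1) mesh_interior[OF assms(2)]] by blast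
  then show "affine_map (piece T v)" "x \<in> interior T \<Longrightarrow> v x = piece T v x" using p by auto
qed

lemma P1_combination:
  fixes v w :: "'a \<Rightarrow> 'b::euclidean_space"
  assumes v: "v \<in> P1 \<T>" and w: "w \<in> P1 \<T>"
  shows "(\<lambda>x. v x + c *\<^sub>R w x) \<in> P1 \<T>"
    "T \<in> \<T> \<Longrightarrow> piece T (\<lambda>x. v x + c *\<^sub>R w x) = (\<lambda>x. piece T v x + c *\<^sub>R piece T w x)"
proof -
  have a: "affine_map (\<lambda>x. piece T v x + c *\<^sub>R piece T w x)" if "T \<in> \<T>" for T
    by (intro affine_map_combination P1_piece(1) v w that)
  show "(\<lambda>x. v x + c *\<^sub>R w x) \<in> P1 \<T>"
    unfolding P1_def
  proof (intro CollectI ballI)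
    fix T assume T: "T \<in> \<T>"
    show "\<exists>p. affine_map p \<and> (\<forall>x\<in>interior T. v x + c *\<^sub>R w x = p x)"
      using a[OF T] P1_piece(2)[OF v T] P1_piece(2)[OF w T] by (intro exI conjI) auto
  qed
  show "piece T (\<lambda>x. v x + c *\<^sub>R w x) = (\<lambda>x. piece T v x + c *\<^sub>R piece T w x)" if T: "T \<in> \<T>"
    by (rule piece_eqI[OF a[OF T] mesh_interior[OF T]]) (simp add: P1_piece(2)[OF v T] P1_piece(2)[OF w T])
qed

lemma P1_of_pieces:
  fixes p :: "'a set \<Rightarrow> 'a \<Rightarrow> 'b::euclidean_space"
  assumes p: "\<And>T. T \<in> \<T> \<Longrightarrow> affine_map (p T)"
  shows "(\<lambda>x. \<Sum>T\<in>\<T>. indicator (interior T) x *\<^sub>R p T x) \<in> P1 \<T>"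
    "T \<in> \<T> \<Longrightarrow> piece T (\<lambda>x. \<Sum>T\<in>\<T>. indicator (interior T) x *\<^sub>R p T x) = p T"
proof -
  have e: "(\<Sum>T\<in>\<T>. indicator (interior T) x *\<^sub>R p T x) = p T x" if "T \<in> \<T>" "x \<in> interior T" for T x
    by (rule element_sum[OF that, of "\<lambda>T. p T x"])
  show "(\<lambda>x. \<Sum>T\<in>\<T>. indicator (interior T) x *\<^sub>R p T x) \<in> P1 \<T>"
    unfolding P1_def using p e by blast
  show "piece T (\<lambda>x. \<Sum>T\<in>\<T>. indicator (interior T) x *\<^sub>R p T x) = p T" if "T \<in> \<T>"
    by (rule piece_eqI[OF p[OF that] mesh_interior[OF that]]) (rule e[OF that])
qed

lemma pw_const_P1:
  "pw_const \<T> k \<in> P1 \<T>" "T \<in> \<T> \<Longrightarrow> piece T (pw_const \<T> k) = (\<lambda>x. k T)"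
  using P1_of_pieces[of "\<lambda>T x. k T"] affine_map_const unfolding pw_const_def[abs_def] by auto

lemma P1_L2:
  fixes v :: "'a \<Rightarrow> 'b::euclidean_space"
  assumes v: "v \<in> P1 \<T>"
  shows "v \<in> L2 (lebesgue_on \<Omega>)"
proof -
  let ?w = "\<lambda>x. \<Sum>T\<in>\<T>. indicator (interior T) x *\<^sub>R piece T v x"
  have w: "?w \<in> L2 (lebesgue_on \<Omega>)"
  proof (rule L2_sum)
    fix T assume T: "T \<in> \<T>"
    have c: "continuous_on A (piece T v)" for A by (rule affine_map_continuous[OF P1_piece(1)[OF v T]])
    have "compact (piece T v ` T)" by (rule compact_continuous_image[OF c simplex_basics(1)[OF simplex[OF T]]])
    then obtain B where B: "\<And>x. x \<in> T \<Longrightarrow> norm (piece T v x) \<le> B"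
      using compact_imp_bounded by (fastforce simp: bounded_iff)
    show "(\<lambda>x. indicator (interior T) x *\<^sub>R piece T v x) \<in> L2 (lebesgue_on \<Omega>)"
    proof (rule L2_bounded[OF domain(5)])
      have "(\<lambda>x. indicator (interior T) x *\<^sub>R piece T v x) \<in> borel_measurable borel"
        using borel_measurable_continuous_onI[OF c] by (intro borel_measurable_scaleR borel_measurable_indicator) auto
      then have "(\<lambda>x. indicator (interior T) x *\<^sub>R piece T v x) \<in> borel_measurable lebesgue" by (simp add: measurable_completion)
      then show "(\<lambda>x. indicator (interior T) x *\<^sub>R piece T v x) \<in> borel_measurable (lebesgue_on \<Omega>)"
        by (rule measurable_restrict_space1)
      fix x
      show "norm (indicator (interior T) x *\<^sub>R piece T v x) \<le> max B 0"
        using B[of x] interior_subset[of T] by (auto simp: indicator_def intro: order_trans max.cobounded1)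
    qed
  qed
  have ae: "AE x in lebesgue_on \<Omega>. ?w x = v x"
  proof (rule AE_elementsI)
    fix T x assume T: "T \<in> \<T>" "x \<in> interior T"
    show "?w x = v x" using element_sum[OF T, of "\<lambda>T. piece T v x"] P1_piece(2)[OF v T] by simp
  qed
  show ?thesis
    by (rule L2_cong_AE[OF w ae lebesgue_on_measurable_AE[OF domain(4) L2_measurable[OF w] ae]])
qed

lemma pw_const_L2: "pw_const \<T> k \<in> L2 (lebesgue_on \<Omega>)"
  by (rule P1_L2[OF pw_const_P1(1)])

lemma L2_element:
  fixes f :: "'a \<Rightarrow> 'b::euclidean_space"
  assumes f: "f \<in> L2 (lebesgue_on \<Omega>)" and T: "T \<in> \<T>"
  shows "f \<in> L2 (lebesgue_on T)" "integrable (lebesgue_on T) f"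
    "(LINT x|lebesgue_on T. f x) = (LINT x|lebesgue_on (interior T). f x)"
proof -
  note Tb = simplex_basics[OF simplex[OF T]]
  have i: "f \<in> L2 (lebesgue_on (interior T))"
    by (rule L2_lebesgue_on_subset(1)[OF f interior_mesh_subset[OF T] domain(4) Tb(6)])
  show "f \<in> L2 (lebesgue_on T)" by (rule L2_spike_set(1)[OF interior_subset Tb(4) Tb(6) Tb(5) i])
  then show "integrable (lebesgue_on T) f" by (rule L2_integrable_vec[OF Tb(8)])
  show "(LINT x|lebesgue_on T. f x) = (LINT x|lebesgue_on (interior T). f x)"
    by (rule lebesgue_on_spike_set(2)[OF interior_subset Tb(4) Tb(6) Tb(5) L2_measurable[OF i]])
qed

lemma integral_element_cong:
  fixes f g :: "'a \<Rightarrow> 'b::euclidean_space"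
  assumes T: "T \<in> \<T>" and f: "f \<in> L2 (lebesgue_on \<Omega>)" "g \<in> borel_measurable (lebesgue_on (interior T))"
    and eq: "AE x in lebesgue_on (interior T). f x = g x"
  shows "(LINT x|lebesgue_on T. f x) = (LINT x|lebesgue_on T. g x)"
proof -
  note Tb = simplex_basics[OF simplex[OF T]]
  have i: "f \<in> L2 (lebesgue_on (interior T))"
    by (rule L2_lebesgue_on_subset(1)[OF f(1) interior_mesh_subset[OF T] domain(4) Tb(6)])
  have "(LINT x|lebesgue_on T. g x) = (LINT x|lebesgue_on (interior T). g x)"
    by (rule lebesgue_on_spike_set(2)[OF interior_subset Tb(4) Tb(6) Tb(5) f(2)])
  also have "\<dots> = (LINT x|lebesgue_on (interior T). f x)"
    using eq by (intro integral_cong_AE f(2) L2_measurable[OF i]) (auto elim: eventually_mono)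
  finally show ?thesis using L2_element(3)[OF f(1) T] by simp
qed

lemma average_element:
  fixes f :: "'a \<Rightarrow> 'b::euclidean_space"
  assumes "T \<in> \<T>"
  shows "measure (lebesgue_on T) T *\<^sub>R average (lebesgue_on T) f = (LINT x|lebesgue_on T. f x)"
  using simplex_basics(9)[OF simplex[OF assms]] by (simp add: average_def)

lemma L2_inner_pw_const:
  assumes f: "f \<in> L2 (lebesgue_on \<Omega>)"
  shows "L2_inner (lebesgue_on \<Omega>) (pw_const \<T> k) f = (\<Sum>T\<in>\<T>. k T \<bullet> (LINT x|lebesgue_on T. f x))"
proof -
  have "L2_inner (lebesgue_on \<Omega>) (pw_const \<T> k) f = (\<Sum>T\<in>\<T>. LINT x|lebesgue_on (interior T). pw_const \<T> k x \<bullet> f x)"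
    unfolding L2_inner_def by (rule integral_elements[OF L2_inner_integrable[OF pw_const_L2 f]])
  also have "\<dots> = (\<Sum>T\<in>\<T>. k T \<bullet> (LINT x|lebesgue_on T. f x))"
  proof (rule sum.cong[OF refl])
    fix T assume T: "T \<in> \<T>"
    note Tb = simplex_basics[OF simplex[OF T]]
    have i: "integrable (lebesgue_on (interior T)) f"
      by (rule L2_integrable_vec[OF bounded_lebesgue_finite_measure[OF Tb(7,6)] L2_lebesgue_on_subset(1)[OF f interior_mesh_subset[OF T] domain(4) Tb(6)]])
    have "(LINT x|lebesgue_on (interior T). pw_const \<T> k x \<bullet> f x) = (LINT x|lebesgue_on (interior T). k T \<bullet> f x)"
      by (rule Bochner_Integration.integral_cong[OF refl]) (simp add: pw_const_interior[OF T])
    also have "\<dots> = k T \<bullet> (LINT x|lebesgue_on (interior T). f x)" using i by (simp add: integral_inner_right)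
    finally show "(LINT x|lebesgue_on (interior T). pw_const \<T> k x \<bullet> f x) = k T \<bullet> (LINT x|lebesgue_on T. f x)"
      using L2_element(3)[OF f T] by simp
  qed
  finally show ?thesis .
qed

lemma integral_pw_const:
  assumes T: "T \<in> \<T>"
  shows "(LINT x|lebesgue_on T. pw_const \<T> k x) = measure (lebesgue_on T) T *\<^sub>R k T"
proof -
  have "(LINT x|lebesgue_on T. pw_const \<T> k x) = (LINT x|lebesgue_on T. k T)"
    by (rule integral_element_cong[OF T pw_const_L2]) (auto intro!: AE_I2 simp: pw_const_interior[OF T])
  then show ?thesis by simp
qed

lemma L2_inner_pw_const_pw_const:
  "L2_inner (lebesgue_on \<Omega>) (pw_const \<T> k) (pw_const \<T> k') = (\<Sum>T\<in>\<T>. measure (lebesgue_on T) T * (k T \<bullet> k' T))"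
  unfolding L2_inner_pw_const[OF pw_const_L2]
  by (rule sum.cong[OF refl]) (simp add: integral_pw_const)

lemma Pi_h_L2: "Pi_h \<T> f \<in> L2 (lebesgue_on \<Omega>)"
  unfolding Pi_h_eq_pw_const by (rule pw_const_L2)

text \<open>\<open>Pi_h\<close> is the orthogonal projection onto piecewise constants, so it may be
  dropped against such a function.\<close>

lemma L2_inner_pw_const_Pi_h:
  assumes f: "f \<in> L2 (lebesgue_on \<Omega>)"
  shows "L2_inner (lebesgue_on \<Omega>) (pw_const \<T> k) (Pi_h \<T> f) = L2_inner (lebesgue_on \<Omega>) (pw_const \<T> k) f"
  unfolding Pi_h_eq_pw_const L2_inner_pw_const_pw_const L2_inner_pw_const[OF f]
proof (rule sum.cong[OF refl])
  fix T assume T: "T \<in> \<T>"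
  show "measure (lebesgue_on T) T * (k T \<bullet> average (lebesgue_on T) f) = k T \<bullet> (LINT x|lebesgue_on T. f x)"
    using average_element[OF T, of f, symmetric] by simp
qed

lemma pw_const_cong: "(\<And>T. T \<in> \<T> \<Longrightarrow> k T = k' T) \<Longrightarrow> pw_const \<T> k = pw_const \<T> k'"
  by (auto simp: pw_const_def fun_eq_iff)

lemma pw_const_combination: "pw_const \<T> (\<lambda>T. k T + c *\<^sub>R k' T) x = pw_const \<T> k x + c *\<^sub>R pw_const \<T> k' x"
  by (simp add: pw_const_def scaleR_right.sum sum.distrib scaleR_add_right mult.commute)

lemma Pi_h_combination:
  fixes f g :: "'a \<Rightarrow> 'b::euclidean_space"
  assumes "f \<in> L2 (lebesgue_on \<Omega>)" "g \<in> L2 (lebesgue_on \<Omega>)"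
  shows "Pi_h \<T> (\<lambda>x. f x + c *\<^sub>R g x) x = Pi_h \<T> f x + c *\<^sub>R Pi_h \<T> g x"
proof -
  have "pw_const \<T> (\<lambda>T. average (lebesgue_on T) (\<lambda>x. f x + c *\<^sub>R g x)) = pw_const \<T> (\<lambda>T. average (lebesgue_on T) f + c *\<^sub>R average (lebesgue_on T) g)"
    by (rule pw_const_cong)
      (use L2_element(2)[OF assms(1)] L2_element(2)[OF assms(2)] in \<open>simp add: average_def scaleR_add_right mult.commute\<close>)
  then show ?thesis by (simp only: Pi_h_eq_pw_const pw_const_combination)
qed

lemma Pi_h_diff:
  fixes f g :: "'a \<Rightarrow> 'b::euclidean_space"
  assumes "f \<in> L2 (lebesgue_on \<Omega>)" "g \<in> L2 (lebesgue_on \<Omega>)"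
  shows "Pi_h \<T> (\<lambda>x. f x - g x) x = Pi_h \<T> f x - Pi_h \<T> g x"
  using Pi_h_combination[OF assms, of "-1" x] by simp

lemma Pi_h_pw_const: "Pi_h \<T> (pw_const \<T> k) = pw_const \<T> k"
  unfolding Pi_h_eq_pw_const
proof (rule pw_const_cong)
  fix T assume T: "T \<in> \<T>"
  show "average (lebesgue_on T) (pw_const \<T> k) = k T"
    using integral_pw_const[OF T, of k] simplex_basics(9)[OF simplex[OF T]] by (simp add: average_def)
qed

lemma Pi_h_cong_AE:
  fixes f g :: "'a \<Rightarrow> 'b::euclidean_space"
  assumes f: "f \<in> L2 (lebesgue_on \<Omega>)" and g: "g \<in> L2 (lebesgue_on \<Omega>)" and ae: "AE x in lebesgue_on \<Omega>. f x = g x"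
  shows "Pi_h \<T> f = Pi_h \<T> g"
  unfolding Pi_h_eq_pw_const
proof (rule pw_const_cong)
  fix T assume T: "T \<in> \<T>"
  note Tb = simplex_basics[OF simplex[OF T]]
  have "AE x in lebesgue. x \<in> \<Omega> \<longrightarrow> f x = g x" using ae domain(4) by (subst (asm) AE_restrict_space_iff) auto
  then have "AE x in lebesgue. x \<in> interior T \<longrightarrow> f x = g x"
    by (rule eventually_mono) (use interior_mesh_subset[OF T] in blast)
  then have ae': "AE x in lebesgue_on (interior T). f x = g x" using Tb(6) by (subst AE_restrict_space_iff) auto
  have "(LINT x|lebesgue_on T. f x) = (LINT x|lebesgue_on T. g x)"
    by (rule integral_element_cong[OF T f L2_measurable[OF L2_lebesgue_on_subset(1)[OF g interior_mesh_subset[OF T] domain(4) Tb(6)]] ae'])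
  then show "average (lebesgue_on T) f = average (lebesgue_on T) g" by (simp add: average_def)
qed

lemma slope_eq:
  assumes "v \<in> P1 \<T>" "T \<in> \<T>" shows "gradient (piece T v) x = slope T v" "C1 (piece T v)"
  using affine_map_C1[OF P1_piece(1)[OF assms]] by (auto simp: slope_def)

text \<open>On the open interior \<open>v\<close> agrees with an affine map and has its derivative;
  the indicators discard the skeleton, where \<open>v\<close> need not be differentiable.\<close>

lemma nabla_h_eq_pw_const:
  assumes v: "v \<in> P1 \<T>" shows "nabla_h \<T> v = pw_const \<T> (\<lambda>T. slope T v)"
proof
  fix x
  have "indicator (interior T) x *\<^sub>R gradient v x = indicator (interior T) x *\<^sub>R slope T v" if T: "T \<in> \<T>" for T
  proof (cases "x \<in> interior T")
    case True
    have "gradient v x = slope T v"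
    proof (rule gradient_eqI, rule has_derivative_transform_within_open[OF _ open_interior True])
      show "(piece T v has_derivative (\<lambda>h. slope T v \<bullet> h)) (at x)"
        using C1_has_derivative[OF slope_eq(2)[OF v T], of x] by (simp add: slope_eq(1)[OF v T])
    qed (simp add: P1_piece(2)[OF v T])
    then show ?thesis by simp
  qed simp
  then show "nabla_h \<T> v x = pw_const \<T> (\<lambda>T. slope T v) x"
    unfolding nabla_h_def pw_const_def by (rule sum.cong[OF refl])
qed

lemma nabla_h_L2: "v \<in> P1 \<T> \<Longrightarrow> nabla_h \<T> v \<in> L2 (lebesgue_on \<Omega>)"
  by (simp add: nabla_h_eq_pw_const pw_const_L2)

lemma slope_combination:
  assumes v: "v \<in> P1 \<T>" and w: "w \<in> P1 \<T>" and T: "T \<in> \<T>"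
  shows "slope T (\<lambda>x. v x + c * w x) = slope T v + c *\<^sub>R slope T w"
proof -
  note pc = P1_combination(2)[OF v w T, of c]
  have "gradient (\<lambda>x. piece T v x + c * piece T w x) = (\<lambda>x. gradient (piece T v) x + c *\<^sub>R gradient (piece T w) x)"
    using C1_add(2)[OF slope_eq(2)[OF v T] C1_mult(1)[OF C1_const(1)[of c] slope_eq(2)[OF w T]]]
      C1_mult(2)[OF C1_const(1)[of c] slope_eq(2)[OF w T]] by (simp add: C1_const(2))
  then show ?thesis using pc by (simp add: slope_def)
qed

lemma nabla_h_combination:
  assumes v: "v \<in> P1 \<T>" and w: "w \<in> P1 \<T>"
  shows "nabla_h \<T> (\<lambda>x. v x + c * w x) x = nabla_h \<T> v x + c *\<^sub>R nabla_h \<T> w x"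
proof -
  have "(\<lambda>x. v x + c * w x) \<in> P1 \<T>" using P1_combination(1)[OF v w, of c] by simp
  then have "nabla_h \<T> (\<lambda>x. v x + c * w x) = pw_const \<T> (\<lambda>T. slope T v + c *\<^sub>R slope T w)"
    unfolding nabla_h_eq_pw_const[OF \<open>(\<lambda>x. v x + c * w x) \<in> P1 \<T>\<close>]
    by (intro pw_const_cong slope_combination[OF v w])
  then show ?thesis by (simp only: nabla_h_eq_pw_const[OF v] nabla_h_eq_pw_const[OF w] pw_const_combination)
qed

subsection \<open>Crouzeix-Raviart functions\<close>

lemma CR_P1: "v \<in> CR \<T> \<Longrightarrow> v \<in> P1 \<T>" and CR_D_CR: "v \<in> CR_D \<T> \<Gamma>D \<Longrightarrow> v \<in> CR \<T>"
  by (auto simp: CR_def CR_D_def)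

lemma piece_continuous: "v \<in> P1 \<T> \<Longrightarrow> T \<in> \<T> \<Longrightarrow> continuous_on A (piece T v)"
  for v :: "'a \<Rightarrow> 'b::euclidean_space"
  by (rule affine_map_continuous[OF P1_piece(1)])

lemma CR_iff:
  "v \<in> CR \<T> \<longleftrightarrow> v \<in> P1 \<T> \<and> (\<forall>T\<in>\<T>. \<forall>T'\<in>\<T>. \<forall>S. T \<noteq> T' \<and> S facet_of T \<and> S facet_of T' \<longrightarrow>
     average (surface_measure S) (piece T v) = average (surface_measure S) (piece T' v))"
proof -
  have d: "average (surface_measure S) (\<lambda>x. piece T v x - piece T' v x) =
     average (surface_measure S) (piece T v) - average (surface_measure S) (piece T' v)"
    if "v \<in> P1 \<T>" "T \<in> \<T>" "T' \<in> \<T>" "S facet_of T" for T T' S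
    using average_combination[OF simplex[OF that(2)] that(4) piece_continuous[OF that(1,2)] piece_continuous[OF that(1,3)], of "-1"]
    by simp
  show ?thesis
  proof
    assume v: "v \<in> CR \<T>"
    then have vP: "v \<in> P1 \<T>" by (simp add: CR_def)
    show "v \<in> P1 \<T> \<and> (\<forall>T\<in>\<T>. \<forall>T'\<in>\<T>. \<forall>S. T \<noteq> T' \<and> S facet_of T \<and> S facet_of T' \<longrightarrow>
     average (surface_measure S) (piece T v) = average (surface_measure S) (piece T' v))"
    proof (intro conjI ballI allI impI vP)
      fix T T' S assume T: "T \<in> \<T>" "T' \<in> \<T>" "T \<noteq> T' \<and> S facet_of T \<and> S facet_of T'"
      then have "average (surface_measure S) (\<lambda>x. piece T v x - piece T' v x) = 0" using v unfolding CR_def by blast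
      then show "average (surface_measure S) (piece T v) = average (surface_measure S) (piece T' v)"
        using d[OF vP T(1,2)] T(3) by simp
    qed
  next
    assume v: "v \<in> P1 \<T> \<and> (\<forall>T\<in>\<T>. \<forall>T'\<in>\<T>. \<forall>S. T \<noteq> T' \<and> S facet_of T \<and> S facet_of T' \<longrightarrow>
     average (surface_measure S) (piece T v) = average (surface_measure S) (piece T' v))"
    show "v \<in> CR \<T>"
      unfolding CR_def
    proof (intro CollectI conjI ballI allI impI)
      show vP: "v \<in> P1 \<T>" using v by blast
      fix T T' S assume T: "T \<in> \<T>" "T' \<in> \<T>" "T \<noteq> T' \<and> S facet_of T \<and> S facet_of T'"
      then have "average (surface_measure S) (piece T v) = average (surface_measure S) (piece T' v)" using v by blast
      then show "average (surface_measure S) (\<lambda>x. piece T v x - piece T' v x) = 0"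
        using d[OF vP T(1,2)] T(3) by simp
    qed
  qed
qed

lemma average_piece_combination:
  fixes v w :: "'a \<Rightarrow> real"
  assumes "v \<in> P1 \<T>" "w \<in> P1 \<T>" "T \<in> \<T>" "S facet_of T"
  shows "average (surface_measure S) (piece T (\<lambda>x. v x + c * w x)) =
    average (surface_measure S) (piece T v) + c * average (surface_measure S) (piece T w)"
  using P1_combination(2)[OF assms(1-3), of c]
    average_combination[OF simplex[OF assms(3)] assms(4) piece_continuous[OF assms(1,3)] piece_continuous[OF assms(2,3)], of c]
  by simp

lemma CR_combination:
  assumes "v \<in> CR \<T>" "w \<in> CR \<T>" shows "(\<lambda>x. v x + c * w x) \<in> CR \<T>"
  using assms P1_combination(1)[of v w c] average_piece_combination[of v w] unfolding CR_iff by auto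

lemma CR_D_combination:
  assumes "v \<in> CR_D \<T> \<Gamma>D" "w \<in> CR_D \<T> \<Gamma>D" shows "(\<lambda>x. v x + c * w x) \<in> CR_D \<T> \<Gamma>D"
  using assms CR_combination[of v w c] average_piece_combination[OF CR_P1 CR_P1, of v w] unfolding CR_D_def by auto

lemma integral_piece_eq_average:
  assumes "T \<in> \<T>" "S facet_of T"
  shows "(LINT y|surface_measure S. f y) = measure (surface_measure S) S * average (surface_measure S) f"
  using facet_surface_measure(2,3)[OF simplex[OF assms(1)] assms(2)] by (simp add: average_def)

text \<open>Divergence theorem for an affine function: its slope is determined by the facet means
  alone. The gradients of the interpolant and of the facet basis functions are both read off from
  this.\<close>

lemma slope_eq_averages:
  assumes v: "v \<in> P1 \<T>" and T: "T \<in> \<T>"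
  shows "measure (lebesgue_on T) T * (slope T v \<bullet> b) =
    (\<Sum>S | S facet_of T. (outer_normal T S \<bullet> b) * (measure (surface_measure S) S * average (surface_measure S) (piece T v)))"
proof -
  have "(LINT x|lebesgue_on T. gradient (piece T v) x \<bullet> b) = measure (lebesgue_on T) T * (slope T v \<bullet> b)"
    by (simp add: slope_eq(1)[OF v T])
  moreover have "(\<Sum>S | S facet_of T. (outer_normal T S \<bullet> b) * (LINT y|surface_measure S. piece T v y))
    = (\<Sum>S | S facet_of T. (outer_normal T S \<bullet> b) * (measure (surface_measure S) S * average (surface_measure S) (piece T v)))"
    by (rule sum.cong[OF refl]) (use integral_piece_eq_average[OF T] in simp)
  ultimately show ?thesis using simplex_divergence[OF simplex[OF T] slope_eq(2)[OF v T], of b] by simp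
qed

subsection \<open>Raviart-Thomas fields\<close>

lemma RT_P1: "r \<in> RT \<T> \<Longrightarrow> r \<in> P1 \<T>" and RT_N_RT: "r \<in> RT_N \<T> \<Gamma>N \<Longrightarrow> r \<in> RT \<T>"
  by (auto simp: RT_def RT_N_def)

lemma facet_nonempty:
  assumes "S facet_of T" shows "(SOME y. y \<in> S) \<in> S"
proof -
  have "S \<noteq> {}" using assms by (simp add: facet_of_def)
  then have "\<exists>y. y \<in> S" by (simp add: ex_in_conv)
  then show ?thesis by (rule someI_ex)
qed

lemma RT_constant_flux:
  assumes "r \<in> RT \<T>" "T \<in> \<T>" "S facet_of T"
  shows "\<exists>c. \<forall>x\<in>S. piece T r x \<bullet> outer_normal T S = c"
proof -
  have "\<forall>T\<in>\<T>. \<forall>S. S facet_of T \<longrightarrow> (\<exists>c. \<forall>x\<in>S. piece T r x \<bullet> outer_normal T S = c)"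
    using assms(1) by (simp add: RT_def)
  from this[rule_format, OF assms(2,3)] show ?thesis .
qed

lemma RT_continuous_flux:
  assumes "r \<in> RT \<T>" "T \<in> \<T>" "T' \<in> \<T>" "T \<noteq> T'" "S facet_of T" "S facet_of T'" "x \<in> S"
  shows "piece T r x \<bullet> outer_normal T S = piece T' r x \<bullet> outer_normal T S"
proof -
  have "\<forall>T\<in>\<T>. \<forall>T'\<in>\<T>. \<forall>S. T \<noteq> T' \<and> S facet_of T \<and> S facet_of T' \<longrightarrow>
        (\<forall>x\<in>S. piece T r x \<bullet> outer_normal T S = piece T' r x \<bullet> outer_normal T S)"
    using assms(1) by (simp add: RT_def)
  from this[rule_format, OF assms(2,3) conjI[OF assms(4) conjI[OF assms(5,6)]] assms(7)] show ?thesis .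
qed

lemma RT_N_zero_flux:
  assumes "r \<in> RT_N \<T> \<Gamma>N" "T \<in> \<T>" "S facet_of T" "S \<subseteq> closure \<Gamma>N" "x \<in> S"
  shows "piece T r x \<bullet> outer_normal T S = 0"
proof -
  have "\<forall>T\<in>\<T>. \<forall>S. S facet_of T \<and> S \<subseteq> closure \<Gamma>N \<longrightarrow> (\<forall>x\<in>S. piece T r x \<bullet> outer_normal T S = 0)"
    using assms(1) by (simp add: RT_N_def)
  from this[rule_format, OF assms(2) conjI[OF assms(3,4)] assms(5)] show ?thesis .
qed

lemma flux:
  assumes r: "r \<in> RT \<T>" and T: "T \<in> \<T>" and S: "S facet_of T" and x: "x \<in> S"
  shows "piece T r x \<bullet> outer_normal T S = flux r T S"
proof -
  obtain c where "\<forall>x\<in>S. piece T r x \<bullet> outer_normal T S = c" using RT_constant_flux[OF r T S] by blast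
  then show ?thesis using x facet_nonempty[OF S] by (simp add: flux_def)
qed

lemma flux_opposite:
  assumes r: "r \<in> RT \<T>" and T: "T \<in> \<T>" "T' \<in> \<T>" "T \<noteq> T'" and S: "S facet_of T" "S facet_of T'"
  shows "flux r T' S = - flux r T S"
proof -
  from RT_continuous_flux[OF r T S facet_nonempty[OF S(1)]] show ?thesis
    using facet_opposite_normals[OF T S] by (simp add: flux_def)
qed

lemma flux_Neumann:
  "r \<in> RT_N \<T> \<Gamma>N \<Longrightarrow> T \<in> \<T> \<Longrightarrow> S facet_of T \<Longrightarrow> S \<subseteq> closure \<Gamma>N \<Longrightarrow> flux r T S = 0"
  unfolding flux_def by (rule RT_N_zero_flux[OF _ _ _ _ facet_nonempty])

lemma RT_divergence_element:
  assumes r: "r \<in> RT \<T>" and T: "T \<in> \<T>" and phi: "C1 \<phi>"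
  shows "(LINT x|lebesgue_on T. piece T r x \<bullet> gradient \<phi> x + affine_div (piece T r) * \<phi> x) =
    (\<Sum>S | S facet_of T. flux r T S * (LINT y|surface_measure S. \<phi> y))"
  unfolding simplex_affine_divergence[OF simplex[OF T] P1_piece(1)[OF RT_P1[OF r] T] phi]
proof (rule sum.cong[OF refl])
  fix S assume "S \<in> {S. S facet_of T}"
  then have S: "S facet_of T" by simp
  have "(LINT y|surface_measure S. (piece T r y \<bullet> outer_normal T S) * \<phi> y) = (LINT y|surface_measure S. flux r T S * \<phi> y)"
    by (rule Bochner_Integration.integral_cong[OF refl])
      (use flux[OF r T S] facet_surface_measure(2)[OF simplex[OF T] S] in simp)
  then show "(LINT y|surface_measure S. (piece T r y \<bullet> outer_normal T S) * \<phi> y) = flux r T S * (LINT y|surface_measure S. \<phi> y)"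
    by simp
qed

text \<open>Crossing a facet to the neighbouring element is an involution on pairs of an element and
  an interior facet. It reverses the sign of the summand, so the sum equals its negative.\<close>

lemma facet_cancellation:
  fixes c :: "'a set \<Rightarrow> 'a set \<Rightarrow> real"
  assumes bd: "\<And>T S. T \<in> \<T> \<Longrightarrow> S facet_of T \<Longrightarrow> S \<subseteq> frontier \<Omega> \<Longrightarrow> c T S = 0"
    and sh: "\<And>T T' S. T \<in> \<T> \<Longrightarrow> T' \<in> \<T> \<Longrightarrow> T \<noteq> T' \<Longrightarrow> S facet_of T \<Longrightarrow> S facet_of T' \<Longrightarrow> c T' S = - c T S"
  shows "(\<Sum>T\<in>\<T>. \<Sum>S | S facet_of T. c T S) = 0"
proof -
  define P where "P = (SIGMA T:\<T>. {S. S facet_of T})"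
  define Q where "Q = {(T, S) \<in> P. \<not> S \<subseteq> frontier \<Omega>}"
  have finP: "finite P" unfolding P_def using finite_mesh finite_facets[OF simplex] by auto
  have QP: "Q \<subseteq> P" by (auto simp: Q_def)
  have "(\<Sum>T\<in>\<T>. \<Sum>S | S facet_of T. c T S) = (\<Sum>(T, S)\<in>P. c T S)"
    unfolding P_def by (rule sum.Sigma) (use finite_mesh finite_facets[OF simplex] in auto)
  also have "\<dots> = (\<Sum>(T, S)\<in>Q. c T S)"
    by (rule sum.mono_neutral_right[OF finP QP]) (use bd in \<open>auto simp: P_def Q_def\<close>)
  also have "\<dots> = 0"
  proof -
    define nb where "nb = (\<lambda>T S. SOME T'. T' \<in> \<T> \<and> T' \<noteq> T \<and> S facet_of T')"
    have nb: "nb T S \<in> \<T>" "nb T S \<noteq> T" "S facet_of nb T S" if "(T, S) \<in> Q" for T S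
    proof -
      have "T \<in> \<T>" "S facet_of T" "\<not> S \<subseteq> frontier \<Omega>" using that by (auto simp: Q_def P_def)
      then have "\<exists>T'. T' \<in> \<T> \<and> T' \<noteq> T \<and> S facet_of T'" using facet_neighbour by metis
      from someI_ex[OF this] show "nb T S \<in> \<T>" "nb T S \<noteq> T" "S facet_of nb T S" unfolding nb_def by blast+
    qed
    have nbQ: "(nb T S, S) \<in> Q" if "(T, S) \<in> Q" for T S
      using nb[OF that] that by (auto simp: Q_def P_def)
    have nbnb: "nb (nb T S) S = T" if q: "(T, S) \<in> Q" for T S
    proof -
      have T: "T \<in> \<T>" "S facet_of T" using q by (auto simp: Q_def P_def)
      show ?thesis
        by (rule facet_at_most_two[OF nb(1)[OF q] T(1) nb(1)[OF nbQ[OF q]] nb(3)[OF q] T(2) nb(3)[OF nbQ[OF q]] nb(2)[OF q] nb(2)[OF nbQ[OF q]]])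
    qed
    have "(\<Sum>(T, S)\<in>Q. c T S) = (\<Sum>(T, S)\<in>Q. - c T S)"
    proof (rule sum.reindex_bij_witness[of Q "\<lambda>(T, S). (nb T S, S)" "\<lambda>(T, S). (nb T S, S)"])
      fix a assume "a \<in> Q"
      then obtain T S where a: "a = (T, S)" "(T, S) \<in> Q" by (cases a) auto
      then have T: "T \<in> \<T>" "S facet_of T" by (auto simp: Q_def P_def)
      have "c (nb T S) S = - c T S" by (rule sh[OF T(1) nb(1)[OF a(2)] nb(2)[OF a(2), symmetric] T(2) nb(3)[OF a(2)]])
      then show "(case (case a of (T, S) \<Rightarrow> (nb T S, S)) of (T, S) \<Rightarrow> - c T S) = (case a of (T, S) \<Rightarrow> c T S)"
        by (simp add: a)
    qed (auto simp: nbnb nbQ)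
    then have "(\<Sum>(T, S)\<in>Q. c T S) = - (\<Sum>(T, S)\<in>Q. c T S)" by (simp add: sum_negf case_prod_unfold)
    then show ?thesis by simp
  qed
  finally show ?thesis .
qed

text \<open>Interface terms cancel because the normal component is continuous, and the test function
  vanishes on the boundary, so the element-wise divergence is the weak one.\<close>

lemma RT_weak_divergence:
  assumes r: "r \<in> RT \<T>"
  shows "weak_divergence \<Omega> r (pw_const \<T> (\<lambda>T. affine_div (piece T r)))"
  unfolding weak_divergence_def
proof (intro allI impI)
  fix \<phi> assume phi: "test_function \<Omega> \<phi>"
  note p = test_function_C1[OF phi] and rP = RT_P1[OF r]
  obtain K where K: "K \<subseteq> \<Omega>" "\<And>x. x \<notin> K \<Longrightarrow> \<phi> x = 0"
    by (rule test_functionE[OF phi]) blast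
  let ?w = "pw_const \<T> (\<lambda>T. affine_div (piece T r))"
  have pL: "\<phi> \<in> L2 (lebesgue_on \<Omega>)" by (rule test_function_L2[OF phi domain(2,4)])
  have gL: "gradient \<phi> \<in> L2 (lebesgue_on \<Omega>)" by (rule L2_continuous_bounded_domain[OF C1_continuous_gradient[OF p] domain(2,4)])
  have i1: "integrable (lebesgue_on \<Omega>) (\<lambda>x. r x \<bullet> gradient \<phi> x)" by (rule L2_inner_integrable[OF P1_L2[OF rP] gL])
  have i2: "integrable (lebesgue_on \<Omega>) (\<lambda>x. ?w x * \<phi> x)" by (rule L2_mult_integrable[OF pw_const_L2 pL])
  have "(LINT x|lebesgue_on \<Omega>. r x \<bullet> gradient \<phi> x) + (LINT x|lebesgue_on \<Omega>. ?w x * \<phi> x)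
      = (LINT x|lebesgue_on \<Omega>. r x \<bullet> gradient \<phi> x + ?w x * \<phi> x)" using i1 i2 by simp
  also have "\<dots> = (\<Sum>T\<in>\<T>. LINT x|lebesgue_on (interior T). r x \<bullet> gradient \<phi> x + ?w x * \<phi> x)"
    by (rule integral_elements) (intro Bochner_Integration.integrable_add i1 i2)
  also have "\<dots> = (\<Sum>T\<in>\<T>. \<Sum>S | S facet_of T. flux r T S * (LINT y|surface_measure S. \<phi> y))"
  proof (rule sum.cong[OF refl])
    fix T assume T: "T \<in> \<T>"
    note Tb = simplex_basics[OF simplex[OF T]]
    let ?g = "\<lambda>x. piece T r x \<bullet> gradient \<phi> x + affine_div (piece T r) * \<phi> x"
    have "continuous_on UNIV ?g"
      by (intro continuous_intros piece_continuous[OF rP T] C1_continuous C1_continuous_gradient p)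
    then have gm: "?g \<in> borel_measurable (lebesgue_on (interior T))" by (rule continuous_lebesgue_on_measurable)
    have "(LINT x|lebesgue_on (interior T). r x \<bullet> gradient \<phi> x + ?w x * \<phi> x) = (LINT x|lebesgue_on (interior T). ?g x)"
      by (rule Bochner_Integration.integral_cong[OF refl]) (simp add: pw_const_interior[OF T] P1_piece(2)[OF rP T])
    also have "\<dots> = (LINT x|lebesgue_on T. ?g x)"
      by (rule lebesgue_on_spike_set(2)[OF interior_subset Tb(4) Tb(6) Tb(5) gm, symmetric])
    also have "\<dots> = (\<Sum>S | S facet_of T. flux r T S * (LINT y|surface_measure S. \<phi> y))"
      by (rule RT_divergence_element[OF r T p])
    finally show "(LINT x|lebesgue_on (interior T). r x \<bullet> gradient \<phi> x + ?w x * \<phi> x) = (\<Sum>S | S facet_of T. flux r T S * (LINT y|surface_measure S. \<phi> y))" .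
  qed
  also have "\<dots> = 0"
  proof (rule facet_cancellation)
    fix T S assume T: "T \<in> \<T>" "S facet_of T" and S: "S \<subseteq> frontier \<Omega>"
    have "S \<inter> \<Omega> = {}" using S domain(1) by (auto simp: frontier_def interior_open)
    then have "(LINT y|surface_measure S. \<phi> y) = (LINT y|surface_measure S. 0)"
      using K facet_surface_measure(2)[OF simplex[OF T(1)] T(2)]
      by (intro Bochner_Integration.integral_cong[OF refl]) auto
    then show "flux r T S * (LINT y|surface_measure S. \<phi> y) = 0" by simp
  next
    fix T T' S assume "T \<in> \<T>" "T' \<in> \<T>" "T \<noteq> T'" "S facet_of T" "S facet_of T'"
    from flux_opposite[OF r this]
    show "flux r T' S * (LINT y|surface_measure S. \<phi> y) = - (flux r T S * (LINT y|surface_measure S. \<phi> y))" by simp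
  qed
  finally show "(LINT x|lebesgue_on \<Omega>. r x \<bullet> gradient \<phi> x) = - (LINT x|lebesgue_on \<Omega>. ?w x * \<phi> x)" by simp
qed

lemma Hdiv_divergence:
  assumes "r \<in> Hdiv U" shows "divergence U r \<in> L2 (lebesgue_on U)" "weak_divergence U r (divergence U r)"
proof -
  have "\<exists>w. w \<in> L2 (lebesgue_on U) \<and> weak_divergence U r w" using assms by (auto simp: Hdiv_def)
  from someI_ex[OF this] show "divergence U r \<in> L2 (lebesgue_on U)" "weak_divergence U r (divergence U r)"
    unfolding divergence_def by blast+
qed

lemma divergence_eq_AE:
  assumes "r \<in> L2 (lebesgue_on \<Omega>)" "w \<in> L2 (lebesgue_on \<Omega>)" "weak_divergence \<Omega> r w"
  shows "r \<in> Hdiv \<Omega>" "AE x in lebesgue_on \<Omega>. divergence \<Omega> r x = w x"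
proof -
  show r: "r \<in> Hdiv \<Omega>" using assms by (auto simp: Hdiv_def)
  show "AE x in lebesgue_on \<Omega>. divergence \<Omega> r x = w x"
    by (rule weak_divergence_unique[OF domain(1,2) Hdiv_divergence(1)[OF r] assms(2) Hdiv_divergence(2)[OF r] assms(3)])
qed

lemma Hdiv_combination:
  assumes r: "r \<in> Hdiv \<Omega>" "s \<in> Hdiv \<Omega>"
  shows "(\<lambda>x. r x + c *\<^sub>R s x) \<in> Hdiv \<Omega>"
    "AE x in lebesgue_on \<Omega>. divergence \<Omega> (\<lambda>x. r x + c *\<^sub>R s x) x = divergence \<Omega> r x + c * divergence \<Omega> s x"
proof -
  have rL: "r \<in> L2 (lebesgue_on \<Omega>)" "s \<in> L2 (lebesgue_on \<Omega>)" using r by (auto simp: Hdiv_def)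
  note dL = Hdiv_divergence(1)[OF r(1)] Hdiv_divergence(1)[OF r(2)]
  have L: "(\<lambda>x. r x + c *\<^sub>R s x) \<in> L2 (lebesgue_on \<Omega>)" by (intro L2_add L2_scaleR rL)
  have D: "(\<lambda>x. divergence \<Omega> r x + c * divergence \<Omega> s x) \<in> L2 (lebesgue_on \<Omega>)"
    using L2_add[OF dL(1) L2_scaleR[OF dL(2), of c]] by simp
  have W: "weak_divergence \<Omega> (\<lambda>x. r x + c *\<^sub>R s x) (\<lambda>x. divergence \<Omega> r x + c * divergence \<Omega> s x)"
    unfolding weak_divergence_def
  proof (intro allI impI)
    fix \<phi> assume phi: "test_function \<Omega> \<phi>"
    have pL: "\<phi> \<in> L2 (lebesgue_on \<Omega>)" by (rule test_function_L2[OF phi domain(2,4)])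
    have gL: "gradient \<phi> \<in> L2 (lebesgue_on \<Omega>)"
      by (rule L2_continuous_bounded_domain[OF C1_continuous_gradient[OF test_function_C1[OF phi]] domain(2,4)])
    have "(LINT x|lebesgue_on \<Omega>. (r x + c *\<^sub>R s x) \<bullet> gradient \<phi> x)
      = (LINT x|lebesgue_on \<Omega>. r x \<bullet> gradient \<phi> x) + c * (LINT x|lebesgue_on \<Omega>. s x \<bullet> gradient \<phi> x)"
      using L2_inner_integrable[OF rL(1) gL] L2_inner_integrable[OF rL(2) gL] by (simp add: inner_add_left)
    also have "\<dots> = - (LINT x|lebesgue_on \<Omega>. divergence \<Omega> r x * \<phi> x) + c * - (LINT x|lebesgue_on \<Omega>. divergence \<Omega> s x * \<phi> x)"
      using Hdiv_divergence(2)[OF r(1)] Hdiv_divergence(2)[OF r(2)] phi unfolding weak_divergence_def by simp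
    also have "\<dots> = - (LINT x|lebesgue_on \<Omega>. (divergence \<Omega> r x + c * divergence \<Omega> s x) * \<phi> x)"
      using L2_mult_integrable[OF dL(1) pL] L2_mult_integrable[OF dL(2) pL] by (simp add: distrib_right mult.assoc)
    finally show "(LINT x|lebesgue_on \<Omega>. (r x + c *\<^sub>R s x) \<bullet> gradient \<phi> x) = - (LINT x|lebesgue_on \<Omega>. (divergence \<Omega> r x + c * divergence \<Omega> s x) * \<phi> x)" .
  qed
  show "(\<lambda>x. r x + c *\<^sub>R s x) \<in> Hdiv \<Omega>"
    "AE x in lebesgue_on \<Omega>. divergence \<Omega> (\<lambda>x. r x + c *\<^sub>R s x) x = divergence \<Omega> r x + c * divergence \<Omega> s x"
    using divergence_eq_AE[OF L D W] by auto
qed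

lemma RT_Hdiv:
  assumes r: "r \<in> RT \<T>"
  shows "r \<in> Hdiv \<Omega>" "AE x in lebesgue_on \<Omega>. divergence \<Omega> r x = pw_const \<T> (\<lambda>T. affine_div (piece T r)) x"
  using divergence_eq_AE[OF P1_L2[OF RT_P1[OF r]] pw_const_L2 RT_weak_divergence[OF r]] by auto

lemma RT_N_combination:
  assumes r: "r \<in> RT_N \<T> \<Gamma>N" "s \<in> RT_N \<T> \<Gamma>N"
  shows "(\<lambda>x. r x + c *\<^sub>R s x) \<in> RT_N \<T> \<Gamma>N"
proof -
  note R = RT_N_RT[OF r(1)] and S = RT_N_RT[OF r(2)]
  note pc = P1_combination(2)[OF RT_P1[OF R] RT_P1[OF S], of _ c]
  have 1: "(\<lambda>x. r x + c *\<^sub>R s x) \<in> P1 \<T>" by (rule P1_combination(1)[OF RT_P1[OF R] RT_P1[OF S]])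
  have 2: "\<exists>k. \<forall>x\<in>F. piece T (\<lambda>x. r x + c *\<^sub>R s x) x \<bullet> outer_normal T F = k" if T: "T \<in> \<T>" "F facet_of T" for T F
    using flux[OF R T] flux[OF S T] by (auto simp: pc[OF T(1)] inner_add_left)
  have 3: "piece T (\<lambda>x. r x + c *\<^sub>R s x) x \<bullet> outer_normal T F = piece T' (\<lambda>x. r x + c *\<^sub>R s x) x \<bullet> outer_normal T F"
    if T: "T \<in> \<T>" "T' \<in> \<T>" "T \<noteq> T'" "F facet_of T" "F facet_of T'" "x \<in> F" for T T' F x
  proof -
    have "piece T r x \<bullet> outer_normal T F = piece T' r x \<bullet> outer_normal T F"
      "piece T s x \<bullet> outer_normal T F = piece T' s x \<bullet> outer_normal T F"
      by (rule RT_continuous_flux[OF R T], rule RT_continuous_flux[OF S T])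
    then show ?thesis by (simp add: pc[OF T(1)] pc[OF T(2)] inner_add_left)
  qed
  have 4: "piece T (\<lambda>x. r x + c *\<^sub>R s x) x \<bullet> outer_normal T F = 0"
    if T: "T \<in> \<T>" "F facet_of T" "F \<subseteq> closure \<Gamma>N" "x \<in> F" for T F x
  proof -
    have "piece T r x \<bullet> outer_normal T F = 0" "piece T s x \<bullet> outer_normal T F = 0"
      by (rule RT_N_zero_flux[OF r(1) T], rule RT_N_zero_flux[OF r(2) T])
    then show ?thesis by (simp add: pc[OF T(1)] inner_add_left)
  qed
  show ?thesis
    unfolding RT_N_def RT_def
  proof (intro CollectI conjI ballI allI impI)
    show "(\<lambda>x. r x + c *\<^sub>R s x) \<in> P1 \<T>" by (rule 1)
    show "\<exists>k. \<forall>x\<in>F. piece T (\<lambda>x. r x + c *\<^sub>R s x) x \<bullet> outer_normal T F = k"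
      if "T \<in> \<T>" "F facet_of T" for T F by (rule 2[OF that])
    show "piece T (\<lambda>x. r x + c *\<^sub>R s x) x \<bullet> outer_normal T F = piece T' (\<lambda>x. r x + c *\<^sub>R s x) x \<bullet> outer_normal T F"
      if "T \<in> \<T>" "T' \<in> \<T>" "T \<noteq> T' \<and> F facet_of T \<and> F facet_of T'" "x \<in> F" for T T' F x
      using 3[OF that(1,2) _ _ _ that(4)] that(3) by simp
    show "piece T (\<lambda>x. r x + c *\<^sub>R s x) x \<bullet> outer_normal T F = 0"
      if "T \<in> \<T>" "F facet_of T \<and> F \<subseteq> closure \<Gamma>N" "x \<in> F" for T F x
      using 4[OF that(1) _ _ that(3)] that(2) by simp
  qed
qed

text \<open>A constant normal component sees \<open>v\<close> only through its facet means. These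
  are single-valued on interior facets and vanish on Dirichlet facets, while the flux vanishes on
  Neumann facets; so the jumps of \<open>v\<close> itself do no harm.\<close>

lemma discrete_integration_by_parts:
  assumes r: "r \<in> RT_N \<T> \<Gamma>N" and v: "v \<in> CR_D \<T> \<Gamma>D"
  shows "L2_inner (lebesgue_on \<Omega>) (Pi_h \<T> r) (nabla_h \<T> v) = - L2_inner (lebesgue_on \<Omega>) (divergence \<Omega> r) (Pi_h \<T> v)"
proof -
  note R = RT_N_RT[OF r] and V = CR_D_CR[OF v]
  note rP = RT_P1[OF R] and vP = CR_P1[OF V]
  let ?w = "pw_const \<T> (\<lambda>T. affine_div (piece T r))"
  have "L2_inner (lebesgue_on \<Omega>) (divergence \<Omega> r) (Pi_h \<T> v) = L2_inner (lebesgue_on \<Omega>) ?w (Pi_h \<T> v)"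
    using L2_measurable[OF Hdiv_divergence(1)[OF RT_Hdiv(1)[OF R]]] L2_measurable[OF pw_const_L2] L2_measurable[OF Pi_h_L2]
    by (intro L2_inner_cong_AE RT_Hdiv(2)[OF R]) auto
  also have "\<dots> = L2_inner (lebesgue_on \<Omega>) ?w v" by (rule L2_inner_pw_const_Pi_h[OF P1_L2[OF vP]])
  also have "\<dots> = (\<Sum>T\<in>\<T>. affine_div (piece T r) * (LINT x|lebesgue_on T. v x))"
    unfolding L2_inner_pw_const[OF P1_L2[OF vP]] by simp
  finally have 1: "L2_inner (lebesgue_on \<Omega>) (divergence \<Omega> r) (Pi_h \<T> v) = (\<Sum>T\<in>\<T>. affine_div (piece T r) * (LINT x|lebesgue_on T. v x))" .
  have "L2_inner (lebesgue_on \<Omega>) (Pi_h \<T> r) (nabla_h \<T> v) = L2_inner (lebesgue_on \<Omega>) (nabla_h \<T> v) (Pi_h \<T> r)"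
    by (rule L2_inner_commute)
  also have "\<dots> = L2_inner (lebesgue_on \<Omega>) (pw_const \<T> (\<lambda>T. slope T v)) r"
    unfolding nabla_h_eq_pw_const[OF vP] by (rule L2_inner_pw_const_Pi_h[OF P1_L2[OF rP]])
  also have "\<dots> = (\<Sum>T\<in>\<T>. slope T v \<bullet> (LINT x|lebesgue_on T. r x))"
    by (rule L2_inner_pw_const[OF P1_L2[OF rP]])
  finally have 2: "L2_inner (lebesgue_on \<Omega>) (Pi_h \<T> r) (nabla_h \<T> v) = (\<Sum>T\<in>\<T>. slope T v \<bullet> (LINT x|lebesgue_on T. r x))" .
  have "(\<Sum>T\<in>\<T>. slope T v \<bullet> (LINT x|lebesgue_on T. r x)) + (\<Sum>T\<in>\<T>. affine_div (piece T r) * (LINT x|lebesgue_on T. v x))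
    = (\<Sum>T\<in>\<T>. \<Sum>S | S facet_of T. flux r T S * (LINT y|surface_measure S. piece T v y))"
    unfolding sum.distrib[symmetric]
  proof (rule sum.cong[OF refl])
    fix T assume T: "T \<in> \<T>"
    note Tb = simplex_basics[OF simplex[OF T]]
    have e1: "(LINT x|lebesgue_on T. r x) = (LINT x|lebesgue_on T. piece T r x)"
      by (rule integral_element_cong[OF T P1_L2[OF rP] continuous_lebesgue_on_measurable[OF piece_continuous[OF rP T]]])
        (auto intro!: AE_I2 simp: P1_piece(2)[OF rP T])
    have e2: "(LINT x|lebesgue_on T. v x) = (LINT x|lebesgue_on T. piece T v x)"
      by (rule integral_element_cong[OF T P1_L2[OF vP] continuous_lebesgue_on_measurable[OF piece_continuous[OF vP T]]])
        (auto intro!: AE_I2 simp: P1_piece(2)[OF vP T])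
    have i1: "integrable (lebesgue_on T) (piece T r)" and i2: "integrable (lebesgue_on T) (piece T v)"
      by (intro integrable_lebesgue_on_compact Tb(1) piece_continuous rP vP T)+
    have "(LINT x|lebesgue_on T. piece T r x \<bullet> gradient (piece T v) x + affine_div (piece T r) * piece T v x)
      = (LINT x|lebesgue_on T. piece T r x) \<bullet> slope T v + affine_div (piece T r) * (LINT x|lebesgue_on T. piece T v x)"
      using i1 i2 by (simp add: slope_eq(1)[OF vP T] integrable_inner_left)
    then show "slope T v \<bullet> (LINT x|lebesgue_on T. r x) + affine_div (piece T r) * (LINT x|lebesgue_on T. v x)
      = (\<Sum>S | S facet_of T. flux r T S * (LINT y|surface_measure S. piece T v y))"
      using RT_divergence_element[OF R T slope_eq(2)[OF vP T]] by (simp add: e1 e2 inner_commute)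
  qed
  also have "\<dots> = 0"
  proof (rule facet_cancellation)
    fix T S assume T: "T \<in> \<T>" "S facet_of T" and S: "S \<subseteq> frontier \<Omega>"
    have "S \<subseteq> closure \<Gamma>D \<or> S \<subseteq> closure \<Gamma>N" using mesh T S unfolding simplicial_mesh_def by blast
    then show "flux r T S * (LINT y|surface_measure S. piece T v y) = 0"
    proof
      assume "S \<subseteq> closure \<Gamma>D"
      then have "average (surface_measure S) (piece T v) = 0" using v T unfolding CR_D_def by blast
      then show ?thesis by (simp add: integral_piece_eq_average[OF T])
    next
      assume "S \<subseteq> closure \<Gamma>N"
      then show ?thesis using flux_Neumann[OF r T] by simp
    qed
  next
    fix T T' S assume T: "T \<in> \<T>" "T' \<in> \<T>" "T \<noteq> T'" "S facet_of T" "S facet_of T'"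
    have "average (surface_measure S) (piece T v) = average (surface_measure S) (piece T' v)"
      using V T unfolding CR_iff by blast
    then show "flux r T' S * (LINT y|surface_measure S. piece T' v y) = - (flux r T S * (LINT y|surface_measure S. piece T v y))"
      using flux_opposite[OF R T] integral_piece_eq_average[OF T(1,4)] integral_piece_eq_average[OF T(2,5)] by simp
  qed
  finally show ?thesis using 1 2 by simp
qed

text \<open>Nodal basis function of a facet. It respects the Dirichlet condition because its only
  nonzero mean is on a facet not contained in \<open>closure \<Gamma>D\<close>.\<close>

lemma CR_facet_function:
  assumes T: "T \<in> \<T>" and S: "S facet_of T" and nD: "\<not> S \<subseteq> closure \<Gamma>D"
  obtains v where "v \<in> CR_D \<T> \<Gamma>D"
    "\<And>T' S'. T' \<in> \<T> \<Longrightarrow> S' facet_of T' \<Longrightarrow> average (surface_measure S') (piece T' v) = (if S' = S then 1 else 0)"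
proof -
  have "\<forall>T'. \<exists>p. T' \<in> \<T> \<longrightarrow> (affine_map p \<and> (\<forall>S'. S' facet_of T' \<longrightarrow> average (surface_measure S') p = (if S' = S then 1 else (0::real))))"
  proof
    fix T'
    show "\<exists>p. T' \<in> \<T> \<longrightarrow> (affine_map p \<and> (\<forall>S'. S' facet_of T' \<longrightarrow> average (surface_measure S') p = (if S' = S then 1 else (0::real))))"
    proof (cases "T' \<in> \<T>")
      case True
      show ?thesis by (rule affine_with_facet_means[OF simplex[OF True], of "\<lambda>S'. if S' = S then 1 else 0"]) blast
    qed simp
  qed
  from choice[OF this] obtain p where p: "\<And>T'. T' \<in> \<T> \<Longrightarrow> affine_map (p T')"
    "\<And>T' S'. T' \<in> \<T> \<Longrightarrow> S' facet_of T' \<Longrightarrow> average (surface_measure S') (p T') = (if S' = S then 1 else (0::real))"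
    by blast
  define v where "v = (\<lambda>x. \<Sum>T\<in>\<T>. indicator (interior T) x *\<^sub>R p T x)"
  have vP: "v \<in> P1 \<T>" and vp: "\<And>T. T \<in> \<T> \<Longrightarrow> piece T v = p T"
    unfolding v_def using P1_of_pieces[of p] p(1) by auto
  have av: "average (surface_measure S') (piece T' v) = (if S' = S then 1 else 0)" if "T' \<in> \<T>" "S' facet_of T'" for T' S'
    using p(2)[OF that] vp[OF that(1)] by simp
  have vC: "v \<in> CR \<T>" unfolding CR_iff using vP av by auto
  have "v \<in> CR_D \<T> \<Gamma>D" unfolding CR_D_def using vC av nD by auto
  then show thesis using that av by blast
qed

text \<open>Only one term of the facet-mean formula survives. The gradient is a multiple of the
  outer normal on the elements at \<open>S\<close>, which is why testing with it measures normal
  components.\<close>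

lemma slope_facet_function:
  assumes v: "v \<in> P1 \<T>" and S: "S facet_of T0"
    and av: "\<And>T' S'. T' \<in> \<T> \<Longrightarrow> S' facet_of T' \<Longrightarrow> average (surface_measure S') (piece T' v) = (if S' = S then 1 else 0)"
    and T: "T \<in> \<T>"
  shows "measure (lebesgue_on T) T * (slope T v \<bullet> b) = (if S facet_of T then (outer_normal T S \<bullet> b) * measure (surface_measure S) S else 0)"
proof -
  have "measure (lebesgue_on T) T * (slope T v \<bullet> b) = (\<Sum>S' | S' facet_of T. if S' = S then (outer_normal T S \<bullet> b) * measure (surface_measure S) S else 0)"
    unfolding slope_eq_averages[OF v T] by (rule sum.cong[OF refl]) (use av[OF T] in auto)
  then show ?thesis using finite_facets[OF simplex[OF T]] by simp
qed

text \<open>Testing with the basis function of a facet reads off the jump of the normal component there.\<close>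

lemma orthogonal_to_CR_gradients_imp_RT_N:
  assumes orth: "\<And>v. v \<in> CR_D \<T> \<Gamma>D \<Longrightarrow> L2_inner (lebesgue_on \<Omega>) (pw_const \<T> k) (nabla_h \<T> v) = 0"
  shows "pw_const \<T> k \<in> RT_N \<T> \<Gamma>N" "AE x in lebesgue_on \<Omega>. divergence \<Omega> (pw_const \<T> k) x = 0"
proof -
  have key: "(\<Sum>T'\<in>\<T>. if S facet_of T' then (outer_normal T' S \<bullet> k T') else 0) = 0"
    if T: "T \<in> \<T>" and S: "S facet_of T" and nD: "\<not> S \<subseteq> closure \<Gamma>D" for T S
  proof -
    obtain v where v: "v \<in> CR_D \<T> \<Gamma>D"
      "\<And>T' S'. T' \<in> \<T> \<Longrightarrow> S' facet_of T' \<Longrightarrow> average (surface_measure S') (piece T' v) = (if S' = S then 1 else 0)"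
      by (rule CR_facet_function[OF T S nD]) (rule that; assumption)
    note vP = CR_P1[OF CR_D_CR[OF v(1)]]
    let ?s = "measure (surface_measure S) S"
    have "0 = (\<Sum>T'\<in>\<T>. measure (lebesgue_on T') T' * (k T' \<bullet> slope T' v))"
      using orth[OF v(1)] unfolding nabla_h_eq_pw_const[OF vP] L2_inner_pw_const_pw_const by simp
    also have "\<dots> = (\<Sum>T'\<in>\<T>. ?s * (if S facet_of T' then (outer_normal T' S \<bullet> k T') else 0))"
      by (rule sum.cong[OF refl])
        (use slope_facet_function[OF vP S v(2)] in \<open>auto simp: inner_commute[of "k _"]\<close>)
    also have "\<dots> = ?s * (\<Sum>T'\<in>\<T>. if S facet_of T' then (outer_normal T' S \<bullet> k T') else 0)"
      by (rule sum_distrib_left[symmetric])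
    finally show ?thesis using facet_surface_measure(3)[OF simplex[OF T] S] by simp
  qed
  note pk = pw_const_P1(2)[of _ k]
  have nc: "k T \<bullet> outer_normal T S = k T' \<bullet> outer_normal T S"
    if T: "T \<in> \<T>" "T' \<in> \<T>" "T \<noteq> T'" "S facet_of T" "S facet_of T'" for T T' S
  proof -
    have nD: "\<not> S \<subseteq> closure \<Gamma>D" using shared_facet_not_frontier[OF T] boundary_parts(1) by blast
    have "(\<Sum>R\<in>\<T>. if S facet_of R then (outer_normal R S \<bullet> k R) else 0) = (\<Sum>R\<in>{T, T'}. outer_normal R S \<bullet> k R)"
    proof (rule sum.mono_neutral_cong_right)
      show "\<forall>R\<in>\<T> - {T, T'}. (if S facet_of R then outer_normal R S \<bullet> k R else 0) = 0"
        using facet_at_most_two[OF T(1,2) _ T(4,5) _ T(3)] by auto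
    qed (use finite_mesh T in auto)
    then show ?thesis
      using key[OF T(1,4) nD] T(3) facet_opposite_normals[OF T] by (simp add: inner_commute)
  qed
  have nN: "k T \<bullet> outer_normal T S = 0" if T: "T \<in> \<T>" "S facet_of T" "S \<subseteq> closure \<Gamma>N" for T S
  proof -
    \<comment> \<open>A Neumann facet that also lay in \<open>closure \<Gamma>D\<close> would carry
      no test function, and its flux would remain undetermined.\<close>
    have nD: "\<not> S \<subseteq> closure \<Gamma>D" by (rule facet_not_both_parts[OF T])
    have un: "R = T" if "R \<in> \<T>" "S facet_of R" for R
    proof (rule ccontr)
      assume "R \<noteq> T"
      then have "\<not> S \<subseteq> frontier \<Omega>" using shared_facet_not_frontier[OF that(1) T(1) _ that(2) T(2)] by blast
      then show False using T(3) boundary_parts(2) by blast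
    qed
    have "(\<Sum>R\<in>\<T>. if S facet_of R then (outer_normal R S \<bullet> k R) else 0) = (\<Sum>R\<in>\<T>. if R = T then outer_normal T S \<bullet> k T else 0)"
    proof (rule sum.cong[OF refl])
      fix R assume R: "R \<in> \<T>"
      show "(if S facet_of R then (outer_normal R S \<bullet> k R) else 0) = (if R = T then outer_normal T S \<bullet> k T else 0)"
        using un[OF R] T(2) by (cases "R = T") auto
    qed
    then show ?thesis using key[OF T(1,2) nD] finite_mesh T(1) by (simp add: inner_commute)
  qed
  have R: "pw_const \<T> k \<in> RT \<T>"
    unfolding RT_def
  proof (intro CollectI conjI ballI allI impI)
    show "pw_const \<T> k \<in> P1 \<T>" by (rule pw_const_P1(1))
    show "\<exists>c. \<forall>x\<in>S. piece T (pw_const \<T> k) x \<bullet> outer_normal T S = c" if "T \<in> \<T>" for T S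
      by (simp add: pk[OF that])
    show "piece T (pw_const \<T> k) x \<bullet> outer_normal T S = piece T' (pw_const \<T> k) x \<bullet> outer_normal T S"
      if "T \<in> \<T>" "T' \<in> \<T>" "T \<noteq> T' \<and> S facet_of T \<and> S facet_of T'" for T T' S x
      using nc that by (simp add: pk)
  qed
  show "pw_const \<T> k \<in> RT_N \<T> \<Gamma>N"
    unfolding RT_N_def using R nN by (auto simp: pk)
  \<comment> \<open>Constant pieces have divergence 0, and for a Raviart-Thomas field the weak
    divergence is the element-wise one.\<close>
  have "pw_const \<T> (\<lambda>T. affine_div (piece T (pw_const \<T> k))) = pw_const \<T> (\<lambda>T. 0)"
    by (rule pw_const_cong) (simp add: pk affine_div_const)
  then have "pw_const \<T> (\<lambda>T. affine_div (piece T (pw_const \<T> k))) = (\<lambda>x. 0)" by (simp add: pw_const_def fun_eq_iff)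
  then show "AE x in lebesgue_on \<Omega>. divergence \<Omega> (pw_const \<T> k) x = 0"
    using RT_Hdiv(2)[OF R] by simp
qed

end

subsection \<open>The Crouzeix-Raviart interpolant\<close>

context simplicial_triangulation
begin

text \<open>A trace is chosen for each facet before the affine pieces are chosen for each element.
  Both elements at a facet are then given the same mean, and membership in \<open>CR\<close>
  follows.\<close>

lemma cr_interpolant_exists:
  assumes v: "v \<in> H1 \<Omega>" shows "\<exists>w. cr_interpolant \<T> v w"
proof -
  have "\<forall>S. \<exists>g. \<forall>T\<in>\<T>. S facet_of T \<longrightarrow> has_trace (interior T) v S g"
  proof
    fix S
    show "\<exists>g. \<forall>T\<in>\<T>. S facet_of T \<longrightarrow> has_trace (interior T) v S g"
    proof (cases "\<exists>T\<in>\<T>. S facet_of T")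
      case True
      then obtain T where T: "T \<in> \<T>" "S facet_of T" by blast
      obtain g where "\<And>T'. T' \<in> \<T> \<Longrightarrow> S facet_of T' \<Longrightarrow> has_trace (interior T') v S g"
        by (rule common_trace[OF T v]) (rule that; assumption)
      then show ?thesis by blast
    qed blast
  qed
  from choice[OF this] obtain g where g: "\<And>T S. T \<in> \<T> \<Longrightarrow> S facet_of T \<Longrightarrow> has_trace (interior T) v S (g S)" by blast
  have "\<forall>T. \<exists>p. T \<in> \<T> \<longrightarrow> (affine_map p \<and> (\<forall>S. S facet_of T \<longrightarrow> average (surface_measure S) p = average (surface_measure S) (g S)))"
  proof
    fix T
    show "\<exists>p. T \<in> \<T> \<longrightarrow> (affine_map p \<and> (\<forall>S. S facet_of T \<longrightarrow> average (surface_measure S) p = average (surface_measure S) (g S)))"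
    proof (cases "T \<in> \<T>")
      case True
      show ?thesis by (rule affine_with_facet_means[OF simplex[OF True], of "\<lambda>S. average (surface_measure S) (g S)"]) blast
    qed simp
  qed
  from choice[OF this] obtain p where p: "\<And>T. T \<in> \<T> \<Longrightarrow> affine_map (p T)"
    "\<And>T S. T \<in> \<T> \<Longrightarrow> S facet_of T \<Longrightarrow> average (surface_measure S) (p T) = average (surface_measure S) (g S)" by blast
  define w where "w = (\<lambda>x. \<Sum>T\<in>\<T>. indicator (interior T) x *\<^sub>R p T x)"
  have wP: "w \<in> P1 \<T>" and wp: "\<And>T. T \<in> \<T> \<Longrightarrow> piece T w = p T"
    unfolding w_def using P1_of_pieces[of p] p(1) by auto
  have av: "average (surface_measure S) (piece T w) = average (surface_measure S) (g S)" if "T \<in> \<T>" "S facet_of T" for T S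
    using p(2)[OF that] wp[OF that(1)] by simp
  have "w \<in> CR \<T>" unfolding CR_iff using wP av by auto
  then have "cr_interpolant \<T> v w" unfolding cr_interpolant_def using g av by blast
  then show ?thesis by blast
qed

lemma I_cr: "v \<in> H1 \<Omega> \<Longrightarrow> cr_interpolant \<T> v (I_cr \<T> v)"
  using someI_ex[OF cr_interpolant_exists[of v]] by (simp only: I_cr_def)

lemma I_cr_CR: "v \<in> H1 \<Omega> \<Longrightarrow> I_cr \<T> v \<in> CR \<T>"
  using I_cr by (simp add: cr_interpolant_def)

lemma I_cr_P1: "v \<in> H1 \<Omega> \<Longrightarrow> I_cr \<T> v \<in> P1 \<T>"
  by (rule CR_P1[OF I_cr_CR])

lemma I_cr_average:
  assumes v: "v \<in> H1 \<Omega>" and T: "T \<in> \<T>" and S: "S facet_of T"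
  shows "\<exists>g. has_trace (interior T) v S g \<and> average (surface_measure S) (piece T (I_cr \<T> v)) = average (surface_measure S) g"
proof -
  have "\<forall>T\<in>\<T>. \<forall>S. S facet_of T \<longrightarrow> (\<exists>g. has_trace (interior T) v S g \<and>
          average (surface_measure S) (piece T (I_cr \<T> v)) = average (surface_measure S) g)"
    using I_cr[OF v] unfolding cr_interpolant_def by (rule conjunct2)
  from this[rule_format, OF T S] show ?thesis .
qed

text \<open>On each element both sides are obtained by the divergence theorem from the facet means
  of the trace, which the interpolant preserves.\<close>

lemma nabla_h_I_cr:
  assumes v: "v \<in> H1 \<Omega>"
  shows "nabla_h \<T> (I_cr \<T> v) = Pi_h \<T> (grad \<Omega> v)"
  unfolding nabla_h_eq_pw_const[OF I_cr_P1[OF v]] Pi_h_eq_pw_const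
proof (rule pw_const_cong)
  fix T assume T: "T \<in> \<T>"
  note Tb = simplex_basics[OF simplex[OF T]] and sub = interior_mesh_subset[OF T]
  let ?w = "I_cr \<T> v" and ?I = "interior T"
  have gL: "grad \<Omega> v \<in> L2 (lebesgue_on \<Omega>)" by (rule H1_grad(1)[OF v])
  have vI: "v \<in> H1 ?I" by (rule H1_restrict(1)[OF domain(1,2) open_interior sub v])
  have "\<forall>S. \<exists>g. S facet_of T \<longrightarrow> (has_trace ?I v S g \<and> average (surface_measure S) (piece T ?w) = average (surface_measure S) g)"
    using I_cr_average[OF v T] by blast
  from choice[OF this] obtain g where g: "\<And>S. S facet_of T \<Longrightarrow> has_trace ?I v S (g S)"
    "\<And>S. S facet_of T \<Longrightarrow> average (surface_measure S) (piece T ?w) = average (surface_measure S) (g S)" by blast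
  have c: "measure (lebesgue_on T) T * (slope T ?w \<bullet> b) = (LINT x|lebesgue_on T. grad \<Omega> v x) \<bullet> b" for b
  proof -
    have "measure (lebesgue_on T) T * (slope T ?w \<bullet> b) = (\<Sum>S | S facet_of T. (outer_normal T S \<bullet> b) * (LINT y|surface_measure S. g S y))"
      unfolding slope_eq_averages[OF I_cr_P1[OF v] T]
      by (rule sum.cong[OF refl]) (use g(2) integral_piece_eq_average[OF T] in simp)
    also have "\<dots> = (LINT x|lebesgue_on ?I. grad ?I v x \<bullet> b)"
      by (rule integral_grad_eq_traces[OF simplex[OF T] g(1), symmetric])
    also have "\<dots> = (LINT x|lebesgue_on ?I. grad \<Omega> v x \<bullet> b)"
    proof (rule integral_cong_AE)
      show "(\<lambda>x. grad ?I v x \<bullet> b) \<in> borel_measurable (lebesgue_on ?I)"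
        by (rule L2_measurable[OF L2_component[OF H1_grad(1)[OF vI]]])
      show "(\<lambda>x. grad \<Omega> v x \<bullet> b) \<in> borel_measurable (lebesgue_on ?I)"
        by (rule L2_measurable[OF L2_component[OF L2_lebesgue_on_subset(1)[OF gL sub domain(4) Tb(6)]]])
      show "AE x in lebesgue_on ?I. grad ?I v x \<bullet> b = grad \<Omega> v x \<bullet> b"
        using H1_restrict(2)[OF domain(1,2) open_interior sub v] by eventually_elim simp
    qed
    also have "\<dots> = (LINT x|lebesgue_on T. grad \<Omega> v x \<bullet> b)"
      by (rule L2_element(3)[OF L2_component[OF gL] T, symmetric])
    also have "\<dots> = (LINT x|lebesgue_on T. grad \<Omega> v x) \<bullet> b"
      using L2_element(2)[OF gL T] by (rule integral_inner_left)
    finally show ?thesis .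
  qed
  have "measure (lebesgue_on T) T *\<^sub>R slope T ?w = (LINT x|lebesgue_on T. grad \<Omega> v x)"
    by (rule euclidean_eqI) (use c in simp)
  then show "slope T ?w = average (lebesgue_on T) (grad \<Omega> v)"
    using Tb(9) by (simp add: average_def flip: \<open>measure (lebesgue_on T) T *\<^sub>R slope T ?w = (LINT x|lebesgue_on T. grad \<Omega> v x)\<close>)
qed

text \<open>A Dirichlet facet is a \<open>(d-1)\<close>-simplex in the boundary, so it carries a
  zero trace relative to \<Omega>. After restriction to the element this agrees, by uniqueness, with
  whichever trace the interpolant used.\<close>

lemma I_cr_CR_D:
  assumes v: "v \<in> H1_D \<Omega> \<Gamma>D" shows "I_cr \<T> v \<in> CR_D \<T> \<Gamma>D"
proof -
  have vH: "v \<in> H1 \<Omega>" and z: "zero_trace_on \<Omega> (closure \<Gamma>D) v" using v by (auto simp: H1_D_def)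
  have "average (surface_measure S) (piece T (I_cr \<T> v)) = 0"
    if T: "T \<in> \<T>" and S: "S facet_of T" and D: "S \<subseteq> closure \<Gamma>D" for T S
  proof -
    note sT = simplex[OF T]
    obtain C where C: "\<not> affine_dependent C" "finite C" "card C = Suc DIM('a)" and TC: "T = convex hull C"
      using simplex_vertices[OF sT] .
    obtain a where a: "a \<in> C" and Sa: "S = convex hull (C - {a})"
      using S facet_of_simplex[OF C(1,3)] unfolding TC by blast
    have "(int DIM('a) - 1) simplex S"
      unfolding simplex_def
    proof (intro exI[of _ "C - {a}"] conjI)
      show "\<not> affine_dependent (C - {a})" using C(1) affine_dependent_subset by blast
      show "int (card (C - {a})) = int DIM('a) - 1 + 1" using C a by simp
    qed (rule Sa)
    moreover have "S \<subseteq> frontier \<Omega>" using D boundary_parts(1) by blast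
    ultimately obtain g where g: "has_trace \<Omega> v S g" "AE x in surface_measure S. x \<in> closure \<Gamma>D \<longrightarrow> g x = 0"
      using z unfolding zero_trace_on_def by blast
    have "AE x in surface_measure S. g x = 0"
      using g(2) AE_space by eventually_elim (use D facet_surface_measure(2)[OF sT S] in auto)
    then have "(LINT x|surface_measure S. g x) = (LINT x|surface_measure S. 0)"
      using g(1) by (intro integral_cong_AE) (auto simp: has_trace_def)
    then have g0: "average (surface_measure S) g = 0" by (simp add: average_def)
    have gT: "has_trace (interior T) v S g"
      by (rule has_trace_restrict[OF domain(1,2) open_interior interior_mesh_subset[OF T] g(1)])
    obtain g' where g': "has_trace (interior T) v S g'" "average (surface_measure S) (piece T (I_cr \<T> v)) = average (surface_measure S) g'"
      using I_cr_average[OF vH T S] by blast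
    show ?thesis using average_trace_unique[OF sT S g'(1) gT] g'(2) g0 by simp
  qed
  then show ?thesis unfolding CR_D_def using I_cr_CR[OF vH] by blast
qed

subsection \<open>The space with Dirichlet boundary conditions\<close>

lemma H1_D_H1: "v \<in> H1_D \<Omega> \<Gamma>D \<Longrightarrow> v \<in> H1 \<Omega>"
  by (simp add: H1_D_def)

text \<open>\<open>zero_trace_on\<close> ranges over all \<open>(d-1)\<close>-simplices in the
  boundary, not only over mesh facets, so square-integrability of traces of smooth functions is
  shown for these in general.\<close>

lemma surface_measure_L2:
  assumes F: "(int DIM('a) - 1) simplex F" and f: "continuous_on UNIV (f :: 'a \<Rightarrow> real)"
  shows "f \<in> L2 (surface_measure F)"
proof -
  have "aff_dim F = int DIM('a) - 1" by (rule aff_dim_simplex[OF F])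
  also have "\<dots> = int (DIM('a) - 1)" by (simp add: of_nat_diff)
  finally have "\<exists>m d. m \<noteq> 0 \<and> affine hull F = {x. m \<bullet> x = d}" by (rule aff_dim_eq_hyperplane[THEN iffD1])
  then obtain m d where m: "m \<noteq> 0" and md: "affine hull F = {x. m \<bullet> x = d}" by (elim exE conjE)
  define n where "n = m /\<^sub>R norm m"
  have n: "norm n = 1" using m by (simp add: n_def)
  have aff: "affine hull F = {x. n \<bullet> x = d / norm m}" unfolding md using m by (auto simp: n_def field_simps)
  have cF: "compact F" by (rule compact_simplex[OF F])
  then have Fm: "F \<in> sets borel" by (simp add: borel_compact)
  let ?\<sigma> = "hyperplane_measure n (d / norm m)"
  have e: "surface_measure F = restrict_space ?\<sigma> F" by (rule surface_measure_eq[OF n aff])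
  have sp: "space (surface_measure F) = F" by (simp add: e space_restrict_space)
  have fin: "finite_measure (surface_measure F)"
    by (rule finite_measureI)
      (use emeasure_hyperplane_measure_finite[OF n Fm compact_imp_bounded[OF cF], of "d / norm m"] Fm in
        \<open>simp add: e space_restrict_space emeasure_restrict_space sets_hyperplane_measure\<close>)
  have "f \<in> borel_measurable borel" using f by (rule borel_measurable_continuous_onI)
  then have "f \<in> borel_measurable ?\<sigma>" by measurable
  then have fm: "f \<in> borel_measurable (surface_measure F)" unfolding e by (rule measurable_restrict_space1)
  have "compact (f ` F)" by (rule compact_continuous_image[OF continuous_on_subset[OF f] cF]) simp
  then obtain B where "\<And>x. x \<in> F \<Longrightarrow> norm (f x) \<le> B"
    using compact_imp_bounded by (fastforce simp: bounded_iff)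
  then show ?thesis by (intro L2_bounded[OF fin fm]) (use sp in auto)
qed

lemma H1_D_combination:
  assumes v: "v \<in> H1_D \<Omega> \<Gamma>D" "w \<in> H1_D \<Omega> \<Gamma>D"
  shows "(\<lambda>x. v x + c * w x) \<in> H1_D \<Omega> \<Gamma>D"
  unfolding H1_D_def zero_trace_on_def
proof (intro CollectI conjI allI impI)
  show "(\<lambda>x. v x + c * w x) \<in> H1 \<Omega>" by (intro H1_combination(1) domain H1_D_H1 v)
  fix F assume F: "(int DIM('a) - 1) simplex F \<and> F \<subseteq> frontier \<Omega>"
  obtain g where g: "has_trace \<Omega> v F g" "AE x in surface_measure F. x \<in> closure \<Gamma>D \<longrightarrow> g x = 0"
    using v(1) F unfolding H1_D_def zero_trace_on_def by blast
  obtain g' where g': "has_trace \<Omega> w F g'" "AE x in surface_measure F. x \<in> closure \<Gamma>D \<longrightarrow> g' x = 0"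
    using v(2) F unfolding H1_D_def zero_trace_on_def by blast
  have "has_trace \<Omega> (\<lambda>x. v x + c * w x) F (\<lambda>x. g x + c * g' x)"
    by (rule has_trace_combination[OF domain(1,2) g(1) g'(1)])
      (use F in \<open>auto intro!: surface_measure_L2 smooth_continuous\<close>)
  moreover have "AE x in surface_measure F. x \<in> closure \<Gamma>D \<longrightarrow> g x + c * g' x = 0"
    using g(2) g'(2) by eventually_elim simp
  ultimately show "\<exists>g. has_trace \<Omega> (\<lambda>x. v x + c * w x) F g \<and> (AE x in surface_measure F. x \<in> closure \<Gamma>D \<longrightarrow> g x = 0)"
    by blast
qed

text \<open>The constant sequence approximates, and compact support gives zero boundary values.
  Testing the primal equation with these functions identifies a weak divergence.\<close>

lemma test_function_H1_D:
  assumes phi: "test_function \<Omega> \<phi>"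
  shows "\<phi> \<in> H1_D \<Omega> \<Gamma>D"
  unfolding H1_D_def zero_trace_on_def
proof (intro CollectI conjI allI impI)
  note p = test_function_C1[OF phi]
  note h = H1_C1[OF domain(1,2) p]
  show "\<phi> \<in> H1 \<Omega>" by (rule h(1))
  obtain K where K: "K \<subseteq> \<Omega>" "\<And>x. x \<notin> K \<Longrightarrow> \<phi> x = 0" by (rule test_functionE[OF phi]) blast
  fix F assume F: "(int DIM('a) - 1) simplex F \<and> F \<subseteq> frontier \<Omega>"
  have sp: "space (surface_measure F) \<subseteq> F"
  proof -
    have "aff_dim F = int DIM('a) - 1" using aff_dim_simplex F by blast
    also have "\<dots> = int (DIM('a) - 1)" by (simp add: of_nat_diff)
    finally have "\<exists>m d. m \<noteq> 0 \<and> affine hull F = {x. m \<bullet> x = d}" by (rule aff_dim_eq_hyperplane[THEN iffD1])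
    then obtain m d where m: "m \<noteq> 0" and md: "affine hull F = {x. m \<bullet> x = d}" by (elim exE conjE)
    have "norm (m /\<^sub>R norm m) = 1" "affine hull F = {x. (m /\<^sub>R norm m) \<bullet> x = d / norm m}"
      unfolding md using m by (auto simp: field_simps)
    from surface_measure_eq[OF this] show ?thesis by (simp add: space_restrict_space)
  qed
  have z: "\<phi> x = 0" if "x \<in> F" for x
    using that F K domain(1) by (auto simp: frontier_def interior_open)
  have "L2_norm (surface_measure F) (\<lambda>x. \<phi> x - 0) = 0"
  proof -
    have "L2_inner (surface_measure F) (\<lambda>x. \<phi> x - 0) (\<lambda>x. \<phi> x - 0) = (LINT x|surface_measure F. 0)"
      unfolding L2_inner_def by (rule Bochner_Integration.integral_cong[OF refl]) (use z sp in auto)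
    then show ?thesis by (simp add: L2_norm_def)
  qed
  moreover have "L2_norm (lebesgue_on \<Omega>) (\<lambda>x. gradient \<phi> x - grad \<Omega> \<phi> x) = 0"
  proof -
    have gL: "gradient \<phi> \<in> L2 (lebesgue_on \<Omega>)" by (rule L2_continuous_bounded_domain[OF C1_continuous_gradient[OF p] domain(2,4)])
    have "L2_norm (lebesgue_on \<Omega>) (\<lambda>x. gradient \<phi> x - grad \<Omega> \<phi> x) = L2_norm (lebesgue_on \<Omega>) (\<lambda>x. 0 :: 'a)"
      by (rule L2_norm_cong_AE)
        (use h(2) L2_measurable[OF L2_diff[OF gL H1_grad(1)[OF h(1)]]] in \<open>auto elim: eventually_mono\<close>)
    then show ?thesis by simp
  qed
  moreover have "smooth \<phi>" using phi by (simp add: test_function_def)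
  ultimately have "has_trace \<Omega> \<phi> F (\<lambda>x. 0)"
    unfolding has_trace_def using h(1) by (intro conjI exI[of _ "\<lambda>n. \<phi>"]) auto
  then show "\<exists>g. has_trace \<Omega> \<phi> F g \<and> (AE x in surface_measure F. x \<in> closure \<Gamma>D \<longrightarrow> g x = 0)"
    by (intro exI[of _ "\<lambda>x. 0"]) simp
qed

lemma Hdiv_N_D:
  assumes "r \<in> Hdiv_N \<Omega> \<Gamma>D"
  shows "r \<in> Hdiv \<Omega>" "r \<in> L2 (lebesgue_on \<Omega>)"
    "v \<in> H1_D \<Omega> \<Gamma>D \<Longrightarrow> L2_inner (lebesgue_on \<Omega>) r (grad \<Omega> v) = - L2_inner (lebesgue_on \<Omega>) (divergence \<Omega> r) v"
  using assms by (auto simp: Hdiv_N_def Hdiv_def eq_neg_iff_add_eq_0)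

lemma Hdiv_N_combination:
  assumes r: "r \<in> Hdiv_N \<Omega> \<Gamma>D" "s \<in> Hdiv_N \<Omega> \<Gamma>D"
  shows "(\<lambda>x. r x + c *\<^sub>R s x) \<in> Hdiv_N \<Omega> \<Gamma>D"
  unfolding Hdiv_N_def
proof (intro CollectI conjI ballI)
  let ?M = "lebesgue_on \<Omega>" and ?t = "\<lambda>x. r x + c *\<^sub>R s x"
  note H = Hdiv_combination[OF Hdiv_N_D(1)[OF r(1)] Hdiv_N_D(1)[OF r(2)], of c]
  show "?t \<in> Hdiv \<Omega>" by (rule H(1))
  fix v assume v: "v \<in> H1_D \<Omega> \<Gamma>D"
  note vL = H1_D1[OF H1_D_H1[OF v]] and gL = H1_grad(1)[OF H1_D_H1[OF v]]
  note dr = Hdiv_divergence(1)[OF Hdiv_N_D(1)[OF r(1)]] and ds = Hdiv_divergence(1)[OF Hdiv_N_D(1)[OF r(2)]]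
  have dL: "(\<lambda>x. divergence \<Omega> r x + c * divergence \<Omega> s x) \<in> L2 ?M"
    using L2_add[OF dr L2_scaleR[OF ds, of c]] by simp
  have "L2_inner ?M (divergence \<Omega> ?t) v = L2_inner ?M (\<lambda>x. divergence \<Omega> r x + c * divergence \<Omega> s x) v"
    by (rule L2_inner_cong_AE[OF H(2)])
      (auto intro!: L2_measurable dL Hdiv_divergence(1)[OF H(1)] vL)
  also have "\<dots> = L2_inner ?M (divergence \<Omega> r) v + c * L2_inner ?M (divergence \<Omega> s) v"
    using L2_inner_add_left[OF dr L2_scaleR[OF ds, of c] vL] L2_inner_scaleR_left[of ?M c "divergence \<Omega> s" v] by simp
  finally show "L2_inner ?M ?t (grad \<Omega> v) + L2_inner ?M (divergence \<Omega> ?t) v = 0"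
    using L2_inner_add_left[OF Hdiv_N_D(2)[OF r(1)] L2_scaleR[OF Hdiv_N_D(2)[OF r(2)], of c] gL]
      L2_inner_scaleR_left[of ?M c s "grad \<Omega> v"] Hdiv_N_D(3)[OF r(1) v] Hdiv_N_D(3)[OF r(2) v]
    by (simp add: algebra_simps)
qed

end

subsection \<open>Error identity and quasi-optimality\<close>

lemma is_arg_max_not_less: "is_arg_max f P x \<Longrightarrow> P y \<Longrightarrow> \<not> f x < f y"
  by (auto simp: is_arg_max_def)

text \<open>Every optimality condition below has this form: the energy along a line is a quadratic
  polynomial in \<open>t\<close>, and no linear term can survive at an extremum.\<close>

lemma nonneg_quadratic_imp_zero:
  fixes A B :: real
  assumes "\<And>t. 0 \<le> t\<^sup>2 * A + t * B" and "0 \<le> A"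
  shows "B = 0"
proof -
  have "(B / 2)\<^sup>2 \<le> 0 * A"
    by (rule nonneg_quadratic_imp) (use assms in \<open>auto simp: algebra_simps\<close>)
  then show ?thesis by simp
qed

lemma L2_norm_square_orthogonal:
  assumes "x \<in> L2 M" "y \<in> L2 M" "L2_inner M x y = 0"
  shows "(L2_norm M (\<lambda>t. x t - y t))\<^sup>2 = (L2_norm M x)\<^sup>2 + (L2_norm M y)\<^sup>2"
proof -
  have "L2_inner M x (\<lambda>t. - y t) = 0" using assms(3) by (simp add: L2_inner_def)
  then show ?thesis using L2_norm_square_add[OF assms(1) L2_minus[OF assms(2)]] by (simp add: L2_norm_minus)
qed

text \<open>For orthogonal \<open>x\<close> and \<open>y\<close>, the sum on the right equals
  \<open>\<parallel>z\<parallel>\<^sup>2 + \<parallel>z - x - y\<parallel>\<^sup>2\<close>.\<close>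

lemma L2_norm_square_le_orthogonal:
  assumes x: "x \<in> L2 M" and y: "y \<in> L2 M" and z: "z \<in> L2 M" and xy: "L2_inner M x y = 0"
  shows "(L2_norm M z)\<^sup>2 \<le> (L2_norm M (\<lambda>t. z t - x t))\<^sup>2 + (L2_norm M (\<lambda>t. z t - y t))\<^sup>2"
proof -
  have "(L2_norm M (\<lambda>t. z t - x t))\<^sup>2 + (L2_norm M (\<lambda>t. z t - y t))\<^sup>2
      = (L2_norm M z)\<^sup>2 + (L2_norm M (\<lambda>t. (z t - x t) - y t))\<^sup>2"
    using xy by (simp add: L2_norm_square L2_inner_diff_left L2_inner_diff_right L2_diff x y z
        L2_inner_commute[of M x z] L2_inner_commute[of M y z] L2_inner_commute[of M y x])
  then show ?thesis by simp
qed

section \<open>The Poisson problem: primal and dual optimality\<close>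

locale poisson_discretisation = simplicial_triangulation \<Omega> \<Gamma>D \<Gamma>N \<T>
  for \<Omega> \<Gamma>D \<Gamma>N :: "'a::euclidean_space set" and \<T> :: "'a set set" +
  fixes f uD u uh :: "'a \<Rightarrow> real" and fv q qh :: "'a \<Rightarrow> 'a" and I_rt :: "('a \<Rightarrow> 'a) \<Rightarrow> 'a \<Rightarrow> 'a"
  assumes uD: "uD \<in> H1 \<Omega>" and f: "f \<in> L2 (lebesgue_on \<Omega>)" and fv: "fv \<in> L2 (lebesgue_on \<Omega>)"
    and I_rt: "rt_interpolation \<Omega> \<Gamma>D \<Gamma>N \<T> I_rt"
    and u_min: "is_arg_min (primal_energy \<Omega> f fv uD) (\<lambda>v. v \<in> H1_D \<Omega> \<Gamma>D) u"
    and q_max: "is_arg_max (dual_energy \<Omega> f fv uD) (\<lambda>r. (\<lambda>x. r x - fv x) \<in> Hdiv_N \<Omega> \<Gamma>D) q"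
    and uh_min: "is_arg_min (discrete_primal_energy \<Omega> \<T> (Pi_h \<T> f) (Pi_h \<T> fv) (I_cr \<T> uD)) (\<lambda>vh. vh \<in> CR_D \<T> \<Gamma>D) uh"
    and qh_max: "is_arg_max (discrete_dual_energy \<Omega> \<T> (Pi_h \<T> f) (Pi_h \<T> fv) (I_cr \<T> uD))
      (\<lambda>rh. (\<lambda>x. rh x - Pi_h \<T> fv x) \<in> RT_N \<T> \<Gamma>N) qh"
begin

abbreviation (input) "M \<equiv> lebesgue_on \<Omega>"
abbreviation (input) "uDh \<equiv> I_cr \<T> uD"
abbreviation (input) "fh \<equiv> Pi_h \<T> f"
abbreviation (input) "fvh \<equiv> Pi_h \<T> fv"

text \<open>The candidate for the dual maximiser, followed by its discrete counterpart
  \<open>ph\<close>. Agreement of \<open>p\<close> with \<open>q\<close>, and of \<open>ph\<close>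
  with \<open>Pi_h qh\<close>, is obtained up to null sets.\<close>

definition p where "p = grad \<Omega> (\<lambda>x. u x + uD x)"
definition ph where "ph = nabla_h \<T> (\<lambda>x. uh x + uDh x)"

lemma u: "u \<in> H1_D \<Omega> \<Gamma>D" "u \<in> H1 \<Omega>"
  using u_min H1_D_H1 by (auto simp: is_arg_min_def)

lemma u_uD: "(\<lambda>x. u x + uD x) \<in> H1 \<Omega>" "AE x in M. p x = grad \<Omega> u x + grad \<Omega> uD x"
  using H1_combination[OF domain(1,2) u(2) uD, of 1] by (auto simp: p_def)

lemma p_L2: "p \<in> L2 M"
  unfolding p_def by (rule H1_grad(1)[OF u_uD(1)])

lemma primal_Euler_Lagrange:
  assumes v: "v \<in> H1_D \<Omega> \<Gamma>D"
  shows "L2_inner M p (grad \<Omega> v) = L2_inner M f v + L2_inner M fv (grad \<Omega> v)"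
proof -
  note vH = H1_D_H1[OF v]
  note vL = H1_D1[OF vH] and gL = H1_grad(1)[OF vH]
  note uL = H1_D1[OF u(2)] and guL = H1_grad(1)[OF u(2)]
  let ?B = "L2_inner M p (grad \<Omega> v) - L2_inner M f v - L2_inner M fv (grad \<Omega> v)"
  have "0 \<le> t\<^sup>2 * ((L2_norm M (grad \<Omega> v))\<^sup>2 / 2) + t * ?B" for t
  proof -
    let ?w = "\<lambda>x. u x + t * v x"
    have "?w \<in> H1_D \<Omega> \<Gamma>D" by (rule H1_D_combination[OF u(1) v])
    then have min: "primal_energy \<Omega> f fv uD u \<le> primal_energy \<Omega> f fv uD ?w"
      using u_min unfolding is_arg_min_def by (meson not_le)
    note wH = H1_D_H1[OF \<open>?w \<in> H1_D \<Omega> \<Gamma>D\<close>]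
    have ae1: "AE x in M. grad \<Omega> ?w x = grad \<Omega> u x + t *\<^sub>R grad \<Omega> v x"
      by (rule H1_combination(2)[OF domain(1,2) u(2) vH])
    have e1: "(\<lambda>x. ?w x + uD x) = (\<lambda>x. (u x + uD x) + t * v x)" by auto
    have wuH: "(\<lambda>x. ?w x + uD x) \<in> H1 \<Omega>" unfolding e1 by (rule H1_combination(1)[OF domain(1,2) u_uD(1) vH])
    have ae2: "AE x in M. grad \<Omega> (\<lambda>x. ?w x + uD x) x = p x + t *\<^sub>R grad \<Omega> v x"
      unfolding e1 p_def by (rule H1_combination(2)[OF domain(1,2) u_uD(1) vH])
    have n: "L2_norm M (grad \<Omega> (\<lambda>x. ?w x + uD x)) = L2_norm M (\<lambda>x. p x + t *\<^sub>R grad \<Omega> v x)"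
      by (rule L2_norm_cong_AE[OF ae2]) (auto intro!: L2_measurable H1_grad(1)[OF wuH] L2_add L2_scaleR p_L2 gL)
    have i1: "L2_inner M fv (grad \<Omega> ?w) = L2_inner M fv (\<lambda>x. grad \<Omega> u x + t *\<^sub>R grad \<Omega> v x)"
      by (rule L2_inner_cong_AE[OF _ ae1]) (auto intro!: L2_measurable H1_grad(1)[OF wH] L2_add L2_scaleR guL gL fv)
    have i2: "L2_inner M f ?w = L2_inner M f u + t * L2_inner M f v"
      using L2_inner_add_right[OF uL L2_scaleR[OF vL, of t] f] L2_inner_scaleR_right[of M f t v] by simp
    have s: "(L2_norm M (\<lambda>x. p x + t *\<^sub>R grad \<Omega> v x))\<^sup>2 = (L2_norm M p)\<^sup>2 + 2 * (t * L2_inner M p (grad \<Omega> v)) + t\<^sup>2 * (L2_norm M (grad \<Omega> v))\<^sup>2"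
      using L2_norm_square_add[OF p_L2 L2_scaleR[OF gL, of t]]
      by (simp add: L2_inner_scaleR_right L2_norm_scaleR power_mult_distrib)
    have "primal_energy \<Omega> f fv uD ?w = primal_energy \<Omega> f fv uD u + (t\<^sup>2 * ((L2_norm M (grad \<Omega> v))\<^sup>2 / 2) + t * ?B)"
      unfolding primal_energy_def n i1 i2 s p_def[symmetric]
      using L2_inner_add_right[OF guL L2_scaleR[OF gL, of t] fv] L2_inner_scaleR_right[of M fv t "grad \<Omega> v"]
      by (simp add: algebra_simps add_divide_distrib)
    then show ?thesis using min by simp
  qed
  then have "?B = 0" by (rule nonneg_quadratic_imp_zero) simp
  then show ?thesis by simp
qed

text \<open>Test functions in the primal equation identify the divergence of \<open>p - fv\<close>
  as \<open>-f\<close>; general elements of \<open>H1_D\<close> then give the weak Neumann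
  condition.\<close>

lemma p_feasible:
  "(\<lambda>x. p x - fv x) \<in> Hdiv_N \<Omega> \<Gamma>D" "AE x in M. divergence \<Omega> (\<lambda>x. p x - fv x) x = - f x"
proof -
  have L: "(\<lambda>x. p x - fv x) \<in> L2 M" by (intro L2_diff p_L2 fv)
  have W: "weak_divergence \<Omega> (\<lambda>x. p x - fv x) (\<lambda>x. - f x)"
    unfolding weak_divergence_def
  proof (intro allI impI)
    fix \<phi> assume phi: "test_function \<Omega> \<phi>"
    note pD = test_function_H1_D[OF phi]
    note gL = H1_grad(1)[OF H1_D_H1[OF pD]]
    have gcL: "gradient \<phi> \<in> L2 M"
      by (rule L2_continuous_bounded_domain[OF C1_continuous_gradient[OF test_function_C1[OF phi]] domain(2,4)])
    have "(LINT x|M. (p x - fv x) \<bullet> gradient \<phi> x) = L2_inner M (\<lambda>x. p x - fv x) (gradient \<phi>)" by (simp add: L2_inner_def)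
    also have "\<dots> = L2_inner M (\<lambda>x. p x - fv x) (grad \<Omega> \<phi>)"
      by (rule L2_inner_cong_AE)
        (use H1_C1(2)[OF domain(1,2) test_function_C1[OF phi]] L2_measurable[OF L] L2_measurable[OF gcL] L2_measurable[OF gL] in
          \<open>auto elim: eventually_mono\<close>)
    also have "\<dots> = L2_inner M f \<phi>"
      using primal_Euler_Lagrange[OF pD] by (simp add: L2_inner_diff_left[OF p_L2 fv gL])
    finally show "(LINT x|M. (p x - fv x) \<bullet> gradient \<phi> x) = - (LINT x|M. - f x * \<phi> x)"
      by (simp add: L2_inner_def)
  qed
  note d = divergence_eq_AE[OF L L2_minus[OF f] W]
  show "AE x in M. divergence \<Omega> (\<lambda>x. p x - fv x) x = - f x" by (rule d(2))
  show "(\<lambda>x. p x - fv x) \<in> Hdiv_N \<Omega> \<Gamma>D"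
    unfolding Hdiv_N_def
  proof (intro CollectI conjI ballI)
    show "(\<lambda>x. p x - fv x) \<in> Hdiv \<Omega>" by (rule d(1))
    fix v assume v: "v \<in> H1_D \<Omega> \<Gamma>D"
    note vL = H1_D1[OF H1_D_H1[OF v]] and gL = H1_grad(1)[OF H1_D_H1[OF v]]
    have "L2_inner M (divergence \<Omega> (\<lambda>x. p x - fv x)) v = L2_inner M (\<lambda>x. - f x) v"
      by (rule L2_inner_cong_AE[OF d(2)]) (auto intro!: L2_measurable Hdiv_divergence(1)[OF d(1)] L2_minus f vL)
    then show "L2_inner M (\<lambda>x. p x - fv x) (grad \<Omega> v) + L2_inner M (divergence \<Omega> (\<lambda>x. p x - fv x)) v = 0"
      using primal_Euler_Lagrange[OF v] by (simp add: L2_inner_diff_left[OF p_L2 fv gL] L2_inner_minus_left)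
  qed
qed

text \<open>Feasibility comes from finiteness: fields that violate the divergence constraint have
  energy minus infinity, and \<open>p\<close> is a competitor with finite energy.\<close>

lemma q_feasible:
  "(\<lambda>x. q x - fv x) \<in> Hdiv_N \<Omega> \<Gamma>D" "q \<in> L2 M" "AE x in M. divergence \<Omega> (\<lambda>x. q x - fv x) x = - f x"
proof -
  show q: "(\<lambda>x. q x - fv x) \<in> Hdiv_N \<Omega> \<Gamma>D" using q_max by (simp add: is_arg_max_def)
  have "(\<lambda>x. (q x - fv x) + fv x) \<in> L2 M" by (rule L2_add[OF Hdiv_N_D(2)[OF q] fv])
  then show "q \<in> L2 M" by simp
  show "AE x in M. divergence \<Omega> (\<lambda>x. q x - fv x) x = - f x"
  proof (rule ccontr)
    assume "\<not> ?thesis"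
    then have "dual_energy \<Omega> f fv uD q = - \<infinity>" by (simp add: dual_energy_def)
    moreover have "dual_energy \<Omega> f fv uD p > - \<infinity>" using p_feasible(2) by (simp add: dual_energy_def)
    ultimately show False using q_max p_feasible(1) unfolding is_arg_max_def by metis
  qed
qed

text \<open>Strong duality: \<open>p\<close> is itself feasible, and \<open>p - q\<close> is orthogonal both to \<open>p - \<nabla>uD\<close> (test with \<open>u\<close>)
  and to \<open>q - \<nabla>uD\<close> (optimality of \<open>q\<close>).\<close>

lemma q_eq_p: "AE x in M. q x = p x"
proof -
  let ?s = "\<lambda>x. p x - q x"
  let ?a = "\<lambda>x. q x - fv x" and ?b = "\<lambda>x. p x - fv x"
  note qL = q_feasible(2)
  have sL: "?s \<in> L2 M" by (intro L2_diff p_L2 qL)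
  note guL = H1_grad(1)[OF u(2)] and gDL = H1_grad(1)[OF uD]
  have sN: "?s \<in> Hdiv_N \<Omega> \<Gamma>D"
    using Hdiv_N_combination[OF p_feasible(1) q_feasible(1), of "-1"] by simp
  \<comment> \<open>The line through \<open>q\<close> in direction \<open>p - q\<close> keeps the
    constraint for every real \<open>t\<close>, so the first variation vanishes instead of only
    having a sign.\<close>
  have sdiv: "AE x in M. divergence \<Omega> ?s x = 0"
    using Hdiv_combination(2)[OF Hdiv_N_D(1)[OF p_feasible(1)] Hdiv_N_D(1)[OF q_feasible(1)], of "-1"] p_feasible(2) q_feasible(3)
    by eventually_elim simp
  let ?g = "grad \<Omega> uD"
  let ?B = "L2_inner M q ?s - L2_inner M ?s ?g"
  have "0 \<le> t\<^sup>2 * ((L2_norm M ?s)\<^sup>2 / 2) + t * ?B" for t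
  proof -
    let ?r = "\<lambda>x. q x + t *\<^sub>R ?s x"
    have e: "(\<lambda>x. ?r x - fv x) = (\<lambda>x. ?a x + t *\<^sub>R ?s x)" by auto
    have rN: "(\<lambda>x. ?r x - fv x) \<in> Hdiv_N \<Omega> \<Gamma>D" unfolding e by (rule Hdiv_N_combination[OF q_feasible(1) sN])
    have rd: "AE x in M. divergence \<Omega> (\<lambda>x. ?r x - fv x) x = - f x"
      unfolding e
      using Hdiv_combination(2)[OF Hdiv_N_D(1)[OF q_feasible(1)] Hdiv_N_D(1)[OF sN], of t] q_feasible(3) sdiv
      by eventually_elim simp
    have "\<not> dual_energy \<Omega> f fv uD q < dual_energy \<Omega> f fv uD ?r"
      by (rule is_arg_max_not_less[OF q_max]) (rule rN)
    then have "- (L2_norm M ?r)\<^sup>2 / 2 + L2_inner M ?r ?g \<le> - (L2_norm M q)\<^sup>2 / 2 + L2_inner M q ?g"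
      using rd q_feasible(3) by (simp add: dual_energy_def)
    moreover have "(L2_norm M ?r)\<^sup>2 = (L2_norm M q)\<^sup>2 + 2 * (t * L2_inner M q ?s) + t\<^sup>2 * (L2_norm M ?s)\<^sup>2"
      using L2_norm_square_add[OF qL L2_scaleR[OF sL, of t]]
      by (simp only: L2_inner_scaleR_right L2_norm_scaleR power_mult_distrib power2_abs)
    moreover have "L2_inner M ?r ?g = L2_inner M q ?g + t * L2_inner M ?s ?g"
      using L2_inner_add_left[OF qL L2_scaleR[OF sL, of t] gDL] L2_inner_scaleR_left[of M t ?s ?g] by (simp only:)
    ultimately show ?thesis by (simp add: algebra_simps add_divide_distrib)
  qed
  then have B: "?B = 0" by (rule nonneg_quadratic_imp_zero) simp
  have su: "L2_inner M ?s (grad \<Omega> u) = 0"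
  proof -
    have "L2_inner M (divergence \<Omega> ?s) u = L2_inner M (\<lambda>x. 0) u"
      by (rule L2_inner_cong_AE[OF sdiv])
        (auto intro!: L2_measurable Hdiv_divergence(1)[OF Hdiv_N_D(1)[OF sN]] H1_D1[OF u(2)])
    then show ?thesis using Hdiv_N_D(3)[OF sN u(1)] by (simp add: L2_inner_def)
  qed
  have "L2_inner M ?s p = L2_inner M ?s (\<lambda>x. grad \<Omega> u x + ?g x)"
    by (rule L2_inner_cong_AE[OF _ u_uD(2)]) (auto intro!: L2_measurable sL p_L2 L2_add guL gDL)
  also have "\<dots> = L2_inner M ?s ?g" using su by (simp add: L2_inner_add_right[OF guL gDL sL])
  finally have "L2_inner M ?s p = L2_inner M ?s q" using B by (simp add: L2_inner_commute[of M q])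
  then have "(L2_norm M ?s)\<^sup>2 = 0" by (simp add: L2_norm_square L2_inner_diff_right[OF p_L2 qL sL])
  then have "L2_norm M ?s = 0" by simp
  from L2_norm_eq_0_imp_AE[OF sL this] show ?thesis by eventually_elim simp
qed

section \<open>The discrete optimality conditions\<close>

lemma uDh: "uDh \<in> P1 \<T>"
  by (rule I_cr_P1[OF uD])

lemma uh: "uh \<in> CR_D \<T> \<Gamma>D" "uh \<in> P1 \<T>"
  using uh_min CR_P1[OF CR_D_CR] by (auto simp: is_arg_min_def)

lemma uh_uDh: "(\<lambda>x. uh x + uDh x) \<in> P1 \<T>" "ph x = nabla_h \<T> uh x + nabla_h \<T> uDh x"
  using P1_combination(1)[OF uh(2) uDh, of 1] nabla_h_combination[OF uh(2) uDh, of 1] by (auto simp: ph_def)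

lemma ph_L2: "ph \<in> L2 M"
  unfolding ph_def by (rule nabla_h_L2[OF uh_uDh(1)])

lemma discrete_Euler_Lagrange:
  assumes v: "v \<in> CR_D \<T> \<Gamma>D"
  shows "L2_inner M ph (nabla_h \<T> v) = L2_inner M fh (Pi_h \<T> v) + L2_inner M fvh (nabla_h \<T> v)"
proof -
  note vP = CR_P1[OF CR_D_CR[OF v]]
  note gL = nabla_h_L2[OF vP] and guL = nabla_h_L2[OF uh(2)]
  let ?B = "L2_inner M ph (nabla_h \<T> v) - L2_inner M fh (Pi_h \<T> v) - L2_inner M fvh (nabla_h \<T> v)"
  let ?E = "discrete_primal_energy \<Omega> \<T> fh fvh uDh"
  have "0 \<le> t\<^sup>2 * ((L2_norm M (nabla_h \<T> v))\<^sup>2 / 2) + t * ?B" for t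
  proof -
    let ?w = "\<lambda>x. uh x + t * v x"
    have "?w \<in> CR_D \<T> \<Gamma>D" by (rule CR_D_combination[OF uh(1) v])
    then have min: "?E uh \<le> ?E ?w"
      using uh_min unfolding is_arg_min_def by (meson not_le)
    have e1: "(\<lambda>x. ?w x + uDh x) = (\<lambda>x. (uh x + uDh x) + t * v x)" by auto
    have n: "nabla_h \<T> (\<lambda>x. ?w x + uDh x) = (\<lambda>x. ph x + t *\<^sub>R nabla_h \<T> v x)"
      unfolding e1 ph_def by (rule ext) (rule nabla_h_combination[OF uh_uDh(1) vP])
    have n2: "nabla_h \<T> ?w = (\<lambda>x. nabla_h \<T> uh x + t *\<^sub>R nabla_h \<T> v x)"
      by (rule ext) (rule nabla_h_combination[OF uh(2) vP])
    have n3: "Pi_h \<T> ?w = (\<lambda>x. Pi_h \<T> uh x + t *\<^sub>R Pi_h \<T> v x)"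
      using Pi_h_combination[OF P1_L2[OF uh(2)] P1_L2[OF vP], of t] by (auto simp: fun_eq_iff)
    have s: "(L2_norm M (\<lambda>x. ph x + t *\<^sub>R nabla_h \<T> v x))\<^sup>2 = (L2_norm M ph)\<^sup>2 + 2 * (t * L2_inner M ph (nabla_h \<T> v)) + t\<^sup>2 * (L2_norm M (nabla_h \<T> v))\<^sup>2"
      using L2_norm_square_add[OF ph_L2 L2_scaleR[OF gL, of t]]
      by (simp add: L2_inner_scaleR_right L2_norm_scaleR power_mult_distrib)
    have "?E ?w = ?E uh + (t\<^sup>2 * ((L2_norm M (nabla_h \<T> v))\<^sup>2 / 2) + t * ?B)"
      unfolding discrete_primal_energy_def n n2 n3 s ph_def[symmetric]
      using L2_inner_add_right[OF guL L2_scaleR[OF gL, of t] Pi_h_L2[of fv]] L2_inner_scaleR_right[of M fvh t "nabla_h \<T> v"]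
        L2_inner_add_right[OF Pi_h_L2[of uh] L2_scaleR[OF Pi_h_L2[of v], of t] Pi_h_L2[of f]] L2_inner_scaleR_right[of M fh t "Pi_h \<T> v"]
      by (simp add: algebra_simps add_divide_distrib)
    then show ?thesis using min by simp
  qed
  then have "?B = 0" by (rule nonneg_quadratic_imp_zero) simp
  then show ?thesis by simp
qed

lemma RT_N_L2: "r \<in> RT_N \<T> \<Gamma>N \<Longrightarrow> r \<in> L2 M"
  by (rule P1_L2[OF RT_P1[OF RT_N_RT]])

text \<open>Here the choice \<open>fh = Pi_h f\<close> pays off: since \<open>I_rt\<close> commutes
  with the divergence up to \<open>Pi_h\<close>, the interpolated flux satisfies the discrete
  constraint exactly.\<close>

lemma J:
  "I_rt (\<lambda>y. q y - fv y) \<in> RT_N \<T> \<Gamma>N"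
  "AE x in M. divergence \<Omega> (I_rt (\<lambda>y. q y - fv y)) x = - fh x"
proof -
  have J: "I_rt (\<lambda>y. q y - fv y) \<in> RT_N \<T> \<Gamma>N"
    "AE x in M. divergence \<Omega> (I_rt (\<lambda>y. q y - fv y)) x = Pi_h \<T> (divergence \<Omega> (\<lambda>y. q y - fv y)) x"
    using I_rt q_feasible(1) unfolding rt_interpolation_def by blast+
  show "I_rt (\<lambda>y. q y - fv y) \<in> RT_N \<T> \<Gamma>N" by (rule J(1))
  have "Pi_h \<T> (divergence \<Omega> (\<lambda>y. q y - fv y)) = Pi_h \<T> (\<lambda>x. - f x)"
    by (rule Pi_h_cong_AE[OF Hdiv_divergence(1)[OF Hdiv_N_D(1)[OF q_feasible(1)]] L2_minus[OF f] q_feasible(3)])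
  moreover have "Pi_h \<T> (\<lambda>x. - f x) x = - fh x" for x
    using Pi_h_diff[OF L2_zero f, of x] Pi_h_combination[OF f f, of "-1" x] by simp
  ultimately show "AE x in M. divergence \<Omega> (I_rt (\<lambda>y. q y - fv y)) x = - fh x" using J(2) by simp
qed

lemma J_admissible: "(\<lambda>x. I_rt (\<lambda>y. q y - fv y) x + fvh x) \<in> admissible_fluxes \<Omega> \<Gamma>N \<T> fh fvh"
  using J by (simp add: admissible_fluxes_def)

text \<open>The interpolated continuous flux, shifted by \<open>fvh\<close>, is a competitor of
  finite discrete energy, which excludes the infinite branch for \<open>qh\<close>.\<close>

lemma qh_admissible: "qh \<in> admissible_fluxes \<Omega> \<Gamma>N \<T> fh fvh"
proof -
  have qN: "(\<lambda>x. qh x - fvh x) \<in> RT_N \<T> \<Gamma>N" using qh_max by (simp add: is_arg_max_def)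
  let ?J = "\<lambda>x. I_rt (\<lambda>y. q y - fv y) x + fvh x"
  let ?D = "discrete_dual_energy \<Omega> \<T> fh fvh uDh"
  have "AE x in M. divergence \<Omega> (\<lambda>y. qh y - fvh y) x = - fh x"
  proof (rule ccontr)
    assume "\<not> ?thesis"
    then have "?D qh = - \<infinity>" by (simp add: discrete_dual_energy_def)
    moreover have "?D ?J > - \<infinity>" using J_admissible by (simp add: discrete_dual_energy_def admissible_fluxes_def)
    moreover have "(\<lambda>x. ?J x - fvh x) \<in> RT_N \<T> \<Gamma>N" using J_admissible by (simp add: admissible_fluxes_def)
    ultimately show False using qh_max unfolding is_arg_max_def by metis
  qed
  then show ?thesis using qN by (simp add: admissible_fluxes_def)
qed

lemma admissible_L2:
  assumes "r \<in> admissible_fluxes \<Omega> \<Gamma>N \<T> fh fvh" shows "r \<in> L2 M"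
proof -
  have "(\<lambda>x. (r x - fvh x) + fvh x) \<in> L2 M"
    using assms by (intro L2_add RT_N_L2 Pi_h_L2) (simp add: admissible_fluxes_def)
  then show ?thesis by simp
qed

lemma admissible_diff:
  assumes r: "r \<in> admissible_fluxes \<Omega> \<Gamma>N \<T> fh fvh" and s: "s \<in> admissible_fluxes \<Omega> \<Gamma>N \<T> fh fvh"
  shows "(\<lambda>x. r x - s x) \<in> RT_N \<T> \<Gamma>N" "AE x in M. divergence \<Omega> (\<lambda>x. r x - s x) x = 0"
proof -
  let ?r = "\<lambda>x. r x - fvh x" and ?s = "\<lambda>x. s x - fvh x"
  have N: "?r \<in> RT_N \<T> \<Gamma>N" "?s \<in> RT_N \<T> \<Gamma>N"
    and d: "AE x in M. divergence \<Omega> ?r x = - fh x" "AE x in M. divergence \<Omega> ?s x = - fh x"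
    using r s by (auto simp: admissible_fluxes_def)
  show "(\<lambda>x. r x - s x) \<in> RT_N \<T> \<Gamma>N" using RT_N_combination[OF N, of "-1"] by simp
  show "AE x in M. divergence \<Omega> (\<lambda>x. r x - s x) x = 0"
    using Hdiv_combination(2)[OF RT_Hdiv(1)[OF RT_N_RT[OF N(1)]] RT_Hdiv(1)[OF RT_N_RT[OF N(2)]], of "-1"] d
    by eventually_elim simp
qed

lemma divergence_free_orthogonal:
  assumes r: "r \<in> RT_N \<T> \<Gamma>N" "AE x in M. divergence \<Omega> r x = 0" and v: "v \<in> CR_D \<T> \<Gamma>D"
  shows "L2_inner M (Pi_h \<T> r) (nabla_h \<T> v) = 0"
proof -
  have "L2_inner M (divergence \<Omega> r) (Pi_h \<T> v) = L2_inner M (\<lambda>x. 0) (Pi_h \<T> v)"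
    by (rule L2_inner_cong_AE[OF r(2)])
      (auto intro!: L2_measurable Hdiv_divergence(1)[OF RT_Hdiv(1)[OF RT_N_RT[OF r(1)]]] Pi_h_L2)
  then show ?thesis unfolding discrete_integration_by_parts[OF r(1) v] by (simp add: L2_inner_def)
qed

text \<open>Only \<open>Pi_h\<close> of a direction enters the finite branch of the discrete energy,
  and divergence-free directions keep the constraint for every \<open>t\<close>.\<close>

lemma discrete_dual_Euler_Lagrange:
  assumes s: "s \<in> RT_N \<T> \<Gamma>N" "AE x in M. divergence \<Omega> s x = 0"
  shows "L2_inner M (Pi_h \<T> qh) (Pi_h \<T> s) = L2_inner M (Pi_h \<T> s) (nabla_h \<T> uDh)"
proof -
  have qN: "(\<lambda>x. qh x - fvh x) \<in> RT_N \<T> \<Gamma>N" and qd: "AE x in M. divergence \<Omega> (\<lambda>y. qh y - fvh y) x = - fh x"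
    using qh_admissible by (auto simp: admissible_fluxes_def)
  note sL = RT_N_L2[OF s(1)] and qL = admissible_L2[OF qh_admissible]
  note PL = Pi_h_L2[of qh] and PS = Pi_h_L2[of s] and gDL = nabla_h_L2[OF uDh]
  let ?g = "nabla_h \<T> uDh"
  let ?B = "L2_inner M (Pi_h \<T> qh) (Pi_h \<T> s) - L2_inner M (Pi_h \<T> s) ?g"
  let ?D = "discrete_dual_energy \<Omega> \<T> fh fvh uDh"
  have "0 \<le> t\<^sup>2 * ((L2_norm M (Pi_h \<T> s))\<^sup>2 / 2) + t * ?B" for t
  proof -
    let ?r = "\<lambda>x. qh x + t *\<^sub>R s x"
    have e: "(\<lambda>x. ?r x - fvh x) = (\<lambda>x. (qh x - fvh x) + t *\<^sub>R s x)" by auto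
    have rN: "(\<lambda>x. ?r x - fvh x) \<in> RT_N \<T> \<Gamma>N" unfolding e by (rule RT_N_combination[OF qN s(1)])
    have rd: "AE x in M. divergence \<Omega> (\<lambda>x. ?r x - fvh x) x = - fh x"
      unfolding e
      using Hdiv_combination(2)[OF RT_Hdiv(1)[OF RT_N_RT[OF qN]] RT_Hdiv(1)[OF RT_N_RT[OF s(1)]], of t] qd s(2)
      by eventually_elim simp
    have n: "Pi_h \<T> ?r = (\<lambda>x. Pi_h \<T> qh x + t *\<^sub>R Pi_h \<T> s x)"
      using Pi_h_combination[OF qL sL, of t] by (auto simp: fun_eq_iff)
    have "\<not> ?D qh < ?D ?r" by (rule is_arg_max_not_less[OF qh_max]) (rule rN)
    then have "- (L2_norm M (Pi_h \<T> ?r))\<^sup>2 / 2 + L2_inner M (Pi_h \<T> ?r) ?g \<le> - (L2_norm M (Pi_h \<T> qh))\<^sup>2 / 2 + L2_inner M (Pi_h \<T> qh) ?g"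
      using rd qd by (simp add: discrete_dual_energy_def)
    moreover have "(L2_norm M (Pi_h \<T> ?r))\<^sup>2 = (L2_norm M (Pi_h \<T> qh))\<^sup>2 + 2 * (t * L2_inner M (Pi_h \<T> qh) (Pi_h \<T> s)) + t\<^sup>2 * (L2_norm M (Pi_h \<T> s))\<^sup>2"
      unfolding n using L2_norm_square_add[OF PL L2_scaleR[OF PS, of t]]
      by (simp only: L2_inner_scaleR_right L2_norm_scaleR power_mult_distrib power2_abs)
    moreover have "L2_inner M (Pi_h \<T> ?r) ?g = L2_inner M (Pi_h \<T> qh) ?g + t * L2_inner M (Pi_h \<T> s) ?g"
      unfolding n using L2_inner_add_left[OF PL L2_scaleR[OF PS, of t] gDL] L2_inner_scaleR_left[of M t "Pi_h \<T> s" ?g] by (simp only:)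
    ultimately show ?thesis by (simp add: field_simps)
  qed
  then have "?B = 0" by (rule nonneg_quadratic_imp_zero) simp
  then show ?thesis by simp
qed

text \<open>Strong duality for the discrete problem: the difference is orthogonal to all discrete gradients,
  hence itself an admissible divergence-free direction of the discrete dual problem.\<close>

lemma Pi_qh_eq_ph: "AE x in M. Pi_h \<T> qh x = ph x"
proof -
  \<comment> \<open>Element values of the difference \<open>Pi_h qh - ph\<close>, which is exactly
    piecewise constant.\<close>
  define k where "k = (\<lambda>T. average (lebesgue_on T) qh + (-1) *\<^sub>R slope T (\<lambda>x. uh x + uDh x))"
  have y: "pw_const \<T> k = (\<lambda>x. Pi_h \<T> qh x - ph x)"
    unfolding k_def ph_def nabla_h_eq_pw_const[OF uh_uDh(1)] Pi_h_eq_pw_const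
    by (rule ext) (subst pw_const_combination, simp)
  have qN: "(\<lambda>x. qh x - fvh x) \<in> RT_N \<T> \<Gamma>N" and qd: "AE x in M. divergence \<Omega> (\<lambda>y. qh y - fvh y) x = - fh x"
    using qh_admissible by (auto simp: admissible_fluxes_def)
  note qL = admissible_L2[OF qh_admissible]
  have orth: "L2_inner M (pw_const \<T> k) (nabla_h \<T> v) = 0" if v: "v \<in> CR_D \<T> \<Gamma>D" for v
  proof -
    note gL = nabla_h_L2[OF CR_P1[OF CR_D_CR[OF v]]]
    have "Pi_h \<T> (\<lambda>x. qh x - fvh x) = (\<lambda>x. Pi_h \<T> qh x - fvh x)"
    proof
      fix x
      have "Pi_h \<T> fvh = fvh" unfolding Pi_h_eq_pw_const[of \<T> fv] by (rule Pi_h_pw_const)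
      then show "Pi_h \<T> (\<lambda>x. qh x - fvh x) x = Pi_h \<T> qh x - fvh x"
        using Pi_h_diff[OF qL Pi_h_L2[of fv], of x] by (simp only:)
    qed
    then have "L2_inner M (Pi_h \<T> qh) (nabla_h \<T> v) - L2_inner M fvh (nabla_h \<T> v) = L2_inner M (Pi_h \<T> (\<lambda>x. qh x - fvh x)) (nabla_h \<T> v)"
      using L2_inner_diff_left[OF Pi_h_L2[of qh] Pi_h_L2[of fv] gL] by simp
    also have "\<dots> = - L2_inner M (divergence \<Omega> (\<lambda>x. qh x - fvh x)) (Pi_h \<T> v)"
      by (rule discrete_integration_by_parts[OF qN v])
    also have "L2_inner M (divergence \<Omega> (\<lambda>x. qh x - fvh x)) (Pi_h \<T> v) = L2_inner M (\<lambda>x. - fh x) (Pi_h \<T> v)"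
      by (rule L2_inner_cong_AE[OF qd])
        (auto intro!: L2_measurable Hdiv_divergence(1)[OF RT_Hdiv(1)[OF RT_N_RT[OF qN]]] Pi_h_L2 L2_minus)
    finally have "L2_inner M (Pi_h \<T> qh) (nabla_h \<T> v) = L2_inner M ph (nabla_h \<T> v)"
      using discrete_Euler_Lagrange[OF v] by (simp add: L2_inner_minus_left)
    then show ?thesis unfolding y by (simp add: L2_inner_diff_left[OF Pi_h_L2 ph_L2 gL])
  qed
  note R = orthogonal_to_CR_gradients_imp_RT_N[OF orth]
  let ?y = "pw_const \<T> k"
  have yL: "?y \<in> L2 M" by (rule pw_const_L2)
  \<comment> \<open>The field is its own projection, so the dual stationarity condition applies to
    it without change.\<close>
  have "L2_inner M ?y (Pi_h \<T> qh) = L2_inner M ?y (nabla_h \<T> uDh)"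
    using discrete_dual_Euler_Lagrange[OF R] by (simp add: Pi_h_pw_const L2_inner_commute[of M "Pi_h \<T> qh"])
  moreover have "L2_inner M ?y ph = L2_inner M ?y (nabla_h \<T> uh) + L2_inner M ?y (nabla_h \<T> uDh)"
    unfolding uh_uDh(2)[abs_def] by (rule L2_inner_add_right[OF nabla_h_L2[OF uh(2)] nabla_h_L2[OF uDh] yL])
  ultimately have "L2_inner M ?y (\<lambda>x. Pi_h \<T> qh x - ph x) = 0"
    using orth[OF uh(1)] by (simp add: L2_inner_diff_right[OF Pi_h_L2 ph_L2 yL])
  then have "(L2_norm M ?y)\<^sup>2 = 0" by (simp add: L2_norm_square y)
  then have "L2_norm M ?y = 0" by simp
  from L2_norm_eq_0_imp_AE[OF yL this] show ?thesis unfolding y by eventually_elim simp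
qed

section \<open>The error identity and the quasi-optimal estimate\<close>

lemma error_identity:
  "(L2_norm M (\<lambda>x. nabla_h \<T> (I_cr \<T> u) x - nabla_h \<T> uh x))\<^sup>2
   + (L2_norm M (\<lambda>x. Pi_h \<T> (I_rt (\<lambda>y. q y - fv y)) x - Pi_h \<T> (\<lambda>y. qh y - fvh y) x))\<^sup>2
   = (L2_norm M (\<lambda>x. Pi_h \<T> (\<lambda>y. q y - fv y) x - Pi_h \<T> (I_rt (\<lambda>y. q y - fv y)) x))\<^sup>2"
proof -
  let ?J = "I_rt (\<lambda>y. q y - fv y)" and ?r = "\<lambda>y. qh y - fvh y"
  let ?A = "\<lambda>x. nabla_h \<T> (I_cr \<T> u) x - nabla_h \<T> uh x" and ?B = "\<lambda>x. Pi_h \<T> ?J x - Pi_h \<T> ?r x"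
  have IuP: "I_cr \<T> u \<in> P1 \<T>" and IuD: "I_cr \<T> u \<in> CR_D \<T> \<Gamma>D" using I_cr_P1[OF u(2)] I_cr_CR_D[OF u(1)] by auto
  have wD: "(\<lambda>x. I_cr \<T> u x + (-1) * uh x) \<in> CR_D \<T> \<Gamma>D" by (rule CR_D_combination[OF IuD uh(1)])
  have A: "nabla_h \<T> (\<lambda>x. I_cr \<T> u x + (-1) * uh x) = ?A"
    using nabla_h_combination[OF IuP uh(2), of "-1"] by (auto simp: fun_eq_iff)
  have AL: "?A \<in> L2 M" by (intro L2_diff nabla_h_L2 IuP uh(2))
  have rN: "?r \<in> RT_N \<T> \<Gamma>N" using qh_admissible by (simp add: admissible_fluxes_def)
  note JL = RT_N_L2[OF J(1)] and rL = RT_N_L2[OF rN]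
  have BL: "?B \<in> L2 M" by (intro L2_diff Pi_h_L2)
  note d = admissible_diff[OF J_admissible qh_admissible]
  have e: "(\<lambda>x. (?J x + fvh x) - qh x) = (\<lambda>x. ?J x - ?r x)" by auto
  have B: "Pi_h \<T> (\<lambda>x. ?J x - ?r x) = ?B" using Pi_h_diff[OF JL rL] by (auto simp: fun_eq_iff)
  have "L2_inner M ?B ?A = 0"
    using divergence_free_orthogonal[OF d wD] unfolding e B A .
  then have "L2_inner M ?A ?B = 0" by (simp add: L2_inner_commute[of M ?A])
  from L2_norm_square_orthogonal[OF AL BL this]
  have "(L2_norm M ?A)\<^sup>2 + (L2_norm M ?B)\<^sup>2 = (L2_norm M (\<lambda>x. ?A x - ?B x))\<^sup>2" by simp
  also have "L2_norm M (\<lambda>x. ?A x - ?B x) = L2_norm M (\<lambda>x. Pi_h \<T> (\<lambda>y. q y - fv y) x - Pi_h \<T> ?J x)"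
  proof (rule L2_norm_cong_AE)
    show "(\<lambda>x. ?A x - ?B x) \<in> borel_measurable M" by (intro L2_measurable L2_diff AL BL)
    show "(\<lambda>x. Pi_h \<T> (\<lambda>y. q y - fv y) x - Pi_h \<T> ?J x) \<in> borel_measurable M" by (intro L2_measurable L2_diff Pi_h_L2)
    note guL = H1_grad(1)[OF u(2)] and gDL = H1_grad(1)[OF uD]
    note qL = q_feasible(2) and qhL = admissible_L2[OF qh_admissible]
    have "AE x in M. q x = grad \<Omega> u x + 1 *\<^sub>R grad \<Omega> uD x" using q_eq_p u_uD(2) by eventually_elim simp
    from Pi_h_cong_AE[OF qL L2_add[OF guL L2_scaleR[OF gDL]] this]
    \<comment> \<open>Projecting \<open>q\<close>, which equals the gradient of
      \<open>u + uD\<close>, gives interpolated gradients. In the difference \<open>uh\<close>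
      cancels, and the term from \<open>uDh\<close> in \<open>ph\<close> completes
      \<open>Pi_h q\<close>.\<close>
    have Pq: "Pi_h \<T> q x = nabla_h \<T> (I_cr \<T> u) x + nabla_h \<T> uDh x" for x
      using Pi_h_combination[OF guL gDL, of 1 x] by (simp add: nabla_h_I_cr[OF u(2)] nabla_h_I_cr[OF uD])
    have "Pi_h \<T> fvh = fvh" unfolding Pi_h_eq_pw_const[of \<T> fv] by (rule Pi_h_pw_const)
    then have Pr: "Pi_h \<T> ?r x = Pi_h \<T> qh x - fvh x" for x using Pi_h_diff[OF qhL Pi_h_L2[of fv], of x] by simp
    show "AE x in M. ?A x - ?B x = Pi_h \<T> (\<lambda>y. q y - fv y) x - Pi_h \<T> ?J x"
      using Pi_qh_eq_ph
      by eventually_elim (simp add: Pi_h_diff[OF qL fv] Pq Pr uh_uDh(2))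
  qed
  finally show ?thesis .
qed

lemma quasi_optimality_pair:
  assumes v: "v \<in> CR_D \<T> \<Gamma>D" and r: "r \<in> admissible_fluxes \<Omega> \<Gamma>N \<T> fh fvh"
  shows "(L2_norm M (\<lambda>x. p x - ph x))\<^sup>2 + (L2_norm M (\<lambda>x. q x - Pi_h \<T> qh x))\<^sup>2
    \<le> 6 * (L2_norm M (\<lambda>x. p x - nabla_h \<T> (\<lambda>y. v y + uDh y) x))\<^sup>2 + 6 * (L2_norm M (\<lambda>x. q x - Pi_h \<T> r x))\<^sup>2"
proof -
  note vP = CR_P1[OF CR_D_CR[OF v]]
  let ?x = "\<lambda>x. nabla_h \<T> v x - nabla_h \<T> uh x" and ?y = "\<lambda>x. Pi_h \<T> r x - Pi_h \<T> qh x" and ?z = "\<lambda>x. p x - ph x"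
  note rL = admissible_L2[OF r] and qhL = admissible_L2[OF qh_admissible]
  have xL: "?x \<in> L2 M" and yL: "?y \<in> L2 M" and zL: "?z \<in> L2 M"
    by (intro L2_diff nabla_h_L2 vP uh(2) Pi_h_L2 p_L2 ph_L2)+
  have wD: "(\<lambda>x. v x + (-1) * uh x) \<in> CR_D \<T> \<Gamma>D" by (rule CR_D_combination[OF v uh(1)])
  have X: "nabla_h \<T> (\<lambda>x. v x + (-1) * uh x) = ?x"
    using nabla_h_combination[OF vP uh(2), of "-1"] by (auto simp: fun_eq_iff)
  have Y: "Pi_h \<T> (\<lambda>x. r x - qh x) = ?y" using Pi_h_diff[OF rL qhL] by (auto simp: fun_eq_iff)
  have "L2_inner M ?y ?x = 0"
    using divergence_free_orthogonal[OF admissible_diff[OF r qh_admissible] wD] unfolding X Y .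
  then have xy: "L2_inner M ?x ?y = 0" by (simp add: L2_inner_commute[of M ?x])
  have main: "(L2_norm M ?z)\<^sup>2 \<le> (L2_norm M (\<lambda>x. ?z x - ?x x))\<^sup>2 + (L2_norm M (\<lambda>x. ?z x - ?y x))\<^sup>2"
    by (rule L2_norm_square_le_orthogonal[OF xL yL zL xy])
  have nv: "nabla_h \<T> (\<lambda>y. v y + uDh y) x = nabla_h \<T> v x + nabla_h \<T> uDh x" for x
    using nabla_h_combination[OF vP uDh, of 1 x] by simp
  have e1: "(\<lambda>x. ?z x - ?x x) = (\<lambda>x. p x - nabla_h \<T> (\<lambda>y. v y + uDh y) x)"
    by (auto simp: nv uh_uDh(2))
  have e2: "L2_norm M (\<lambda>x. ?z x - ?y x) = L2_norm M (\<lambda>x. q x - Pi_h \<T> r x)"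
  proof (rule L2_norm_cong_AE)
    show "AE x in M. ?z x - ?y x = q x - Pi_h \<T> r x" using q_eq_p Pi_qh_eq_ph by eventually_elim simp
  qed (intro L2_measurable L2_diff zL yL q_feasible(2) Pi_h_L2)+
  \<comment> \<open>The flux error is the gradient error again, so the left-hand side is twice the
    square of the norm of \<open>?z\<close>.\<close>
  have e3: "L2_norm M (\<lambda>x. q x - Pi_h \<T> qh x) = L2_norm M ?z"
  proof (rule L2_norm_cong_AE)
    show "AE x in M. q x - Pi_h \<T> qh x = ?z x" using q_eq_p Pi_qh_eq_ph by eventually_elim simp
  qed (intro L2_measurable L2_diff zL q_feasible(2) Pi_h_L2 p_L2 ph_L2)+
  \<comment> \<open>Doubling \<open>main\<close> gives the constant 2; nonnegativity of the two
    right-hand terms raises it to 6.\<close>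
  show ?thesis using main zero_le_power2[of "L2_norm M (\<lambda>x. p x - nabla_h \<T> (\<lambda>y. v y + uDh y) x)"]
      zero_le_power2[of "L2_norm M (\<lambda>x. q x - Pi_h \<T> r x)"] unfolding e1 e2 e3 by linarith
qed

end

text \<open>A bound holding for all pairs separates: \<open>r\<close> is optimised first with
  \<open>v\<close> fixed, then \<open>v\<close>. For real-valued infima the greatest-lower-bound
  rule asks for nonempty index sets, hence the assumption \<open>ne\<close>.\<close>

lemma le_sum_INF:
  fixes a :: "'a \<Rightarrow> real" and b :: "'b \<Rightarrow> real"
  assumes ne: "V \<noteq> {}" "R \<noteq> {}" and le: "\<And>v r. v \<in> V \<Longrightarrow> r \<in> R \<Longrightarrow> L \<le> c * a v + c * b r" and c: "c > 0"
  shows "L \<le> c * (INF v\<in>V. a v) + c * (INF r\<in>R. b r)"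
proof -
  have "(L - c * a v) / c \<le> (INF r\<in>R. b r)" if v: "v \<in> V" for v
  proof (rule cINF_greatest[OF ne(2)])
    fix r assume "r \<in> R"
    from le[OF v this] show "(L - c * a v) / c \<le> b r" using c by (simp add: divide_le_eq algebra_simps)
  qed
  then have 1: "L - c * a v \<le> c * (INF r\<in>R. b r)" if "v \<in> V" for v
    using that c by (simp add: divide_le_eq algebra_simps)
  have "(L - c * (INF r\<in>R. b r)) / c \<le> (INF v\<in>V. a v)"
  proof (rule cINF_greatest[OF ne(1)])
    fix v assume "v \<in> V"
    from 1[OF this] show "(L - c * (INF r\<in>R. b r)) / c \<le> a v" using c by (simp add: divide_le_eq algebra_simps)
  qed
  then show ?thesis using c by (simp add: divide_le_eq algebra_simps)
qed

theorem corollary1: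
  fixes \<Omega> \<Gamma>D \<Gamma>N :: "'a::euclidean_space set"
    and \<T> :: "'a set set"
    and f uD u fh uDh uh :: "'a \<Rightarrow> real"
    and fv q fvh qh :: "'a \<Rightarrow> 'a"
    and I_rt :: "('a \<Rightarrow> 'a) \<Rightarrow> 'a \<Rightarrow> 'a"
  assumes "DIM('a) \<ge> 2"
    and "lipschitz_domain \<Omega>" and "polyhedral \<Omega>"
    and "boundary_partition \<Omega> \<Gamma>D \<Gamma>N"
    and "simplicial_mesh \<Omega> \<Gamma>D \<Gamma>N \<T>"
    and "uD \<in> H1 \<Omega>" and "f \<in> L2 (lebesgue_on \<Omega>)" and "fv \<in> L2 (lebesgue_on \<Omega>)"
    and "rt_interpolation \<Omega> \<Gamma>D \<Gamma>N \<T> I_rt"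
    and "is_arg_min (primal_energy \<Omega> f fv uD) (\<lambda>v. v \<in> H1_D \<Omega> \<Gamma>D) u"
    and "is_arg_max (dual_energy \<Omega> f fv uD) (\<lambda>r. (\<lambda>x. r x - fv x) \<in> Hdiv_N \<Omega> \<Gamma>D) q"
    and "fh = Pi_h \<T> f" and "fvh = Pi_h \<T> fv" and "uDh = I_cr \<T> uD"
    and "is_arg_min (discrete_primal_energy \<Omega> \<T> fh fvh uDh) (\<lambda>vh. vh \<in> CR_D \<T> \<Gamma>D) uh"
    and "is_arg_max (discrete_dual_energy \<Omega> \<T> fh fvh uDh)
           (\<lambda>rh. (\<lambda>x. rh x - fvh x) \<in> RT_N \<T> \<Gamma>N) qh"
  shows "(L2_norm (lebesgue_on \<Omega>) (\<lambda>x. nabla_h \<T> (I_cr \<T> u) x - nabla_h \<T> uh x))\<^sup>2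
         + (L2_norm (lebesgue_on \<Omega>) (\<lambda>x. Pi_h \<T> (I_rt (\<lambda>y. q y - fv y)) x
              - Pi_h \<T> (\<lambda>y. qh y - fvh y) x))\<^sup>2
         = (L2_norm (lebesgue_on \<Omega>) (\<lambda>x. Pi_h \<T> (\<lambda>y. q y - fv y) x
              - Pi_h \<T> (I_rt (\<lambda>y. q y - fv y)) x))\<^sup>2
       \<and>
         (L2_norm (lebesgue_on \<Omega>) (\<lambda>x. grad \<Omega> (\<lambda>y. u y + uD y) x
              - nabla_h \<T> (\<lambda>y. uh y + uDh y) x))\<^sup>2
         + (L2_norm (lebesgue_on \<Omega>) (\<lambda>x. q x - Pi_h \<T> qh x))\<^sup>2
         \<le> 6 * (INF vh \<in> CR_D \<T> \<Gamma>D. (L2_norm (lebesgue_on \<Omega>)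
              (\<lambda>x. grad \<Omega> (\<lambda>y. u y + uD y) x - nabla_h \<T> (\<lambda>y. vh y + uDh y) x))\<^sup>2)
         + 6 * (INF rh \<in> admissible_fluxes \<Omega> \<Gamma>N \<T> fh fvh.
              (L2_norm (lebesgue_on \<Omega>) (\<lambda>x. q x - Pi_h \<T> rh x))\<^sup>2)"
proof -
  interpret poisson_discretisation \<Omega> \<Gamma>D \<Gamma>N \<T> f uD u uh fv q qh I_rt
    by unfold_locales (use assms in simp_all)
  show ?thesis
    unfolding assms(12-14)
  proof (intro conjI error_identity le_sum_INF)
    show "CR_D \<T> \<Gamma>D \<noteq> {}" using uh(1) by blast
    show "admissible_fluxes \<Omega> \<Gamma>N \<T> (Pi_h \<T> f) (Pi_h \<T> fv) \<noteq> {}" using qh_admissible by blast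
  next
    fix vh rh assume vr: "vh \<in> CR_D \<T> \<Gamma>D" "rh \<in> admissible_fluxes \<Omega> \<Gamma>N \<T> (Pi_h \<T> f) (Pi_h \<T> fv)"
    show "(L2_norm (lebesgue_on \<Omega>) (\<lambda>x. grad \<Omega> (\<lambda>y. u y + uD y) x
              - nabla_h \<T> (\<lambda>y. uh y + I_cr \<T> uD y) x))\<^sup>2
         + (L2_norm (lebesgue_on \<Omega>) (\<lambda>x. q x - Pi_h \<T> qh x))\<^sup>2
         \<le> 6 * (L2_norm (lebesgue_on \<Omega>)
              (\<lambda>x. grad \<Omega> (\<lambda>y. u y + uD y) x - nabla_h \<T> (\<lambda>y. vh y + I_cr \<T> uD y) x))\<^sup>2
         + 6 * (L2_norm (lebesgue_on \<Omega>) (\<lambda>x. q x - Pi_h \<T> rh x))\<^sup>2"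
      by (rule quasi_optimality_pair[OF vr, unfolded p_def ph_def])
  qed simp
qed

end
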